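(* Let $\Omega\subset\mathbb{R}^2$ be a smooth, bounded, simply connected domain and let $L:\mathbb{M}^{2\times2}\to\mathbb{R}$ be smooth and uniformly convex, such that $DL$ has linear growth and $D^2L$ is bounded. Let $\mathbf u\in W^{1,3}(\Omega,\mathbb{R}^2)$ be an area-preserving minimizer of the energy $E[\cdot]$. Assume furthermore that the associated hydrostatic pressure $q$ on the deformed domain $\mathbf u(\Omega)$ is $C^{0,\alpha}$ for some $0<\alpha<1$. Then $\nabla\mathbf u$ is Hölder continuous on a dense open set $\Omega_0\subset\Omega$.
   Context: $\mathbb{M}^{2\times2}$ is the space of real $2\times2$ matrices, $A:B=\operatorname{trace}(A^tB)$, $DL(P)=(\partial L/\partial p^i_j(P))$. Uniformly convex: there is $\lambda_0>0$ with $\sum\frac{\partial^2L}{\partial p^i_j\partial p^k_l}(P)\xi_{ij}\xi_{kl}\ge\lambda_0|\xi|^2$ for all $P,\xi\in\mathbb{M}^{2\times2}$. Linear growth: $|DL(P)|\le C(1+|P|)$. The energy is $E[\mathbf w]=\int_\Omega L(\nabla\mathbf w(x))\,dx$, and the admissible set is $\mathcal A=\{\mathbf w\in W^{1,2}(\Omega,\mathbb{R}^2):\det\nabla\mathbf w=1\text{ a.e. in }\Omega\}$ (area-preserving deformations). An area-preserving minimizer is a local minimizer of $E[\cdot]$ in $\mathcal A$: $\mathbf u\in\mathcal A$ and $E[\mathbf u]\le E[\mathbf w]$ for all $\mathbf w\in\mathcal A$ with $\operatorname{supp}(\mathbf w-\mathbf u)\subset\Omega$ (compact support of $\mathbf w-\mathbf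 u$ in $\Omega$). The associated hydrostatic pressure is the scalar function $q\in L^{3/2}_{\rm loc}(\mathbf u(\Omega))$ (determined up to an additive constant) satisfying $$\int_\Omega DL(\nabla\mathbf u(x)):\nabla(\mathbf v\circ\mathbf u)(x)\,dx=\int_{\mathbf u(\Omega)}q(y)\operatorname{div}\mathbf v(y)\,dy\quad\text{for all }\mathbf v\in C_0^\infty(\mathbf u(\Omega),\mathbb{R}^2).$$ Here $\mathbf u$ denotes its continuous representative; the paper regards $\mathbf u$ in this setting as a homeomorphism of $\Omega$ onto the open set $\mathbf u(\Omega)$. *)

theory Defs
  imports "HOL-Analysis.Analysis"
begin

subsection \<open>Smooth functions\<close>

primrec Ck_on :: "nat \<Rightarrow> 'a::real_normed_vector set \<Rightarrow> ('a \<Rightarrow> 'b::real_normed_vector) \<Rightarrow> bool"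
  where
    "Ck_on 0 S f \<longleftrightarrow> continuous_on S f"
  | "Ck_on (Suc k) S f \<longleftrightarrow>
       (\<forall>x\<in>S. f differentiable (at x)) \<and>
       (\<forall>h. Ck_on k S (\<lambda>x. frechet_derivative f (at x) h))"

text \<open>Meant for open \<open>S\<close>, since the derivatives are taken in the full space.\<close>

definition smooth_on :: "'a::real_normed_vector set \<Rightarrow> ('a \<Rightarrow> 'b::real_normed_vector) \<Rightarrow> bool"
  where "smooth_on S f \<longleftrightarrow> (\<forall>k. Ck_on k S f)"

definition test_function :: "'a::real_normed_vector set \<Rightarrow> ('a \<Rightarrow> 'b::real_normed_vector) \<Rightarrow> bool"
  where "test_function S f \<longleftrightarrow>
    smooth_on UNIV f \<and> compact (closure {x. f x \<noteq> 0}) \<and> closure {x. f x \<noteq> 0} \<subseteq> S"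

definition divergence :: "(real^'n \<Rightarrow> real^'n) \<Rightarrow> real^'n \<Rightarrow> real"
  where "divergence v y = trace (jacobian v (at y))"


subsection \<open>Domains with smooth boundary\<close>

text \<open>
  Near each boundary point, and up to a rotation or reflection of the coordinates, the domain
  is the open region above the graph of a smooth function.
\<close>

definition smooth_boundary :: "(real^2) set \<Rightarrow> bool"
  where "smooth_boundary \<Omega> \<longleftrightarrow>
    (\<forall>x0\<in>frontier \<Omega>. \<exists>r>0. \<exists>T \<gamma>.
       orthogonal_transformation (T :: real^2 \<Rightarrow> real^2) \<and> smooth_on UNIV (\<gamma> :: real \<Rightarrow> real) \<and>
       (\<forall>x\<in>ball x0 r. x \<in> \<Omega> \<longleftrightarrow> T x $ 2 > \<gamma> (T x $ 1)))"


subsection \<open>Hoelder continuity\<close>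

text \<open>
  The space \<open>C^{0,\<alpha>}(S)\<close> over an open set \<open>S\<close>, in the usual convention: the Hoelder constant is
  uniform on compact subsets of \<open>S\<close>, not up to the boundary.
\<close>

definition Holder_on :: "real \<Rightarrow> 'a::metric_space set \<Rightarrow> ('a \<Rightarrow> 'b::metric_space) \<Rightarrow> bool"
  where "Holder_on \<alpha> S f \<longleftrightarrow>
    (\<forall>K. compact K \<and> K \<subseteq> S \<longrightarrow>
       (\<exists>C. \<forall>x\<in>K. \<forall>y\<in>K. dist (f x) (f y) \<le> C * dist x y powr \<alpha>))"


subsection \<open>Lebesgue and Sobolev spaces\<close>

definition Lp_on :: "real \<Rightarrow> 'a::euclidean_space set \<Rightarrow> ('a \<Rightarrow> 'b::euclidean_space) \<Rightarrow> bool"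
  where "Lp_on p S f \<longleftrightarrow>
    f \<in> borel_measurable (lebesgue_on S) \<and>
    integrable (lebesgue_on S) (\<lambda>x. norm (f x) powr p)"

definition Lp_loc_on :: "real \<Rightarrow> 'a::euclidean_space set \<Rightarrow> ('a \<Rightarrow> 'b::euclidean_space) \<Rightarrow> bool"
  where "Lp_loc_on p S f \<longleftrightarrow> (\<forall>K. compact K \<and> K \<subseteq> S \<longrightarrow> Lp_on p K f)"

definition has_weak_gradient ::
    "(real^'n) set \<Rightarrow> (real^'n \<Rightarrow> real^'m) \<Rightarrow> (real^'n \<Rightarrow> real^'n^'m) \<Rightarrow> bool"
  where "has_weak_gradient \<Omega> w G \<longleftrightarrow>
    Lp_loc_on 1 \<Omega> w \<and> Lp_loc_on 1 \<Omega> G \<and>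
    (\<forall>\<phi> :: real^'n \<Rightarrow> real. test_function \<Omega> \<phi> \<longrightarrow>
       (\<forall>i j. (LINT x|lebesgue_on \<Omega>. w x $ i * frechet_derivative \<phi> (at x) (axis j 1))
            = - (LINT x|lebesgue_on \<Omega>. G x $ i $ j * \<phi> x)))"

text \<open>
  The weak gradient on an open set is unique up to null sets; the following picks a
  representative and is meaningful only if a weak gradient exists.
\<close>

definition weak_gradient :: "(real^'n) set \<Rightarrow> (real^'n \<Rightarrow> real^'m) \<Rightarrow> real^'n \<Rightarrow> real^'n^'m"
  where "weak_gradient \<Omega> w = (SOME G. has_weak_gradient \<Omega> w G)"

definition Sobolev1 :: "real \<Rightarrow> (real^'n) set \<Rightarrow> (real^'n \<Rightarrow> real^'m) \<Rightarrow> bool"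
  where "Sobolev1 p \<Omega> w \<longleftrightarrow>
    Lp_on p \<Omega> w \<and> (\<exists>G. has_weak_gradient \<Omega> w G \<and> Lp_on p \<Omega> G)"

text \<open>
  Support of a function on \<open>S\<close> defined only up to null sets: the complement (in the full space)
  of the largest open set on which the function vanishes almost everywhere.  It is closed
  and may reach the boundary of \<open>S\<close>.
\<close>

definition ess_support :: "'a::euclidean_space set \<Rightarrow> ('a \<Rightarrow> 'b::real_vector) \<Rightarrow> 'a set"
  where "ess_support S f =
    - \<Union>{U. open U \<and> (AE x in lebesgue_on S. x \<in> U \<longrightarrow> f x = 0)}"


subsection \<open>The integrand\<close>

definition entry_deriv ::
    "'m \<Rightarrow> 'n \<Rightarrow> (real^'n^'m \<Rightarrow> real) \<Rightarrow> real^'n^'m \<Rightarrow> real"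
  where "entry_deriv i j F P = frechet_derivative F (at P) (axis i (axis j 1))"

definition matrix_gradient :: "(real^'n^'m \<Rightarrow> real) \<Rightarrow> real^'n^'m \<Rightarrow> real^'n^'m"
  where "matrix_gradient F P = (\<chi> i j. entry_deriv i j F P)"

definition matrix_inner :: "real^'n^'m \<Rightarrow> real^'n^'m \<Rightarrow> real"
  where "matrix_inner A B = trace (transpose A ** B)"

text \<open>The norm of type \<^typ>\<open>real^'n^'m\<close> is the Euclidean (Frobenius) norm of the entries.\<close>

definition uniformly_convex :: "(real^'n^'m \<Rightarrow> real) \<Rightarrow> bool"
  where "uniformly_convex F \<longleftrightarrow>
    (\<exists>\<mu>>0. \<forall>P \<xi>.
       (\<Sum>i\<in>UNIV. \<Sum>j\<in>UNIV. \<Sum>k\<in>UNIV. \<Sum>l\<in>UNIV.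
          entry_deriv i j (entry_deriv k l F) P * \<xi> $ i $ j * \<xi> $ k $ l) \<ge> \<mu> * (norm \<xi>)\<^sup>2)"

definition linear_growth :: "(real^'n^'m \<Rightarrow> real^'n^'m) \<Rightarrow> bool"
  where "linear_growth A \<longleftrightarrow> (\<exists>C. \<forall>P. norm (A P) \<le> C * (1 + norm P))"

definition bounded_Hessian :: "(real^'n^'m \<Rightarrow> real) \<Rightarrow> bool"
  where "bounded_Hessian F \<longleftrightarrow>
    (\<exists>M. \<forall>P i j k l. \<bar>entry_deriv i j (entry_deriv k l F) P\<bar> \<le> M)"


subsection \<open>Area-preserving minimizers and the hydrostatic pressure\<close>

definition energy :: "(real^2^2 \<Rightarrow> real) \<Rightarrow> (real^2) set \<Rightarrow> (real^2 \<Rightarrow> real^2) \<Rightarrow> real"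
  where "energy L \<Omega> w = (LINT x|lebesgue_on \<Omega>. L (weak_gradient \<Omega> w x))"

definition admissible :: "(real^2) set \<Rightarrow> (real^2 \<Rightarrow> real^2) set"
  where "admissible \<Omega> =
    {w. Sobolev1 2 \<Omega> w \<and> (AE x in lebesgue_on \<Omega>. det (weak_gradient \<Omega> w x) = 1)}"

definition area_preserving_minimizer ::
    "(real^2^2 \<Rightarrow> real) \<Rightarrow> (real^2) set \<Rightarrow> (real^2 \<Rightarrow> real^2) \<Rightarrow> bool"
  where "area_preserving_minimizer L \<Omega> u \<longleftrightarrow>
    u \<in> admissible \<Omega> \<and>
    (\<forall>w\<in>admissible \<Omega>.
       compact (ess_support \<Omega> (\<lambda>x. w x - u x)) \<and> ess_support \<Omega> (\<lambda>x. w x - u x) \<subseteq> \<Omega> \<longrightarrow>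
       energy L \<Omega> u \<le> energy L \<Omega> w)"

definition hydrostatic_pressure ::
    "(real^2^2 \<Rightarrow> real) \<Rightarrow> (real^2) set \<Rightarrow> (real^2 \<Rightarrow> real^2) \<Rightarrow> (real^2 \<Rightarrow> real) \<Rightarrow> bool"
  where "hydrostatic_pressure L \<Omega> u q \<longleftrightarrow>
    Lp_loc_on (3/2) (u ` \<Omega>) q \<and>
    (\<forall>v :: real^2 \<Rightarrow> real^2. test_function (u ` \<Omega>) v \<longrightarrow>
       (LINT x|lebesgue_on \<Omega>.
          matrix_inner (matrix_gradient L (weak_gradient \<Omega> u x)) (weak_gradient \<Omega> (v \<circ> u) x))
     = (LINT y|lebesgue_on (u ` \<Omega>). q y * divergence v y))"

end

theory Submission
 imports Defs
begin

text \<open>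
 Regularity holds on all of \<open>\<Omega>\<close>. Testing the pressure equation with a mollification of
 \<open>\<phi> \<circ> u\<inverse>\<close>, whose gradient is computed from the Piola identity, yields
 \<open>\<integral> DL(\<nabla>u) : \<nabla>\<phi> = \<integral> (q \<circ> u) cof \<nabla>u : \<nabla>\<phi>\<close>. The exponent 3 makes \<open>u\<close> Hoelder continuous
 and measure preserving (Morrey), so \<open>q \<circ> u\<close> is Hoelder; as the cofactor is a null Lagrangian,
 \<open>q \<circ> u\<close> may be replaced by its oscillation, and the right-hand side is a small multiple of
 \<open>\<nabla>u\<close>. Comparing with near minimizers of \<open>\<integral> L\<close>, whose gradients decay in mean by
 Widman's hole filling in two dimensions, gives excess decay at every point (Campanato).
\<close>

text \<open>Inserting the pulled-back test field pairs three cubically integrable factors: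
  \<open>A (D x)\<close> and \<open>D x\<close>, both of linear growth in the gradient, and the
  mollification error of a field that is itself only as integrable as the gradient. Hence errors are
  measured in the mean of order three, and limits rest on absorbing \<open>a^2 * e\<close> into
  \<open>a^3\<close> and \<open>e^3\<close>.

  A regularity iteration of this kind usually starts only where the excess is small. Here the
  pressure enters linearly in the gradient, with its oscillation over the cube as coefficient. That
  coefficient decays geometrically with the scale whatever the size of the gradient, so the means
  stay bounded and the iteration starts at every point.

  Cubes are used because segments, contractions and a covering of the square annulus by rectangles
  yield the Poincare and Morrey inequalities with explicit constants. Of the constants only
  independence of the scale matters, so they are kept crude.\<close>

lemmas LINT_cong = Bochner_Integration.integral_cong
lemmas LINT_cong_AE = Bochner_Integration.integral_cong_AE
lemmas LINT_bound = Bochner_Integration.integrable_bound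
lemmas LINT_nonneg = Bochner_Integration.integral_nonneg
lemmas LINT_add = Bochner_Integration.integrable_add

section \<open>Smooth functions and mollification\<close>

lemma Ck_on_UNIV_Suc_imp: "Ck_on (Suc k) UNIV f ==> Ck_on k UNIV f"
proof (induction k arbitrary: f)
 case 0
 then show ?case
  by (simp add: continuous_at_imp_continuous_on differentiable_imp_continuous_within)
next
 case (Suc k)
 have "\<forall>x. f differentiable (at x)" "!!h. Ck_on (Suc k) UNIV (%x. frechet_derivative f (at x) h)"
  using Suc.prems by simp_all
 then show ?case using Suc.IH by simp
qed

lemma has_derivative_frechet_derivative:
 "f differentiable F ==> F = at x ==> (f has_derivative frechet_derivative f (at x)) (at x)"
 using frechet_derivative_works by blast

lemma Ck_on_const: "Ck_on k UNIV (%x. c)"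
 by (induction k arbitrary: c) (auto simp: frechet_derivative_const)

lemma Ck_on_add:
 "Ck_on k UNIV f ==> Ck_on k UNIV g ==> Ck_on k UNIV (%x. f x + g x)"
proof (induction k arbitrary: f g)
 case 0 then show ?case by (auto intro: continuous_intros)
next
 case (Suc k)
 have "frechet_derivative (%x. f x + g x) (at x) h =
   frechet_derivative f (at x) h + frechet_derivative g (at x) h" for x h
  using Suc.prems by (subst frechet_derivative_at[symmetric, OF has_derivative_add[OF has_derivative_frechet_derivative[OF _ refl] has_derivative_frechet_derivative[OF _ refl]]]) auto
 then show ?case using Suc by auto
qed

lemma Ck_on_mult:
 fixes f g :: "'a::real_normed_vector => real"
 shows "Ck_on k UNIV f ==> Ck_on k UNIV g ==> Ck_on k UNIV (%x. f x * g x)"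
proof (induction k arbitrary: f g)
 case 0 then show ?case by (auto intro: continuous_intros)
next
 case (Suc k)
 have "frechet_derivative (%x. f x * g x) (at x) h =
   f x * frechet_derivative g (at x) h + frechet_derivative f (at x) h * g x" for x h
  using Suc.prems by (subst frechet_derivative_at[symmetric, OF has_derivative_mult[OF has_derivative_frechet_derivative[OF _ refl] has_derivative_frechet_derivative[OF _ refl]]]) auto
 moreover have "Ck_on k UNIV f" "Ck_on k UNIV g"
  using Suc.prems Ck_on_UNIV_Suc_imp by blast+
 ultimately show ?case using Suc by (auto intro!: Ck_on_add)
qed

lemma Ck_on_affine:
 assumes "bounded_linear f"
 shows "Ck_on k UNIV (%x. f x + c)"
proof (cases k)
 case 0
 then show ?thesis using assms by (simp add: continuous_on_add linear_continuous_on)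
next
 case (Suc m)
 have "((%x. f x + c) has_derivative f) (at x)" for x
  using assms by (auto intro!: derivative_eq_intros bounded_linear_imp_has_derivative)
 then have "frechet_derivative (%x. f x + c) (at x) = f" "(%x. f x + c) differentiable (at x)" for x
  by (simp add: frechet_derivative_at[symmetric], metis differentiableI)
 then show ?thesis using Suc by (auto simp: Ck_on_const)
qed

text \<open>Every derivative of \<open>exp (-1/t)\<close> is a combination of the functions \<open>exp (-1/t) / t ^ n\<close>.\<close>

definition flat_exp :: "nat => real => real"
 where "flat_exp n t = (if t <= 0 then 0 else exp (- (1 / t)) / t ^ n)"

lemma flat_exp_nonneg: "flat_exp n t >= 0"
 by (simp add: flat_exp_def)

text \<open>One term of the exponential series, the one of order \<open>n + 2\<close>, already beats
  the power \<open>t ^ n\<close> with two orders to spare; a quadratic bound is what makes the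
  difference quotient at 0 vanish.\<close>

lemma flat_exp_le: "flat_exp n t <= fact (n + 2) * t^2"
proof (cases "t <= 0")
 case False
 have "(1/t) ^ (n+2) / fact (n+2) <= exp (1/t)"
 proof -
  have s: "summable (%n. inverse (fact n) * (1/t) ^ n)" by (rule summable_exp)
  have "sum (%n. inverse (fact n) * (1/t) ^ n) {n+2} <= suminf (%n. inverse (fact n) * (1/t) ^ n)"
   using False by (intro sum_le_suminf s) auto
  then show ?thesis using False by (simp add: exp_def divide_inverse mult.commute scaleR_conv_of_real)
 qed
 then have "1 <= fact (n+2) * t ^ (n+2) * exp (1/t)"
  using False by (simp add: power_one_over field_simps del: fact_Suc)
 then have "exp (- (1/t)) <= fact (n+2) * t ^ (n+2)"
  by (simp add: exp_minus field_simps)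
 then show ?thesis using False
  by (simp add: flat_exp_def divide_le_eq power_add mult_ac power2_eq_square del: fact_Suc)
qed (simp add: flat_exp_def)

lemma flat_exp_deriv:
 "(flat_exp n has_real_derivative (flat_exp (n + 2) t - real n * flat_exp (n + 1) t)) (at t)"
proof -
 consider "t < 0" | "t = 0" | "t > 0" by linarith
 then show ?thesis
 proof cases
  case 1
  have "((%_. 0) has_real_derivative 0) (at t)" by simp
  then have "(flat_exp n has_real_derivative 0) (at t)"
   by (rule has_field_derivative_transform_within_open[where S="{..<0}"])
    (use 1 in \<open>auto simp: flat_exp_def\<close>)
  then show ?thesis using 1 by (simp add: flat_exp_def)
 next
  case 2
  have "((%h. flat_exp n h / h) \<longlongrightarrow> 0) (at 0)"
  proof (rule Lim_null_comparison)
   show "((%h. fact (n + 2) * \<bar>h\<bar>) \<longlongrightarrow> (0::real)) (at 0)"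
    by (auto intro!: tendsto_eq_intros)
   have "norm (flat_exp n h / h) <= fact (n+2) * \<bar>h\<bar>" if "h ~= 0" for h
   proof -
    have "norm (flat_exp n h / h) = flat_exp n h / \<bar>h\<bar>"
     using flat_exp_nonneg[of n h] by simp
    also have "... <= fact (n+2) * h^2 / \<bar>h\<bar>"
     using flat_exp_le[of n h] by (intro divide_right_mono) auto
    also have "... = fact (n+2) * \<bar>h\<bar>"
     using that by (simp add: power2_eq_square abs_if)
    finally show ?thesis .
   qed
   then show "\<forall>\<^sub>F h in at 0. norm (flat_exp n h / h) <= fact (n+2) * \<bar>h\<bar>"
    by (auto simp: eventually_at intro!: exI[of _ 1])
  qed
  then show ?thesis using 2 by (simp add: DERIV_def flat_exp_def)
 next
  case 3
  have "((%t. exp (- (1 / t)) / t ^ n) has_real_derivative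
    (exp (- (1 / t)) * (1/t^2) * t^n - exp (- (1/t)) * (real n * t ^ (n-1))) / (t^n * t^n)) (at t)"
   using 3 by (auto intro!: derivative_eq_intros simp: power2_eq_square)
  moreover have "(exp (- (1 / t)) * (1/t^2) * t^n - exp (- (1/t)) * (real n * t ^ (n-1))) / (t^n * t^n)
   = flat_exp (n + 2) t - real n * flat_exp (n + 1) t"
   using 3 by (cases n) (auto simp: flat_exp_def field_simps power_add power2_eq_square)
  ultimately have "((%t. exp (- (1 / t)) / t ^ n) has_real_derivative flat_exp (n + 2) t - real n * flat_exp (n + 1) t) (at t)"
   by simp
  then show ?thesis
   by (rule has_field_derivative_transform_within_open[where S="{0<..}"])
    (use 3 in \<open>auto simp: flat_exp_def\<close>)
 qed
qed

text \<open>The induction runs over all \<open>n\<close> at once because differentiation raises the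
  index by one and by two.\<close>

lemma Ck_on_flat_exp:
 assumes "!!k. Ck_on k UNIV g"
 shows "Ck_on k UNIV (%x. flat_exp n (g x))"
proof (induction k arbitrary: n)
 case 0
 have "continuous_on UNIV g" using assms[of 0] by simp
 moreover have "continuous_on UNIV (flat_exp n)"
  by (meson DERIV_isCont continuous_at_imp_continuous_on flat_exp_deriv)
 ultimately have "continuous_on UNIV (%x. flat_exp n (g x))"
  by (intro continuous_on_compose2[of UNIV "flat_exp n" UNIV g]) auto
 then show ?case by simp
next
 case (Suc k)
 have g: "g differentiable (at x)" "Ck_on k UNIV (%x. frechet_derivative g (at x) h)" for x h
  using assms[of "Suc k"] by auto
 have d: "((%x. flat_exp n (g x)) has_derivative
   (%h. (flat_exp (n + 2) (g x) + (- real n) * flat_exp (n + 1) (g x)) * frechet_derivative g (at x) h)) (at x)" for x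
 proof -
  have "(flat_exp n has_derivative (%h. (flat_exp (n + 2) (g x) - real n * flat_exp (n + 1) (g x)) * h)) (at (g x))"
   using flat_exp_deriv[of n "g x"] by (simp add: has_field_derivative_def)
  from has_derivative_compose[OF has_derivative_frechet_derivative[OF g(1) refl] this]
  show ?thesis by simp
 qed
 have "Ck_on k UNIV (%x. (flat_exp (n + 2) (g x) + (- real n) * flat_exp (n + 1) (g x)) * frechet_derivative g (at x) h)" for h
  by (intro Ck_on_mult Ck_on_add Suc.IH Ck_on_const g)
 then show ?case
  using d by (auto simp: differentiableI frechet_derivative_at[OF d, symmetric] intro: differentiableI)
qed

text \<open>Each radius has its own normalized bump instead of a rescaled fixed profile, so unit
  mass is immediate and no change of scale is needed.\<close>

definition mollifier :: "real => 'a::euclidean_space => real"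
 where "mollifier e x = flat_exp 0 (e^2 - x \<bullet> x) / (LINT z|lborel. flat_exp 0 (e^2 - (z::'a) \<bullet> z))"

lemma Ck_on_bump: "Ck_on k UNIV (%x. flat_exp 0 (c - (x - y) \<bullet> (x - y)))"
proof (rule Ck_on_flat_exp)
 show "Ck_on k UNIV (%x. c - (x - y) \<bullet> (x - y))" for k
 proof (cases k)
  case (Suc m)
  have d: "((%x. c - (x - y) \<bullet> (x - y)) has_derivative (%h. (-2) * ((x - y) \<bullet> h))) (at x)" for x
   by (auto intro!: derivative_eq_intros simp: inner_commute)
  have "Ck_on m UNIV (%x. x \<bullet> ((-2) *\<^sub>R h) + 2 * (y \<bullet> h))" for h
   by (intro Ck_on_affine bounded_linear_inner_left)
  then have "Ck_on m UNIV (%x. (-2) * ((x - y) \<bullet> h))" for h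
   by (simp add: algebra_simps)
  then show ?thesis
   using Suc d by (auto simp: frechet_derivative_at[OF d, symmetric] intro: differentiableI)
 qed (auto intro!: continuous_intros)
qed

lemma flat_exp_0_pos: "t > 0 ==> flat_exp 0 t > 0"
 by (simp add: flat_exp_def)

lemma bump_continuous: "continuous_on UNIV (%z::'a::euclidean_space. flat_exp 0 (c - z \<bullet> z))"
 using Ck_on_bump[of 0 c 0] by simp

lemma integrable_continuous_compact_support:
 fixes f :: "'a::euclidean_space => 'b::euclidean_space"
 assumes "continuous_on UNIV f" "!!x. norm x > R ==> f x = 0"
 shows "integrable lborel f"
proof -
 have "integrable lborel (%x. indicator (cball 0 R) x *\<^sub>R f x)"
  using assms(1) by (intro borel_integrable_compact) (auto intro: continuous_on_subset)
 moreover have "(%x. indicator (cball 0 R) x *\<^sub>R f x) = f"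
  using assms(2) by (auto simp: fun_eq_iff indicator_def not_le)
 ultimately show ?thesis by simp
qed

lemma bump_vanish: "norm x >= e ==> e >= 0 ==> flat_exp 0 (e^2 - x \<bullet> x) = 0"
 by (simp add: flat_exp_def dot_square_norm power_mono)

lemma bump_integral_pos:
 assumes "e > 0"
 shows "(LINT z|lborel. flat_exp 0 (e^2 - (z::'a::euclidean_space) \<bullet> z)) > 0"
proof -
 let ?f = "%z::'a. flat_exp 0 (e^2 - z \<bullet> z)"
 have i: "integrable lborel ?f"
  using assms by (intro integrable_continuous_compact_support[where R=e] bump_continuous) (auto intro: bump_vanish)
 have "(LINT z|lborel. ?f z) ~= 0"
 proof
  assume "(LINT z|lborel. ?f z) = 0"
  then have "AE z in lborel. ?f z = 0"
   using integral_nonneg_eq_0_iff_AE[OF i] by (simp add: flat_exp_nonneg)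
  moreover have "?f z = 0 ==> z ~: ball 0 e" for z
  proof
   assume a: "?f z = 0" "z : ball 0 e"
   then have "z \<bullet> z < e^2" using assms by (simp add: dot_square_norm power_strict_mono)
   then show False using flat_exp_0_pos[of "e^2 - z \<bullet> z"] a by simp
  qed
  ultimately have "AE z in lborel. z ~: ball (0::'a) e" by (auto elim: eventually_mono)
  then have "emeasure lborel (ball (0::'a) e) = 0"
   by (subst (asm) AE_iff_measurable[where N="ball 0 e"]) auto
  then show False using assms unit_ball_vol_pos[of "real DIM('a)"] by (simp add: emeasure_ball)
 qed
 moreover have "(LINT z|lborel. ?f z) >= 0" by (intro LINT_nonneg) (auto simp: flat_exp_nonneg)
 ultimately show ?thesis by linarith
qed

lemma mollifier_nonneg: "mollifier e x >= 0"
 unfolding mollifier_def by (intro divide_nonneg_nonneg LINT_nonneg) (auto simp: flat_exp_nonneg)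

lemma mollifier_vanish: "norm x >= e ==> e >= 0 ==> mollifier e x = 0"
 unfolding mollifier_def by (simp add: bump_vanish)

lemma mollifier_minus: "mollifier e (x - y) = mollifier e (y - x)"
 unfolding mollifier_def by (simp add: inner_diff inner_commute algebra_simps)

lemma Ck_on_mollifier: "Ck_on k UNIV (%x. mollifier e (x - y))"
proof -
 have "Ck_on k UNIV (%x. flat_exp 0 (e^2 - (x - y) \<bullet> (x - y)) * (1 / (LINT z|lborel. flat_exp 0 (e^2 - (z::'a) \<bullet> z))))"
  by (intro Ck_on_mult Ck_on_bump Ck_on_const)
 then show ?thesis by (simp add: mollifier_def)
qed

lemma Ck_on_mollifier_0: "Ck_on k UNIV (mollifier e)"
 using Ck_on_mollifier[of k e 0] by simp

lemma mollifier_continuous: "continuous_on UNIV (mollifier e)"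
 using Ck_on_mollifier_0[of 0] by simp

lemma mollifier_integrable: "e >= 0 ==> integrable lborel (mollifier e :: 'a::euclidean_space => real)"
 by (intro integrable_continuous_compact_support[where R=e] mollifier_continuous) (auto intro: mollifier_vanish)

lemma mollifier_integral:
 assumes "e > 0" shows "(LINT x|lborel. mollifier e (x::'a::euclidean_space)) = 1"
 unfolding mollifier_def using bump_integral_pos[OF assms, where 'a='a] by simp

section \<open>Convolution with a compactly supported kernel\<close>

definition conv :: "('a::euclidean_space => real) => ('a => 'b::euclidean_space) => 'a => 'b"
 where "conv k f x = (LINT y|lborel. k (x - y) *\<^sub>R f y)"

lemma compact_support_bounded:
 fixes k :: "'a::euclidean_space => 'b::real_normed_vector"
 assumes "continuous_on UNIV k" "!!x. norm x > R ==> k x = 0"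
 obtains B where "B > 0" "!!x. norm (k x) <= B"
proof -
 have "compact (k ` cball 0 R)"
  using assms(1) by (intro compact_continuous_image) (auto intro: continuous_on_subset)
 then obtain B where "B > 0" "!!y. y : k ` cball 0 R ==> norm y <= B"
  using compact_imp_bounded bounded_pos by metis
 then show ?thesis using that[of B] assms(2) by (metis imageI linorder_not_le mem_cball_0 norm_zero order_less_imp_le)
qed

lemma compact_support_uniformly_continuous:
 fixes k :: "'a::euclidean_space => 'b::real_normed_vector"
 assumes "continuous_on UNIV k" "!!x. norm x > R ==> k x = 0" "e > 0"
 obtains d where "d > 0" "!!x y. norm (x - y) < d ==> norm (k x - k y) < e"
proof -
 \<comment> \<open>The margin 1 settles the case distinction: two points closer than 1 either both
   lie in the enlarged ball, or both lie outside radius \<open>R\<close>, where \<open>k\<close>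
   vanishes.\<close>
 have "uniformly_continuous_on (cball 0 (R + 1)) k"
  using assms(1) by (intro compact_uniformly_continuous) (auto intro: continuous_on_subset)
 then obtain d where d: "d > 0"
   "!!x y. x : cball 0 (R+1) ==> y : cball 0 (R+1) ==> dist x y < d ==> dist (k x) (k y) < e"
  using \<open>e > 0\<close> unfolding uniformly_continuous_on_def by metis
 have "norm (k x - k y) < e" if "norm (x - y) < min d 1" for x y
 proof (cases "x : cball 0 (R+1) & y : cball 0 (R+1)")
  case True
  then show ?thesis using d(2)[of x y] that by (simp add: dist_norm)
 next
  case False
  have "\<bar>norm x - norm y\<bar> < 1" using that norm_triangle_ineq3[of x y] by simp
  then have "norm x > R" "norm y > R" using False by auto
  then show ?thesis using assms(2,3) by simp
 qed
 then show ?thesis using d(1) by (intro that[of "min d 1"]) auto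
qed

lemma integrable_bounded_scaleR:
 fixes f :: "'a::euclidean_space => 'b::euclidean_space"
 assumes "integrable lborel f" "continuous_on UNIV k" "!!x. \<bar>k x\<bar> <= B"
 shows "integrable lborel (%y. k y *\<^sub>R f y)"
proof (rule LINT_bound)
 show "integrable lborel (%y. B *\<^sub>R f y)" using assms(1) by simp
 have [measurable]: "k : borel_measurable borel" using assms(2) by (rule borel_measurable_continuous_onI)
 have [measurable]: "f : borel_measurable borel" using assms(1) by (auto dest: borel_measurable_integrable)
 show "(%y. k y *\<^sub>R f y) : borel_measurable lborel" by simp
 have "norm (k y *\<^sub>R f y) <= norm (B *\<^sub>R f y)" for y
  using assms(3)[of y] by (auto intro!: mult_right_mono)
 then show "AE y in lborel. norm (k y *\<^sub>R f y) <= norm (B *\<^sub>R f y)" by simp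
qed

lemma continuous_on_reflect:
 "continuous_on UNIV k ==> continuous_on UNIV (%y::'a::real_normed_vector. k (x - y))"
 by (rule continuous_on_compose2[of UNIV k]) (auto intro: continuous_intros)

lemma conv_integrable:
 fixes f :: "'a::euclidean_space => 'b::euclidean_space"
 assumes "integrable lborel f" "continuous_on UNIV k" "!!x. norm x > R ==> k x = 0"
 shows "integrable lborel (%y. k (x - y) *\<^sub>R f y)"
proof -
 obtain B where "!!x. norm (k x) <= B" using compact_support_bounded[OF assms(2,3)] by metis
 then show ?thesis
  by (intro integrable_bounded_scaleR[where B=B] assms continuous_on_reflect) auto
qed

lemma conv_continuous:
 fixes f :: "'a::euclidean_space => 'b::euclidean_space"
 assumes "integrable lborel f" "continuous_on UNIV k" "!!x. norm x > R ==> k x = 0"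
 shows "continuous_on UNIV (conv k f)"
 unfolding continuous_on_iff
proof (intro ballI allI impI)
 fix x and e :: real assume "e > 0"
 define I where "I = (LINT y|lborel. norm (f y))"
 have "I >= 0" by (simp add: I_def)
 obtain d where d: "d > 0" "!!x y. norm (x - y) < d ==> norm (k x - k y) < e / (I + 1)"
  using compact_support_uniformly_continuous[OF assms(2,3), where e="e/(I+1)" and R=R] \<open>e > 0\<close> \<open>I >= 0\<close> by auto
 have "dist (conv k f x') (conv k f x) < e" if "dist x' x < d" for x'
 proof -
  have i: "integrable lborel (%y. k (x - y) *\<^sub>R f y)" for x
   by (rule conv_integrable[OF assms])
  have "norm (conv k f x' - conv k f x) = norm (LINT y|lborel. (k (x' - y) - k (x - y)) *\<^sub>R f y)"
   unfolding conv_def by (simp add: i scaleR_left_diff_distrib)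
  also have "... <= (LINT y|lborel. norm ((k (x' - y) - k (x - y)) *\<^sub>R f y))"
   by (rule integral_norm_bound)
  also have "... <= (LINT y|lborel. e / (I + 1) * norm (f y))"
  proof (rule integral_mono)
   show "integrable lborel (%y. norm ((k (x' - y) - k (x - y)) *\<^sub>R f y))"
    using Bochner_Integration.integrable_diff[OF i[of x'] i[of x]]
    by (intro integrable_norm) (simp add: scaleR_left_diff_distrib)
   show "norm ((k (x' - y) - k (x - y)) *\<^sub>R f y) <= e / (I + 1) * norm (f y)" for y
    unfolding norm_scaleR using d(2)[of "x' - y" "x - y"] that
    by (intro mult_right_mono) (auto simp: dist_norm)
  qed (use assms(1) in simp)
  also have "... = e / (I + 1) * I" by (simp add: I_def)
  also have "... < e" using \<open>e > 0\<close> \<open>I >= 0\<close> by (simp add: field_simps)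
  finally show ?thesis by (simp add: dist_norm)
 qed
 then show "\<exists>d>0. \<forall>x'\<in>UNIV. dist x' x < d --> dist (conv k f x') (conv k f x) < e"
  using d(1) by blast
qed

text \<open>All smoothness sits in the kernel: its first-order Taylor error is small uniformly in
  the base point, since \<open>g\<close> is uniformly continuous, and this uniform bound is
  integrated against the merely integrable \<open>f\<close>.\<close>

lemma conv_has_derivative:
 fixes f :: "'a::euclidean_space => 'b::euclidean_space"
 assumes f: "integrable lborel f"
  and der: "!!x. (k has_derivative (%h. g x \<bullet> h)) (at x)" and g: "continuous_on UNIV g"
  and van: "!!x. norm x > R ==> k x = 0" "!!x. norm x > R ==> g x = 0"
 shows "(conv k f has_derivative (%h. conv (%z. g z \<bullet> h) f x)) (at x)"
proof -
 have k: "continuous_on UNIV k"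
  using der by (meson continuous_at_imp_continuous_on has_derivative_continuous)
 have gh: "continuous_on UNIV (%z. g z \<bullet> h)" for h by (intro continuous_intros g)
 have i: "integrable lborel (%y. k (x - y) *\<^sub>R f y)" for x
  by (rule conv_integrable[OF f k van(1)])
 have ig: "integrable lborel (%y. (g (x - y) \<bullet> h) *\<^sub>R f y)" for x h
  by (rule conv_integrable[OF f gh, where R=R]) (simp add: van)
 obtain B where B: "!!x. norm (g x) <= B" using compact_support_bounded[OF g van(2)] by metis
 define I where "I = (LINT y|lborel. norm (f y))"
 have "I >= 0" by (simp add: I_def)
 have bl: "bounded_linear (%h. conv (%z. g z \<bullet> h) f x)"
 proof (rule bounded_linear_intro)
  show "conv (%z. g z \<bullet> (a + b)) f x = conv (%z. g z \<bullet> a) f x + conv (%z. g z \<bullet> b) f x" for a b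
   unfolding conv_def by (simp add: ig inner_add_right scaleR_left_distrib)
  show "conv (%z. g z \<bullet> (r *\<^sub>R a)) f x = r *\<^sub>R conv (%z. g z \<bullet> a) f x" for r a
   unfolding conv_def by (simp flip: integral_scaleR_right)
  show "norm (conv (%z. g z \<bullet> h) f x) <= norm h * (B * I)" for h
  proof -
   have "norm (conv (%z. g z \<bullet> h) f x) <= (LINT y|lborel. norm ((g (x - y) \<bullet> h) *\<^sub>R f y))"
    unfolding conv_def by (rule integral_norm_bound)
   also have "... <= (LINT y|lborel. B * norm h * norm (f y))"
   proof (rule integral_mono)
    show "norm ((g (x - y) \<bullet> h) *\<^sub>R f y) <= B * norm h * norm (f y)" for y
     using order_trans[OF Cauchy_Schwarz_ineq2 mult_right_mono[OF B norm_ge_zero], of "x - y" h]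
     by (auto intro!: mult_right_mono)
    show "integrable lborel (%y. norm ((g (x - y) \<bullet> h) *\<^sub>R f y))"
     by (rule integrable_norm[OF ig])
   qed (use f in simp)
   finally show ?thesis by (simp add: I_def mult_ac)
  qed
 qed
 show ?thesis
  unfolding has_derivative_at_alt
 proof (rule conjI[OF bl], intro allI impI)
  fix e :: real assume "e > 0"
  obtain d where d: "d > 0" "!!x y. norm (x - y) < d ==> norm (g x - g y) < e / (I + 1)"
   using compact_support_uniformly_continuous[OF g van(2), where e="e/(I+1)" and R=R] \<open>e > 0\<close> \<open>I >= 0\<close> by auto
  have lin: "\<bar>k (z + h) - k z - g z \<bullet> h\<bar> <= norm h * (e / (I + 1))" if "norm h < d" for z h
  proof -
   have "norm (k (z + h) - k z - g z \<bullet> (z + h - z)) <= norm (z + h - z) * (e / (I + 1))"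
   proof (rule differentiable_bound_linearization[where S="ball z d" and f'="%y h. g y \<bullet> h"])
    show "z + t *\<^sub>R (z + h - z) : ball z d" if "t : {0..1}" for t
    proof -
     have "norm (t *\<^sub>R h) <= norm h" using that by (auto simp: mult_left_le_one_le)
     then show ?thesis using \<open>norm h < d\<close> by (simp add: dist_norm)
    qed
    show "(k has_derivative (%h. g y \<bullet> h)) (at y within ball z d)" for y
     by (rule has_derivative_at_withinI[OF der])
    show "onorm ((%h. g y \<bullet> h) - (%h. g z \<bullet> h)) <= e / (I + 1)" if "y : ball z d" for y
     unfolding fun_diff_def
    proof (rule onorm_le)
     fix i
     have "norm (g y \<bullet> i - g z \<bullet> i) <= norm (g y - g z) * norm i"
      by (simp add: Cauchy_Schwarz_ineq2 flip: inner_diff_left)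
     also have "... <= e / (I + 1) * norm i"
      using d(2)[of y z] that by (intro mult_right_mono) (auto simp: dist_norm norm_minus_commute)
     finally show "norm (g y \<bullet> i - g z \<bullet> i) <= e / (I + 1) * norm i" .
    qed
    show "z : ball z d" using d(1) by simp
   qed
   then show ?thesis by simp
  qed
  have "norm (conv k f x' - conv k f x - conv (%z. g z \<bullet> (x' - x)) f x) <= e * norm (x' - x)"
   if "norm (x' - x) < d" for x'
  proof -
   let ?r = "%y. k (x' - y) - k (x - y) - g (x - y) \<bullet> (x' - x)"
   have "norm (conv k f x' - conv k f x - conv (%z. g z \<bullet> (x' - x)) f x) = norm (LINT y|lborel. ?r y *\<^sub>R f y)"
    unfolding conv_def by (simp add: i ig scaleR_left_diff_distrib)
   also have "... <= (LINT y|lborel. norm (?r y *\<^sub>R f y))"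
    by (rule integral_norm_bound)
   also have "... <= (LINT y|lborel. norm (x' - x) * (e / (I + 1)) * norm (f y))"
   proof (rule integral_mono)
    show "integrable lborel (%y. norm (?r y *\<^sub>R f y))"
     by (intro integrable_norm) (simp add: scaleR_left_diff_distrib i ig)
    show "norm (?r y *\<^sub>R f y) <= norm (x' - x) * (e / (I + 1)) * norm (f y)" for y
    proof -
     have "\<bar>?r y\<bar> <= norm (x' - x) * (e / (I + 1))"
      using lin[OF that, of "x - y"] by (simp add: algebra_simps)
     then show ?thesis unfolding norm_scaleR by (intro mult_right_mono) auto
    qed
   qed (use f in simp)
   also have "... = norm (x' - x) * (e / (I + 1) * I)"
    by (simp add: I_def)
   also have "... <= norm (x' - x) * e"
    using \<open>e > 0\<close> \<open>I >= 0\<close> by (intro mult_left_mono) (auto simp: field_simps)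
   finally show ?thesis by (simp add: mult.commute)
  qed
  then show "\<exists>d>0. \<forall>y. norm (y - x) < d -->
    norm (conv k f y - conv k f x - conv (%z. g z \<bullet> (y - x)) f x) <= e * norm (y - x)"
   using d(1) by blast
 qed
qed


section \<open>Gradients and smoothness of convolutions\<close>

definition grad :: "('a::euclidean_space => real) => 'a => 'a"
 where "grad k x = (\<Sum>b\<in>Basis. frechet_derivative k (at x) b *\<^sub>R b)"

lemma inner_grad:
 assumes "k differentiable (at x)"
 shows "grad k x \<bullet> h = frechet_derivative k (at x) h"
proof -
 have l: "linear (frechet_derivative k (at x))"
  using assms by (rule linear_frechet_derivative)
 have "frechet_derivative k (at x) h = frechet_derivative k (at x) (\<Sum>b\<in>Basis. (h \<bullet> b) *\<^sub>R b)"
  by (simp add: euclidean_representation)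
 also have "... = grad k x \<bullet> h"
  unfolding grad_def by (simp add: linear_sum[OF l] linear_scale[OF l] inner_sum_left inner_commute[of h] mult.commute)
 finally show ?thesis by simp
qed

lemma has_derivative_grad:
 assumes "k differentiable (at x)"
 shows "(k has_derivative (%h. grad k x \<bullet> h)) (at x)"
 using assms by (simp add: inner_grad has_derivative_frechet_derivative)

lemma frechet_derivative_vanish:
 fixes k :: "'a::euclidean_space => 'b::real_normed_vector"
 assumes "!!x. norm x > R ==> k x = 0" "norm x > R"
 shows "frechet_derivative k (at x) = (%h. 0)"
proof -
 have "((%x. 0) has_derivative (%h. 0 :: 'b)) (at x)" by simp
 then have "(k has_derivative (%h. 0)) (at x)"
 proof (rule has_derivative_transform_within_open)
  show "open {x :: 'a. norm x > R}" by (intro open_Collect_less continuous_intros)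
 qed (use assms in auto)
 then show ?thesis by (simp add: frechet_derivative_at[symmetric])
qed

lemma Ck_on_imp_C1:
 fixes k :: "'a::euclidean_space => real"
 assumes "Ck_on (Suc m) UNIV k"
 shows "(k has_derivative (%h. grad k x \<bullet> h)) (at x)" "continuous_on UNIV (grad k)"
proof -
 show "(k has_derivative (%h. grad k x \<bullet> h)) (at x)"
  using assms by (intro has_derivative_grad) simp
 have "Ck_on 1 UNIV k"
  using assms by (induction m) (auto simp del: Ck_on.simps dest: Ck_on_UNIV_Suc_imp)
 then show "continuous_on UNIV (grad k)"
  unfolding grad_def by (auto intro!: continuous_intros)
qed

lemma Ck_on_conv:
 fixes f :: "'a::euclidean_space => 'b::euclidean_space"
 assumes f: "integrable lborel f"
 shows "Ck_on m UNIV k ==> (!!x. norm x > R ==> k x = 0) ==> Ck_on m UNIV (conv k f)"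
proof (induction m arbitrary: k)
 case 0
 then show ?case using conv_continuous[OF f, of k R] by simp
next
 case (Suc m)
 have gv: "grad k x = 0" if "norm x > R" for x
  using frechet_derivative_vanish[OF Suc.prems(2) that] by (simp add: grad_def)
 have d: "(conv k f has_derivative (%h. conv (%z. grad k z \<bullet> h) f x)) (at x)" for x
  by (rule conv_has_derivative[OF f Ck_on_imp_C1[OF Suc.prems(1)] Suc.prems(2) gv])
 have "(%z. grad k z \<bullet> h) = (%z. frechet_derivative k (at z) h)" for h
  using Suc.prems(1) by (auto simp: inner_grad)
 then have "Ck_on m UNIV (%z. grad k z \<bullet> h)" for h using Suc.prems(1) by simp
 then have "Ck_on m UNIV (conv (%z. grad k z \<bullet> h) f)" for h
  by (rule Suc.IH) (simp add: gv)
 then show ?case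
  using d by (auto simp: frechet_derivative_at[OF d, symmetric] intro: differentiableI)
qed

lemma conv_vanish:
 assumes "!!x. norm x >= e ==> k x = 0" "!!y. norm (x - y) < e ==> f y = 0"
 shows "conv k f x = 0"
proof -
 have "k (x - y) *\<^sub>R f y = 0" for y
  using assms by (cases "norm (x - y) < e") auto
 then show ?thesis by (simp add: conv_def del: scaleR_eq_0_iff)
qed

subsection \<open>Convergence of mollifications in the mean of order three\<close>

text \<open>Convexity of the cube as a tangent inequality: with \<open>a\<close> the mean of
  \<open>t\<close> under a probability weight, integration yields Jensen's inequality.\<close>

lemma cube_tangent: "(t::real)^3 >= a^3 + 3 * a^2 * (t - a)" if "t >= 0" "a >= 0"
proof -
 have "t^3 - (a^3 + 3 * a^2 * (t - a)) = (t - a)^2 * (t + 2 * a)"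
  by (simp add: power2_eq_square power3_eq_cube algebra_simps)
 moreover have "(t - a)^2 * (t + 2 * a) >= 0" using that by simp
 ultimately show ?thesis by linarith
qed

lemma norm_add_cube:
 "norm (a + b) ^ 3 <= 4 * (norm a ^ 3 + norm (b::'a::real_normed_vector) ^ 3)"
proof -
 have "norm (a + b) ^ 3 <= (norm a + norm b) ^ 3"
  by (intro power_mono norm_triangle_ineq) auto
 also have "... <= 4 * (norm a ^ 3 + norm b ^ 3)"
 proof -
  have "4 * (x^3 + y^3) - (x + y)^3 = 3 * (x + y) * (x - y)^2" for x y :: real
   by (simp add: power2_eq_square power3_eq_cube algebra_simps)
  moreover have "3 * (norm a + norm b) * (norm a - norm b)^2 >= 0" by simp
  ultimately show ?thesis by (metis diff_ge_0_iff_ge)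
 qed
 finally show ?thesis .
qed

lemma mollifier_shift:
 fixes x :: "'a::euclidean_space"
 assumes e: "e > 0"
 shows "integrable lborel (%y. mollifier e (x - y))" "(LINT y|lborel. mollifier e (x - y)) = 1"
proof -
 let ?m = "mollifier e :: 'a => real"
 have [measurable]: "?m : borel_measurable borel"
  by (rule borel_measurable_continuous_onI[OF mollifier_continuous])
 have eq: "(%y. ?m (x - y)) = (%y. ?m (- x + y))"
  using mollifier_minus[of e x] by (auto simp: algebra_simps)
 have "integrable (distr lborel borel ((+) (- x))) ?m" "(LINT z|distr lborel borel ((+) (- x)). ?m z) = 1"
  using mollifier_integrable[of e] mollifier_integral[OF e] e by (simp_all add: lborel_distr_plus)
 then show "integrable lborel (%y. mollifier e (x - y))" "(LINT y|lborel. mollifier e (x - y)) = 1"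
  unfolding eq by (simp_all add: integrable_distr_eq integral_distr)
qed

text \<open>Jensen's inequality for the probability density \<open>mollifier e (x - y)\<close> holds
  at each \<open>x\<close>; integrating in \<open>x\<close> and exchanging the integrals by Tonelli
  shows that mollification is a contraction in the mean of order three.\<close>

lemma conv_mollifier_Jensen:
 fixes f :: "'a::euclidean_space => 'b::euclidean_space"
 assumes f: "integrable lborel f" "integrable lborel (%x. norm (f x) ^ 3)" and e: "e > 0"
 shows "integrable lborel (%x. norm (conv (mollifier e) f x) ^ 3)"
  "(LINT x|lborel. norm (conv (mollifier e) f x) ^ 3) <= (LINT x|lborel. norm (f x) ^ 3)"
proof -
 let ?m = "mollifier e :: 'a => real"
 have mv: "norm x > e ==> ?m x = 0" for x using e by (simp add: mollifier_vanish)
 have [measurable]: "?m : borel_measurable borel"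
  by (rule borel_measurable_continuous_onI[OF mollifier_continuous])
 have [measurable]: "f : borel_measurable borel" using f(1) by (auto dest: borel_measurable_integrable)
 have [measurable]: "conv ?m f : borel_measurable borel"
  by (rule borel_measurable_continuous_onI[OF conv_continuous[OF f(1) mollifier_continuous mv]])
 have i1: "integrable lborel (%y. ?m (x - y) *\<^sub>R f y)" for x
  by (rule conv_integrable[OF f(1) mollifier_continuous mv])
 have i2: "integrable lborel (%y. ?m (x - y) *\<^sub>R (norm (f y) ^ 3))" for x
  by (rule conv_integrable[OF f(2) mollifier_continuous mv])
 have i3: "integrable lborel (%y. ?m (x - y) *\<^sub>R norm (f y))" for x
  by (rule conv_integrable[OF integrable_norm[OF f(1)] mollifier_continuous mv])
 note m = mollifier_shift[OF e, where 'a='a]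
 have pt: "norm (conv ?m f x) ^ 3 <= (LINT y|lborel. ?m (x - y) * norm (f y) ^ 3)" for x
 proof -
  define a where "a = (LINT y|lborel. ?m (x - y) * norm (f y))"
  have "norm (conv ?m f x) <= (LINT y|lborel. norm (?m (x - y) *\<^sub>R f y))"
   unfolding conv_def by (rule integral_norm_bound)
  also have "... = a" unfolding a_def by (simp add: mollifier_nonneg)
  finally have na: "norm (conv ?m f x) <= a" .
  then have "a >= 0" using norm_ge_zero order_trans by blast
  have "(LINT y|lborel. (a^3 - 3 * a^2 * a) * ?m (x - y) + 3 * a^2 * (?m (x - y) * norm (f y)))
    <= (LINT y|lborel. ?m (x - y) * norm (f y) ^ 3)"
  proof (rule integral_mono)
   show "(a^3 - 3 * a^2 * a) * ?m (x - y) + 3 * a^2 * (?m (x - y) * norm (f y)) <= ?m (x - y) * norm (f y) ^ 3" for y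
    using mult_left_mono[OF cube_tangent[OF norm_ge_zero \<open>a >= 0\<close>, of "f y"] mollifier_nonneg[of e "x - y"]]
    by (simp add: algebra_simps)
  qed (use i2[of x] i3[of x] m in auto)
  moreover have "(LINT y|lborel. (a^3 - 3 * a^2 * a) * ?m (x - y) + 3 * a^2 * (?m (x - y) * norm (f y)))
    = (a^3 - 3 * a^2 * a) * 1 + 3 * a^2 * a"
   using i3[of x] m[of x] by (subst Bochner_Integration.integral_add) (auto simp: a_def)
  ultimately have "a ^ 3 <= (LINT y|lborel. ?m (x - y) * norm (f y) ^ 3)" by simp
  then show ?thesis using power_mono[OF na, of 3] by simp
 qed
 let ?I = "LINT x|lborel. norm (f x) ^ 3"
 have "(\<integral>\<^sup>+x. ennreal (norm (conv ?m f x) ^ 3) \<partial>lborel)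
   <= (\<integral>\<^sup>+x. (\<integral>\<^sup>+y. ennreal (?m (x - y) * norm (f y) ^ 3) \<partial>lborel) \<partial>lborel)"
 proof (rule nn_integral_mono)
  fix x
  have "(\<integral>\<^sup>+y. ennreal (?m (x - y) * norm (f y) ^ 3) \<partial>lborel) = ennreal (LINT y|lborel. ?m (x - y) * norm (f y) ^ 3)"
   using i2[of x] by (intro nn_integral_eq_integral) (auto simp: mollifier_nonneg)
  then show "ennreal (norm (conv ?m f x) ^ 3) <= (\<integral>\<^sup>+y. ennreal (?m (x - y) * norm (f y) ^ 3) \<partial>lborel)"
   using pt[of x] by (simp add: ennreal_leI)
 qed
 also have "... = (\<integral>\<^sup>+y. (\<integral>\<^sup>+x. ennreal (?m (x - y) * norm (f y) ^ 3) \<partial>lborel) \<partial>lborel)"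
  by (rule lborel_pair.Fubini') measurable
 also have "... = (\<integral>\<^sup>+y. ennreal (norm (f y) ^ 3) \<partial>lborel)"
 proof (rule nn_integral_cong)
  fix y
  have "(\<integral>\<^sup>+x. ennreal (?m (x - y) * norm (f y) ^ 3) \<partial>lborel)
   = (\<integral>\<^sup>+x. ennreal (norm (f y) ^ 3) * ennreal (?m (y - x)) \<partial>lborel)"
   by (simp add: mollifier_nonneg mollifier_minus[of e y] flip: ennreal_mult) (simp add: mult.commute)
  also have "... = ennreal (norm (f y) ^ 3) * (\<integral>\<^sup>+x. ennreal (?m (y - x)) \<partial>lborel)"
   by (rule nn_integral_cmult) simp
  also have "(\<integral>\<^sup>+x. ennreal (?m (y - x)) \<partial>lborel) = 1"
   using m[of y] by (subst nn_integral_eq_integral) (auto simp: mollifier_nonneg)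
  finally show "(\<integral>\<^sup>+x. ennreal (?m (x - y) * norm (f y) ^ 3) \<partial>lborel) = ennreal (norm (f y) ^ 3)" by simp
 qed
 also have "... = ennreal ?I"
  using f(2) by (intro nn_integral_eq_integral) auto
 finally have le: "(\<integral>\<^sup>+x. ennreal (norm (conv ?m f x) ^ 3) \<partial>lborel) <= ennreal ?I" .
 show int: "integrable lborel (%x. norm (conv ?m f x) ^ 3)"
  using le_less_trans[OF le ennreal_less_top] by (intro integrableI_bounded) auto
 have "ennreal (LINT x|lborel. norm (conv ?m f x) ^ 3) <= ennreal ?I"
  using le nn_integral_eq_integral[OF int] by simp
 then show "(LINT x|lborel. norm (conv ?m f x) ^ 3) <= ?I"
  by (subst (asm) ennreal_le_iff) auto
qed

lemma cube_integrable_bound: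
 fixes f :: "'a::euclidean_space => 'b::euclidean_space"
 assumes "integrable lborel (%x. norm (f x) ^ 3)" "integrable lborel (%x. norm (g x) ^ 3)"
  "f : borel_measurable borel" "g : borel_measurable borel"
 shows "integrable lborel (%x. norm (f x + g x) ^ 3)"
  "(LINT x|lborel. norm (f x + g x) ^ 3) <= 4 * ((LINT x|lborel. norm (f x) ^ 3) + (LINT x|lborel. norm (g x) ^ 3))"
proof -
 have i: "integrable lborel (%x. 4 * (norm (f x) ^ 3 + norm (g x) ^ 3))" using assms by simp
 show j: "integrable lborel (%x. norm (f x + g x) ^ 3)"
  using assms norm_add_cube by (intro LINT_bound[OF i]) auto
 have "(LINT x|lborel. norm (f x + g x) ^ 3) <= (LINT x|lborel. 4 * (norm (f x) ^ 3 + norm (g x) ^ 3))"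
  by (intro integral_mono i j norm_add_cube)
 then show "(LINT x|lborel. norm (f x + g x) ^ 3) <= 4 * ((LINT x|lborel. norm (f x) ^ 3) + (LINT x|lborel. norm (g x) ^ 3))"
  using assms by simp
qed


text \<open>A measurable function is an almost everywhere limit of continuous \<open>g n\<close>,
  but without domination. Truncation in value and in space supplies it: first \<open>n\<close> is
  fixed so that the truncation of \<open>f\<close> is close, then \<open>g m\<close> is truncated in
  the same way and \<open>m\<close> tends to infinity.\<close>

lemma L3_continuous_approx:
 fixes f :: "'a::euclidean_space => 'b::euclidean_space"
 assumes f: "integrable lborel f" "integrable lborel (%x. norm (f x) ^ 3)" and "d > 0"
 obtains c R where "continuous_on UNIV c" "!!x. norm x > R ==> c x = 0"
  "integrable lborel (%x. norm (f x - c x) ^ 3)" "(LINT x|lborel. norm (f x - c x) ^ 3) < d"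
proof -
 have [measurable]: "f : borel_measurable borel" using f(1) by (auto dest: borel_measurable_integrable)
 have "f : borel_measurable lebesgue" by (simp add: measurable_completion)
 then have "f measurable_on UNIV" by (intro lebesgue_measurable_imp_measurable_on) auto
 then obtain N g where N: "negligible N" and g: "!!n. continuous_on UNIV (g n)"
  and lim: "!!x. x ~: N ==> (%n. g n x) \<longlonglongrightarrow> f x"
  unfolding measurable_on_def by auto
 have AE: "AE x in lborel. x ~: N"
 proof -
  have "AE x in lebesgue. x ~: N"
   using N by (intro AE_not_in) (simp add: negligible_iff_null_sets)
  then show ?thesis by (simp add: AE_completion_iff)
 qed
 \<comment> \<open>The nearest-point map to a ball is continuous, bounded by \<open>n\<close>, and
   the identity on vectors of norm at most \<open>n\<close>; composing with it preserves continuity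
   and pointwise limits.\<close>
 define T :: "nat => 'b => 'b" where "T n = closest_point (cball 0 (real n))" for n
 define cut :: "nat => 'a => real" where "cut n x = max 0 (min 1 (real n + 1 - norm x))" for n x
 have T_cont: "continuous_on UNIV (T n)" for n
  unfolding T_def by (intro continuous_on_closest_point) auto
 have T_le: "norm (T n v) <= real n" for n v
  using closest_point_in_set[of "cball 0 (real n)" v] by (auto simp: T_def)
 have T_le2: "norm (T n v) <= norm v" for n v
  using closest_point_lipschitz[of "cball 0 (real n)" v 0] by (auto simp: T_def closest_point_self)
 have T_eq: "norm v <= real n ==> T n v = v" for n v
  by (simp add: T_def closest_point_self)
 have cut_cont: "continuous_on UNIV (cut n)" for n
  unfolding cut_def by (intro continuous_intros)
 have cut_le: "0 <= cut n x" "cut n x <= 1" for n x by (auto simp: cut_def)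
 have cut_0: "cut n x = 0" if "norm x > real n + 1" for n x using that by (simp add: cut_def)
 have [measurable]: "T n : borel_measurable borel" "cut n : borel_measurable borel" "g n : borel_measurable borel" for n
  by (intro borel_measurable_continuous_onI T_cont cut_cont g)+
 define F where "F n x = cut n x *\<^sub>R T n (f x)" for n x
 have F_le: "norm (F n x) <= norm (f x)" for n x
  using mult_mono[OF cut_le(2)[of n x] T_le2[of n "f x"]] cut_le by (simp add: F_def)
 have "(%n. LINT x|lborel. norm (f x - F n x) ^ 3) \<longlonglongrightarrow> (LINT (x::'a)|lborel. 0)"
 proof (rule integral_dominated_convergence)
  show "integrable lborel (%x. 8 * norm (f x) ^ 3)" using f(2) by simp
  show "AE x in lborel. norm (norm (f x - F n x) ^ 3) <= 8 * norm (f x) ^ 3" for n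
  proof (rule AE_I2)
   fix x
   have "norm (f x - F n x) <= 2 * norm (f x)"
    using norm_triangle_ineq4[of "f x" "F n x"] F_le[of n x] by simp
   then have "norm (f x - F n x) ^ 3 <= (2 * norm (f x)) ^ 3" by (intro power_mono) auto
   then show "norm (norm (f x - F n x) ^ 3) <= 8 * norm (f x) ^ 3" by (simp add: power_mult_distrib)
  qed
  show "AE x in lborel. (%n. norm (f x - F n x) ^ 3) \<longlonglongrightarrow> 0"
  proof (rule AE_I2)
   fix x
   obtain n0 where n0: "norm x <= real n0" "norm (f x) <= real n0"
    using real_arch_simple[of "max (norm x) (norm (f x))"] by auto
   have "norm (f x - F n x) ^ 3 = 0" if "n >= n0" for n
   proof -
    have "norm x <= real n" "norm (f x) <= real n" using n0 that by linarith+
    then show ?thesis by (simp add: F_def T_eq cut_def)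
   qed
   then have "\<forall>\<^sub>F n in sequentially. norm (f x - F n x) ^ 3 = 0"
    by (auto simp: eventually_sequentially)
   then show "(%n. norm (f x - F n x) ^ 3) \<longlonglongrightarrow> 0"
    by (rule tendsto_eventually)
  qed
 qed (auto simp: F_def)
 \<comment> \<open>\<open>norm_add_cube\<close> costs a factor 4 on the sum of the two errors, so
   one sixteenth of \<open>d\<close> for each leaves room.\<close>
 then have "\<forall>\<^sub>F n in sequentially. (LINT x|lborel. norm (f x - F n x) ^ 3) < d / 16"
  using \<open>d > 0\<close> by (intro order_tendstoD(2)[where y=0]) auto
 then obtain n where n: "(LINT x|lborel. norm (f x - F n x) ^ 3) < d / 16"
  by (auto simp: eventually_sequentially)
 define c where "c m x = cut n x *\<^sub>R T n (g m x)" for m x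
 have c_le: "norm (F n x - c m x) <= 2 * real n * indicator (cball 0 (real n + 1)) x" for m x
 proof (cases "norm x > real n + 1")
  case False
  have "norm (F n x) <= real n" "norm (c m x) <= real n"
   using mult_mono[OF cut_le(2)[of n x] T_le[of n "f x"]] mult_mono[OF cut_le(2)[of n x] T_le[of n "g m x"]] cut_le
   by (auto simp: F_def c_def)
  then have "norm (F n x - c m x) <= 2 * real n"
   using norm_triangle_ineq4[of "F n x" "c m x"] by simp
  then show ?thesis using False by simp
 qed (simp add: F_def c_def cut_0)
 have c_le3: "norm (F n x - c m x) ^ 3 <= (2 * real n) ^ 3 * indicator (cball 0 (real n + 1)) x" for m x
  using power_mono[OF c_le[of x m], of 3] by (auto simp: power_mult_distrib indicator_def)
 have bi: "integrable lborel (%x. (2 * real n) ^ 3 * indicator (cball 0 (real n + 1)) (x::'a))"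
  by (intro integrable_mult_right integrable_real_indicator) (use emeasure_lborel_cball_finite in auto)
 have ic: "integrable lborel (%x. norm (F n x - c m x) ^ 3)" for m
  using c_le3[of _ m] by (intro LINT_bound[OF bi]) (auto simp: F_def c_def)
 have "(%m. LINT x|lborel. norm (F n x - c m x) ^ 3) \<longlonglongrightarrow> (LINT (x::'a)|lborel. 0)"
 proof (rule integral_dominated_convergence[OF _ _ bi])
  show "AE x in lborel. norm (norm (F n x - c m x) ^ 3) <= (2 * real n) ^ 3 * indicator (cball 0 (real n + 1)) x" for m
   using c_le3[of _ m] by simp
  have "(%m. norm (F n x - c m x) ^ 3) \<longlonglongrightarrow> 0" if "x ~: N" for x
  proof -
   have "(%m. T n (g m x)) \<longlonglongrightarrow> T n (f x)"
    using continuous_on_tendsto_compose[OF T_cont lim[OF that]] by simp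
   then have "(%m. norm (F n x - c m x) ^ 3) \<longlonglongrightarrow> norm (F n x - F n x) ^ 3"
    unfolding c_def by (intro tendsto_intros) (simp add: F_def tendsto_intros)
   then show ?thesis by simp
  qed
  then show "AE x in lborel. (%m. norm (F n x - c m x) ^ 3) \<longlonglongrightarrow> 0"
   using AE by (auto elim: eventually_mono)
 qed (auto simp: F_def c_def)
 then have "\<forall>\<^sub>F m in sequentially. (LINT x|lborel. norm (F n x - c m x) ^ 3) < d / 16"
  using \<open>d > 0\<close> by (intro order_tendstoD(2)[where y=0]) auto
 then obtain m where m: "(LINT x|lborel. norm (F n x - c m x) ^ 3) < d / 16"
  by (auto simp: eventually_sequentially)
 have iF: "integrable lborel (%x. norm (f x - F n x) ^ 3)"
 proof (rule LINT_bound)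
  show "integrable lborel (%x. 8 * norm (f x) ^ 3)" using f(2) by simp
  have "norm (f x - F n x) <= 2 * norm (f x)" for x
   using norm_triangle_ineq4[of "f x" "F n x"] F_le[of n x] by simp
  then have "norm (f x - F n x) ^ 3 <= (2 * norm (f x)) ^ 3" for x by (intro power_mono) auto
  then show "AE x in lborel. norm (norm (f x - F n x) ^ 3) <= norm (8 * norm (f x) ^ 3)"
   by (simp add: power_mult_distrib)
 qed (simp add: F_def)
 have mF: "(%x. f x - F n x) : borel_measurable borel" "(%x. F n x - c m x) : borel_measurable borel"
  by (auto simp: F_def c_def)
 note cb = cube_integrable_bound[OF iF ic mF]
 show thesis
 proof (rule that[of "c m" "real n + 1"])
  show "continuous_on UNIV (c m)" unfolding c_def
   by (intro continuous_intros cut_cont continuous_on_compose2[OF T_cont g]) auto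
  show "norm x > real n + 1 ==> c m x = 0" for x by (simp add: c_def cut_0)
  show "integrable lborel (%x. norm (f x - c m x) ^ 3)" using cb(1) by simp
  show "(LINT x|lborel. norm (f x - c m x) ^ 3) < d" using cb(2) n m \<open>d > 0\<close> by simp
 qed
qed

lemma mollification_close:
 fixes c :: "'a::euclidean_space => 'b::euclidean_space"
 assumes c: "integrable lborel c" and e: "e > 0"
  and close: "!!y. norm (x - y) < e ==> norm (c y - c x) <= h"
 shows "norm (conv (mollifier e) c x - c x) <= h"
proof -
 let ?m = "mollifier e :: 'a => real"
 have mv: "norm x > e ==> ?m x = 0" for x using e by (simp add: mollifier_vanish)
 have i1: "integrable lborel (%y. ?m (x - y) *\<^sub>R c y)"
  by (rule conv_integrable[OF c mollifier_continuous mv])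
 have i2: "integrable lborel (%y. ?m (x - y) *\<^sub>R c x)"
  using mollifier_shift(1)[OF e, of x] by simp
 have "(LINT y|lborel. ?m (x - y) *\<^sub>R c x) = c x"
  using mollifier_shift[OF e, of x] by simp
 then have "norm (conv ?m c x - c x) = norm (LINT y|lborel. ?m (x - y) *\<^sub>R (c y - c x))"
  using i1 i2 by (simp add: conv_def scaleR_diff_right)
 also have "... <= (LINT y|lborel. norm (?m (x - y) *\<^sub>R (c y - c x)))" by (rule integral_norm_bound)
 also have "... <= (LINT y|lborel. ?m (x - y) * h)"
 proof (rule integral_mono)
  show "integrable lborel (%y. norm (?m (x - y) *\<^sub>R (c y - c x)))"
   using i1 i2 by (intro integrable_norm) (simp add: scaleR_diff_right)
  show "norm (?m (x - y) *\<^sub>R (c y - c x)) <= ?m (x - y) * h" for y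
  proof (cases "norm (x - y) < e")
   case True
   then show ?thesis using close mollifier_nonneg[of e "x - y"] by (auto intro: mult_left_mono)
  next
   case False
   then show ?thesis using e by (simp add: mollifier_vanish)
  qed
 qed (use mollifier_shift(1)[OF e, of x] in simp)
 also have "... = h" using mollifier_shift[OF e, of x] by simp
 finally show ?thesis .
qed

text \<open>With a continuous compactly supported \<open>c\<close> near \<open>f\<close>, the error
  splits into the mollification of \<open>f - c\<close>, bounded by the contraction property, the
  uniformly small error of \<open>c\<close>, and \<open>c - f\<close>. Two uses of
  \<open>norm_add_cube\<close> bring the total to 36/64 of \<open>d\<close>.\<close>

lemma mollification_L3:
 fixes f :: "'a::euclidean_space => 'b::euclidean_space"
 assumes f: "integrable lborel f" "integrable lborel (%x. norm (f x) ^ 3)" and "d > 0"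
 obtains e0 where "e0 > 0"
  "!!e. 0 < e ==> e < e0 ==> integrable lborel (%x. norm (conv (mollifier e) f x - f x) ^ 3)"
  "!!e. 0 < e ==> e < e0 ==> (LINT x|lborel. norm (conv (mollifier e) f x - f x) ^ 3) < d"
proof -
 obtain c R where c: "continuous_on UNIV c" "!!x. norm x > R ==> c x = 0"
  "integrable lborel (%x. norm (f x - c x) ^ 3)" "(LINT x|lborel. norm (f x - c x) ^ 3) < d/64"
  using L3_continuous_approx[OF f, of "d/64"] \<open>d > 0\<close> by auto
 have [measurable]: "f : borel_measurable borel" using f(1) by (auto dest: borel_measurable_integrable)
 have [measurable]: "c : borel_measurable borel" by (rule borel_measurable_continuous_onI[OF c(1)])
 have ci: "integrable lborel c" by (rule integrable_continuous_compact_support[OF c(1,2)])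
 define V where "V = measure lborel (cball (0::'a) (R + 1))"
 have "V >= 0" by (simp add: V_def)
 \<comment> \<open>\<open>h\<close> is at most 1, so its cube is at most \<open>h\<close>;
   multiplied by the volume \<open>V\<close> of the ball of radius \<open>R + 1\<close>, which
   contains the support of the error when \<open>e < 1\<close>, it stays below
   \<open>d / 64\<close>.\<close>
 define h where "h = min 1 (d / (64 * (V + 1)))"
 have h: "h > 0" "h ^ 3 * V < d / 64"
 proof -
  show "h > 0" using \<open>d > 0\<close> \<open>V >= 0\<close> by (simp add: h_def)
  have "h ^ 3 <= h ^ 1" using \<open>h > 0\<close> by (intro power_decreasing) (auto simp: h_def)
  then have "h ^ 3 * V <= h * V" using \<open>V >= 0\<close> by (simp add: mult_right_mono)
  also have "... < h * (V + 1)" using \<open>h > 0\<close> by simp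
  also have "... <= d / (64 * (V + 1)) * (V + 1)"
   using \<open>V >= 0\<close> by (intro mult_right_mono) (auto simp: h_def)
  also have "... = d / 64" using \<open>V >= 0\<close> by (simp add: divide_simps)
  finally show "h ^ 3 * V < d / 64" .
 qed
 obtain e0 where e0: "e0 > 0" "!!x y. norm (x - y) < e0 ==> norm (c x - c y) < h"
  using compact_support_uniformly_continuous[OF c(1,2) h(1)] by metis
 have main: "integrable lborel (%x. norm (conv (mollifier e) f x - f x) ^ 3) &
   (LINT x|lborel. norm (conv (mollifier e) f x - f x) ^ 3) < d" if e: "0 < e" "e < min e0 1" for e
 proof -
  let ?m = "mollifier e :: 'a => real"
  have mv: "norm x > e ==> ?m x = 0" for x using e by (simp add: mollifier_vanish)
  have [measurable]: "conv ?m f : borel_measurable borel" "conv ?m c : borel_measurable borel"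
   by (rule borel_measurable_continuous_onI[OF conv_continuous[OF _ mollifier_continuous mv]]; use f ci in simp)+
  have lin: "conv ?m (%x. f x - c x) x = conv ?m f x - conv ?m c x" for x
   using conv_integrable[OF f(1) mollifier_continuous mv, where x=x] conv_integrable[OF ci mollifier_continuous mv, where x=x]
   by (simp add: conv_def scaleR_diff_right)
  have fc: "integrable lborel (%x. f x - c x)" using f ci by simp
  note J = conv_mollifier_Jensen[OF fc c(3) e(1)]
  have pt: "norm (conv ?m c x - c x) ^ 3 <= h ^ 3 * indicator (cball 0 (R + 1)) x" for x :: 'a
  proof (cases "norm x > R + 1")
   case True
   have "c y = 0" if "norm (x - y) < e" for y :: 'a
    using that True e norm_triangle_ineq2[of x y] by (intro c(2)) auto
   then have "conv ?m c x = 0" using e by (intro conv_vanish[where e=e] mollifier_vanish) auto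
   then show ?thesis using c(2) True h(1) by simp
  next
   case False
   have "norm (conv ?m c x - c x) <= h"
    using e e0(2) by (intro mollification_close ci) (auto simp: norm_minus_commute intro: less_imp_le)
   then show ?thesis using False power_mono[of "norm (conv (mollifier e) c x - c x)" h 3] by simp
  qed
  have bi: "integrable lborel (%x. h ^ 3 * indicator (cball 0 (R + 1)) (x::'a))"
   by (intro integrable_mult_right integrable_real_indicator) (use emeasure_lborel_cball_finite in auto)
  have ic: "integrable lborel (%x. norm (conv ?m c x - c x) ^ 3)"
   using pt h(1) by (intro LINT_bound[OF bi]) (auto simp: abs_mult)
  have "(LINT x|lborel. norm (conv ?m c x - c x) ^ 3) <= (LINT x|lborel. h ^ 3 * indicator (cball 0 (R + 1)) (x::'a))"
   by (intro integral_mono ic bi pt)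
  also have "... = h ^ 3 * V" by (simp add: V_def)
  finally have B: "(LINT x|lborel. norm (conv ?m c x - c x) ^ 3) < d / 64" using h(2) by linarith
  have ic2: "integrable lborel (%x. norm (c x - f x) ^ 3)" using c(3) by (simp add: norm_minus_commute)
  have C: "(LINT x|lborel. norm (c x - f x) ^ 3) < d / 64" using c(4) by (simp add: norm_minus_commute)
  have b1: "integrable lborel (%x. norm ((conv ?m c x - c x) + (c x - f x)) ^ 3)"
   "(LINT x|lborel. norm ((conv ?m c x - c x) + (c x - f x)) ^ 3) <= 4 * (d/64 + d/64)"
   using cube_integrable_bound[OF ic ic2] B C by auto
  have b2: "integrable lborel (%x. norm (conv ?m (%x. f x - c x) x + ((conv ?m c x - c x) + (c x - f x))) ^ 3)"
   "(LINT x|lborel. norm (conv ?m (%x. f x - c x) x + ((conv ?m c x - c x) + (c x - f x))) ^ 3)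
    <= 4 * ((LINT x|lborel. norm (conv ?m (%x. f x - c x) x) ^ 3) + (LINT x|lborel. norm ((conv ?m c x - c x) + (c x - f x)) ^ 3))"
   by (intro cube_integrable_bound J(1) b1(1); simp add: lin)+
  have eq: "conv ?m (%x. f x - c x) x + ((conv ?m c x - c x) + (c x - f x)) = conv ?m f x - f x" for x
   by (simp add: lin)
  note b2(2)[unfolded eq]
  also have "4 * ((LINT x|lborel. norm (conv ?m (%x. f x - c x) x) ^ 3) + (LINT x|lborel. norm ((conv ?m c x - c x) + (c x - f x)) ^ 3))
   <= 4 * (d / 64 + 4 * (d/64 + d/64))"
   by (intro mult_left_mono add_mono order_trans[OF J(2)] less_imp_le[OF c(4)] b1(2)) simp
  also have "... < d" using \<open>d > 0\<close> by simp
  finally show ?thesis using b2(1) unfolding eq by simp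
 qed
 show thesis using e0(1) main by (intro that[of "min e0 1"]) auto
qed

section \<open>Weak gradients\<close>

lemma compact_neighbourhood:
 fixes K :: "'a::euclidean_space set"
 assumes "compact K" "K <= S" "open S"
 obtains e K' where "e > 0" "compact K'" "K' <= S" "!!x y. x : K ==> norm (x - y) <= e ==> y : K'"
proof (cases "K = {}")
 case True
 then show ?thesis using that[of 1 "{}"] by auto
next
 case False
 obtain d where d: "d > 0" "(\<Union>x\<in>K. ball x d) <= S"
  using compact_subset_open_imp_ball_epsilon_subset[OF assms(1,3,2)] by auto
 let ?K = "{x. infdist x K <= d / 2}"
 have "compact ?K" using False assms(1) d(1) by (intro compact_infdist_le) auto
 moreover have "?K <= S"
 proof
  fix x assume "x : ?K"
  obtain a where "a : K" "infdist x K = dist x a"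
   using infdist_attains_inf[of K x] False assms(1) compact_imp_closed by metis
  then have "x : ball a d" using \<open>x : ?K\<close> d(1) by (simp add: dist_commute)
  then show "x : S" using d(2) \<open>a : K\<close> by blast
 qed
 moreover have "y : ?K" if "x : K" "norm (x - y) <= d / 2" for x y
  using infdist_le[OF that(1), of y] that(2) by (simp add: dist_norm norm_minus_commute)
 ultimately show ?thesis using d(1) by (intro that[of "d/2" ?K]) auto
qed

lemma test_functionI:
 assumes "!!k. Ck_on k UNIV f" "compact K" "K <= S" "!!x. x ~: K ==> f x = 0"
 shows "test_function S f"
proof -
 have c: "closure {x. f x ~= 0} <= K"
  using assms by (intro closure_minimal compact_imp_closed) auto
 then have "K \<inter> closure {x. f x ~= 0} = closure {x. f x ~= 0}" by blast
 then have "compact (closure {x. f x ~= 0})"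
  using compact_Int_closed[OF assms(2) closed_closure, of "{x. f x ~= 0}"] by simp
 then show ?thesis
  unfolding test_function_def smooth_on_def using assms(1,3) c by blast
qed

lemma test_function_conv:
 fixes c :: "'a::euclidean_space => 'b::euclidean_space"
 assumes c: "integrable lborel c" and e: "e > 0" and K': "compact K'" "K' <= S"
  and van: "!!x y. x ~: K' ==> norm (x - y) <= e ==> c y = 0"
 shows "test_function S (conv (mollifier e) c)" "!!x. x ~: K' ==> conv (mollifier e) c x = 0"
proof -
 show z: "conv (mollifier e) c x = 0" if "x ~: K'" for x
  using that van e by (intro conv_vanish[where e=e] mollifier_vanish) auto
 show "test_function S (conv (mollifier e) c)"
  using e z K' by (intro test_functionI Ck_on_conv[OF c Ck_on_mollifier_0, where R=e]) (simp_all add: mollifier_vanish)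
qed

lemma test_function_mollifier:
 fixes x :: "'a::euclidean_space"
 assumes "e > 0" "cball x e <= S"
 shows "test_function S (%y. mollifier e (y - x))"
 using assms by (intro test_functionI[where K="cball x e"] Ck_on_mollifier)
  (auto simp: dist_norm norm_minus_commute intro!: mollifier_vanish)

lemma frechet_derivative_mollifier:
 "frechet_derivative (%y. mollifier e (y - x)) (at y) h = grad (mollifier e) (y - x) \<bullet> h"
proof -
 have "(mollifier e has_derivative (%h. grad (mollifier e) (y - x) \<bullet> h)) (at (y - x))"
  using Ck_on_imp_C1(1)[OF Ck_on_mollifier_0[of "Suc 0" e]] .
 moreover have "((%y. y - x) has_derivative (%h. h)) (at y)"
  by (auto intro!: derivative_eq_intros)
 ultimately have "((%y. mollifier e (y - x)) has_derivative (%h. grad (mollifier e) (y - x) \<bullet> h)) (at y)"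
  using has_derivative_compose[of "%y. y - x" "%h. h" y UNIV "mollifier e"] by simp
 then show ?thesis by (simp add: frechet_derivative_at[symmetric])
qed

lemma grad_mollifier_vanish:
 assumes "norm x > e" "e >= 0" shows "grad (mollifier e) x = 0"
proof -
 have "frechet_derivative (mollifier e) (at x) = (%h. 0)"
  by (rule frechet_derivative_vanish[OF _ assms(1)]) (use assms(2) in \<open>simp add: mollifier_vanish\<close>)
 then show ?thesis by (simp add: grad_def)
qed

lemma grad_mollifier_minus: "grad (mollifier e) (x - y) = - grad (mollifier e) (y - x)"
proof (rule euclidean_eqI)
 fix b :: 'a assume "b : Basis"
 have 1: "(mollifier e has_derivative (%h. grad (mollifier e) x \<bullet> h)) (at x)" for x :: 'a
  using Ck_on_imp_C1(1)[OF Ck_on_mollifier_0[of "Suc 0" e]] .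
 have "((%z. - z) has_derivative (%h. - h)) (at (x - y))" by (auto intro!: derivative_eq_intros)
 from has_derivative_compose[OF this 1]
 have "((%z. mollifier e (- z)) has_derivative (%h. grad (mollifier e) (y - x) \<bullet> (- h))) (at (x - y))"
  by simp
 moreover have "(%z. mollifier e (- z)) = (mollifier e :: 'a => real)"
  using mollifier_minus[of e 0] by auto
 ultimately have "(%h. grad (mollifier e) (y - x) \<bullet> (- h)) = (%h. grad (mollifier e) (x - y) \<bullet> h)"
  using has_derivative_unique[OF 1[of "x - y"]] by simp
 then have "grad (mollifier e) (y - x) \<bullet> (- b) = grad (mollifier e) (x - y) \<bullet> b" by (rule fun_cong)
 then show "grad (mollifier e) (x - y) \<bullet> b = - grad (mollifier e) (y - x) \<bullet> b" by simp
qed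

text \<open>The Jacobian is carried as a matrix field of its own, so that it can be integrated and
  approximated like any other function; both live on the whole space, which leaves cubes and
  supports free to be chosen later.\<close>

definition C1_map :: "(real^'n => real^'m) => (real^'n => real^'n^'m) => bool"
 where "C1_map f F \<longleftrightarrow> (\<forall>x. (f has_derivative (%h. F x *v h)) (at x)) & continuous_on UNIV F"

lemma matrix_inner_eq: "matrix_inner A B = A \<bullet> B"
 by (simp add: matrix_inner_def trace_def matrix_matrix_mult_def transpose_def inner_vec_def)
  (rule sum.swap)

lemma integral_vec_nth:
 fixes f :: "'a => real^'n"
 assumes "integrable M f"
 shows "(LINT x|M. f x $ i) = (LINT x|M. f x) $ i" "integrable M (%x. f x $ i)"
 using integral_inner_left[of "axis i 1" M f] integrable_inner_left[of "axis i 1" M f] assms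
 by (simp_all add: inner_axis)

lemma integral_mat_nth:
 fixes f :: "'a => real^'n^'m"
 assumes "integrable M f"
 shows "(LINT x|M. f x $ i $ j) = (LINT x|M. f x) $ i $ j" "integrable M (%x. f x $ i $ j)"
proof -
 have ax: "A \<bullet> axis i (axis j 1) = A $ i $ j" for A :: "real^'n^'m"
  by (simp add: inner_axis)
 show "(LINT x|M. f x $ i $ j) = (LINT x|M. f x) $ i $ j" "integrable M (%x. f x $ i $ j)"
  using integral_inner_left[of "axis i (axis j 1)" M f] integrable_inner_left[of "axis i (axis j 1)" M f] assms
  by (simp_all add: ax)
qed

text \<open>Only translates of the mollifier occur as test functions, hence the hypothesis
  \<open>weak\<close> at the single point \<open>x\<close>: in the reference domain it is at hand
  where the ball of radius \<open>e\<close> fits inside, and for the pulled-back field it holds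
  everywhere.\<close>

lemma conv_mollifier_derivative:
 fixes U :: "real^'n => real^'m" and W :: "real^'n => real^'n^'m"
 assumes U: "integrable lborel U" and W: "integrable lborel W" and e: "e > 0"
  and weak: "!!i j. (LINT y|lborel. U y $ i * frechet_derivative (%y. mollifier e (y - x)) (at y) (axis j 1))
    = - (LINT y|lborel. W y $ i $ j * mollifier e (y - x))"
 shows "(conv (mollifier e) U has_derivative (%h. conv (mollifier e) W x *v h)) (at x)"
proof -
 let ?m = "mollifier e :: real^'n => real"
 note C1 = Ck_on_imp_C1[OF Ck_on_mollifier_0[of "Suc 0" e, where 'a="real^'n"]]
 have mv: "norm x > e ==> ?m x = 0" for x using e by (simp add: mollifier_vanish)
 have gv: "norm x > e ==> grad ?m x = 0" for x using e by (simp add: grad_mollifier_vanish)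
 have d: "(conv ?m U has_derivative (%h. conv (%z. grad ?m z \<bullet> h) U x)) (at x)"
  by (rule conv_has_derivative[OF U C1 mv gv])
 have ci: "integrable lborel (%y. (grad ?m (x - y) \<bullet> h) *\<^sub>R U y)" for h
  by (rule conv_integrable[OF U, where R=e]) (auto intro!: continuous_intros C1(2) simp: gv)
 have wi: "integrable lborel (%y. ?m (x - y) *\<^sub>R W y)"
  by (rule conv_integrable[OF W mollifier_continuous mv])
 have ax: "conv (%z. grad ?m z \<bullet> axis j 1) U x $ i = conv ?m W x $ i $ j" for i j
 proof -
  have "conv (%z. grad ?m z \<bullet> axis j 1) U x $ i = (LINT y|lborel. (grad ?m (x - y) \<bullet> axis j 1) * U y $ i)"
   unfolding conv_def using integral_vec_nth(1)[OF ci, of "axis j 1" i] by simp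
  also have "... = (LINT y|lborel. - (U y $ i * frechet_derivative (%y. ?m (y - x)) (at y) (axis j 1)))"
   by (simp add: frechet_derivative_mollifier grad_mollifier_minus[of e x] mult.commute)
  also have "... = (LINT y|lborel. W y $ i $ j * ?m (y - x))"
   using weak[of i j] by simp
  also have "... = conv ?m W x $ i $ j"
   unfolding conv_def using integral_mat_nth(1)[OF wi, of i j]
   by (simp add: mollifier_minus[of e x] mult.commute)
  finally show ?thesis .
 qed
 have "conv (%z. grad ?m z \<bullet> h) U x = conv ?m W x *v h" for h
 proof -
  have l: "linear (%h. conv (%z. grad ?m z \<bullet> h) U x)"
   using has_derivative_linear[OF d] .
  have "conv (%z. grad ?m z \<bullet> h) U x = matrix (%h. conv (%z. grad ?m z \<bullet> h) U x) *v h"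
   using matrix_works[OF l[folded linear_matrix_vector_mul_eq]] by simp
  also have "matrix (%h. conv (%z. grad ?m z \<bullet> h) U x) = conv ?m W x"
   by (simp add: matrix_def ax vec_eq_iff)
  finally show ?thesis .
 qed
 then show ?thesis using d by simp
qed

text \<open>Where the ball of radius \<open>e\<close> does not fit into the domain, the derivative
  of the mollified zero extension is unrelated to the weak gradient; only the existence of a
  continuous Jacobian is recorded here, to be identified on compact sets.\<close>

lemma conv_mollifier_C1_map:
 fixes U :: "real^'n => real^'m"
 assumes U: "integrable lborel U" and e: "e > 0"
 obtains F where "C1_map (conv (mollifier e) U) F"
proof -
 let ?m = "mollifier e :: real^'n => real"
 note C1 = Ck_on_imp_C1[OF Ck_on_mollifier_0[of "Suc 0" e, where 'a="real^'n"]]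
 have mv: "norm x > e ==> ?m x = 0" for x using e by (simp add: mollifier_vanish)
 have gv: "norm x > e ==> grad ?m x = 0" for x using e by (simp add: grad_mollifier_vanish)
 have d: "(conv ?m U has_derivative (%h. conv (%z. grad ?m z \<bullet> h) U x)) (at x)" for x
  by (rule conv_has_derivative[OF U C1 mv gv])
 define F where "F x = matrix (%h. conv (%z. grad ?m z \<bullet> h) U x)" for x
 have "conv (%z. grad ?m z \<bullet> h) U x = F x *v h" for x h
  using matrix_works[OF has_derivative_linear[OF d, folded linear_matrix_vector_mul_eq]] by (simp add: F_def)
 moreover have "continuous_on UNIV (conv (%z. grad ?m z \<bullet> h) U)" for h
  by (rule conv_continuous[OF U, where R=e]) (auto intro!: continuous_intros C1(2) simp: gv)
 then have "continuous_on UNIV F"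
  unfolding F_def matrix_def by (intro continuous_on_vec_lambda continuous_intros)
 ultimately show ?thesis using d by (intro that[of F]) (simp add: C1_map_def)
qed

text \<open>\<open>D\<close> is a Borel representative of the weak gradient that vanishes off
  \<Omega>. With it and the zero extension of \<open>u\<close>, integrals run over
  \<open>lborel\<close> and measurability is settled once.\<close>

locale continuous_Sobolev =
 fixes \<Omega> :: "(real^'n) set" and u :: "real^'n => real^'m" and D :: "real^'n => real^'n^'m"
 assumes open_\<Omega>: "open \<Omega>"
  and cont_u: "continuous_on \<Omega> u"
  and int_u: "integrable lborel (%x. indicator \<Omega> x *\<^sub>R u x)"
  and D_borel [measurable]: "D : borel_measurable borel"
  and D_outside: "!!x. x ~: \<Omega> ==> D x = 0"
  and D_int: "integrable lborel D"
  and D_int3: "integrable lborel (%x. norm (D x) ^ 3)"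
  and weak: "!!\<phi> i j. test_function \<Omega> \<phi> ==>
   (LINT x|lborel. (indicator \<Omega> x *\<^sub>R u x) $ i * frechet_derivative \<phi> (at x) (axis j 1))
    = - (LINT x|lborel. D x $ i $ j * \<phi> x)"
begin

lemma C1_approx:
 assumes K: "compact K" "K <= \<Omega>" and "d > 0"
 obtains f F where "C1_map f F" "!!x. x : K ==> norm (f x - u x) <= d"
  "integrable lborel (%x. indicator K x * norm (F x - D x) ^ 3)"
  "(LINT x|lborel. indicator K x * norm (F x - D x) ^ 3) < d"
proof -
 let ?U = "%x. indicator \<Omega> x *\<^sub>R u x"
 obtain e1 K' where K': "e1 > 0" "compact K'" "K' <= \<Omega>" "!!x y. x : K ==> norm (x - y) <= e1 ==> y : K'"
  using compact_neighbourhood[OF K open_\<Omega>] by metis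
 have "uniformly_continuous_on K' u"
  using K' cont_u by (intro compact_uniformly_continuous) (auto intro: continuous_on_subset)
 then obtain e2 where e2: "e2 > 0" "!!x y. x : K' ==> y : K' ==> dist x y < e2 ==> dist (u x) (u y) < d"
  using \<open>d > 0\<close> unfolding uniformly_continuous_on_def by metis
 obtain e3 where e3: "e3 > 0"
  "!!e. 0 < e ==> e < e3 ==> integrable lborel (%x. norm (conv (mollifier e) D x - D x) ^ 3)"
  "!!e. 0 < e ==> e < e3 ==> (LINT x|lborel. norm (conv (mollifier e) D x - D x) ^ 3) < d"
  by (rule mollification_L3[OF D_int D_int3 \<open>d > 0\<close>]) blast
 define e where "e = min e1 (min e2 e3) / 2"
 have e: "e > 0" "e < e1" "e < e2" "e < e3" using K'(1) e2(1) e3(1) by (auto simp: e_def)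
 have mv: "norm x > e ==> (mollifier e :: real^'n => real) x = 0" for x using e by (simp add: mollifier_vanish)
 obtain F where F: "C1_map (conv (mollifier e) ?U) F"
  using conv_mollifier_C1_map[OF int_u e(1)] by metis
 have FD: "F x = conv (mollifier e) D x" if "x : K" for x
 proof -
  have "cball x e <= \<Omega>" using K'(3,4) that e by (force simp: dist_norm)
  then have "(conv (mollifier e) ?U has_derivative (%h. conv (mollifier e) D x *v h)) (at x)"
   by (intro conv_mollifier_derivative int_u D_int e(1) weak test_function_mollifier)
  moreover have "(conv (mollifier e) ?U has_derivative (%h. F x *v h)) (at x)"
   using F by (simp add: C1_map_def)
  ultimately have "(%h. F x *v h) = (%h. conv (mollifier e) D x *v h)"
   by (rule has_derivative_unique[rotated])
  then show ?thesis by (metis matrix_eq)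
 qed
 have [measurable]: "conv (mollifier e) D : borel_measurable borel"
  by (rule borel_measurable_continuous_onI[OF conv_continuous[OF D_int mollifier_continuous mv]])
 have [measurable]: "F : borel_measurable borel"
  using F by (auto simp: C1_map_def intro: borel_measurable_continuous_onI)
 have [measurable]: "K : sets borel" using K(1) by (simp add: borel_compact)
 have eq: "indicator K x * norm (F x - D x) ^ 3 = indicator K x * norm (conv (mollifier e) D x - D x) ^ 3" for x
  using FD by (simp add: indicator_def)
 show ?thesis
 proof (rule that[OF F])
  show "norm (conv (mollifier e) ?U x - u x) <= d" if "x : K" for x
  proof -
   have x: "x : K'" using K'(4)[OF that, of x] K'(1) by simp
   have "norm (?U y - ?U x) <= d" if "norm (x - y) < e" for y
   proof -
    have "y : K'" using K'(4)[OF \<open>x : K\<close>, of y] that e by simp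
    then show ?thesis using e2(2)[of y x] x K'(3) that e
     by (auto simp: dist_norm norm_minus_commute subset_iff)
   qed
   then have "norm (conv (mollifier e) ?U x - ?U x) <= d"
    by (rule mollification_close[where c="?U", OF int_u e(1)])
   then show ?thesis using x K'(3) by (auto simp: subset_iff)
  qed
  show i: "integrable lborel (%x. indicator K x * norm (F x - D x) ^ 3)"
   unfolding eq using e3(2)[OF e(1,4)]
   by (rule LINT_bound) (auto simp: indicator_def)
  have "(LINT x|lborel. indicator K x * norm (F x - D x) ^ 3) <= (LINT x|lborel. norm (conv (mollifier e) D x - D x) ^ 3)"
   using i unfolding eq by (intro integral_mono e3(2) e) (auto simp: indicator_def)
  then show "(LINT x|lborel. indicator K x * norm (F x - D x) ^ 3) < d"
   using e3(3)[OF e(1,4)] by simp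
 qed
qed

end

section \<open>Poincare and Morrey inequalities on boxes\<close>

lemma norm_matrix_vector_mult_le:
 fixes A :: "real^'n^'m"
 shows "norm (A *v h) <= norm A * norm h"
proof -
 have "(norm (A *v h))^2 = (\<Sum>i\<in>UNIV. (A $ i \<bullet> h)^2)"
  by (simp add: norm_vec_def L2_set_def sum_nonneg matrix_vector_mul_component)
 also have "... <= (\<Sum>i\<in>UNIV. (norm (A $ i))^2 * (norm h)^2)"
  by (intro sum_mono) (metis Cauchy_Schwarz_ineq power2_norm_eq_inner)
 also have "... = (norm A * norm h)^2"
  by (simp add: norm_vec_def[of A] L2_set_def sum_nonneg power_mult_distrib sum_distrib_right)
 finally show ?thesis by (rule power2_le_imp_le) simp
qed

lemma C1_map_continuous: "C1_map f F ==> continuous_on S f"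
 unfolding C1_map_def
 by (meson continuous_at_imp_continuous_on has_derivative_continuous continuous_on_subset subset_UNIV)

lemma C1_map_continuous_deriv: "C1_map f F ==> continuous_on S F"
 unfolding C1_map_def by (meson continuous_on_subset subset_UNIV)

text \<open>The parametrization \<open>p\<close> of the segment is left free: the Poincare
  inequality takes \<open>p t = t\<close>, the Morrey inequality \<open>p t = t^3\<close>, where the
  small speed compensates the concentration near the starting point.\<close>

lemma path_increment_le:
 assumes f: "C1_map f F"
  and p: "!!t. t : {0..1} ==> (p has_real_derivative p' t) (at t)" "continuous_on {0..1} p'"
   "p 0 = 0" "p 1 = 1" "!!t. t : {0..1} ==> p' t >= 0"
 shows "norm (f y - f x) <= integral {0..1} (%t. p' t * norm (F (x + p t *\<^sub>R (y - x))) * norm (y - x))"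
proof -
 let ?g = "%t. x + p t *\<^sub>R (y - x)"
 have cp: "continuous_on {0..1} p"
  using p(1) by (meson DERIV_isCont continuous_at_imp_continuous_on)
 have cF: "continuous_on {0..1} (%t. F (?g t))"
  by (rule continuous_on_compose2[OF C1_map_continuous_deriv[OF f, of UNIV]]) (auto intro!: continuous_intros cp)
 have vd: "((%t. f (?g t)) has_vector_derivative F (?g t) *v (p' t *\<^sub>R (y - x))) (at t within {0..1})"
  if "t : {0..1}" for t
 proof -
  have "(%h. h * p' t) = (*) (p' t)" by auto
  then have "(p has_derivative (%h. h * p' t)) (at t within {0..1})"
   using p(1)[OF that] by (simp add: has_field_derivative_def has_derivative_at_withinI)
  then have "(?g has_derivative (%h. (h * p' t) *\<^sub>R (y - x))) (at t within {0..1})"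
   by (auto intro!: derivative_eq_intros)
  moreover have "(f has_derivative (%h. F (?g t) *v h)) (at (?g t))"
   using f by (simp add: C1_map_def)
  ultimately have "((%t. f (?g t)) has_derivative (%h. F (?g t) *v ((h * p' t) *\<^sub>R (y - x)))) (at t within {0..1})"
   by (rule has_derivative_compose)
  then show ?thesis
   by (simp add: has_vector_derivative_def matrix_vector_mult_scaleR)
 qed
 have hi: "((%t. F (?g t) *v (p' t *\<^sub>R (y - x))) has_integral (f (?g 1) - f (?g 0))) {0..1}"
  by (intro fundamental_theorem_of_calculus vd) auto
 have "norm (f y - f x) = norm (integral {0..1} (%t. F (?g t) *v (p' t *\<^sub>R (y - x))))"
  using integral_unique[OF hi] p by simp
 also have "... <= integral {0..1} (%t. p' t * norm (F (?g t)) * norm (y - x))"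
 proof (rule integral_norm_bound_integral)
  show "(%t. F (?g t) *v (p' t *\<^sub>R (y - x))) integrable_on {0..1}" using hi by blast
  show "(%t. p' t * norm (F (?g t)) * norm (y - x)) integrable_on {0..1}"
   by (intro integrable_continuous_interval continuous_intros p cF)
  show "norm (F (?g t) *v (p' t *\<^sub>R (y - x))) <= p' t * norm (F (?g t)) * norm (y - x)" if "t : {0..1}" for t
   using norm_matrix_vector_mult_le[of "F (?g t)" "p' t *\<^sub>R (y - x)"] p(5)[OF that] by (simp add: mult_ac)
 qed
 finally show ?thesis .
qed

lemma square_tangent: "(t::real)^2 >= a^2 + 2 * a * (t - a)"
 using zero_le_power2[of "t - a"] by (simp add: power2_eq_square algebra_simps)

lemma integral_square_le:
 fixes g :: "real => real"
 assumes "continuous_on {0..1} g"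
 shows "(integral {0..1} g)^2 <= integral {0..1} (%t. (g t)^2)"
proof -
 let ?a = "integral {0..1} g"
 have i: "g integrable_on {0..1}" using assms by (rule integrable_continuous_interval)
 have "((%t. ?a^2 + 2 * ?a * (g t - ?a)) has_integral (1 - 0) *\<^sub>R ?a^2 + 2 * ?a * (?a - (1 - 0) *\<^sub>R ?a)) {0..1}"
  by (intro has_integral_add has_integral_mult_right has_integral_diff integrable_integral[OF i])
   (use has_integral_const_real[of "?a^2" 0 1] has_integral_const_real[of ?a 0 1] in auto)
 then have "?a^2 = integral {0..1} (%t. ?a^2 + 2 * ?a * (g t - ?a))" by (simp add: integral_unique)
 also have "... <= integral {0..1} (%t. (g t)^2)"
  by (intro integral_le integrable_continuous_interval continuous_intros assms square_tangent)
 finally show ?thesis .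
qed

lemma integral_cube_le:
 fixes g :: "real => real"
 assumes "continuous_on {0..1} g" "!!t. t : {0..1} ==> g t >= 0"
 shows "(integral {0..1} g)^3 <= integral {0..1} (%t. (g t)^3)"
proof -
 let ?a = "integral {0..1} g"
 have i: "g integrable_on {0..1}" using assms(1) by (rule integrable_continuous_interval)
 have a: "?a >= 0" using assms(2) by (intro integral_nonneg i) auto
 have "((%t. ?a^3 + 3 * ?a^2 * (g t - ?a)) has_integral (1 - 0) *\<^sub>R ?a^3 + 3 * ?a^2 * (?a - (1 - 0) *\<^sub>R ?a)) {0..1}"
  by (intro has_integral_add has_integral_mult_right has_integral_diff integrable_integral[OF i])
   (use has_integral_const_real[of "?a^3" 0 1] has_integral_const_real[of ?a 0 1] in auto)
 then have "?a^3 = integral {0..1} (%t. ?a^3 + 3 * ?a^2 * (g t - ?a))" by (simp add: integral_unique)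
 also have "... <= integral {0..1} (%t. (g t)^3)"
  by (intro integral_le integrable_continuous_interval continuous_intros assms cube_tangent a) auto
 finally show ?thesis .
qed

text \<open>Contraction towards a point of the box maps the box into itself by convexity, and
  \<open>s^2\<close> is its planar Jacobian.\<close>

lemma shrink_integral_le:
 fixes g :: "real^2 => real"
 assumes g: "continuous_on UNIV g" "!!x. g x >= 0" and s: "0 < s" "s <= 1" and z: "z : cbox a b"
 shows "s^2 * integral (cbox a b) (%x. g (z + s *\<^sub>R (x - z))) <= integral (cbox a b) g"
proof -
 define c where "c = (1 - s) *\<^sub>R z"
 let ?J = "cbox (s *\<^sub>R a + c) (s *\<^sub>R b + c)"
 have ne: "cbox a b ~= {}" using z by auto
 then have ne': "?J ~= {}" using s by (auto simp: box_ne_empty inner_add_left)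
 have "(g has_integral integral ?J g) ?J"
  by (intro integrable_integral integrable_continuous continuous_on_subset[OF g(1)]) auto
 then have "((%x. g (s *\<^sub>R x + c)) has_integral (1 / \<bar>s\<bar> ^ DIM(real^2)) *\<^sub>R integral ?J g)
   ((%x. (1 / s) *\<^sub>R x + - ((1 / s) *\<^sub>R c)) ` ?J)"
  using s by (intro has_integral_affinity) auto
 moreover have "(%x. (1 / s) *\<^sub>R x + - ((1 / s) *\<^sub>R c)) ` ?J = cbox a b"
  using ne' s by (subst image_affinity_cbox) (auto simp: algebra_simps)
 moreover have "s *\<^sub>R x + c = z + s *\<^sub>R (x - z)" for x by (simp add: c_def algebra_simps)
 ultimately have "((%x. g (z + s *\<^sub>R (x - z))) has_integral (1 / s^2) * integral ?J g) (cbox a b)"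
  using s by simp
 then have "integral (cbox a b) (%x. g (z + s *\<^sub>R (x - z))) = (1 / s^2) * integral ?J g"
  by (rule integral_unique)
 moreover have "integral ?J g <= integral (cbox a b) g"
 proof (rule integral_subset_le)
  show "?J <= cbox a b"
  proof
   fix x assume x: "x : ?J"
   show "x : cbox a b"
    unfolding mem_box
   proof
    fix i :: "real^2" assume i: "i : Basis"
    have 1: "s * (a \<bullet> i) + (1 - s) * (z \<bullet> i) <= x \<bullet> i" "x \<bullet> i <= s * (b \<bullet> i) + (1 - s) * (z \<bullet> i)"
     using x i by (auto simp: mem_box c_def inner_add_left)
    have 2: "a \<bullet> i <= z \<bullet> i" "z \<bullet> i <= b \<bullet> i" using z i by (auto simp: mem_box)
    have "s * (a \<bullet> i) + (1 - s) * (a \<bullet> i) <= x \<bullet> i" "x \<bullet> i <= s * (b \<bullet> i) + (1 - s) * (b \<bullet> i)"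
     using 1 mult_left_mono[OF 2(1), of "1 - s"] mult_left_mono[OF 2(2), of "1 - s"] s by linarith+
    then show "a \<bullet> i <= x \<bullet> i & x \<bullet> i <= b \<bullet> i" by (simp add: algebra_simps)
   qed
  qed
 qed (use g in \<open>auto intro!: integrable_continuous continuous_on_subset[OF g(1)]\<close>)
 ultimately show ?thesis using s by (simp add: field_simps)
qed

text \<open>With \<open>p t = t^3\<close> the cube of the speed is \<open>27 * t^6\<close>, exactly
  27 times the Jacobian of the contraction with ratio \<open>t^3\<close>. The factors cancel in
  \<open>shrink_integral_le\<close>, and no singular kernel is left in the integral over
  \<open>t\<close>.\<close>

lemma Morrey_box_point:
 fixes f :: "real^2 => real^'m"
 assumes f: "C1_map f F" and x: "x : cbox a b" and d: "!!y. y : cbox a b ==> norm (y - x) <= d"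
 shows "integral (cbox a b) (%y. norm (f y - f x) ^ 3) <= 27 * d^3 * integral (cbox a b) (%y. norm (F y) ^ 3)"
proof -
 have d0: "d >= 0" using d[OF x] by simp
 let ?c = "%t y. 27 * d^3 * t^6 * norm (F (x + t^3 *\<^sub>R (y - x))) ^ 3"
 have cF: "continuous_on UNIV F" using f by (simp add: C1_map_def)
 have cN: "continuous_on S (%p. norm (F (q p)) ^ 3)" if "continuous_on S q" for q and S :: "'z::topological_space set"
  by (intro continuous_intros continuous_on_compose2[OF cF that]) auto
 have cf: "continuous_on S f" for S by (rule C1_map_continuous[OF f])
 have pt: "norm (f y - f x) ^ 3 <= integral {0..1} (%t. ?c t y)" if y: "y : cbox a b" for y
 proof -
  let ?g = "%t. 3 * t^2 * norm (F (x + t^3 *\<^sub>R (y - x))) * norm (y - x)"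
  have cg: "continuous_on {0..1} ?g"
   by (intro continuous_intros continuous_on_compose2[OF cF, of "{0..1}"]) auto
  have "norm (f y - f x) <= integral {0..1} ?g"
   by (rule path_increment_le[OF f, where p="%t. t^3"])
    (auto intro!: derivative_eq_intros continuous_intros)
  then have "norm (f y - f x) ^ 3 <= (integral {0..1} ?g) ^ 3" by (intro power_mono) auto
  also have "... <= integral {0..1} (%t. ?g t ^ 3)" by (intro integral_cube_le cg) auto
  also have "... <= integral {0..1} (%t. ?c t y)"
  proof (rule integral_le)
   show "(%t. ?g t ^ 3) integrable_on {0..1}"
    by (intro integrable_continuous_interval continuous_intros cg)
   show "(%t. ?c t y) integrable_on {0..1}"
    by (intro integrable_continuous_interval continuous_intros cN)
   show "?g t ^ 3 <= ?c t y" if "t : {0..1}" for t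
   proof -
    have "?g t ^ 3 = 27 * t ^ 6 * norm (F (x + t^3 *\<^sub>R (y - x))) ^ 3 * norm (y - x) ^ 3"
     by (simp add: power_mult_distrib flip: power_mult)
    also have "... <= 27 * t ^ 6 * norm (F (x + t^3 *\<^sub>R (y - x))) ^ 3 * d ^ 3"
     by (intro mult_left_mono power_mono d y) auto
    finally show ?thesis by (simp add: mult_ac)
   qed
  qed
  finally show ?thesis .
 qed
 have "integral (cbox a b) (%y. norm (f y - f x) ^ 3) <= integral (cbox a b) (%y. integral (cbox 0 1) (%t. ?c t y))"
 proof (rule integral_le)
  show "(%y. norm (f y - f x) ^ 3) integrable_on cbox a b"
   by (intro integrable_continuous continuous_intros cf)
  show "(%y. integral (cbox 0 1) (%t. ?c t y)) integrable_on cbox a b"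
   by (intro integrable_continuous integral_continuous_on_param) (auto simp: split_beta intro!: continuous_intros cN)
 qed (use pt in auto)
 also have "... = integral (cbox 0 1) (%t. integral (cbox a b) (%y. ?c t y))"
  by (rule integral_swap_continuous) (auto simp: split_beta intro!: continuous_intros cN)
 also have "... <= integral (cbox 0 1) (%t::real. 27 * d^3 * integral (cbox a b) (%y. norm (F y) ^ 3))"
 proof (rule integral_le)
  show "(%t. integral (cbox a b) (%y. ?c t y)) integrable_on cbox 0 1"
   by (intro integrable_continuous integral_continuous_on_param) (auto simp: split_beta intro!: continuous_intros cN)
  show "integral (cbox a b) (%y. ?c t y) <= 27 * d^3 * integral (cbox a b) (%y. norm (F y) ^ 3)" if "t : cbox 0 1" for t :: real
  proof (cases "t = 0")
   case True
   then show ?thesis using d0 continuous_on_subset[OF cF subset_UNIV]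
    by (auto intro!: mult_nonneg_nonneg integral_nonneg integrable_continuous cN continuous_intros)
  next
   case False
   have "(t^3)^2 * integral (cbox a b) (%y. norm (F (x + t^3 *\<^sub>R (y - x))) ^ 3) <= integral (cbox a b) (%y. norm (F y) ^ 3)"
    using False that x by (intro shrink_integral_le cN) (auto simp: power_le_one intro: continuous_intros)
   then have "27 * d^3 * (t^6 * integral (cbox a b) (%y. norm (F (x + t^3 *\<^sub>R (y - x))) ^ 3))
     <= 27 * d^3 * integral (cbox a b) (%y. norm (F y) ^ 3)"
    using d0 by (intro mult_left_mono) (auto simp flip: power_mult)
   then show ?thesis by (simp add: mult.assoc)
  qed
 qed auto
 also have "... = 27 * d^3 * integral (cbox a b) (%y. norm (F y) ^ 3)" by simp
 finally show ?thesis .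
qed

text \<open>Both values are compared with \<open>f y\<close> and the result is integrated over the
  box; 216 is \<open>4 * (27 + 27)\<close>.\<close>

lemma Morrey_box:
 fixes f :: "real^2 => real^'m"
 assumes f: "C1_map f F" and x: "x : cbox a b" "z : cbox a b"
  and d: "!!y z. y : cbox a b ==> z : cbox a b ==> norm (y - z) <= d"
 shows "measure lborel (cbox a b) * norm (f x - f z) ^ 3 <= 216 * d^3 * integral (cbox a b) (%y. norm (F y) ^ 3)"
proof -
 have cf: "continuous_on S f" for S by (rule C1_map_continuous[OF f])
 have i: "(%y. norm (f y - f x) ^ 3) integrable_on cbox a b" for x
  by (intro integrable_continuous continuous_intros cf)
 have pt: "norm (f x - f z) ^ 3 <= 4 * (norm (f y - f x) ^ 3 + norm (f y - f z) ^ 3)" for y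
  using norm_add_cube[of "f x - f y" "f y - f z"] by (simp add: norm_minus_commute)
 have "measure lborel (cbox a b) * norm (f x - f z) ^ 3 = integral (cbox a b) (%y. norm (f x - f z) ^ 3)" by simp
 also have "... <= integral (cbox a b) (%y. 4 * (norm (f y - f x) ^ 3 + norm (f y - f z) ^ 3))"
  by (intro integral_le integrable_on_mult_right integrable_add i pt) auto
 also have "... = 4 * (integral (cbox a b) (%y. norm (f y - f x) ^ 3) + integral (cbox a b) (%y. norm (f y - f z) ^ 3))"
  by (simp add: integral_add i)
 also have "... <= 4 * (27 * d^3 * integral (cbox a b) (%y. norm (F y) ^ 3) + 27 * d^3 * integral (cbox a b) (%y. norm (F y) ^ 3))"
  by (intro mult_left_mono add_mono Morrey_box_point f x d) auto
 finally show ?thesis by simp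
qed

text \<open>\<open>m\<close> is the value of \<open>f\<close> at a point \<open>x\<close> where the
  integral over \<open>y\<close> of the bound for the squared increments is at most its average over
  all \<open>x\<close>.\<close>

lemma Poincare_box:
 fixes f :: "real^2 => real^'m"
 assumes f: "C1_map f F" and d: "!!x y. x : cbox a b ==> y : cbox a b ==> norm (y - x) <= d"
  and pos: "measure lborel (cbox a b) > 0"
 obtains m where "integral (cbox a b) (%x. (norm (f x - m))^2) <= 4 * d^2 * integral (cbox a b) (%x. (norm (F x))^2)"
proof -
 let ?Q = "cbox a b"
 let ?c = "%x y t. d^2 * (norm (F (x + t *\<^sub>R (y - x))))^2"
 let ?I = "integral ?Q (%x. (norm (F x))^2)"
 have cF: "continuous_on UNIV F" using f by (simp add: C1_map_def)
 have cN: "continuous_on S (%p. (norm (F (q p)))^2)" if "continuous_on S q" for q and S :: "'z::topological_space set"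
  by (intro continuous_intros continuous_on_compose2[OF cF that]) auto
 have cf: "continuous_on S f" for S by (rule C1_map_continuous[OF f])
 have cf2: "continuous_on S (%p. f (q p))" if "continuous_on S q" for q and S :: "'z::topological_space set"
  by (rule continuous_on_compose2[OF cf that]) auto
 have pt: "(norm (f y - f x))^2 <= integral {0..1} (?c x y)" if "x : ?Q" "y : ?Q" for x y
 proof -
  let ?g = "%t. 1 * norm (F (x + t *\<^sub>R (y - x))) * norm (y - x)"
  have cg: "continuous_on {0..1} ?g"
   by (intro continuous_intros continuous_on_compose2[OF cF, of "{0..1}"]) auto
  have "norm (f y - f x) <= integral {0..1} ?g"
   by (rule path_increment_le[OF f, where p="%t. t"]) auto
  then have "(norm (f y - f x))^2 <= (integral {0..1} ?g)^2" by (intro power_mono) auto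
  also have "... <= integral {0..1} (%t. (?g t)^2)" by (intro integral_square_le cg)
  also have "... <= integral {0..1} (?c x y)"
  proof (rule integral_le)
   show "(%t. (?g t)^2) integrable_on {0..1}"
    by (intro integrable_continuous_interval continuous_intros cg)
   show "?c x y integrable_on {0..1}"
    by (intro integrable_continuous_interval continuous_intros cN)
   show "(?g t)^2 <= ?c x y t" for t
    using mult_right_mono[OF power_mono[OF d[OF that], of 2], of "(norm (F (x + t *\<^sub>R (y - x))))^2"]
    by (simp add: power_mult_distrib mult.commute)
  qed
  finally show ?thesis .
 qed
 let ?Y = "%x. integral ?Q (%y. integral (cbox 0 1) (?c x y))"
 have ct: "continuous_on (?Q \<times> cbox 0 1) (%(x, t). integral ?Q (%y. ?c x y t))"
  unfolding split_beta by (rule integral_continuous_on_param[where f="%p y. ?c (fst p) y (snd p)"])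
   (auto simp: split_beta intro!: continuous_intros cN)
 have Ysw: "?Y x = integral (cbox 0 1) (%t. integral ?Q (%y. ?c x y t))" for x
  by (rule integral_swap_continuous) (auto simp: split_beta intro!: continuous_intros cN)
 have cY: "continuous_on ?Q ?Y"
  unfolding Ysw by (rule integral_continuous_on_param) (use ct in \<open>simp add: split_beta\<close>)
 have slice: "integral ?Q (%x. integral ?Q (%y. ?c x y t)) <= measure lborel ?Q * (4 * d^2 * ?I)" if t: "t : cbox 0 1" for t :: real
 proof -
  \<comment> \<open>Contractions with ratio at least 1/2 lose at most a factor 4 in the Jacobian.
    The point at parameter \<open>t\<close> between \<open>x\<close> and \<open>y\<close> is such a
    contraction towards \<open>x\<close> if \<open>t >= 1/2\<close>, and towards \<open>y\<close>
    otherwise.\<close>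
  have key: "integral ?Q (%y. d^2 * (norm (F (z + s *\<^sub>R (y - z))))^2) <= 4 * d^2 * ?I"
   if "z : ?Q" "1/2 <= s" "s <= 1" for z s
  proof -
   have p0: "0 <= integral ?Q (%y. (norm (F (z + s *\<^sub>R (y - z))))^2)"
    by (intro integral_nonneg integrable_continuous cN continuous_intros) auto
   have "(1/2)^2 * integral ?Q (%y. (norm (F (z + s *\<^sub>R (y - z))))^2) <= s^2 * integral ?Q (%y. (norm (F (z + s *\<^sub>R (y - z))))^2)"
    using that by (intro mult_right_mono power_mono p0) auto
   also have "... <= ?I"
    using that by (intro shrink_integral_le cN continuous_intros) auto
   finally have "d^2 * integral ?Q (%y. (norm (F (z + s *\<^sub>R (y - z))))^2) <= d^2 * (4 * ?I)"
    by (intro mult_left_mono) (auto simp: power2_eq_square)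
   then show ?thesis by (simp add: mult_ac)
  qed
  have const: "integral ?Q (%x. 4 * d^2 * ?I) = measure lborel ?Q * (4 * d^2 * ?I)" by simp
  show ?thesis
  proof (cases "t >= 1/2")
   case True
   have "integral ?Q (%x. integral ?Q (%y. ?c x y t)) <= integral ?Q (%x. 4 * d^2 * ?I)"
   proof (rule integral_le)
    show "(%x. integral ?Q (%y. ?c x y t)) integrable_on ?Q"
     by (intro integrable_continuous integral_continuous_on_param) (auto simp: split_beta intro!: continuous_intros cN)
    show "integral ?Q (%y. ?c x y t) <= 4 * d^2 * ?I" if "x : ?Q" for x
     using key[OF that True] t by auto
   qed auto
   then show ?thesis using const by (simp add: mult_ac)
  next
   case False
   have "integral ?Q (%x. integral ?Q (%y. ?c x y t)) = integral ?Q (%y. integral ?Q (%x. ?c x y t))"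
    by (rule integral_swap_continuous) (auto simp: split_beta intro!: continuous_intros cN)
   also have "... <= integral ?Q (%y. 4 * d^2 * ?I)"
   proof (rule integral_le)
    show "(%y. integral ?Q (%x. ?c x y t)) integrable_on ?Q"
     by (intro integrable_continuous integral_continuous_on_param) (auto simp: split_beta intro!: continuous_intros cN)
    show "integral ?Q (%x. ?c x y t) <= 4 * d^2 * ?I" if "y : ?Q" for y
    proof -
     have eq: "x + t *\<^sub>R (y - x) = y + (1 - t) *\<^sub>R (x - y)" for x by (simp add: algebra_simps)
     show ?thesis unfolding eq using key[OF that, of "1 - t"] False t by auto
    qed
   qed auto
   finally show ?thesis using const by (simp add: mult_ac)
  qed
 qed
 have tot: "integral ?Q ?Y <= measure lborel ?Q * (4 * d^2 * ?I)"
 proof -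
  have "integral ?Q ?Y = integral (cbox 0 1) (%t. integral ?Q (%x. integral ?Q (%y. ?c x y t)))"
   unfolding Ysw
   by (rule integral_swap_continuous[where f="%x t. integral ?Q (%y. ?c x y t)"]) (use ct in \<open>simp add: cbox_Pair_eq\<close>)
  also have "... <= integral (cbox 0 1) (%t::real. measure lborel ?Q * (4 * d^2 * ?I))"
  proof (rule integral_le)
   have "continuous_on (cbox 0 1 \<times> ?Q) (%(t, x). integral ?Q (%y. ?c x y t))"
    unfolding split_beta by (rule integral_continuous_on_param[where f="%p y. ?c (snd p) y (fst p)"])
     (auto simp: split_beta intro!: continuous_intros cN)
   then show "(%t. integral ?Q (%x. integral ?Q (%y. ?c x y t))) integrable_on cbox 0 1"
    by (intro integrable_continuous integral_continuous_on_param) (simp add: split_beta)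
  qed (use slice in auto)
  also have "... = measure lborel ?Q * (4 * d^2 * ?I)" by simp
  finally show ?thesis .
 qed
 \<comment> \<open>A continuous function above the bound everywhere would have a minimum above it,
   contradicting the total integral.\<close>
 have "\<exists>x\<in>?Q. ?Y x <= 4 * d^2 * ?I"
 proof (rule ccontr)
  assume "\<not> ?thesis"
  then have gt: "!!x. x : ?Q ==> ?Y x > 4 * d^2 * ?I" by (auto simp: not_le)
  have ne: "?Q ~= {}" using pos by auto
  obtain x0 where x0: "x0 : ?Q" "!!x. x : ?Q ==> ?Y x0 <= ?Y x"
   using continuous_attains_inf[OF compact_cbox ne cY] by metis
  have "measure lborel ?Q * ?Y x0 = integral ?Q (%x. ?Y x0)" by simp
  also have "... <= integral ?Q ?Y"
  proof (rule integral_le)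
   show "?Y integrable_on ?Q" by (rule integrable_continuous[OF cY])
  qed (use x0(2) in auto)
  finally have "measure lborel ?Q * ?Y x0 <= measure lborel ?Q * (4 * d^2 * ?I)" using tot by linarith
  then show False using gt[OF x0(1)] pos by simp
 qed
 then obtain x where x: "x : ?Q" "?Y x <= 4 * d^2 * ?I" by blast
 have "integral ?Q (%y. (norm (f y - f x))^2) <= ?Y x"
 proof (rule integral_le)
  show "(%y. (norm (f y - f x))^2) integrable_on ?Q"
   by (intro integrable_continuous continuous_intros cf)
  show "(%y. integral (cbox 0 1) (?c x y)) integrable_on ?Q"
   by (intro integrable_continuous integral_continuous_on_param) (auto simp: split_beta intro!: continuous_intros cN)
 qed (use pt[OF x(1)] in auto)
 then show ?thesis using x(2) by (intro that[of "f x"]) linarith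
qed

section \<open>Cubes\<close>

definition cube :: "real^2 => real => (real^2) set"
 where "cube x r = cbox (x - vec r) (x + vec r)"

lemma mem_cube: "y : cube x r \<longleftrightarrow> (\<forall>i. \<bar>y $ i - x $ i\<bar> <= r)"
 by (auto simp: cube_def mem_box_cart abs_le_iff algebra_simps)

lemma mem_cube_2: "y : cube x r \<longleftrightarrow> \<bar>y $ 1 - x $ 1\<bar> <= r & \<bar>y $ 2 - x $ 2\<bar> <= r"
 by (simp add: mem_cube forall_2)

lemma measure_cbox_2:
 fixes a b :: "real^2"
 assumes "a $ 1 <= b $ 1" "a $ 2 <= b $ 2"
 shows "measure lborel (cbox a b) = (b $ 1 - a $ 1) * (b $ 2 - a $ 2)"
proof -
 have "cbox a b ~= {}" using assms by (simp add: interval_ne_empty_cart forall_2)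
 then show ?thesis by (simp add: content_cbox_cart UNIV_2)
qed

lemma measure_cube: "r >= 0 ==> measure lborel (cube x r) = 4 * r^2"
 unfolding cube_def by (subst measure_cbox_2) (auto simp: power2_eq_square)

text \<open>The factor 3/2 is a rational substitute for the square root of 2.\<close>

lemma norm_le_sup_2: "\<bar>z $ 1\<bar> <= c ==> \<bar>z $ 2\<bar> <= c ==> norm z <= 3/2 * c" for z :: "real^2"
proof -
 assume a: "\<bar>z $ 1\<bar> <= c" "\<bar>z $ 2\<bar> <= c"
 have "(norm z)^2 = \<bar>z $ 1\<bar>^2 + \<bar>z $ 2\<bar>^2"
  by (simp add: norm_vec_def L2_set_def sum_2)
 also have "... <= c^2 + c^2" by (intro add_mono power_mono a) auto
 also have "... <= (3/2 * c)^2"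
 proof -
  have "(3/2 * c)^2 = 9/4 * c^2" by (simp add: power2_eq_square)
  then show ?thesis using zero_le_power2[of c] by linarith
 qed
 finally show ?thesis by (rule power2_le_imp_le) (use a in linarith)
qed

lemma cube_diameter: "y : cube x r ==> z : cube x r ==> norm (y - z) <= 3 * r"
 using norm_le_sup_2[of "y - z" "2 * r"] by (auto simp: mem_cube_2)

lemma cube_radius: "y : cube x r ==> norm (y - x) <= 2 * r"
 using norm_le_sup_2[of "y - x" r] by (auto simp: mem_cube_2)

lemma centre_in_cube: "r >= 0 ==> x : cube x r"
 by (simp add: mem_cube)

lemma cube_mono: "r <= r' ==> cube x r <= cube x r'"
 unfolding mem_cube subset_iff by (meson order_trans)

lemma cball_subset_cube: "cball x r <= cube x r"
proof
 fix y assume "y : cball x r"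
 then show "y : cube x r"
  using component_le_norm_cart[of "y - x"] by (auto simp: mem_cube dist_norm norm_minus_commute intro: order_trans)
qed

lemma compact_cube: "compact (cube x r)" by (simp add: cube_def)

lemma integrable_on_cube: "continuous_on UNIV f ==> f integrable_on cube x r" for f :: "real^2 => 'b::banach"
 unfolding cube_def by (intro integrable_continuous) (auto intro: continuous_on_subset)

lemma integrable_on_cbox_UNIV: "continuous_on UNIV f ==> f integrable_on cbox a b" for f :: "'a::euclidean_space => 'b::banach"
 by (intro integrable_continuous) (auto intro: continuous_on_subset)

lemma integral_translate:
 fixes f :: "real^2 => real"
 assumes "continuous_on UNIV f"
 shows "integral (cbox (a + s) (b + s)) f = integral (cbox a b) (%x. f (x + s))"
proof -
 have "(f has_integral integral (cbox (a + s) (b + s)) f) (cbox (a + s) (b + s))"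
  by (intro integrable_integral integrable_on_cbox_UNIV assms)
 then have "((%x. f (1 *\<^sub>R x + s)) has_integral (1 / \<bar>1\<bar> ^ DIM(real^2)) *\<^sub>R integral (cbox (a + s) (b + s)) f)
   ((%x. (1 / 1) *\<^sub>R x + - ((1 / 1) *\<^sub>R s)) ` cbox (a + s) (b + s))"
  by (intro has_integral_affinity) auto
 moreover have "(%x. (1 / 1) *\<^sub>R x + - ((1 / 1) *\<^sub>R s)) ` cbox (a + s) (b + s) = cbox a b"
  using cbox_translation[of "- s" "a + s" "b + s"] by (simp add: algebra_simps)
 ultimately show ?thesis by (simp add: integral_unique)
qed

lemma integral_cube_translate:
 fixes f :: "real^2 => real"
 assumes "continuous_on UNIV f"
 shows "integral (cube (x + s) r) f = integral (cube x r) (%y. f (y + s))"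
 using integral_translate[OF assms, of "x - vec r" s "x + vec r"] by (simp add: cube_def algebra_simps)

lemma integral_vanish_outside:
 fixes f :: "'a::euclidean_space => 'b::banach"
 assumes "S <= T" "!!x. x ~: S ==> f x = 0"
 shows "integral T f = integral S f"
proof -
 have "integral T f = integral T (%x. if x : S then f x else 0)"
  using assms(2) by (intro integral_cong) auto
 also have "... = integral (S \<inter> T) f" using integral_restrict_Int[of T S f] by (simp add: Int_commute)
 finally show ?thesis using assms(1) by (simp add: Int_absorb2)
qed

section \<open>Calculus of C^1 maps\<close>

lemma C1_map_vanish:
 assumes f: "C1_map f F" and "closed K" "!!x. x ~: K ==> f x = 0" "x ~: K"
 shows "F x = 0"
proof -
 have "((%x. 0) has_derivative (%h. 0)) (at x)" by simp
 then have "(f has_derivative (%h. 0)) (at x)"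
  by (rule has_derivative_transform_within_open[of _ _ _ UNIV "- K"]) (use assms in auto)
 moreover have "(f has_derivative (%h. F x *v h)) (at x)" using f by (simp add: C1_map_def)
 ultimately have "(%h. F x *v h) = (%h. 0)" by (rule has_derivative_unique[rotated])
 then show ?thesis by (metis matrix_eq matrix_vector_mult_0)
qed

lemma C1_map_add: "C1_map f F ==> C1_map g G ==> C1_map (%x. f x + g x) (%x. F x + G x)"
 unfolding C1_map_def
 by (auto intro!: derivative_eq_intros continuous_intros simp: matrix_vector_mult_add_rdistrib)

lemma C1_map_scaleR: "C1_map f F ==> C1_map (%x. c *\<^sub>R f x) (%x. c *\<^sub>R F x)"
 unfolding C1_map_def
 by (auto intro!: derivative_eq_intros continuous_intros simp: scaleR_matrix_vector_assoc)

lemma C1_map_diff: "C1_map f F ==> C1_map g G ==> C1_map (%x. f x - g x) (%x. F x - G x)"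
 using C1_map_add[of f F "%x. (-1) *\<^sub>R g x" "%x. (-1) *\<^sub>R G x"] C1_map_scaleR[of g G "-1"] by simp

lemma C1_map_linear: "C1_map (%x. P *v x) (%x. P)"
 unfolding C1_map_def by (auto intro: bounded_linear_imp_has_derivative)

lemma C1_map_const: "C1_map (%x. c) (%x. 0)"
proof -
 have eq: "(*v) (0 :: real^'n^'m) = (%h. 0)" by auto
 show ?thesis unfolding C1_map_def eq by simp
qed

lemma C1_map_translate:
 assumes "C1_map f F" shows "C1_map (%x. f (x + s)) (%x. F (x + s))"
proof -
 have "((%x. f (x + s)) has_derivative (%h. F (x + s) *v h)) (at x)" for x
 proof -
  have "((%x. x + s) has_derivative (%h. h)) (at x)" by (auto intro!: derivative_eq_intros)
  moreover have "(f has_derivative (%h. F (x + s) *v h)) (at (x + s))" using assms by (simp add: C1_map_def)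
  ultimately show ?thesis by (rule has_derivative_compose)
 qed
 moreover have "continuous_on UNIV (%x. F (x + s))"
  by (rule continuous_on_compose2[OF C1_map_continuous_deriv[OF assms, of UNIV]]) (auto intro: continuous_intros)
 ultimately show ?thesis by (simp add: C1_map_def)
qed

text \<open>The tensor product of \<open>v\<close> and \<open>g\<close>: the contribution of the
  gradient of a scalar factor to the Jacobian of a product.\<close>

definition outer :: "real^'m => real^'n => real^'n^'m"
 where "outer v g = (\<chi> i. v $ i *\<^sub>R g)"

lemma continuous_on_outer [continuous_intros]:
 "continuous_on S v ==> continuous_on S g ==> continuous_on S (%x. outer (v x) (g x))"
 unfolding outer_def by (intro continuous_on_vec_lambda continuous_intros)

lemma norm_outer: "norm (outer v g) = norm v * norm g"
proof -
 have "(norm (outer v g))^2 = (\<Sum>i\<in>UNIV. (v $ i)^2 * (norm g)^2)"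
  unfolding norm_vec_def[of "outer v g"] L2_set_def
  by (subst real_sqrt_pow2) (auto simp: outer_def power_mult_distrib intro: sum_nonneg)
 also have "... = (norm v * norm g)^2"
  by (simp add: norm_vec_def[of v] L2_set_def sum_nonneg power_mult_distrib sum_distrib_right)
 finally show ?thesis by (simp add: power2_eq_iff_nonneg)
qed

lemma outer_mult: "outer v g *v h = (g \<bullet> h) *\<^sub>R v"
 by (simp add: vec_eq_iff matrix_vector_mul_component outer_def mult.commute)

lemma C1_map_mult:
 assumes "C1_map f F" "!!x. (k has_derivative (%h. g x \<bullet> h)) (at x)" "continuous_on UNIV g"
 shows "C1_map (%x. k x *\<^sub>R f x) (%x. k x *\<^sub>R F x + outer (f x) (g x))"
proof -
 have ck: "continuous_on UNIV k"
  using assms(2) by (meson continuous_at_imp_continuous_on has_derivative_continuous)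
 have "((%x. k x *\<^sub>R f x) has_derivative (%h. k x *\<^sub>R (F x *v h) + (g x \<bullet> h) *\<^sub>R f x)) (at x)" for x
  using assms by (intro has_derivative_scaleR) (auto simp: C1_map_def)
 moreover have "(%h. k x *\<^sub>R (F x *v h) + (g x \<bullet> h) *\<^sub>R f x) = (%h. (k x *\<^sub>R F x + outer (f x) (g x)) *v h)" for x
  by (simp add: matrix_vector_mult_add_rdistrib outer_mult scaleR_matrix_vector_assoc)
 ultimately show ?thesis
  unfolding C1_map_def using ck assms(3) C1_map_continuous[OF assms(1)] C1_map_continuous_deriv[OF assms(1)]
  by (auto intro!: continuous_intros)
qed

section \<open>Cutoff functions\<close>

text \<open>The function \<open>t \<mapsto> max 0 t ^ 2\<close> is \<open>C\<^sup>1\<close>; the cutoff is round, so that its gradient lives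
 between the inscribed ball of the large cube and the circumscribed ball of the small one.\<close>

lemma max_0_square_deriv: "((%t. (max 0 t)^2) has_real_derivative 2 * max 0 t) (at (t::real))"
proof -
 consider "t < 0" | "t = 0" | "t > 0" by linarith
 then show ?thesis
 proof cases
  case 1
  have "((%_. 0) has_real_derivative 0) (at t)" by simp
  then have "((%t. (max 0 t)^2) has_real_derivative 0) (at t)"
   by (rule has_field_derivative_transform_within_open[where S="{..<0}"]) (use 1 in auto)
  then show ?thesis using 1 by simp
 next
  case 2
  have "((%h::real. (max 0 h)^2 / h) \<longlongrightarrow> 0) (at 0)"
  proof (rule Lim_null_comparison)
   show "((%h. \<bar>h\<bar>) \<longlongrightarrow> (0::real)) (at 0)" by (auto intro!: tendsto_eq_intros)
   have "norm ((max 0 h)^2 / h) <= \<bar>h\<bar>" for h :: real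
    by (cases "h > 0") (auto simp: power2_eq_square max_def)
   then show "\<forall>\<^sub>F h::real in at 0. norm ((max 0 h)^2 / h) <= \<bar>h\<bar>" by simp
  qed
  then show ?thesis using 2 by (simp add: DERIV_def)
 next
  case 3
  have "((%t. t^2) has_real_derivative 2 * t) (at t)" by (auto intro!: derivative_eq_intros)
  then have "((%t. (max 0 t)^2) has_real_derivative 2 * t) (at t)"
   by (rule has_field_derivative_transform_within_open[where S="{0<..}"]) (use 3 in auto)
  then show ?thesis using 3 by simp
 qed
qed

lemma cutoff_exists:
 fixes x0 :: "real^2"
 assumes r: "r > 0"
 obtains k g where "!!x. (k has_derivative (%h. g x \<bullet> h)) (at x)" "continuous_on UNIV g"
  "!!x. 0 <= k x & k x <= 1" "!!x. x : cube x0 r ==> k x = 1" "!!x. x : cube x0 r ==> g x = 0"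
  "!!x. x ~: cube x0 (3 * r) ==> k x = 0" "!!x. norm (g x) <= 4 / r"
proof -
 \<comment> \<open>\<open>s\<close> is 0 on the circle of radius \<open>sqrt 2 * r\<close>
   circumscribed to the inner cube, and 1 on the circle of radius \<open>3 * r\<close> inscribed in
   the outer one; hence the shift 2 and the divisor 9 - 2.\<close>
 define s where "s x = ((x - x0) \<bullet> (x - x0) / r^2 - 2) / 7" for x :: "real^2"
 define k where "k x = (max 0 (1 - (max 0 (s x))^2))^2" for x
 define g where "g x = (- (2 * max 0 (1 - (max 0 (s x))^2) * (2 * max 0 (s x)) * (2 / (7 * r^2)))) *\<^sub>R (x - x0)" for x
 have ds: "(s has_derivative (%h. (2 / (7 * r^2)) * ((x - x0) \<bullet> h))) (at x)" for x
 proof -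
  have "((%x. (x - x0) \<bullet> (x - x0)) has_derivative (%h. 2 * ((x - x0) \<bullet> h))) (at x)"
   by (auto intro!: derivative_eq_intros simp: inner_commute)
  then have "((%x. (1 / (7 * r^2)) * ((x - x0) \<bullet> (x - x0)) - 2 / 7) has_derivative
    (%h. (1 / (7 * r^2)) * (2 * ((x - x0) \<bullet> h)) - 0)) (at x)"
   by (intro has_derivative_diff has_derivative_mult_right has_derivative_const)
  moreover have "s = (%x. (1 / (7 * r^2)) * ((x - x0) \<bullet> (x - x0)) - 2 / 7)"
   by (auto simp: s_def diff_divide_distrib)
  ultimately show ?thesis by simp
 qed
 have dP: "((%t::real. (max 0 t)^2) has_derivative (%h. (2 * max 0 t) * h)) (at t)" for t
  using max_0_square_deriv[of t] by (simp add: has_field_derivative_def)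
 have d1: "((%x. 1 - (max 0 (s x))^2) has_derivative (%h. - ((2 * max 0 (s x)) * ((2 / (7 * r^2)) * ((x - x0) \<bullet> h))))) (at x)" for x
  using has_derivative_diff[OF has_derivative_const[of 1] has_derivative_compose[OF ds dP]] by simp
 have dk: "(k has_derivative (%h. g x \<bullet> h)) (at x)" for x
 proof -
  have "(k has_derivative (%h. (2 * max 0 (1 - (max 0 (s x))^2)) * (- ((2 * max 0 (s x)) * ((2 / (7 * r^2)) * ((x - x0) \<bullet> h)))))) (at x)"
   unfolding k_def by (rule has_derivative_compose[OF d1 dP])
  then show ?thesis by (simp add: g_def mult_ac)
 qed
 have cs: "continuous_on UNIV s"
  using ds by (meson continuous_at_imp_continuous_on has_derivative_continuous)
 have cg: "continuous_on UNIV g" unfolding g_def by (intro continuous_intros cs)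
 have kr: "0 <= k x & k x <= 1" for x
 proof -
  have "max 0 (1 - (max 0 (s x))^2) <= 1" by simp
  then have "(max 0 (1 - (max 0 (s x))^2))^2 <= 1" by (intro power_le_one) auto
  then show ?thesis by (simp add: k_def)
 qed
 have small: "s x <= 0" if "x : cube x0 r" for x
 proof -
  have "(x - x0) \<bullet> (x - x0) = \<bar>x $ 1 - x0 $ 1\<bar>^2 + \<bar>x $ 2 - x0 $ 2\<bar>^2"
   by (simp add: inner_vec_def sum_2 power2_eq_square)
  also have "... <= r^2 + r^2" using that by (intro add_mono power_mono) (auto simp: mem_cube_2)
  finally show ?thesis using r by (simp add: s_def field_simps)
 qed
 have large: "s x > 1" if "norm (x - x0) > 3 * r" for x
 proof -
  have "(norm (x - x0))^2 > (3 * r)^2" using that r by (intro power_strict_mono) auto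
  then show ?thesis using r by (simp add: s_def dot_square_norm field_simps power_mult_distrib)
 qed
 show thesis
 proof (rule that[OF dk cg kr])
  show "k x = 1" "g x = 0" if "x : cube x0 r" for x
   using small[OF that] by (auto simp: k_def g_def)
  have sq: "1 <= (max 0 t)^2" if "t > 1" for t :: real using that by (simp add: one_le_power)
  show "k x = 0" if "x ~: cube x0 (3 * r)" for x
  proof -
   have "norm (x - x0) > 3 * r"
    using that cball_subset_cube[of x0 "3 * r"] by (force simp: dist_norm norm_minus_commute not_le)
   then show ?thesis using sq[OF large, of x] by (simp add: k_def)
  qed
  show "norm (g x) <= 4 / r" for x
  proof (cases "s x > 1")
   case True
   then show ?thesis using sq[of "s x"] r by (simp add: g_def)
  next
   case False
   have 1: "norm (x - x0) <= 3 * r" using large False by (meson not_le)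
   have 2: "0 <= max 0 (s x)" "max 0 (s x) <= 1" "0 <= max 0 (1 - (max 0 (s x))^2)" "max 0 (1 - (max 0 (s x))^2) <= 1"
    using False by auto
   have "norm (g x) = (max 0 (1 - (max 0 (s x))^2) * max 0 (s x)) * (8 / (7 * r^2)) * norm (x - x0)"
    using 2 by (simp add: g_def abs_mult)
   also have "... <= (1 * 1) * (8 / (7 * r^2)) * (3 * r)"
    using 1 2 r by (intro mult_mono) auto
   also have "... <= 4 / r" using r by (simp add: field_simps power2_eq_square)
   finally show ?thesis .
  qed
 qed
qed

section \<open>Poincare inequality on a square annulus\<close>

text \<open>On the overlap both constants are close to \<open>w\<close>, hence to each other. Their
  distance, weighted with the area of the second box, which is three times that of the overlap,
  carries the estimate there over to the constant of the first box.\<close>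

lemma Poincare_transfer:
 fixes w :: "real^2 => real^'m"
 assumes w: "continuous_on UNIV w"
  and P: "integral (cbox a b) (%x. (norm (w x - m))^2) <= EP"
  and R: "integral (cbox a' b') (%x. (norm (w x - m'))^2) <= ER"
  and S: "cbox c d <= cbox a b" "cbox c d <= cbox a' b'"
  and vol: "measure lborel (cbox a' b') = 3 * measure lborel (cbox c d)" "measure lborel (cbox c d) > 0"
 shows "integral (cbox a' b') (%x. (norm (w x - m))^2) <= 14 * (EP + ER)"
proof -
 let ?v = "measure lborel (cbox c d)"
 have i: "(%x. (norm (w x - m))^2) integrable_on cbox a b" for a b m
  by (intro integrable_on_cbox_UNIV continuous_intros w)
 have sq: "(norm (p + q))^2 <= 2 * ((norm p)^2 + (norm q)^2)" for p q :: "real^'m"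
 proof -
  have "(norm (p + q))^2 <= (norm p + norm q)^2" by (intro power_mono norm_triangle_ineq) auto
  also have "... <= 2 * ((norm p)^2 + (norm q)^2)"
   using zero_le_power2[of "norm p - norm q"] by (simp add: power2_eq_square algebra_simps)
  finally show ?thesis .
 qed
 have "?v * (norm (m' - m))^2 = integral (cbox c d) (%x. (norm (m' - m))^2)" by simp
 also have "... <= integral (cbox c d) (%x. 2 * ((norm (w x - m))^2 + (norm (w x - m'))^2))"
 proof (intro integral_le integrable_on_mult_right integrable_add i)
  show "(norm (m' - m))^2 <= 2 * ((norm (w x - m))^2 + (norm (w x - m'))^2)" for x
   using sq[of "w x - m" "m' - w x"] by (simp add: norm_minus_commute)
 qed auto
 also have "... = 2 * (integral (cbox c d) (%x. (norm (w x - m))^2) + integral (cbox c d) (%x. (norm (w x - m'))^2))"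
  by (simp add: integral_add i)
 also have "... <= 2 * (EP + ER)"
  by (intro mult_left_mono add_mono order_trans[OF integral_subset_le P] order_trans[OF integral_subset_le R] S i) auto
 finally have v: "?v * (norm (m' - m))^2 <= 2 * (EP + ER)" .
 have EP: "EP >= 0" using order_trans[OF integral_nonneg[OF i] P] by simp
 have "integral (cbox a' b') (%x. (norm (w x - m))^2)
   <= integral (cbox a' b') (%x. 2 * ((norm (w x - m'))^2 + (norm (m' - m))^2))"
 proof (intro integral_le integrable_on_mult_right integrable_add i)
  show "(norm (w x - m))^2 <= 2 * ((norm (w x - m'))^2 + (norm (m' - m))^2)" for x
   using sq[of "w x - m'" "m' - m"] by simp
 qed auto
 also have "... = 2 * (integral (cbox a' b') (%x. (norm (w x - m'))^2) + 3 * (?v * (norm (m' - m))^2))"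
  by (subst integral_mult_right, subst integral_add) (auto simp add: i vol mult.commute integrable_const)
 also have "... <= 2 * (ER + 3 * (2 * (EP + ER)))"
  by (intro mult_left_mono add_mono R v) auto
 also have "... <= 14 * (EP + ER)" using EP by simp
 finally show ?thesis .
qed

lemma integrable_Un_cbox:
 fixes f :: "'a::euclidean_space => real"
 assumes "continuous_on UNIV f"
 shows "f integrable_on (cbox a b \<union> cbox c d)"
proof -
 have "f absolutely_integrable_on cbox a b" "f absolutely_integrable_on cbox c d"
  using assms by (auto intro!: absolutely_integrable_continuous intro: continuous_on_subset)
 then have "f absolutely_integrable_on (cbox a b \<union> cbox c d)"
  by (rule absolutely_integrable_Un)
 then show ?thesis by (rule set_lebesgue_integral_eq_integral(1))
qed

text \<open>The annulus is not convex, so it is covered by four overlapping 2 by 6 rectangles in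
  units of \<open>r\<close>, and one constant is carried from the right side to the top and the
  bottom, and from the top to the left. The estimate speaks of continuous minorants of the squared
  distance that vanish in the hole, because this is how the cutoff gradient enters.\<close>

lemma Poincare_annulus:
 fixes w :: "real^2 => real^'m"
 assumes w: "C1_map w W" and r: "r > 0"
 obtains c where "!!f. continuous_on UNIV f ==> (!!x. 0 <= f x & f x <= (norm (w x - c))^2) ==>
   (!!x. x : cube x0 r ==> f x = 0) ==>
   integral (cube x0 (3 * r)) f <= 180000 * r^2 *
    (integral (cube x0 (3 * r)) (%x. (norm (W x))^2) - integral (cube x0 r) (%x. (norm (W x))^2))"
proof -
 have cw: "continuous_on UNIV w" and cW: "continuous_on UNIV W"
  using C1_map_continuous[OF w] C1_map_continuous_deriv[OF w] by auto
 define B where "B p q p' q' = cbox (x0 + r *\<^sub>R (vector [p, q] :: real^2)) (x0 + r *\<^sub>R vector [p', q'])" for p q p' q'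
 have memB: "x : B p q p' q' \<longleftrightarrow> r * p <= x $ 1 - x0 $ 1 & x $ 1 - x0 $ 1 <= r * p' & r * q <= x $ 2 - x0 $ 2 & x $ 2 - x0 $ 2 <= r * q'" for x p q p' q'
  by (auto simp: B_def mem_box_cart forall_2 algebra_simps)
 have volB: "measure lborel (B p q p' q') = r^2 * ((p' - p) * (q' - q))" if "p <= p'" "q <= q'" for p q p' q'
  unfolding B_def using that r by (subst measure_cbox_2) (auto simp: power2_eq_square algebra_simps)
 have iB: "f integrable_on B p q p' q'" if "continuous_on UNIV f" for f :: "real^2 => real" and p q p' q'
  unfolding B_def by (rule integrable_on_cbox_UNIV[OF that])
 let ?Z = "integral (cube x0 (3 * r)) (%x. (norm (W x))^2) - integral (cube x0 r) (%x. (norm (W x))^2)"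
 have cW2: "continuous_on UNIV (%x. (norm (W x))^2)" by (intro continuous_intros cW)
 \<comment> \<open>The diagonal of a 2 by 6 rectangle is \<open>sqrt 40 <= 7\<close>, so
   \<open>Poincare_box\<close> gives \<open>4 * 49 = 196\<close>; the rectangle meets the hole only
   along lines, hence the difference of the two integrals.\<close>
 have piece: "\<exists>m. integral (B p q p' q') (%x. (norm (w x - m))^2) <= 196 * r^2 * ?Z"
  if pq: "(p, q, p', q') : {(1,-3,3,3), (-3,1,3,3), (-3,-3,-1,3), (-3,-3,3,-1)}" for p q p' q' :: real
 proof -
  have pq2: "p < p'" "q < q'" "p' - p <= 6" "q' - q <= 6" "-3 <= p" "p' <= 3" "-3 <= q" "q' <= 3"
   "(p' - p)^2 + (q' - q)^2 = 40" using pq by auto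
  have diam: "norm (y - x) <= 7 * r" if "x : B p q p' q'" "y : B p q p' q'" for x y
  proof -
   have 1: "\<bar>y $ 1 - x $ 1\<bar> <= r * (p' - p)" "\<bar>y $ 2 - x $ 2\<bar> <= r * (q' - q)"
    using that by (auto simp: memB abs_le_iff algebra_simps)
   have "(norm (y - x))^2 = \<bar>y $ 1 - x $ 1\<bar>^2 + \<bar>y $ 2 - x $ 2\<bar>^2"
    by (simp add: norm_vec_def L2_set_def sum_2)
   also have "... <= (r * (p' - p))^2 + (r * (q' - q))^2" by (intro add_mono power_mono 1) auto
   also have "... = 40 * r^2" using pq2(9) by (simp add: power_mult_distrib flip: distrib_left)
   also have "... <= (7 * r)^2" by (simp add: power_mult_distrib)
   finally show ?thesis by (rule power2_le_imp_le) (use r in simp)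
  qed
  have pos: "measure lborel (B p q p' q') > 0" using pq2(1,2) r by (simp add: volB)
  obtain m where m: "integral (B p q p' q') (%x. (norm (w x - m))^2) <= 4 * (7 * r)^2 * integral (B p q p' q') (%x. (norm (W x))^2)"
   unfolding B_def
   by (rule Poincare_box[OF w, where d="7 * r"]) (use diam pos in \<open>auto simp: B_def\<close>)
  have "integral (B p q p' q') (%x. (norm (W x))^2) + integral (cube x0 r) (%x. (norm (W x))^2)
    = integral (B p q p' q' \<union> cube x0 r) (%x. (norm (W x))^2)"
  proof (rule integral_Un[symmetric])
   show "negligible (B p q p' q' \<inter> cube x0 r)"
   proof -
    have "B p q p' q' \<inter> cube x0 r <= {x. axis 1 1 \<bullet> x = x0 $ 1 + r} \<union> {x. axis 1 1 \<bullet> x = x0 $ 1 - r}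
      \<union> {x. axis 2 1 \<bullet> x = x0 $ 2 + r} \<union> {x. axis 2 1 \<bullet> x = x0 $ 2 - r}"
     using pq by (auto simp: memB mem_cube_2 inner_axis' abs_le_iff)
    moreover have "negligible ..."
     by (intro negligible_Un negligible_hyperplane) (auto simp: axis_eq_0_iff)
    ultimately show ?thesis by (rule negligible_subset[rotated])
   qed
  qed (intro iB integrable_on_cube cW2)+
  also have "... <= integral (cube x0 (3 * r)) (%x. (norm (W x))^2)"
  proof (rule integral_subset_le)
   show "B p q p' q' \<union> cube x0 r <= cube x0 (3 * r)"
    using pq r by (auto simp: memB mem_cube_2 abs_le_iff)
   show "(%x. (norm (W x))^2) integrable_on B p q p' q' \<union> cube x0 r"
    unfolding B_def cube_def by (intro integrable_Un_cbox cW2)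
  qed (auto intro!: integrable_on_cube cW2)
  finally have Z: "integral (B p q p' q') (%x. (norm (W x))^2) <= ?Z" by simp
  have "integral (B p q p' q') (%x. (norm (w x - m))^2) <= 4 * (7 * r)^2 * ?Z"
   using Z by (intro order_trans[OF m] mult_left_mono) auto
  then show ?thesis by (auto simp: power_mult_distrib)
 qed
 define E where "E = 196 * r^2 * ?Z"
 obtain m1 m2 m3 m4 where
  m1: "integral (B 1 (-3) 3 3) (%x. (norm (w x - m1))^2) <= E" and
  m2: "integral (B (-3) 1 3 3) (%x. (norm (w x - m2))^2) <= E" and
  m3: "integral (B (-3) (-3) (-1) 3) (%x. (norm (w x - m3))^2) <= E" and
  m4: "integral (B (-3) (-3) 3 (-1)) (%x. (norm (w x - m4))^2) <= E"
  using piece[of 1 "-3" 3 3] piece[of "-3" 1 3 3] piece[of "-3" "-3" "-1" 3] piece[of "-3" "-3" 3 "-1"]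
  unfolding E_def by auto
 have E: "E >= 0"
 proof -
  have "continuous_on UNIV (%x. (norm (w x - m1))^2)" by (intro continuous_intros cw)
  then show ?thesis using order_trans[OF integral_nonneg[OF iB] m1] by simp
 qed
 have tr: "integral (B p3 q3 p3' q3') (%x. (norm (w x - m))^2) <= 14 * (EP + ER)"
  if "integral (B p1 q1 p1' q1') (%x. (norm (w x - m))^2) <= EP"
   "integral (B p3 q3 p3' q3') (%x. (norm (w x - m'))^2) <= ER"
   "p1 <= p2" "q1 <= q2" "p2' <= p1'" "q2' <= q1'" "p3 <= p2" "q3 <= q2" "p2' <= p3'" "q2' <= q3'"
   "p2 < p2'" "q2 < q2'" "(p3' - p3) * (q3' - q3) = 3 * ((p2' - p2) * (q2' - q2))"
  for p1 q1 p1' q1' p2 q2 p2' q2' p3 q3 p3' q3' m m' EP ER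
 proof -
  have vol: "measure lborel (B p3 q3 p3' q3') = 3 * measure lborel (B p2 q2 p2' q2')" "measure lborel (B p2 q2 p2' q2') > 0"
   using that r by (simp_all add: volB)
  have mono: "r * p <= r * q" if "p <= q" for p q using that r by simp
  have sub: "B p2 q2 p2' q2' <= B p1 q1 p1' q1'" "B p2 q2 p2' q2' <= B p3 q3 p3' q3'"
   using mono[OF that(3)] mono[OF that(4)] mono[OF that(5)] mono[OF that(6)]
    mono[OF that(7)] mono[OF that(8)] mono[OF that(9)] mono[OF that(10)]
   by (auto simp: memB)
  show ?thesis
   using Poincare_transfer[OF cw that(1)[unfolded B_def] that(2)[unfolded B_def] sub[unfolded B_def] vol[unfolded B_def]]
   unfolding B_def .
 qed
 \<comment> \<open>Neighbouring rectangles share a 2 by 2 square, one third of their area. The costs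
   are \<open>14 * (1 + 1) = 28\<close> for top and bottom and \<open>14 * (28 + 1) = 406\<close>
   for the left side; with the right side they add up to 463.\<close>
 have t2: "integral (B (-3) 1 3 3) (%x. (norm (w x - m1))^2) <= 28 * E"
  using tr[OF m1 m2, of 1 1 3 3] by simp
 have t4: "integral (B (-3) (-3) 3 (-1)) (%x. (norm (w x - m1))^2) <= 28 * E"
  using tr[OF m1 m4, of 1 "-3" 3 "-1"] by simp
 have t3: "integral (B (-3) (-3) (-1) 3) (%x. (norm (w x - m1))^2) <= 406 * E"
  using tr[OF t2 m3, of "-3" 1 "-1" 3] by simp
 show thesis
 proof (rule that[of m1])
  fix f assume f: "continuous_on UNIV f" "!!x. 0 <= f x & f x <= (norm (w x - m1))^2" "!!x. x : cube x0 r ==> f x = 0"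
  let ?h = "%x. (norm (w x - m1))^2"
  have ch: "continuous_on UNIV ?h" by (intro continuous_intros cw)
  have sub: "B p q p' q' <= cube x0 (3 * r)" if "-3 <= p" "-3 <= q" "p' <= 3" "q' <= 3" for p q p' q'
  proof -
   have "r * (-3) <= r * p" "r * (-3) <= r * q" "r * p' <= r * 3" "r * q' <= r * 3"
    using mult_left_mono[OF that(1), of r] mult_left_mono[OF that(2), of r]
     mult_left_mono[OF that(3), of r] mult_left_mono[OF that(4), of r] r by auto
   then show ?thesis by (auto simp: memB mem_cube_2 abs_le_iff)
  qed
  have ind: "(%x. if x : B p q p' q' then ?h x else 0) integrable_on cube x0 (3 * r)"
    "integral (cube x0 (3 * r)) (%x. if x : B p q p' q' then ?h x else 0) = integral (B p q p' q') ?h"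
   if "-3 <= p" "-3 <= q" "p' <= 3" "q' <= 3" for p q p' q'
   using integrable_restrict_Int[of "B p q p' q'" ?h "cube x0 (3 * r)"] integral_restrict_Int[of "cube x0 (3 * r)" "B p q p' q'" ?h]
    iB[OF ch] sub[OF that] by (auto simp: Int_absorb2 Int_absorb1)
  let ?i = "%p q p' q' x. if x : B p q p' q' then ?h x else 0"
  have pt: "f x <= ?i 1 (-3) 3 3 x + ?i (-3) 1 3 3 x + ?i (-3) (-3) (-1) 3 x + ?i (-3) (-3) 3 (-1) x"
   if "x : cube x0 (3 * r)" for x
  proof (cases "x : cube x0 r")
   case True
   then show ?thesis using f(3)[OF True] by (auto intro!: add_nonneg_nonneg)
  next
   case False
   then have "x : B 1 (-3) 3 3 \<or> x : B (-3) 1 3 3 \<or> x : B (-3) (-3) (-1) 3 \<or> x : B (-3) (-3) 3 (-1)"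
    using that by (auto simp: memB mem_cube_2 abs_le_iff)
   then have "?h x <= ?i 1 (-3) 3 3 x + ?i (-3) 1 3 3 x + ?i (-3) (-3) (-1) 3 x + ?i (-3) (-3) 3 (-1) x"
    by auto
   then show ?thesis using f(2)[of x] by (meson order_trans)
  qed
  have "integral (cube x0 (3 * r)) f <= integral (cube x0 (3 * r)) (%x. ?i 1 (-3) 3 3 x + ?i (-3) 1 3 3 x + ?i (-3) (-3) (-1) 3 x + ?i (-3) (-3) 3 (-1) x)"
  proof (rule integral_le)
   show "f integrable_on cube x0 (3 * r)" by (rule integrable_on_cube[OF f(1)])
   show "(%x. ?i 1 (-3) 3 3 x + ?i (-3) 1 3 3 x + ?i (-3) (-3) (-1) 3 x + ?i (-3) (-3) 3 (-1) x) integrable_on cube x0 (3 * r)"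
    by (intro integrable_add ind) auto
  qed (rule pt)
  also have "... = integral (B 1 (-3) 3 3) ?h + integral (B (-3) 1 3 3) ?h + integral (B (-3) (-3) (-1) 3) ?h + integral (B (-3) (-3) 3 (-1)) ?h"
  proof -
   have hi: "((%x. ?i p q p' q' x) has_integral integral (B p q p' q') ?h) (cube x0 (3 * r))"
    if "-3 <= p" "-3 <= q" "p' <= 3" "q' <= 3" for p q p' q'
    using integrable_integral[OF ind(1)[OF that]] ind(2)[OF that] by simp
   show ?thesis
    by (rule integral_unique, intro has_integral_add hi) auto
  qed
  also have "... <= 463 * E" using m1 t2 t3 t4 by linarith
  also have "... <= 180000 * r^2 * ?Z" unfolding E_def
  proof -
   have "r^2 * ?Z >= 0" using E by (simp add: E_def)
   then show "463 * (196 * r^2 * ?Z) <= 180000 * r^2 * ?Z" by linarith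
  qed
  finally show "integral (cube x0 (3 * r)) f <= 180000 * r^2 * ?Z" .
 qed
qed

section \<open>Almost minimizers of uniformly convex energies\<close>

lemma norm_add_square_le: "(norm (p + q))^2 <= 2 * (norm p)^2 + 2 * (norm q)^2"
 for p q :: "'a::real_normed_vector"
proof -
 have "(norm (p + q))^2 <= (norm p + norm q)^2" by (intro power_mono norm_triangle_ineq) auto
 also have "... <= 2 * (norm p)^2 + 2 * (norm q)^2"
  using zero_le_power2[of "norm p - norm q"] by (simp add: power2_eq_square algebra_simps)
 finally show ?thesis .
qed

lemma integral_value_le:
 fixes f :: "real^2 => real"
 assumes f: "continuous_on UNIV f" and r: "r > 0" and le: "integral (cube x r) f <= 4 * r^2 * B"
 obtains y where "y : cube x r" "f y <= B"
proof -
 have "\<exists>y\<in>cube x r. f y <= B"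
 proof (rule ccontr)
  assume "\<not> ?thesis"
  then have gt: "!!y. y : cube x r ==> f y > B" by (auto simp: not_le)
  have "cube x r ~= {}" using centre_in_cube[of r x] r by auto
  then obtain x0 where x0: "x0 : cube x r" "!!y. y : cube x r ==> f x0 <= f y"
   using continuous_attains_inf[OF compact_cube _ continuous_on_subset[OF f subset_UNIV]] by metis
  have "4 * r^2 * f x0 = integral (cube x r) (%y. f x0)"
   using r measure_cube[of r x] by (simp add: cube_def)
  also have "... <= integral (cube x r) f"
   using x0(2) by (intro integral_le integrable_on_cube f) auto
  also note le
  finally show False using gt[OF x0(1)] r by simp
 qed
 then show ?thesis using that by blast
qed

text \<open>The increment is an average of the derivative along the shift, and each intermediate
  translate of the cube lies in the cube enlarged by \<open>d\<close>.\<close>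

lemma difference_quotient_le:
 fixes f :: "real^2 => real^'m"
 assumes f: "C1_map f F" and s: "\<bar>s $ 1\<bar> <= d" "\<bar>s $ 2\<bar> <= d"
 shows "integral (cube x0 r) (%x. (norm (f (x + s) - f x))^2) <= (norm s)^2 * integral (cube x0 (r + d)) (%x. (norm (F x))^2)"
proof -
 have cF: "continuous_on UNIV F" using C1_map_continuous_deriv[OF f] .
 have cf: "continuous_on UNIV f" using C1_map_continuous[OF f] .
 let ?g = "%x t. (norm s)^2 * (norm (F (x + t *\<^sub>R s)))^2"
 have cN: "continuous_on S (%p. (norm (F (q p)))^2)" if "continuous_on S q" for q and S :: "'z::topological_space set"
  by (intro continuous_intros continuous_on_compose2[OF cF that]) auto
 have pt: "(norm (f (x + s) - f x))^2 <= integral {0..1} (?g x)" for x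
 proof -
  let ?h = "%t. 1 * norm (F (x + t *\<^sub>R (x + s - x))) * norm (x + s - x)"
  have ch: "continuous_on {0..1} ?h"
   by (intro continuous_intros continuous_on_compose2[OF cF, of "{0..1}"]) auto
  have "norm (f (x + s) - f x) <= integral {0..1} ?h"
   by (rule path_increment_le[OF f, where p="%t. t"]) auto
  then have "(norm (f (x + s) - f x))^2 <= (integral {0..1} ?h)^2" by (intro power_mono) auto
  also have "... <= integral {0..1} (%t. (?h t)^2)" by (intro integral_square_le ch)
  also have "... = integral {0..1} (?g x)" by (simp add: power_mult_distrib mult.commute)
  finally show ?thesis .
 qed
 have "integral (cube x0 r) (%x. (norm (f (x + s) - f x))^2) <= integral (cube x0 r) (%x. integral (cbox 0 1) (?g x))"
  unfolding cube_def
 proof (rule integral_le)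
  show "(%x. (norm (f (x + s) - f x))^2) integrable_on cbox (x0 - vec r) (x0 + vec r)"
   by (intro integrable_continuous continuous_intros continuous_on_compose2[OF cf] continuous_on_subset[OF cf]) auto
  show "(%x. integral (cbox 0 1) (?g x)) integrable_on cbox (x0 - vec r) (x0 + vec r)"
   by (intro integrable_continuous integral_continuous_on_param) (auto simp: split_beta intro!: continuous_intros cN)
 qed (use pt in auto)
 also have "... = integral (cbox 0 1) (%t. integral (cube x0 r) (%x. ?g x t))"
  unfolding cube_def by (rule integral_swap_continuous) (auto simp: split_beta intro!: continuous_intros cN)
 also have "... <= integral (cbox 0 1) (%t::real. (norm s)^2 * integral (cube x0 (r + d)) (%x. (norm (F x))^2))"
 proof (rule integral_le)
  show "(%t. integral (cube x0 r) (%x. ?g x t)) integrable_on cbox 0 1"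
   unfolding cube_def by (intro integrable_continuous integral_continuous_on_param) (auto simp: split_beta intro!: continuous_intros cN)
  fix t :: real assume t: "t : cbox 0 1"
  have "integral (cube x0 r) (%x. (norm (F (x + t *\<^sub>R s)))^2) = integral (cube (x0 + t *\<^sub>R s) r) (%x. (norm (F x))^2)"
   by (rule integral_cube_translate[symmetric]) (intro continuous_intros cF)
  also have "... <= integral (cube x0 (r + d)) (%x. (norm (F x))^2)"
  proof (rule integral_subset_le)
   have "\<bar>t * s $ i\<bar> <= d" for i
   proof -
    have "\<bar>s $ i\<bar> <= d" using s exhaust_2[of i] by auto
    moreover have "\<bar>t * s $ i\<bar> <= \<bar>s $ i\<bar>" using t by (simp add: abs_mult mult_left_le_one_le)
    ultimately show ?thesis by linarith
   qed
   then have b: "- d <= t * s $ i" "t * s $ i <= d" for i by (auto simp: abs_le_iff minus_le_iff)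
   show "cube (x0 + t *\<^sub>R s) r <= cube x0 (r + d)"
   proof
    fix y assume "y : cube (x0 + t *\<^sub>R s) r"
    then have a: "\<bar>y $ i - (x0 $ i + t * s $ i)\<bar> <= r" for i by (simp add: mem_cube)
    have "\<bar>y $ i - x0 $ i\<bar> <= r + d" for i using a[of i] b[of i] by linarith
    then show "y : cube x0 (r + d)" by (simp add: mem_cube)
   qed
  qed (auto intro!: integrable_on_cube continuous_intros cF)
  finally show "integral (cube x0 r) (%x. ?g x t) <= (norm s)^2 * integral (cube x0 (r + d)) (%x. (norm (F x))^2)"
   by (simp add: mult_left_mono)
 qed auto
 also have "... = (norm s)^2 * integral (cube x0 (r + d)) (%x. (norm (F x))^2)" by simp
 finally show ?thesis .
qed

text \<open>The Hessian bounds enter only through these first-order inequalities: \<open>A\<close>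
  is a strongly monotone Lipschitz field, \<open>lower\<close> keeps the energy bounded below, and
  \<open>upper\<close> controls the energy of a perturbation.\<close>

locale uniformly_elliptic =
 fixes L :: "real^2^2 => real" and A :: "real^2^2 => real^2^2" and \<mu> M :: real
 assumes \<mu>_pos: "\<mu> > 0" and M_pos: "M > 0"
  and monotone: "\<mu> * (norm (P - Q))^2 <= (A P - A Q) \<bullet> (P - Q)"
  and Lipschitz: "norm (A P - A Q) <= M * norm (P - Q)"
  and lower: "L P + A P \<bullet> H + \<mu> / 2 * (norm H)^2 <= L (P + H)"
  and upper: "L (P + H) <= L P + A P \<bullet> H + M * (norm H)^2"
  and L_continuous: "continuous_on UNIV L"
begin

lemma A_continuous: "continuous_on UNIV A"
proof -
 have "continuous_on UNIV A" if "!!x y. dist (A x) (A y) <= M * dist x y"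
  unfolding continuous_on_iff
 proof (intro ballI allI impI)
  fix x and e :: real assume "e > 0"
  then show "\<exists>d>0. \<forall>x'\<in>UNIV. dist x' x < d --> dist (A x') (A x) < e"
   using M_pos by (intro exI[of _ "e / M"]) (auto simp: field_simps intro: le_less_trans[OF that])
 qed
 then show ?thesis using Lipschitz by (simp add: dist_norm)
qed

lemma continuous_on_A: "continuous_on S F ==> continuous_on S (%x. A (F x))"
 by (rule continuous_on_compose2[OF A_continuous]) auto

lemma continuous_on_L: "continuous_on S F ==> continuous_on S (%x. L (F x))"
 by (rule continuous_on_compose2[OF L_continuous]) auto

text \<open>Testing with \<open>\<plusminus>t \<psi>\<close> replaces the exact Euler-Lagrange equation for a near minimizer; no
 compactness or existence theorem is needed for the comparison maps.\<close>

definition almost_critical :: "real => (real^2 => real^2^2) => (real^2) set => bool"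
 where "almost_critical \<delta> H Q \<longleftrightarrow>
  (\<forall>\<psi> \<Psi> t. C1_map \<psi> \<Psi> --> (\<forall>x. x ~: Q --> \<psi> x = 0) --> 0 < t -->
    \<bar>integral Q (%x. A (H x) \<bullet> \<Psi> x)\<bar> <= \<delta> / t + M * t * integral Q (%x. (norm (\<Psi> x))^2))"

lemma almost_criticalD:
 assumes "almost_critical \<delta> H Q" "C1_map \<psi> \<Psi>" "!!x. x ~: Q ==> \<psi> x = 0" "0 < t"
 shows "\<bar>integral Q (%x. A (H x) \<bullet> \<Psi> x)\<bar> <= \<delta> / t + M * t * integral Q (%x. (norm (\<Psi> x))^2)"
 using assms unfolding almost_critical_def by blast

lemma almost_critical_exists:
 assumes f: "C1_map f F" and "\<delta> > 0"
 obtains \<phi> \<Phi> where "C1_map \<phi> \<Phi>" "!!x. x ~: cube x0 R ==> \<phi> x = 0"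
  "almost_critical \<delta> (%x. F x + \<Phi> x) (cube x0 R)"
proof -
 let ?Q = "cube x0 R"
 have cF: "continuous_on UNIV F" using C1_map_continuous_deriv[OF f] .
 define T where "T = {\<Phi>. \<exists>\<phi> :: real^2 => real^2. C1_map \<phi> \<Phi> & (\<forall>x. x ~: ?Q --> \<phi> x = 0)}"
 define J where "J \<Phi> = integral ?Q (%x. L (F x + \<Phi> x))" for \<Phi>
 have cT: "continuous_on UNIV \<Phi>" if "\<Phi> : T" for \<Phi>
  using that C1_map_continuous_deriv unfolding T_def by blast
 have 0: "(%x. 0) : T" using C1_map_const[of 0] unfolding T_def by auto
 \<comment> \<open>Completing the square in \<open>lower\<close> at 0 bounds the energy density
   below by a constant, so the infimum is finite.\<close>
 have lb: "integral ?Q (%x. L 0 - (norm (A 0))^2 / (2 * \<mu>)) <= J \<Phi>" if "\<Phi> : T" for \<Phi>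
  unfolding J_def
 proof (rule integral_le)
  show "L 0 - (norm (A 0))^2 / (2 * \<mu>) <= L (F x + \<Phi> x)" for x
  proof -
   define p q where "p = norm (F x + \<Phi> x)" and "q = norm (A 0)"
   have "L 0 + A 0 \<bullet> (F x + \<Phi> x) + \<mu> / 2 * p^2 <= L (F x + \<Phi> x)"
    using lower[of 0 "F x + \<Phi> x"] by (simp add: p_def)
   moreover have "\<bar>A 0 \<bullet> (F x + \<Phi> x)\<bar> <= q * p"
    unfolding p_def q_def by (rule Cauchy_Schwarz_ineq2)
   moreover have "\<mu> / 2 * p^2 - q * p + q^2 / (2 * \<mu>) >= 0"
   proof -
    have "\<mu> / 2 * p^2 - q * p + q^2 / (2 * \<mu>) = (\<mu> * p - q)^2 / (2 * \<mu>)"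
     using \<mu>_pos by (simp add: power2_eq_square field_simps)
    then show ?thesis using \<mu>_pos by simp
   qed
   ultimately show ?thesis unfolding q_def[symmetric] by linarith
  qed
  show "(%x. L (F x + \<Phi> x)) integrable_on ?Q"
   by (intro integrable_on_cube continuous_on_L continuous_on_add cF cT[OF that])
 qed (auto intro!: integrable_on_cube)
 have bdd: "bdd_below (J ` T)" using lb by (intro bdd_belowI2) auto
 have "J ` T ~= {}" using 0 by auto
 then have "\<exists>y\<in>J ` T. y < Inf (J ` T) + \<delta>"
  using bdd \<open>\<delta> > 0\<close> by (intro cInf_lessD) auto
 then obtain \<Phi> where \<Phi>: "\<Phi> : T" "J \<Phi> < Inf (J ` T) + \<delta>" by auto
 obtain \<phi> where \<phi>: "C1_map \<phi> \<Phi>" "!!x. x ~: ?Q ==> \<phi> x = 0" using \<Phi>(1) by (auto simp: T_def)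
 have min: "J \<Phi> <= J \<Phi>' + \<delta>" if "\<Phi>' : T" for \<Phi>'
  using \<Phi>(2) cInf_lower[OF imageI[OF that] bdd] by linarith
 let ?H = "%x. F x + \<Phi> x"
 have cH: "continuous_on UNIV ?H" by (intro continuous_intros cF cT \<Phi>)
 \<comment> \<open>Division by \<open>t\<close> turns the defect \<delta> of minimality and the
   quadratic Taylor error into the two terms on the right; the opposite sign follows by reversing
   the test field.\<close>
 have one: "- integral ?Q (%x. A (?H x) \<bullet> \<Psi> x) <= \<delta> / t + M * t * integral ?Q (%x. (norm (\<Psi> x))^2)"
  if \<psi>: "C1_map \<psi> \<Psi>" "!!x. x ~: ?Q ==> \<psi> x = 0" and t: "0 < t" for \<psi> \<Psi> t
 proof -
  have c\<Psi>: "continuous_on UNIV \<Psi>" using C1_map_continuous_deriv[OF \<psi>(1)] .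
  have "(%x. \<Phi> x + t *\<^sub>R \<Psi> x) : T"
   unfolding T_def using C1_map_add[OF \<phi>(1) C1_map_scaleR[OF \<psi>(1), of t]] \<phi>(2) \<psi>(2) by auto
  then have "J \<Phi> <= integral ?Q (%x. L (?H x + t *\<^sub>R \<Psi> x)) + \<delta>"
   using min[of "%x. \<Phi> x + t *\<^sub>R \<Psi> x"] by (simp add: J_def add.assoc)
  also have "integral ?Q (%x. L (?H x + t *\<^sub>R \<Psi> x))
   <= integral ?Q (%x. L (?H x) + (t * (A (?H x) \<bullet> \<Psi> x) + (M * t^2) * (norm (\<Psi> x))^2))"
  proof (rule integral_le)
   show "L (?H x + t *\<^sub>R \<Psi> x) <= L (?H x) + (t * (A (?H x) \<bullet> \<Psi> x) + (M * t^2) * (norm (\<Psi> x))^2)" for x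
    using upper[of "?H x" "t *\<^sub>R \<Psi> x"] by (simp add: power_mult_distrib)
  qed (auto intro!: integrable_on_cube continuous_on_L continuous_on_A continuous_intros cH c\<Psi>)
  also have "... = J \<Phi> + (t * integral ?Q (%x. A (?H x) \<bullet> \<Psi> x) + (M * t^2) * integral ?Q (%x. (norm (\<Psi> x))^2))"
   unfolding J_def
   by (subst integral_add | subst integral_mult_right |
     (intro integrable_on_cube continuous_on_L continuous_on_A continuous_intros cH c\<Psi>))+ simp
  finally have "t * (- integral ?Q (%x. A (?H x) \<bullet> \<Psi> x)) <= t * (\<delta> / t + M * t * integral ?Q (%x. (norm (\<Psi> x))^2))"
   using t by (simp add: algebra_simps power2_eq_square)
  then show ?thesis using mult_le_cancel_left_pos[OF t] by blast
 qed
 have "almost_critical \<delta> ?H ?Q"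
  unfolding almost_critical_def
 proof (intro allI impI)
  fix \<psi> :: "real^2 => real^2" and \<Psi> and t :: real assume \<psi>: "C1_map \<psi> \<Psi>" "\<forall>x. x ~: ?Q --> \<psi> x = 0" and t: "0 < t"
  have n: "C1_map (%x. (-1) *\<^sub>R \<psi> x) (%x. (-1) *\<^sub>R \<Psi> x)" using C1_map_scaleR[OF \<psi>(1)] .
  show "\<bar>integral ?Q (%x. A (?H x) \<bullet> \<Psi> x)\<bar> <= \<delta> / t + M * t * integral ?Q (%x. (norm (\<Psi> x))^2)"
   using one[OF \<psi>(1) _ t] one[OF n _ t] \<psi>(2) by (simp add: abs_le_iff)
 qed
 then show ?thesis using \<phi> by (intro that)
qed

text \<open>The bracket collects the coefficients of the defect and of the cutoff term in
  \<open>Caccioppoli\<close>; \<open>4 / \<mu>\<close> inverts the quarter of the ellipticity that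
  survives absorption.\<close>

definition C\<^sub>1 :: real where "C\<^sub>1 = 4 / \<mu> * (32 * M / \<mu> + \<mu> + 2 * M^2 / \<mu>)"

lemma C\<^sub>1_pos: "C\<^sub>1 > 0"
 using \<mu>_pos M_pos unfolding C\<^sub>1_def by (intro mult_pos_pos add_pos_pos) auto

text \<open>Increments replace second derivatives. The same test field is used for \<open>H\<close>
  and, translated, for the shifted \<open>H\<close>; subtracting the two exposes monotonicity. The
  price of near criticality contains the increments themselves and has to be absorbed.\<close>

lemma Caccioppoli:
 assumes h: "C1_map h H" and ac: "almost_critical \<delta> H (cube x0 R)" and "\<delta> >= 0"
  and sub: "cube x0 r <= cube x0 R" "!!x. x : cube x0 r ==> x + s : cube x0 R"
  and k: "!!x. (k has_derivative (%h. g x \<bullet> h)) (at x)" "continuous_on UNIV g"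
   "!!x. 0 <= k x & k x <= 1" "!!x. x ~: cube x0 r ==> k x = 0"
 shows "integral (cube x0 r) (%x. (k x)^2 * (norm (H (x + s) - H x))^2)
  <= C\<^sub>1 * (\<delta> + integral (cube x0 r) (%x. (norm (g x))^2 * (norm (h (x + s) - h x - c))^2))"
proof -
 let ?K = "cube x0 r" and ?Q = "cube x0 R"
 define v where "v x = h (x + s) - h x - c" for x
 define W where "W x = H (x + s) - H x" for x
 have v: "C1_map v W"
  using C1_map_diff[OF C1_map_diff[OF C1_map_translate[OF h] h] C1_map_const] by (simp add: v_def[abs_def] W_def[abs_def])
 have cv: "continuous_on UNIV v" and cW: "continuous_on UNIV W" and cH: "continuous_on UNIV H"
  using C1_map_continuous[OF v] C1_map_continuous_deriv[OF v] C1_map_continuous_deriv[OF h] by auto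
 have ck: "continuous_on UNIV k"
  using k(1) by (meson continuous_at_imp_continuous_on has_derivative_continuous)
 have cHs: "continuous_on UNIV (%x. H (x + s))"
  by (rule C1_map_continuous_deriv[OF C1_map_translate[OF h]])
 define \<psi> where "\<psi> x = (k x)^2 *\<^sub>R v x" for x
 define \<Psi> where "\<Psi> x = (k x)^2 *\<^sub>R W x + outer (v x) ((2 * k x) *\<^sub>R g x)" for x
 have \<psi>: "C1_map \<psi> \<Psi>"
  unfolding \<psi>_def[abs_def] \<Psi>_def[abs_def]
 proof (rule C1_map_mult[OF v])
  show "((%x. (k x)^2) has_derivative (%h. (2 * k x) *\<^sub>R g x \<bullet> h)) (at x)" for x
   using has_derivative_power[OF k(1)[of x], of 2] by (simp add: mult_ac)
  show "continuous_on UNIV (%x. (2 * k x) *\<^sub>R g x)" by (intro continuous_intros ck k)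
 qed
 have \<psi>0: "\<psi> x = 0" if "x ~: ?K" for x using k(4)[OF that] by (simp add: \<psi>_def)
 have \<Psi>0: "\<Psi> x = 0" if "x ~: ?K" for x using k(4)[OF that] by (simp add: \<Psi>_def outer_def vec_eq_iff)
 have c\<Psi>: "continuous_on UNIV \<Psi>" using C1_map_continuous_deriv[OF \<psi>] .
 \<comment> \<open>With this \<open>t\<close> the increments hidden in the two defect terms cost
   \<open>4 * M * t = \<mu> / 4\<close>, half of the \<open>\<mu> / 2\<close> that Young's
   inequality leaves.\<close>
 define t where "t = \<mu> / (16 * M)"
 have t: "t > 0" using \<mu>_pos M_pos by (simp add: t_def)
 let ?N = "integral ?K (%x. (norm (\<Psi> x))^2)"
 have e1: "\<bar>integral ?K (%x. A (H x) \<bullet> \<Psi> x)\<bar> <= \<delta> / t + M * t * ?N"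
 proof -
  have "integral ?Q (%x. A (H x) \<bullet> \<Psi> x) = integral ?K (%x. A (H x) \<bullet> \<Psi> x)"
   "integral ?Q (%x. (norm (\<Psi> x))^2) = ?N"
   by (rule integral_vanish_outside[OF sub(1)]; simp add: \<Psi>0)+
  then show ?thesis using almost_criticalD[OF ac \<psi> \<psi>0 t] sub(1) by auto
 qed
 \<comment> \<open>The equation at the shifted argument is the original one tested with the field
   moved by \<open>s\<close>, whose support still lies in the large cube.\<close>
 have e2: "\<bar>integral ?K (%x. A (H (x + s)) \<bullet> \<Psi> x)\<bar> <= \<delta> / t + M * t * ?N"
 proof -
  let ?K' = "cube (x0 + s) r"
  have shift: "x + - s : ?K \<longleftrightarrow> x : ?K'" for x by (simp add: mem_cube algebra_simps)
  have sub': "?K' <= ?Q"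
  proof
   fix x assume "x : ?K'"
   then have "x + - s : ?K" using shift by simp
   from sub(2)[OF this] show "x : ?Q" by simp
  qed
  have \<psi>': "C1_map (%x. \<psi> (x + - s)) (%x. \<Psi> (x + - s))" by (rule C1_map_translate[OF \<psi>])
  have c': "continuous_on UNIV (%x. \<Psi> (x + - s))" using C1_map_continuous_deriv[OF \<psi>'] .
  have van: "\<psi> (x + - s) = 0" if "x ~: ?Q" for x using \<psi>0[of "x + - s"] shift[of x] sub' that by blast
  have "integral ?Q (%x. A (H x) \<bullet> \<Psi> (x + - s)) = integral ?K' (%x. A (H x) \<bullet> \<Psi> (x + - s))"
   by (rule integral_vanish_outside[OF sub']) (simp only: \<Psi>0 shift not_False_eq_True inner_zero_right)
  also have "... = integral ?K (%x. A (H (x + s)) \<bullet> \<Psi> x)"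
  proof -
   have "continuous_on UNIV (%x. A (H x) \<bullet> \<Psi> (x + - s))" by (intro continuous_intros continuous_on_A cH c')
   from integral_cube_translate[OF this, of x0 s r] show ?thesis by simp
  qed
  finally have 1: "integral ?Q (%x. A (H x) \<bullet> \<Psi> (x + - s)) = integral ?K (%x. A (H (x + s)) \<bullet> \<Psi> x)" .
  have "integral ?Q (%x. (norm (\<Psi> (x + - s)))^2) = integral ?K' (%x. (norm (\<Psi> (x + - s)))^2)"
   by (rule integral_vanish_outside[OF sub']) (simp only: \<Psi>0 shift not_False_eq_True norm_zero, simp)
  also have "... = ?N"
  proof -
   have "continuous_on UNIV (%x. (norm (\<Psi> (x + - s)))^2)" by (intro continuous_intros c')
   from integral_cube_translate[OF this, of x0 s r] show ?thesis by simp
  qed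
  finally have 2: "integral ?Q (%x. (norm (\<Psi> (x + - s)))^2) = ?N" .
  show ?thesis using almost_criticalD[OF ac \<psi>' van t] 1 2 by simp
 qed
 let ?Y = "integral ?K (%x. (k x)^2 * (norm (W x))^2)"
 let ?X = "integral ?K (%x. (norm (g x))^2 * (norm (v x))^2)"
 have iY: "(%x. (k x)^2 * (norm (W x))^2) integrable_on ?K"
  by (intro integrable_on_cube continuous_intros ck cW)
 have iX: "(%x. (norm (g x))^2 * (norm (v x))^2) integrable_on ?K"
  by (intro integrable_on_cube continuous_intros k cv)
 have normo: "norm (outer (v x) ((2 * k x) *\<^sub>R g x)) = 2 * k x * (norm (v x) * norm (g x))" for x
  using k(3)[of x] by (simp add: norm_outer)
 have N: "?N <= 2 * ?Y + 8 * ?X"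
 proof -
  have "?N <= integral ?K (%x. 2 * ((k x)^2 * (norm (W x))^2) + 8 * ((norm (g x))^2 * (norm (v x))^2))"
  proof (rule integral_le)
   show "(%x. (norm (\<Psi> x))^2) integrable_on ?K" by (intro integrable_on_cube continuous_intros c\<Psi>)
   show "(%x. 2 * ((k x)^2 * (norm (W x))^2) + 8 * ((norm (g x))^2 * (norm (v x))^2)) integrable_on ?K"
    by (intro integrable_add integrable_on_mult_right iX iY)
   fix x
   have k2: "(k x)^2 <= 1" using k(3)[of x] by (simp add: power_le_one)
   have "(norm (\<Psi> x))^2 <= 2 * (norm ((k x)^2 *\<^sub>R W x))^2 + 2 * (norm (outer (v x) ((2 * k x) *\<^sub>R g x)))^2"
    unfolding \<Psi>_def by (rule norm_add_square_le)
   also have "... = 2 * ((k x)^2 * ((k x)^2 * (norm (W x))^2)) + 8 * ((k x)^2 * ((norm (g x))^2 * (norm (v x))^2))"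
    by (simp add: normo power_mult_distrib power2_eq_square)
   also have "... <= 2 * (1 * ((k x)^2 * (norm (W x))^2)) + 8 * (1 * ((norm (g x))^2 * (norm (v x))^2))"
    by (intro add_mono mult_left_mono mult_right_mono k2) auto
   finally show "(norm (\<Psi> x))^2 <= 2 * ((k x)^2 * (norm (W x))^2) + 8 * ((norm (g x))^2 * (norm (v x))^2)" by simp
  qed
  then show ?thesis by (simp add: integral_add integrable_on_mult_right iX iY)
 qed
 have "\<mu> / 2 * ?Y - 2 * M^2 / \<mu> * ?X = integral ?K (%x. \<mu> / 2 * ((k x)^2 * (norm (W x))^2) - 2 * M^2 / \<mu> * ((norm (g x))^2 * (norm (v x))^2))"
  by (subst integral_diff) (auto intro!: integrable_on_mult_right iX iY simp del: times_divide_eq_left)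
 also have "... <= integral ?K (%x. A (H (x + s)) \<bullet> \<Psi> x - A (H x) \<bullet> \<Psi> x)"
 proof (rule integral_le)
  show "(%x. \<mu> / 2 * ((k x)^2 * (norm (W x))^2) - 2 * M^2 / \<mu> * ((norm (g x))^2 * (norm (v x))^2)) integrable_on ?K"
   by (intro integrable_diff integrable_on_mult_right iX iY)
  show "(%x. A (H (x + s)) \<bullet> \<Psi> x - A (H x) \<bullet> \<Psi> x) integrable_on ?K"
   by (intro integrable_on_cube continuous_intros continuous_on_A cH cHs c\<Psi>)
  fix x
  define a where "a = A (H (x + s)) - A (H x)"
  define p q where "p = k x * norm (W x)" and "q = norm (v x) * norm (g x)"
  have k0: "0 <= k x" using k(3) by simp
  have "\<mu> * (norm (W x))^2 <= a \<bullet> W x" unfolding a_def W_def by (rule monotone)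
  then have "(k x)^2 * (\<mu> * (norm (W x))^2) <= (k x)^2 * (a \<bullet> W x)" by (rule mult_left_mono) simp
  then have 1: "\<mu> * p^2 <= a \<bullet> ((k x)^2 *\<^sub>R W x)" by (simp add: p_def power_mult_distrib mult_ac)
  have "\<bar>a \<bullet> outer (v x) ((2 * k x) *\<^sub>R g x)\<bar> <= norm a * norm (outer (v x) ((2 * k x) *\<^sub>R g x))"
   by (rule Cauchy_Schwarz_ineq2)
  also have "... <= (M * norm (W x)) * (2 * k x * q)"
   unfolding normo q_def a_def W_def using k0 by (intro mult_right_mono Lipschitz) auto
  finally have 2: "\<bar>a \<bullet> outer (v x) ((2 * k x) *\<^sub>R g x)\<bar> <= 2 * M * p * q" by (simp add: p_def mult_ac)
  \<comment> \<open>Young's inequality as a perfect square, with weights that leave half of the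
    ellipticity.\<close>
  have 3: "0 <= \<mu> / 2 * p^2 - 2 * M * p * q + 2 * M^2 / \<mu> * q^2"
  proof -
   have "\<mu> / 2 * p^2 - 2 * M * p * q + 2 * M^2 / \<mu> * q^2 = (\<mu> * p - 2 * M * q)^2 / (2 * \<mu>)"
    using \<mu>_pos by (simp add: power2_eq_square field_simps)
   then show ?thesis using \<mu>_pos by simp
  qed
  have 4: "A (H (x + s)) \<bullet> \<Psi> x - A (H x) \<bullet> \<Psi> x = a \<bullet> ((k x)^2 *\<^sub>R W x) + a \<bullet> outer (v x) ((2 * k x) *\<^sub>R g x)"
   unfolding a_def \<Psi>_def inner_add_right[symmetric] by (simp only: inner_diff_left)
  have 5: "(k x)^2 * (norm (W x))^2 = p^2" "(norm (g x))^2 * (norm (v x))^2 = q^2"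
   by (simp_all add: p_def q_def power_mult_distrib)
  have "\<mu> * p^2 = \<mu> / 2 * p^2 + \<mu> / 2 * p^2" by simp
  then show "\<mu> / 2 * ((k x)^2 * (norm (W x))^2) - 2 * M^2 / \<mu> * ((norm (g x))^2 * (norm (v x))^2)
    <= A (H (x + s)) \<bullet> \<Psi> x - A (H x) \<bullet> \<Psi> x"
   using 1 2 3 unfolding 4 5 by linarith
 qed
 also have "... = integral ?K (%x. A (H (x + s)) \<bullet> \<Psi> x) - integral ?K (%x. A (H x) \<bullet> \<Psi> x)"
  by (intro integral_diff integrable_on_cube continuous_intros continuous_on_A cH cHs c\<Psi>)
 also have "... <= 2 * (\<delta> / t + M * t * ?N)"
 proof -
  have "b - a <= 2 * B" if "\<bar>a\<bar> <= B" "\<bar>b\<bar> <= B" for a b B :: real using that by linarith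
  from this[OF e1 e2] show ?thesis .
 qed
 also have "... <= 2 * (\<delta> / t + M * t * (2 * ?Y + 8 * ?X))"
  using t M_pos by (intro mult_left_mono add_left_mono N) auto
 also have "... = 32 * M / \<mu> * \<delta> + \<mu> / 4 * ?Y + \<mu> * ?X"
  using \<mu>_pos M_pos by (simp add: t_def field_simps)
 finally have "\<mu> / 4 * ?Y <= 32 * M / \<mu> * \<delta> + (\<mu> + 2 * M^2 / \<mu>) * ?X"
 proof -
  have "a / 4 * Y <= e + (a + b) * X" if "a / 2 * Y - b * X <= e + a / 4 * Y + a * X" for a b e X Y :: real
  proof -
   have "a / 2 * Y = a / 4 * Y + a / 4 * Y" by simp
   then show ?thesis using that unfolding distrib_right by linarith
  qed
  then show "\<mu> / 2 * ?Y - 2 * M^2 / \<mu> * ?X <= 32 * M / \<mu> * \<delta> + \<mu> / 4 * ?Y + \<mu> * ?X ==>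
   \<mu> / 4 * ?Y <= 32 * M / \<mu> * \<delta> + (\<mu> + 2 * M^2 / \<mu>) * ?X" .
 qed
 also have "... <= (32 * M / \<mu> + \<mu> + 2 * M^2 / \<mu>) * (\<delta> + ?X)"
 proof -
  have "0 <= (\<mu> + 2 * M^2 / \<mu>) * \<delta>" using \<mu>_pos \<open>\<delta> >= 0\<close> by (intro mult_nonneg_nonneg add_nonneg_nonneg) auto
  moreover have "0 <= ?X" by (intro integral_nonneg iX) auto
  then have "0 <= 32 * M / \<mu> * ?X" using \<mu>_pos M_pos by (intro mult_nonneg_nonneg) auto
  ultimately show ?thesis by (simp add: algebra_simps)
 qed
 finally have "4 / \<mu> * (\<mu> / 4 * ?Y) <= 4 / \<mu> * ((32 * M / \<mu> + \<mu> + 2 * M^2 / \<mu>) * (\<delta> + ?X))"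
  using \<mu>_pos by (intro mult_left_mono) auto
 moreover have "4 / \<mu> * (\<mu> / 4 * ?Y) = ?Y" using \<mu>_pos by simp
 ultimately show ?thesis unfolding C\<^sub>1_def v_def W_def mult.assoc by simp
qed


text \<open>Hole filling turns \<open>I1 <= a * (I3 - I1)\<close> into
  \<open>I1 <= a / (1 + a) * I3\<close>. Here \<open>a\<close> is \<open>C\<^sub>1\<close> times
  2880000, the annulus constant 180000 times the 16 from the squared cutoff gradient.\<close>

definition \<theta> :: real where "\<theta> = C\<^sub>1 * 2880000 / (1 + C\<^sub>1 * 2880000)"

lemma \<theta>_bounds: "0 < \<theta>" "\<theta> < 1"
 using C\<^sub>1_pos by (auto simp: \<theta>_def field_simps intro!: divide_pos_pos)

text \<open>The cutoff gradient lives in the annulus, where the Poincare inequality bounds the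
  cutoff term by the difference of the integrals over the two cubes; moving the inner integral to
  the left yields a factor below 1.\<close>

lemma hole_filling:
 assumes h: "C1_map h H" and ac: "almost_critical \<delta> H (cube x0 R)" and "\<delta> >= 0" and r: "r > 0"
  and s: "!!i. \<bar>s $ i\<bar> <= d" "3 * r + d <= R"
 shows "integral (cube x0 r) (%x. (norm (H (x + s) - H x))^2)
  <= \<theta> * integral (cube x0 (3 * r)) (%x. (norm (H (x + s) - H x))^2) + C\<^sub>1 * \<delta>"
proof -
 have d: "d >= 0" using s(1)[of 1] by linarith
 define W where "W x = H (x + s) - H x" for x
 have w: "C1_map (%x. h (x + s) - h x) W"
  using C1_map_diff[OF C1_map_translate[OF h] h] by (simp add: W_def[abs_def])
 have cw: "continuous_on UNIV (%x. h (x + s) - h x)" and cW: "continuous_on UNIV W"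
  using C1_map_continuous[OF w] C1_map_continuous_deriv[OF w] by auto
 obtain k g where k: "!!x. (k has_derivative (%h. g x \<bullet> h)) (at x)" "continuous_on UNIV g"
  "!!x. 0 <= k x & k x <= 1" "!!x. x : cube x0 r ==> k x = 1" "!!x. x : cube x0 r ==> g x = 0"
  "!!x. x ~: cube x0 (3 * r) ==> k x = 0" "!!x. norm (g x) <= 4 / r"
  by (rule cutoff_exists[OF r, of x0]) blast
 have ck: "continuous_on UNIV k"
  using k(1) by (meson continuous_at_imp_continuous_on has_derivative_continuous)
 obtain c where c: "!!f. continuous_on UNIV f ==> (!!x. 0 <= f x & f x <= (norm (h (x + s) - h x - c))^2) ==>
   (!!x. x : cube x0 r ==> f x = 0) ==>
   integral (cube x0 (3 * r)) f <= 180000 * r^2 *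
    (integral (cube x0 (3 * r)) (%x. (norm (W x))^2) - integral (cube x0 r) (%x. (norm (W x))^2))"
  by (rule Poincare_annulus[OF w r, of x0]) blast
 let ?I1 = "integral (cube x0 r) (%x. (norm (W x))^2)" and ?I3 = "integral (cube x0 (3 * r)) (%x. (norm (W x))^2)"
 let ?v = "%x. (norm (h (x + s) - h x - c))^2"
 have sub: "cube x0 (3 * r) <= cube x0 R" using s(2) d by (intro cube_mono) linarith
 have shift: "x + s : cube x0 R" if "x : cube x0 (3 * r)" for x
  unfolding mem_cube
 proof
  fix i
  have "\<bar>x $ i - x0 $ i\<bar> <= 3 * r" using that by (simp add: mem_cube)
  then show "\<bar>(x + s) $ i - x0 $ i\<bar> <= R" using s(1)[of i] s(2) unfolding vector_add_component by linarith
 qed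
 have X: "integral (cube x0 (3 * r)) (%x. (norm (g x))^2 * ?v x) <= 2880000 * (?I3 - ?I1)"
 proof -
  \<comment> \<open>Multiplication by \<open>r^2 / 16\<close> brings the squared cutoff gradient
    below 1, so that the integrand is a minorant as \<open>Poincare_annulus\<close> demands.\<close>
  have "integral (cube x0 (3 * r)) (%x. r^2 / 16 * ((norm (g x))^2 * ?v x)) <= 180000 * r^2 * (?I3 - ?I1)"
  proof (rule c)
   show "continuous_on UNIV (%x. r^2 / 16 * ((norm (g x))^2 * ?v x))" by (intro continuous_intros k cw)
   show "0 <= r^2 / 16 * ((norm (g x))^2 * ?v x) & r^2 / 16 * ((norm (g x))^2 * ?v x) <= ?v x" for x
   proof -
    have "(norm (g x))^2 <= (4 / r)^2" by (intro power_mono k) auto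
    then have "r^2 / 16 * (norm (g x))^2 <= r^2 / 16 * (4 / r)^2" by (intro mult_left_mono) auto
    also have "... = 1" using r by (simp add: power_divide)
    finally have "r^2 / 16 * (norm (g x))^2 * ?v x <= 1 * ?v x" by (intro mult_right_mono) auto
    then show ?thesis by (simp add: mult.assoc)
   qed
   show "x : cube x0 r ==> r^2 / 16 * ((norm (g x))^2 * ?v x) = 0" for x using k(5) by simp
  qed
  then have "r^2 / 16 * integral (cube x0 (3 * r)) (%x. (norm (g x))^2 * ?v x) <= r^2 / 16 * (2880000 * (?I3 - ?I1))"
   unfolding integral_mult_right by (simp only: mult_ac times_divide_eq_left times_divide_eq_right)
  moreover have "0 < r^2 / 16" using r by simp
  ultimately show ?thesis using mult_le_cancel_left_pos by blast
 qed
 have "?I1 <= integral (cube x0 (3 * r)) (%x. (k x)^2 * (norm (W x))^2)"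
 proof -
  have "?I1 = integral (cube x0 r) (%x. (k x)^2 * (norm (W x))^2)" by (intro integral_cong) (simp add: k(4))
  also have "... <= integral (cube x0 (3 * r)) (%x. (k x)^2 * (norm (W x))^2)"
   using r by (intro integral_subset_le cube_mono integrable_on_cube continuous_intros ck cW) auto
  finally show ?thesis .
 qed
 also have "... <= C\<^sub>1 * (\<delta> + integral (cube x0 (3 * r)) (%x. (norm (g x))^2 * ?v x))"
  unfolding W_def by (rule Caccioppoli[OF h ac \<open>\<delta> >= 0\<close> sub shift k(1,2,3,6)])
 also have "... <= C\<^sub>1 * (\<delta> + 2880000 * (?I3 - ?I1))"
  using C\<^sub>1_pos X by (intro mult_left_mono) auto
 finally have "?I1 * (1 + C\<^sub>1 * 2880000) <= C\<^sub>1 * 2880000 * ?I3 + C\<^sub>1 * \<delta>" by (simp add: algebra_simps)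
 then have "?I1 <= (C\<^sub>1 * 2880000 * ?I3 + C\<^sub>1 * \<delta>) / (1 + C\<^sub>1 * 2880000)"
  using C\<^sub>1_pos by (subst pos_le_divide_eq) auto
 also have "... = \<theta> * ?I3 + C\<^sub>1 * \<delta> / (1 + C\<^sub>1 * 2880000)" by (simp add: \<theta>_def add_divide_distrib)
 also have "C\<^sub>1 * \<delta> / (1 + C\<^sub>1 * 2880000) <= C\<^sub>1 * \<delta> / 1"
  using C\<^sub>1_pos \<open>\<delta> >= 0\<close> by (intro divide_left_mono) auto
 finally show ?thesis by (simp add: W_def)
qed

text \<open>The iteration starts from the oscillation of \<open>H\<close> about a constant matrix
  \<open>P\<close>: the choice \<open>c = P *v s\<close> in \<open>Caccioppoli\<close> subtracts a
  linear map, and the remaining increments are bounded by \<open>norm s\<close> times the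
  derivative. The radius \<open>R / 6\<close> leaves room for the threefold cutoff cube and a shift
  of size \<open>R / 2\<close>; 576 is the square of \<open>4 * 6\<close>.\<close>

lemma increment_start:
 assumes h: "C1_map h H" and ac: "almost_critical \<delta> H (cube x0 R)" and "\<delta> >= 0" and R: "R > 0"
  and s: "!!i. \<bar>s $ i\<bar> <= R / 2"
 shows "integral (cube x0 (R / 6)) (%x. (norm (H (x + s) - H x))^2)
  <= C\<^sub>1 * (\<delta> + 576 / R^2 * ((norm s)^2 * integral (cube x0 R) (%x. (norm (H x - P))^2)))"
proof -
 have r: "R / 6 > 0" using R by simp
 have r3: "3 * (R / 6) = R / 2" by simp
 obtain k g where k: "!!x. (k has_derivative (%h. g x \<bullet> h)) (at x)" "continuous_on UNIV g"
  "!!x. 0 <= k x & k x <= 1" "!!x. x : cube x0 (R/6) ==> k x = 1" "!!x. x : cube x0 (R/6) ==> g x = 0"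
  "!!x. x ~: cube x0 (R/2) ==> k x = 0" "!!x. norm (g x) <= 4 / (R/6)"
  by (rule cutoff_exists[OF r, of x0, unfolded r3]) blast
 have ck: "continuous_on UNIV k"
  using k(1) by (meson continuous_at_imp_continuous_on has_derivative_continuous)
 have f: "C1_map (%x. h x - P *v x) (%x. H x - P)" by (intro C1_map_diff h C1_map_linear)
 define w where "w x = h (x + s) - h x - P *v s" for x
 have eq: "w x = (h (x + s) - P *v (x + s)) - (h x - P *v x)" for x
  by (simp add: w_def matrix_vector_right_distrib)
 have "C1_map w (%x. H (x + s) - H x - 0)"
  unfolding w_def[abs_def] by (rule C1_map_diff[OF C1_map_diff[OF C1_map_translate[OF h] h] C1_map_const])
 note cw = C1_map_continuous[OF this] and cW = C1_map_continuous_deriv[OF this, unfolded diff_zero]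
 have sub: "cube x0 (R/2) <= cube x0 R" using R by (intro cube_mono) simp
 have shift: "x + s : cube x0 R" if "x : cube x0 (R/2)" for x
  unfolding mem_cube
 proof
  fix i
  have "\<bar>x $ i - x0 $ i\<bar> <= R / 2" using that by (simp add: mem_cube)
  then show "\<bar>(x + s) $ i - x0 $ i\<bar> <= R" using s[of i] unfolding vector_add_component by linarith
 qed
 have "integral (cube x0 (R/6)) (%x. (norm (H (x + s) - H x))^2) = integral (cube x0 (R/6)) (%x. (k x)^2 * (norm (H (x + s) - H x))^2)"
  by (intro integral_cong) (simp add: k(4))
 also have "... <= integral (cube x0 (R/2)) (%x. (k x)^2 * (norm (H (x + s) - H x))^2)"
  using R by (intro integral_subset_le cube_mono integrable_on_cube continuous_intros ck continuous_on_norm[OF cW]) auto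
 also have "... <= C\<^sub>1 * (\<delta> + integral (cube x0 (R/2)) (%x. (norm (g x))^2 * (norm (w x))^2))"
  unfolding w_def by (rule Caccioppoli[OF h ac \<open>\<delta> >= 0\<close> sub shift k(1,2,3,6)])
 also have "... <= C\<^sub>1 * (\<delta> + 576 / R^2 * ((norm s)^2 * integral (cube x0 R) (%x. (norm (H x - P))^2)))"
 proof (intro mult_left_mono add_left_mono)
  have "integral (cube x0 (R/2)) (%x. (norm (g x))^2 * (norm (w x))^2) <= integral (cube x0 (R/2)) (%x. 576 / R^2 * (norm (w x))^2)"
  proof (rule integral_le)
   show "(norm (g x))^2 * (norm (w x))^2 <= 576 / R^2 * (norm (w x))^2" for x
   proof (rule mult_right_mono)
    have "(norm (g x))^2 <= (4 / (R / 6))^2" by (intro power_mono k) auto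
    then show "(norm (g x))^2 <= 576 / R^2" by (simp add: power_divide power_mult_distrib)
   qed simp
  qed (intro integrable_on_cube continuous_intros k cw)+
  also have "... = 576 / R^2 * integral (cube x0 (R/2)) (%x. (norm (w x))^2)" by simp
  also have "... <= 576 / R^2 * ((norm s)^2 * integral (cube x0 R) (%x. (norm (H x - P))^2))"
   unfolding eq using difference_quotient_le[OF f, of s "R/2" x0 "R/2"] s by (intro mult_left_mono) auto
  finally show "integral (cube x0 (R/2)) (%x. (norm (g x))^2 * (norm (w x))^2)
   <= 576 / R^2 * ((norm s)^2 * integral (cube x0 R) (%x. (norm (H x - P))^2))" .
 qed (use C\<^sub>1_pos in simp)
 finally show ?thesis .
qed

text \<open>\<open>C\<^sub>1 * \<delta> / (1 - \<theta>)\<close> is the fixed point of the affine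
  recursion in \<open>hole_filling\<close>, so the defects of all scales together never exceed
  it.\<close>

lemma increment_decay:
 assumes h: "C1_map h H" and ac: "almost_critical \<delta> H (cube x0 R)" and \<delta>: "\<delta> >= 0" and R: "R > 0"
  and s: "!!i. \<bar>s $ i\<bar> <= R / 2"
 shows "integral (cube x0 (R / (6 * 3 ^ k))) (%x. (norm (H (x + s) - H x))^2)
  <= \<theta> ^ k * integral (cube x0 (R / 6)) (%x. (norm (H (x + s) - H x))^2) + C\<^sub>1 * \<delta> / (1 - \<theta>)"
proof (induction k)
 case 0
 have "0 <= C\<^sub>1 * \<delta> / (1 - \<theta>)" using C\<^sub>1_pos \<delta> \<theta>_bounds by (intro divide_nonneg_nonneg) auto
 then show ?case by simp
next
 case (Suc k)
 let ?I = "%r. integral (cube x0 r) (%x. (norm (H (x + s) - H x))^2)"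
 let ?r = "R / (6 * 3 ^ Suc k)"
 have r: "?r > 0" using R by simp
 have r3: "3 * ?r = R / (6 * 3 ^ k)" by simp
 have "R / (6 * 3 ^ k) <= R / 6" using R by (intro divide_left_mono) auto
 then have small: "3 * ?r + R / 2 <= R" using R unfolding r3 by linarith
 have "?I ?r <= \<theta> * ?I (R / (6 * 3 ^ k)) + C\<^sub>1 * \<delta>"
  using hole_filling[OF h ac \<delta> r s small] unfolding r3 .
 also have "... <= \<theta> * (\<theta> ^ k * ?I (R / 6) + C\<^sub>1 * \<delta> / (1 - \<theta>)) + C\<^sub>1 * \<delta>"
  using \<theta>_bounds by (intro add_right_mono mult_left_mono Suc.IH) auto
 also have "... = \<theta> ^ Suc k * ?I (R / 6) + C\<^sub>1 * \<delta> / (1 - \<theta>)"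
  using \<theta>_bounds by (simp add: field_simps)
 finally show ?case .
qed

text \<open>The mean square oscillation is bounded by averaging the increments over all shifts.\<close>

lemma excess_decay:
 assumes h: "C1_map h H" and ac: "almost_critical \<delta> H (cube x0 R)" and \<delta>: "\<delta> >= 0" and R: "R > 0"
 obtains m where "integral (cube x0 (R / (6 * 3 ^ k))) (%x. (norm (H x - m))^2)
  <= 576 * C\<^sub>1 * \<theta> ^ k * (1 / (3 ^ k)^2) * integral (cube x0 R) (%x. (norm (H x - P))^2)
   + 4 * (C\<^sub>1 + C\<^sub>1 / (1 - \<theta>)) * \<delta>"
proof -
 define r where "r = R / (6 * 3 ^ k)"
 have r: "r > 0" using R by (simp add: r_def)
 have "R / (6 * 3 ^ k) <= R / (6 * 1)" using R by (intro divide_left_mono mult_left_mono) auto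
 then have r2: "2 * r <= R / 2" using R unfolding r_def by linarith
 let ?\<Phi> = "integral (cube x0 R) (%x. (norm (H x - P))^2)"
 have cH: "continuous_on UNIV H" using C1_map_continuous_deriv[OF h] .
 have cN: "continuous_on S (%p. H (q p))" if "continuous_on S q" for q and S :: "'z::topological_space set"
  by (rule continuous_on_compose2[OF cH that]) auto
 have \<Phi>0: "?\<Phi> >= 0" by (intro integral_nonneg integrable_on_cube continuous_intros cH) auto
 \<comment> \<open>A bound uniform over the shifts in the cube of half side \<open>2 * r\<close>,
   which contains every difference of two points of the small cube.\<close>
 define B where "B = \<theta> ^ k * (C\<^sub>1 * (\<delta> + 576 / R^2 * (9 * r^2 * ?\<Phi>))) + C\<^sub>1 * \<delta> / (1 - \<theta>)"
 have sB: "integral (cube x0 r) (%x. (norm (H (x + s) - H x))^2) <= B" if "s : cube 0 (2 * r)" for s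
 proof -
  have s: "\<bar>s $ i\<bar> <= 2 * r" for i using that by (simp add: mem_cube)
  have s2: "\<bar>s $ i\<bar> <= R / 2" for i using s[of i] r2 by linarith
  have "norm s <= 3 * r" using norm_le_sup_2[OF s s] by simp
  then have "(norm s)^2 <= 9 * r^2" using power_mono[of "norm s" "3 * r" 2] by (simp add: power_mult_distrib)
  then have "C\<^sub>1 * (\<delta> + 576 / R^2 * ((norm s)^2 * ?\<Phi>)) <= C\<^sub>1 * (\<delta> + 576 / R^2 * (9 * r^2 * ?\<Phi>))"
   using C\<^sub>1_pos \<Phi>0 by (intro mult_left_mono add_left_mono mult_right_mono) auto
  then have "integral (cube x0 (R / 6)) (%x. (norm (H (x + s) - H x))^2) <= C\<^sub>1 * (\<delta> + 576 / R^2 * (9 * r^2 * ?\<Phi>))"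
   using increment_start[OF h ac \<delta> R s2, of P] by linarith
  then have "\<theta> ^ k * integral (cube x0 (R / 6)) (%x. (norm (H (x + s) - H x))^2) <= \<theta> ^ k * (C\<^sub>1 * (\<delta> + 576 / R^2 * (9 * r^2 * ?\<Phi>)))"
   using \<theta>_bounds by (intro mult_left_mono) auto
  then show ?thesis using increment_decay[OF h ac \<delta> R s2, of k] unfolding r_def[symmetric] B_def by linarith
 qed
 let ?f = "%y. integral (cube x0 r) (%x. (norm (H x - H y))^2)"
 have cf: "continuous_on UNIV ?f"
  unfolding cube_def by (rule integral_continuous_on_param) (auto simp: split_beta intro!: cN continuous_intros)
 have "integral (cube x0 r) ?f <= integral (cube x0 r) (%y. integral (cube 0 (2 * r)) (%s. (norm (H (y + s) - H y))^2))"
 proof (rule integral_le)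
  show "?f integrable_on cube x0 r" by (rule integrable_on_cube[OF cf])
  show "(%y. integral (cube 0 (2 * r)) (%s. (norm (H (y + s) - H y))^2)) integrable_on cube x0 r"
   unfolding cube_def by (intro integrable_continuous integral_continuous_on_param)
    (auto simp: split_beta intro!: cN continuous_intros)
  fix y assume y: "y : cube x0 r"
  have "?f y = integral (cube (x0 - y + y) r) (%x. (norm (H x - H y))^2)" by simp
  also have "... = integral (cube (x0 - y) r) (%s. (norm (H (s + y) - H y))^2)"
   by (rule integral_cube_translate) (intro cN continuous_intros)
  also have "... <= integral (cube 0 (2 * r)) (%s. (norm (H (s + y) - H y))^2)"
  proof (rule integral_subset_le)
   show "cube (x0 - y) r <= cube 0 (2 * r)"
   proof
    fix z assume "z : cube (x0 - y) r"
    then have z: "\<bar>z $ i - (x0 $ i - y $ i)\<bar> <= r" for i by (simp add: mem_cube)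
    have y': "\<bar>y $ i - x0 $ i\<bar> <= r" for i using y by (simp add: mem_cube)
    have "\<bar>z $ i\<bar> <= 2 * r" for i using z[of i] y'[of i] by linarith
    then show "z : cube 0 (2 * r)" by (simp add: mem_cube)
   qed
  qed (auto intro!: integrable_on_cube cN continuous_intros)
  finally show "?f y <= integral (cube 0 (2 * r)) (%s. (norm (H (y + s) - H y))^2)"
   by (simp add: add.commute)
 qed
 also have "... = integral (cube 0 (2 * r)) (%s. integral (cube x0 r) (%y. (norm (H (y + s) - H y))^2))"
  unfolding cube_def by (rule integral_swap_continuous) (auto simp: split_beta intro!: cN continuous_intros)
 also have "... <= integral (cube 0 (2 * r)) (%s. B)"
 proof (rule integral_le)
  show "(%s. integral (cube x0 r) (%y. (norm (H (y + s) - H y))^2)) integrable_on cube 0 (2 * r)"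
   unfolding cube_def by (intro integrable_continuous integral_continuous_on_param)
    (auto simp: split_beta intro!: cN continuous_intros)
 qed (auto intro!: integrable_on_cube sB)
 also have "... = 4 * (2 * r)^2 * B" using measure_cube[of "2 * r" 0] r by (simp add: cube_def)
 also have "... = 4 * r^2 * (4 * B)" by (simp add: power_mult_distrib)
 finally have "integral (cube x0 r) ?f <= 4 * r^2 * (4 * B)" .
 then obtain y where y: "?f y <= 4 * B" using integral_value_le[OF cf r] by metis
 \<comment> \<open>The factor \<open>1 / (3 ^ k)^2\<close> stems from \<open>norm s\<close> being of
   order \<open>r\<close> and is the ratio of areas up to the constant; \<open>\<theta> ^ k\<close>
   is the genuine gain. The number is \<open>4 * 576 * 9 / 36\<close>.\<close>
 have "4 * B <= 576 * C\<^sub>1 * \<theta> ^ k * (1 / (3 ^ k)^2) * ?\<Phi> + 4 * (C\<^sub>1 + C\<^sub>1 / (1 - \<theta>)) * \<delta>"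
 proof -
  have "r^2 / R^2 = 1 / (36 * (3 ^ k)^2)" using R by (simp add: r_def power_divide power_mult_distrib)
  moreover have "576 / R^2 * (9 * r^2 * ?\<Phi>) = 5184 * (r^2 / R^2) * ?\<Phi>" by simp
  ultimately have "576 / R^2 * (9 * r^2 * ?\<Phi>) = 144 * (1 / (3 ^ k)^2) * ?\<Phi>" by simp
  then have "4 * B = 576 * C\<^sub>1 * \<theta> ^ k * (1 / (3 ^ k)^2) * ?\<Phi> + 4 * (\<theta> ^ k * C\<^sub>1 + C\<^sub>1 / (1 - \<theta>)) * \<delta>"
   unfolding B_def by (simp add: algebra_simps)
  moreover have "4 * (\<theta> ^ k * C\<^sub>1 + C\<^sub>1 / (1 - \<theta>)) * \<delta> <= 4 * (C\<^sub>1 + C\<^sub>1 / (1 - \<theta>)) * \<delta>"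
   using C\<^sub>1_pos \<delta> \<theta>_bounds by (intro mult_right_mono mult_left_mono add_right_mono) (auto simp: power_le_one)
  ultimately show ?thesis by linarith
 qed
 then show ?thesis using y unfolding r_def by (intro that[of "H y"]) linarith
qed

end

section \<open>Lebesgue points\<close>

text \<open>\<open>integrable_ccontinuous_explicit\<close> differentiates integrals over boxes that
  have the point as lower corner. The four sign changes move such a box into each quadrant, so that
  together they cover the centred cube.\<close>

definition reflect :: "bool \<times> bool => real^2 => real^2"
 where "reflect p x = (\<chi> k. (if (if k = 1 then fst p else snd p) then 1 else - 1) * x $ k)"

lemma reflect_reflect [simp]: "reflect p (reflect p x) = x"
 by (simp add: reflect_def vec_eq_iff)

lemma reflect_linear: "linear (reflect p)"
 by (auto simp: reflect_def vec_eq_iff linear_iff algebra_simps)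

lemma reflect_cube: "reflect p ` cube 0 r = cube 0 r"
proof -
 have "reflect p x : cube 0 r \<longleftrightarrow> x : cube 0 r" for x
  by (auto simp: reflect_def mem_cube abs_mult split: if_splits)
 then show ?thesis by (metis (no_types, lifting) image_eqI reflect_reflect subsetI subset_antisym image_subsetI)
qed

lemma has_integral_reflect:
 fixes g :: "real^2 => real"
 assumes "(g has_integral J) (cbox a b)"
 shows "((%x. g (reflect p x)) has_integral J) (reflect p ` cbox a b)"
proof -
 define m where "m k = (if (if k = 1 then fst p else snd p) then 1 else - 1 :: real)" for k :: 2
 have r: "reflect p = (%x. \<chi> k. m k * x $ k)" by (simp add: reflect_def m_def fun_eq_iff)
 have "\<bar>prod m UNIV\<bar> = 1" by (simp add: UNIV_2 abs_mult m_def)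
 moreover have "((%x. g (\<chi> k. m k * x $ k)) has_integral J /\<^sub>R \<bar>prod m UNIV\<bar>) ((%x. \<chi> k. x $ k / m k) ` cbox a b)"
  by (rule has_integral_stretch_cart[OF assms]) (simp add: m_def)
 ultimately have h: "((%x. g (reflect p x)) has_integral J) ((%x. \<chi> k. x $ k / m k) ` cbox a b)"
  by (simp add: fun_cong[OF r, symmetric])
 have im: "(%x. \<chi> k. x $ k / m k) = reflect p"
  by (auto simp: r m_def fun_eq_iff vec_eq_iff)
 show ?thesis using h unfolding im .
qed

lemma cube_0_exhausts:
 obtains r where "cbox a b <= cube 0 r"
proof -
 obtain r where "!!x. x : cbox a b ==> norm x <= r"
  using bounded_cbox[of a b] by (auto simp: bounded_iff)
 then have "cbox a b <= cube 0 r" using cball_subset_cube[of 0 r] by auto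
 then show ?thesis using that by blast
qed

text \<open>The centred cube is covered by four corner boxes of area \<open>h^2\<close>. Since
  \<open>g\<close> is nonnegative, overlaps do no harm to an upper bound.\<close>

lemma Lebesgue_upper_average:
 fixes g :: "real^2 => real"
 assumes g: "!!a b. g integrable_on cbox a b" and nonneg: "!!x. 0 <= g x"
 obtains N where "negligible N"
  "!!x e. x ~: N ==> 0 < e ==> \<exists>d>0. \<forall>h. 0 < h & h < d --> integral (cube x h) g <= 4 * h^2 * (g x + e)"
proof -
 have One: "(\<Sum>Basis :: real^2) $ k = 1" for k
  using inner_sum_left_Basis[of "axis k 1 :: real^2"] by (simp add: cart_eq_inner_axis)
 have "\<exists>N. negligible N & (\<forall>x e. x ~: N --> 0 < e --> (\<exists>d>0. \<forall>h. 0 < h & h < d -->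
   norm (integral (cbox x (x + h *\<^sub>R \<Sum>Basis)) (%y. g (reflect p y)) /\<^sub>R h ^ DIM(real^2) - g (reflect p x)) < e))" for p
 proof -
  have "(%y. g (reflect p y)) integrable_on cbox a b" for a b
  proof -
   obtain r where r: "cbox a b <= cube 0 r" using cube_0_exhausts by blast
   have "(g has_integral integral (cube 0 r) g) (cube 0 r)"
    unfolding cube_def by (intro integrable_integral g)
   then have "((%y. g (reflect p y)) has_integral integral (cube 0 r) g) (reflect p ` cube 0 r)"
    unfolding cube_def by (rule has_integral_reflect)
   then have "(%y. g (reflect p y)) integrable_on cube 0 r" unfolding reflect_cube by blast
   then show ?thesis using r unfolding cube_def by (rule integrable_on_subcbox)
  qed
  from integrable_ccontinuous_explicit[OF this] show ?thesis by metis
 qed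
 then obtain N where N: "!!p. negligible (N p)"
  "!!p x e. x ~: N p ==> 0 < e ==> \<exists>d>0. \<forall>h. 0 < h & h < d -->
   norm (integral (cbox x (x + h *\<^sub>R \<Sum>Basis)) (%y. g (reflect p y)) /\<^sub>R h ^ DIM(real^2) - g (reflect p x)) < e"
  by metis
 show thesis
 proof (rule that[of "\<Union>p. reflect p ` N p"])
  show "negligible (\<Union>p. reflect p ` N p)"
  proof (rule negligible_countable_Union)
   fix T assume "T : range (%p. reflect p ` N p)"
   then obtain p where T: "T = reflect p ` N p" by blast
   show "negligible T" unfolding T
    using N(1) linear_imp_differentiable_on[OF reflect_linear]
    by (intro negligible_differentiable_image_negligible) auto
  qed simp
  fix x and e :: real assume x: "x ~: (\<Union>p. reflect p ` N p)" and e: "0 < e"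
  have "reflect p x ~: N p" for p
  proof
   assume "reflect p x : N p"
   then have "reflect p (reflect p x) : reflect p ` N p" by (rule imageI)
   then have "x : reflect p ` N p" by (simp only: reflect_reflect)
   then show False using x by blast
  qed
  then have "\<forall>p. \<exists>d>0. \<forall>h. 0 < h & h < d -->
    norm (integral (cbox (reflect p x) (reflect p x + h *\<^sub>R \<Sum>Basis)) (%y. g (reflect p y)) /\<^sub>R h ^ DIM(real^2) - g (reflect p (reflect p x))) < e"
   using N(2) e by blast
  then obtain d where d: "!!p. d p > 0"
   "!!p h. 0 < h ==> h < d p ==> norm (integral (cbox (reflect p x) (reflect p x + h *\<^sub>R \<Sum>Basis)) (%y. g (reflect p y)) /\<^sub>R h ^ DIM(real^2) - g x) < e"
   unfolding reflect_reflect by metis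
  define d0 where "d0 = Min (range d)"
  have d0: "d0 > 0" "!!p. d0 <= d p" using d(1) by (auto simp: d0_def)
  have "integral (cube x h) g <= 4 * h^2 * (g x + e)" if h: "0 < h" "h < d0" for h
  proof -
   define J where "J p = integral (cbox (reflect p x) (reflect p x + h *\<^sub>R \<Sum>Basis)) (%y. g (reflect p y))" for p
   define B where "B p = reflect p ` cbox (reflect p x) (reflect p x + h *\<^sub>R \<Sum>Basis)" for p
   have J: "J p <= h^2 * (g x + e)" for p
   proof -
    have "norm (J p /\<^sub>R h ^ 2 - g x) < e" using d(2)[of h p] h d0(2)[of p] by (simp add: J_def)
    then have "J p / h^2 <= g x + e" by (simp add: divide_inverse mult.commute abs_less_iff)
    then show ?thesis using h by (simp add: field_simps)
   qed
   have gi: "(g has_integral J p) (B p)" for p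
   proof -
    obtain r where r: "cbox (reflect p x) (reflect p x + h *\<^sub>R \<Sum>Basis) <= cube 0 r" using cube_0_exhausts by blast
    have "(g has_integral integral (cube 0 r) g) (cube 0 r)"
     unfolding cube_def by (intro integrable_integral g)
    then have "((%y. g (reflect p y)) has_integral integral (cube 0 r) g) (reflect p ` cube 0 r)"
     unfolding cube_def by (rule has_integral_reflect)
    then have "(%y. g (reflect p y)) integrable_on cube 0 r" unfolding reflect_cube by blast
    then have "(%y. g (reflect p y)) integrable_on cbox (reflect p x) (reflect p x + h *\<^sub>R \<Sum>Basis)"
     using r unfolding cube_def by (rule integrable_on_subcbox)
    then have "((%y. g (reflect p y)) has_integral J p) (cbox (reflect p x) (reflect p x + h *\<^sub>R \<Sum>Basis))"
     unfolding J_def by (rule integrable_integral)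
    from has_integral_reflect[OF this, of p] show ?thesis by (simp add: B_def)
   qed
   have cover: "\<exists>p. y : B p" if y: "y : cube x h" for y
   proof -
    let ?p = "(x $ 1 <= y $ 1, x $ 2 <= y $ 2)"
    have "reflect ?p y : cbox (reflect ?p x) (reflect ?p x + h *\<^sub>R \<Sum>Basis)"
     using y by (auto simp: mem_box_cart forall_2 reflect_def mem_cube_2 One simp del: sum_component)
    then have "reflect ?p (reflect ?p y) : B ?p" unfolding B_def by (rule imageI)
    then show ?thesis by auto
   qed
   have "((%y. if y : cube x h then g y else 0) has_integral integral (cube x h) g) UNIV"
    unfolding has_integral_restrict_UNIV cube_def by (intro integrable_integral g)
   moreover have "((%y. \<Sum>p\<in>UNIV. if y : B p then g y else 0) has_integral (\<Sum>p\<in>UNIV. J p)) UNIV"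
    using gi by (intro has_integral_sum) (simp_all add: has_integral_restrict_UNIV)
   moreover have "(if y : cube x h then g y else 0) <= (\<Sum>p\<in>UNIV. if y : B p then g y else 0)" for y
   proof (cases "y : cube x h")
    case True
    then obtain p where p: "y : B p" using cover by blast
    have "(if y : B p then g y else 0) <= (\<Sum>p\<in>UNIV. if y : B p then g y else 0)"
     by (rule member_le_sum) (auto simp: nonneg)
    then show ?thesis using True p by simp
   qed (auto intro!: sum_nonneg simp: nonneg)
   ultimately have "integral (cube x h) g <= (\<Sum>p\<in>UNIV. J p)" by (rule has_integral_le)
   also have "... <= (\<Sum>p\<in>(UNIV :: (bool \<times> bool) set). h^2 * (g x + e))" by (intro sum_mono J)
   also have "... = 4 * h^2 * (g x + e)" by (simp add: card_UNIV_bool)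
   finally show ?thesis .
  qed
  then show "\<exists>d>0. \<forall>h. 0 < h & h < d --> integral (cube x h) g <= 4 * h^2 * (g x + e)"
   using d0(1) by blast
 qed
qed

lemma cube_power_integrable:
 fixes D :: "real^2 => 'b::euclidean_space"
 assumes [measurable]: "D : borel_measurable borel" and "integrable lborel (%x. norm (D x) ^ 3)"
 shows "set_integrable lborel (cbox a b) (%x. norm (D x - P) ^ 3)"
  "(%x. norm (D x - P) ^ 3) integrable_on cbox a b"
proof -
 have b: "set_integrable lborel (cbox a b) (%x. 4 * (norm (D x) ^ 3 + norm P ^ 3))"
  unfolding set_integrable_def
 proof (rule LINT_bound)
  show "integrable lborel (%x. 4 * norm (D x) ^ 3 + 4 * norm P ^ 3 * indicator (cbox a b) x)"
   using assms by (intro LINT_add integrable_mult_right integrable_real_indicator)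
    (auto simp: emeasure_lborel_cbox_eq)
 qed (auto simp: indicator_def)
 show s: "set_integrable lborel (cbox a b) (%x. norm (D x - P) ^ 3)"
 proof (rule set_integrable_bound[OF b])
  have "norm (D x - P) ^ 3 <= 4 * (norm (D x) ^ 3 + norm P ^ 3)" for x
   using norm_add_cube[of "D x" "- P"] by simp
  then show "AE x in lborel. x : cbox a b --> norm (norm (D x - P) ^ 3) <= norm (4 * (norm (D x) ^ 3 + norm P ^ 3))"
   by (intro AE_I2) (simp add: order_trans[OF _ abs_ge_self])
 qed (simp add: set_borel_measurable_def)
 show "(%x. norm (D x - P) ^ 3) integrable_on cbox a b"
  by (rule set_borel_integral_eq_integral(1)[OF s])
qed

text \<open>Averages of \<open>norm (D y - c) ^ 3\<close> are controlled off a null set for each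
  fixed \<open>c\<close>; a countable dense set of constants has a common null set, and a constant
  close to \<open>D x\<close> transfers the bound to \<open>D x\<close> itself.\<close>

lemma Lebesgue_points:
 fixes D :: "real^2 => 'b::euclidean_space"
 assumes D: "D : borel_measurable borel" "integrable lborel (%x. norm (D x) ^ 3)"
 obtains N where "negligible N"
  "!!x e. x ~: N ==> 0 < e ==> \<exists>d>0. \<forall>h. 0 < h & h < d --> integral (cube x h) (%y. norm (D y - D x) ^ 3) <= e * h^2"
proof -
 obtain C :: "'b set" where C: "countable C" "!!X. open X ==> X ~= {} ==> \<exists>c\<in>C. c : X"
  using countable_dense_exists by blast
 have i: "(%x. norm (D x - P) ^ 3) integrable_on cbox a b" for a b P
  by (rule cube_power_integrable[OF D])
 have "\<exists>N. negligible N & (\<forall>x e. x ~: N --> 0 < e --> (\<exists>d>0. \<forall>h. 0 < h & h < d -->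
   integral (cube x h) (%y. norm (D y - c) ^ 3) <= 4 * h^2 * (norm (D x - c) ^ 3 + e)))" for c
  by (rule Lebesgue_upper_average[OF i]) auto
 then obtain N where N: "!!c. negligible (N c)"
  "!!c x e. x ~: N c ==> 0 < e ==> \<exists>d>0. \<forall>h. 0 < h & h < d -->
   integral (cube x h) (%y. norm (D y - c) ^ 3) <= 4 * h^2 * (norm (D x - c) ^ 3 + e)"
  by metis
 show thesis
 proof (rule that[of "\<Union>c\<in>C. N c"])
  show "negligible (\<Union>c\<in>C. N c)"
   using C(1) N(1) by (intro negligible_countable_Union) auto
  fix x and e :: real assume x: "x ~: (\<Union>c\<in>C. N c)" and e: "0 < e"
  \<comment> \<open>The distance to the constant and the averaging error are both bounded by
    \<open>\<eta> ^ 3\<close>; after \<open>norm_add_cube\<close> and with the area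
    \<open>4 * h^2\<close> these sum up to \<open>48 * h^2 * \<eta> ^ 3\<close>.\<close>
  define \<eta> where "\<eta> = min 1 (e / 48)"
  have \<eta>: "0 < \<eta>" "\<eta> ^ 3 <= e / 48"
  proof -
   show "0 < \<eta>" using e by (simp add: \<eta>_def)
   have "\<eta> ^ 3 <= \<eta> ^ 1" using \<open>0 < \<eta>\<close> by (intro power_decreasing) (auto simp: \<eta>_def)
   then show "\<eta> ^ 3 <= e / 48" by (simp add: \<eta>_def)
  qed
  obtain c where c: "c : C" "norm (D x - c) < \<eta>"
   using C(2)[of "ball (D x) \<eta>"] \<eta>(1) by (auto simp: dist_norm)
  obtain d where d: "d > 0" "!!h. 0 < h ==> h < d ==>
    integral (cube x h) (%y. norm (D y - c) ^ 3) <= 4 * h^2 * (norm (D x - c) ^ 3 + \<eta> ^ 3)"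
   using N(2)[of x c "\<eta> ^ 3"] x c(1) \<eta>(1) by (metis UN_iff zero_less_power)
  have c3: "norm (D x - c) ^ 3 <= \<eta> ^ 3" using c(2) by (intro power_mono) auto
  have "integral (cube x h) (%y. norm (D y - D x) ^ 3) <= e * h^2" if h: "0 < h" "h < d" for h
  proof -
   have "integral (cube x h) (%y. norm (D y - D x) ^ 3) <= integral (cube x h) (%y. 4 * (norm (D y - c) ^ 3 + \<eta> ^ 3))"
   proof (rule integral_le)
    show "(%y. norm (D y - D x) ^ 3) integrable_on cube x h" unfolding cube_def by (rule i)
    show "(%y. 4 * (norm (D y - c) ^ 3 + \<eta> ^ 3)) integrable_on cube x h"
     unfolding cube_def by (intro integrable_on_mult_right integrable_add i) auto
    show "norm (D y - D x) ^ 3 <= 4 * (norm (D y - c) ^ 3 + \<eta> ^ 3)" for y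
     using norm_add_cube[of "D y - c" "c - D x"] c3 by (simp add: norm_minus_commute)
   qed
   also have "... = 4 * (integral (cube x h) (%y. norm (D y - c) ^ 3) + 4 * h^2 * \<eta> ^ 3)"
    using measure_cube[of h x] h unfolding cube_def
    by (subst integral_mult_right, subst integral_add) (auto simp: i integrable_const)
   also have "... <= 4 * (4 * h^2 * (\<eta> ^ 3 + \<eta> ^ 3) + 4 * h^2 * \<eta> ^ 3)"
    using d(2)[OF h] c3 by (intro mult_left_mono add_right_mono order_trans[OF d(2)[OF h]] mult_left_mono) auto
   also have "... = 48 * h^2 * \<eta> ^ 3" by simp
   also have "... <= 48 * h^2 * (e / 48)" by (intro mult_left_mono \<eta>) auto
   finally show ?thesis by (simp add: mult.commute)
  qed
  then show "\<exists>d>0. \<forall>h. 0 < h & h < d --> integral (cube x h) (%y. norm (D y - D x) ^ 3) <= e * h^2"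
   using d(1) by blast
 qed
qed

text \<open>The part of \<open>g\<close> above a high level \<open>k\<close> has small integral, and
  the rest is at most \<open>k\<close> times the measure of the set.\<close>

lemma absolute_continuity_integral:
 fixes g :: "'a::euclidean_space => real"
 assumes g: "integrable lborel g" "!!x. 0 <= g x" and e: "e > 0"
 obtains d where "d > 0" "!!V. V : sets borel ==> emeasure lborel V <= ennreal d ==> (LINT x|lborel. indicator V x * g x) < e"
proof -
 have [measurable]: "g : borel_measurable borel" using g(1) by (auto dest: borel_measurable_integrable)
 have "(%k. LINT x|lborel. g x - min (g x) (real k)) \<longlonglongrightarrow> (LINT (x::'a)|lborel. 0)"
 proof (rule integral_dominated_convergence)
  show "AE x in lborel. (%k. g x - min (g x) (real k)) \<longlonglongrightarrow> 0"
  proof (rule AE_I2)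
   fix x
   obtain k0 where "g x <= real k0" using real_arch_simple by blast
   then have "\<forall>\<^sub>F k in sequentially. g x - min (g x) (real k) = 0"
    unfolding eventually_sequentially by (intro exI[of _ k0]) (auto simp: min_def)
   then show "(%k. g x - min (g x) (real k)) \<longlonglongrightarrow> 0" by (rule tendsto_eventually)
  qed
  show "AE x in lborel. norm (g x - min (g x) (real k)) <= g x" for k
   using g(2) by (intro AE_I2) (auto simp: min_def)
 qed (use g in auto)
 then have "\<forall>\<^sub>F k in sequentially. (LINT x|lborel. g x - min (g x) (real k)) < e / 2"
  using e by (intro order_tendstoD(2)[where y=0]) auto
 then obtain k where k: "(LINT x|lborel. g x - min (g x) (real k)) < e / 2"
  by (auto simp: eventually_sequentially)
 have im: "integrable lborel (%x. min (g x) (real k))"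
  using g by (intro LINT_bound[OF g(1)]) (auto simp: min_def abs_if)
 show thesis
 proof (rule that[of "e / (2 * (real k + 1))"])
  show "e / (2 * (real k + 1)) > 0" using e by simp
  fix V :: "'a set" assume V: "V : sets borel" "emeasure lborel V <= ennreal (e / (2 * (real k + 1)))"
  have fin: "emeasure lborel V < \<infinity>" using V(2) by (simp add: order_le_less_trans[OF _ ennreal_less_top])
  have mV: "measure lborel V <= e / (2 * (real k + 1))"
   using V(2) e by (simp add: measure_def enn2real_leI)
  have i1: "integrable lborel (%x. indicator V x * (g x - min (g x) (real k)))"
   using integrable_mult_indicator[of V lborel "%x. g x - min (g x) (real k)"] V g im by simp
  have i2: "integrable lborel (%x. indicator V x * min (g x) (real k))"
   using integrable_mult_indicator[of V lborel "%x. min (g x) (real k)"] V im by simp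
  have "(LINT x|lborel. indicator V x * g x)
    = (LINT x|lborel. indicator V x * (g x - min (g x) (real k)) + indicator V x * min (g x) (real k))"
   by (simp add: algebra_simps)
  also have "... = (LINT x|lborel. indicator V x * (g x - min (g x) (real k))) + (LINT x|lborel. indicator V x * min (g x) (real k))"
   by (rule Bochner_Integration.integral_add[OF i1 i2])
  also have "(LINT x|lborel. indicator V x * (g x - min (g x) (real k))) <= (LINT x|lborel. g x - min (g x) (real k))"
   using g im by (intro integral_mono i1) (auto simp: indicator_def min_def)
  also have "(LINT x|lborel. indicator V x * min (g x) (real k)) <= (LINT x|lborel. real k * indicator V x)"
   using V fin by (intro integral_mono i2 integrable_mult_right integrable_real_indicator) (auto simp: indicator_def)
  also have "... = real k * measure lborel V" by simp
  also have "... <= (real k + 1) * (e / (2 * (real k + 1)))" using mV by (intro mult_mono) auto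
  also have "... = e / 2" by (simp add: field_simps)
  finally show "(LINT x|lborel. indicator V x * g x) < e" using k by simp
 qed
qed

section \<open>Planar Sobolev maps with cubically integrable gradient\<close>

locale planar_Sobolev = continuous_Sobolev \<Omega> u D
 for \<Omega> :: "(real^2) set" and u :: "real^2 => real^2" and D
begin

lemma D_integrable_on: "(%x. norm (D x - P) ^ 3) integrable_on cbox a b"
 by (rule cube_power_integrable[OF D_borel D_int3])

lemma C1_approx_cbox:
 assumes K: "cbox a b <= \<Omega>" and "d > 0"
 obtains f F where "C1_map f F" "!!x. x : cbox a b ==> norm (f x - u x) <= d"
  "(%x. norm (F x - D x) ^ 3) integrable_on cbox a b"
  "integral (cbox a b) (%x. norm (F x - D x) ^ 3) < d"
proof -
 obtain f F where f: "C1_map f F" "!!x. x : cbox a b ==> norm (f x - u x) <= d"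
  "integrable lborel (%x. indicator (cbox a b) x * norm (F x - D x) ^ 3)"
  "(LINT x|lborel. indicator (cbox a b) x * norm (F x - D x) ^ 3) < d"
  by (rule C1_approx[OF compact_cbox K \<open>d > 0\<close>]) blast
 have s: "set_integrable lborel (cbox a b) (%x. norm (F x - D x) ^ 3)"
  using f(3) by (simp add: set_integrable_def)
 have "integral (cbox a b) (%x. norm (F x - D x) ^ 3) < d"
  using set_borel_integral_eq_integral(2)[OF s] f(4) by (simp add: set_lebesgue_integral_def)
 then show ?thesis using f set_borel_integral_eq_integral(1)[OF s] by (intro that) auto
qed

text \<open>The estimate for C^1 maps is applied to approximations minus the linear map
  \<open>P\<close>: later \<open>P = 0\<close> gives Hoelder continuity and \<open>P = D x\<close>
  differentiability. The factor 16 over 216 comes from two uses of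
  \<open>norm_add_cube\<close>.\<close>

lemma Morrey:
 assumes sub: "cbox a b <= \<Omega>" and x: "x : cbox a b" "z : cbox a b"
  and d: "!!y z. y : cbox a b ==> z : cbox a b ==> norm (y - z) <= d"
 shows "measure lborel (cbox a b) * norm (u x - u z - P *v (x - z)) ^ 3
  <= 3456 * d ^ 3 * integral (cbox a b) (%y. norm (D y - P) ^ 3)"
proof -
 let ?Q = "cbox a b" and ?m = "measure lborel (cbox a b)"
 let ?I = "integral ?Q (%y. norm (D y - P) ^ 3)"
 let ?T = "norm (u x - u z - P *v (x - z))"
 have d0: "d >= 0" using d[OF x(1) x(1)] by simp
 have eps: "?m * ?T ^ 3 <= 3456 * d ^ 3 * ?I + (3456 * d^3 + 32 * ?m) * e" if e: "0 < e" "e <= 1" for e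
 proof -
  obtain f F where f: "C1_map f F" "!!x. x : ?Q ==> norm (f x - u x) <= e"
   "(%x. norm (F x - D x) ^ 3) integrable_on ?Q" "integral ?Q (%x. norm (F x - D x) ^ 3) < e"
   using C1_approx_cbox[OF sub e(1)] by blast
  have g: "C1_map (%x. f x - P *v x) (%x. F x - P)" by (intro C1_map_diff f C1_map_linear)
  let ?S = "norm ((f x - P *v x) - (f z - P *v z))"
  have cF: "continuous_on UNIV F" using C1_map_continuous_deriv[OF f(1)] .
  have "integral ?Q (%y. norm (F y - P) ^ 3) <= integral ?Q (%y. 4 * (norm (F y - D y) ^ 3 + norm (D y - P) ^ 3))"
  proof (rule integral_le)
   show "(%y. norm (F y - P) ^ 3) integrable_on ?Q"
    by (intro integrable_on_cbox_UNIV continuous_intros cF)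
   show "(%y. 4 * (norm (F y - D y) ^ 3 + norm (D y - P) ^ 3)) integrable_on ?Q"
    by (intro integrable_on_mult_right integrable_add f(3) D_integrable_on)
   show "norm (F y - P) ^ 3 <= 4 * (norm (F y - D y) ^ 3 + norm (D y - P) ^ 3)" for y
    using norm_add_cube[of "F y - D y" "D y - P"] by simp
  qed
  also have "... = 4 * (integral ?Q (%y. norm (F y - D y) ^ 3) + ?I)"
   by (simp add: integral_add f(3) D_integrable_on)
  also have "... <= 4 * (e + ?I)" using f(4) by simp
  finally have I: "integral ?Q (%y. norm (F y - P) ^ 3) <= 4 * (e + ?I)" .
  have "?m * ?S ^ 3 <= 216 * d^3 * integral ?Q (%y. norm (F y - P) ^ 3)"
   by (rule Morrey_box[OF g x d])
  also have "... <= 216 * d^3 * (4 * (e + ?I))" using d0 by (intro mult_left_mono I) auto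
  finally have S: "?m * ?S ^ 3 <= 864 * d^3 * (e + ?I)" by (simp add: algebra_simps)
  have "?T <= norm (((f x - P *v x) - (f z - P *v z)) + ((f z - u z) - (f x - u x)))"
   by (simp add: matrix_vector_mult_diff_distrib algebra_simps)
  then have "?T ^ 3 <= norm (((f x - P *v x) - (f z - P *v z)) + ((f z - u z) - (f x - u x))) ^ 3"
   by (intro power_mono) auto
  also have "... <= 4 * (?S ^ 3 + norm ((f z - u z) - (f x - u x)) ^ 3)" by (rule norm_add_cube)
  also have "... <= 4 * (?S ^ 3 + 8 * e)"
  proof -
   have "norm ((f z - u z) - (f x - u x)) <= 2 * e"
    using norm_triangle_ineq4[of "f z - u z" "f x - u x"] f(2)[OF x(1)] f(2)[OF x(2)] by linarith
   then have "norm ((f z - u z) - (f x - u x)) ^ 3 <= (2 * e) ^ 3" by (intro power_mono) auto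
   also have "... <= 8 * e"
   proof -
    have "e ^ 3 <= e ^ 1" using e by (intro power_decreasing) auto
    then show ?thesis by (simp add: power_mult_distrib)
   qed
   finally show ?thesis by simp
  qed
  finally have "?m * ?T ^ 3 <= ?m * (4 * (?S ^ 3 + 8 * e))" by (intro mult_left_mono) auto
  also have "... = 4 * (?m * ?S ^ 3) + 32 * ?m * e" by (simp add: algebra_simps)
  also have "... <= 4 * (864 * d^3 * (e + ?I)) + 32 * ?m * e" using S by simp
  also have "... = 3456 * d ^ 3 * ?I + (3456 * d^3 + 32 * ?m) * e" by (simp add: algebra_simps)
  finally show ?thesis .
 qed
 define c where "c = 3456 * d^3 + 32 * ?m"
 have c: "c >= 0" using d0 by (simp add: c_def)
 show ?thesis
 proof (rule field_le_epsilon)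
  fix t :: real assume t: "0 < t"
  define e where "e = min 1 (t / (c + 1))"
  have e: "0 < e" "e <= 1" using t c by (auto simp: e_def)
  have "c * e <= (c + 1) * e" using e(1) by (simp add: algebra_simps)
  also have "... <= (c + 1) * (t / (c + 1))" using c by (intro mult_left_mono) (auto simp: e_def)
  also have "... = t" using c by simp
  finally show "?m * ?T ^ 3 <= 3456 * d ^ 3 * ?I + t"
   using eps[OF e] unfolding c_def[symmetric] by linarith
 qed
qed

text \<open>The diameter is at most \<open>3 * r\<close> and the area \<open>4 * r^2\<close>, whence
  the constant \<open>3456 * 27 / 4\<close>.\<close>

lemma Morrey_cube:
 assumes "cube x0 r <= \<Omega>" "x : cube x0 r" "z : cube x0 r" "r > 0"
 shows "norm (u x - u z - P *v (x - z)) ^ 3 <= 23328 * r * integral (cube x0 r) (%y. norm (D y - P) ^ 3)"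
proof -
 have "4 * r^2 * norm (u x - u z - P *v (x - z)) ^ 3 <= 3456 * (3 * r) ^ 3 * integral (cube x0 r) (%y. norm (D y - P) ^ 3)"
  using Morrey[of "x0 - vec r" "x0 + vec r" x z "3 * r" P] assms cube_diameter[of _ x0 r] measure_cube[of r x0]
  by (simp add: cube_def)
 also have "... = 4 * r^2 * (23328 * r * integral (cube x0 r) (%y. norm (D y - P) ^ 3))"
  by (simp add: power_mult_distrib power2_eq_square power3_eq_cube)
 finally show ?thesis using assms(4) by simp
qed

section \<open>Differentiability almost everywhere and the Lusin condition\<close>

lemma differentiable_almost_everywhere:
 obtains N where "negligible N" "!!x. x : \<Omega> ==> x ~: N ==> (u has_derivative (%h. D x *v h)) (at x)"
proof -
 obtain N where N: "negligible N"
  "!!x e. x ~: N ==> 0 < e ==> \<exists>d>0. \<forall>h. 0 < h & h < d --> integral (cube x h) (%y. norm (D y - D x) ^ 3) <= e * h^2"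
  by (rule Lebesgue_points[OF D_borel D_int3]) blast
 \<comment> \<open>At a Lebesgue point of order three, Morrey's inequality with
   \<open>P = D x\<close> on the cube of half side \<open>r = norm (y - x)\<close> has a right-hand
   side of at most \<open>23328 * r * (e ^ 3 / 23328 * r^2)\<close>, the cube of the admissible
   error.\<close>
 have "(u has_derivative (%h. D x *v h)) (at x)" if x: "x : \<Omega>" "x ~: N" for x
  unfolding has_derivative_at_alt
 proof (rule conjI[OF matrix_vector_mul_bounded_linear], intro allI impI)
  fix e :: real assume e: "e > 0"
  obtain d1 where d1: "d1 > 0" "ball x d1 <= \<Omega>" using open_\<Omega> x(1) open_contains_ball by blast
  obtain d2 where d2: "d2 > 0" "!!h. 0 < h ==> h < d2 ==> integral (cube x h) (%y. norm (D y - D x) ^ 3) <= e ^ 3 / 23328 * h^2"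
   using N(2)[OF x(2), of "e ^ 3 / 23328"] e by auto
  have "norm (u y - u x - D x *v (y - x)) <= e * norm (y - x)" if y: "norm (y - x) < min (d1 / 2) d2" for y
  proof (cases "y = x")
   case False
   define r where "r = norm (y - x)"
   have r: "0 < r" "r < d2" "2 * r < d1" using False y by (auto simp: r_def)
   have "cube x r <= ball x d1"
   proof
    fix z assume "z : cube x r"
    then show "z : ball x d1" using cube_radius[of z x r] r by (simp add: dist_norm norm_minus_commute)
   qed
   then have sub: "cube x r <= \<Omega>" using d1(2) by blast
   have yc: "y : cube x r" using cball_subset_cube[of x r] by (auto simp: r_def dist_norm norm_minus_commute subset_iff)
   have "norm (u y - u x - D x *v (y - x)) ^ 3 <= 23328 * r * integral (cube x r) (%y. norm (D y - D x) ^ 3)"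
    using Morrey_cube[OF sub yc centre_in_cube r(1)] r(1) by simp
   also have "... <= 23328 * r * (e ^ 3 / 23328 * r^2)" using r by (intro mult_left_mono d2(2)) auto
   also have "... = (e * r) ^ 3" by (simp add: power_mult_distrib power2_eq_square power3_eq_cube)
   finally show ?thesis unfolding r_def[symmetric] using e r by (subst (asm) power_mono_iff) auto
  qed simp
  then show "\<exists>d>0. \<forall>y. norm (y - x) < d --> norm (u y - u x - D x *v (y - x)) <= e * norm (y - x)"
   using d1(1) d2(1) by (intro exI[of _ "min (d1 / 2) d2"]) auto
 qed
 then show ?thesis using N(1) that by blast
qed


text \<open>The null set is covered by dyadic squares inside an open set \<open>V\<close> of small
  measure. Morrey's inequality puts the image of a square into one of half side \<rho> with
  \<open>\<rho> ^ 3 = 23328 * r * ?I\<close>, where \<open>?I\<close> is the integral of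
  \<open>norm (D x) ^ 3\<close> over the square. The area of the image square is at most a multiple
  of \<open>r^2 + ?I\<close>, and this adds up over nonoverlapping squares to an integral over
  \<open>V\<close>.\<close>

lemma Lusin_cube:
 assumes sub: "cube x0 R <= \<Omega>" and R: "R > 0" and N: "negligible N" "N <= cube x0 R"
 shows "negligible (u ` N)"
 unfolding negligible_outer_le
proof (intro allI impI)
 fix e :: real assume e: "e > 0"
 \<comment> \<open>186624 is twice 93312, the constant of the image squares, because the measure of
   \<open>V\<close> and the integral over \<open>V\<close> both contribute up to
   \<open>?e\<close>.\<close>
 let ?e = "e / 186624"
 let ?G = "%x. 1 + norm (D x) ^ 3"
 obtain d where d: "d > 0" "!!V. V : sets borel ==> emeasure lborel V <= ennreal d ==> (LINT x|lborel. indicator V x * norm (D x) ^ 3) < ?e"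
  by (rule absolute_continuity_integral[OF D_int3, of ?e]) (use e in auto)
 define d' where "d' = min d ?e"
 have d': "0 < d'" "d' <= d" "d' <= ?e" using d(1) e by (auto simp: d'_def)
 have Nm: "N : lmeasurable" "measure lebesgue N = 0" using N(1) by (simp_all add: negligible_iff_measure)
 obtain V where V0: "open V" "N <= V" "V - N : lmeasurable" "emeasure lebesgue (V - N) < ennreal d'"
  by (rule sets_lebesgue_outer_open[OF fmeasurableD[OF Nm(1)] d'(1)]) blast
 have VN: "V = (V - N) \<union> N" using V0(2) by blast
 have "V : lmeasurable" using fmeasurable.Un[OF V0(3) Nm(1)] VN by simp
 moreover have "measure lebesgue V <= measure lebesgue (V - N) + measure lebesgue N"
  using measure_Un_le[OF fmeasurableD[OF V0(3)] fmeasurableD[OF Nm(1)]] VN by simp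
 moreover have "measure lebesgue (V - N) < d'"
  using V0(3,4) d'(1) by (simp add: emeasure_eq_measure2 ennreal_less_iff)
 ultimately have V: "open V" "N <= V" "V : lmeasurable" "measure lebesgue V < d'"
  using V0(1,2) Nm(2) by auto
 have Vb: "V : sets borel" using V(1) by simp
 have emV: "emeasure lborel V = ennreal (measure lborel V)" "measure lborel V = measure lebesgue V" "emeasure lborel V < \<infinity>"
  using V(3) Vb by (auto simp: fmeasurable_def emeasure_eq_ennreal_measure measure_completion)
 have Vd: "(LINT x|lborel. indicator V x * norm (D x) ^ 3) < ?e"
  using V(4) d'(2) emV by (intro d(2) Vb) (auto intro!: ennreal_leI)
 have GV: "set_integrable lborel V ?G"
  unfolding set_integrable_def
 proof -
  have "integrable lborel (%x. indicator V x + indicator V x * norm (D x) ^ 3)"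
   using integrable_mult_indicator[of V lborel "%x. norm (D x) ^ 3"] Vb D_int3 emV(3)
   by (intro LINT_add integrable_real_indicator) auto
  then show "integrable lborel (%x. indicator V x *\<^sub>R ?G x)" by (simp add: distrib_left)
 qed
 have GVint: "integral V ?G <= 2 * ?e"
 proof -
  have "integral V ?G = (LINT x|lborel. indicator V x + indicator V x * norm (D x) ^ 3)"
   using set_borel_integral_eq_integral(2)[OF GV] by (simp add: set_lebesgue_integral_def distrib_left)
  also have "... = measure lborel V + (LINT x|lborel. indicator V x * norm (D x) ^ 3)"
   using integrable_mult_indicator[of V lborel "%x. norm (D x) ^ 3"] Vb D_int3 emV(3)
   by (subst Bochner_Integration.integral_add) auto
  finally show ?thesis using Vd V(4) d'(3) emV(2) by linarith
 qed
 have ne: "box (x0 - vec R) (x0 + vec R) ~= {}" using R by (auto simp: interval_ne_empty_cart)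
 \<comment> \<open>The gauge only forces the covering pieces into \<open>V\<close>; they are squares
   because dyadic subdivision of a square keeps its sides equal.\<close>
 have gauge: "gauge (%x. if x : N then V else UNIV)" using V(1,2) by (auto simp: gauge_def)
 obtain \<D> where \<D>: "countable \<D>" "\<Union>\<D> <= cube x0 R"
  "!!K. K : \<D> ==> interior K ~= {} & (\<exists>c d. K = cbox c d)"
  "pairwise (%A B. interior A \<inter> interior B = {}) \<D>"
  "!!K. K : \<D> ==> \<exists>x\<in>N \<inter> K. K <= (if x : N then V else UNIV)"
  "!!p q. cbox p q : \<D> ==> \<exists>n. \<forall>i\<in>Basis. q \<bullet> i - p \<bullet> i = ((x0 + vec R) \<bullet> i - (x0 - vec R) \<bullet> i) / 2^n"
  "N <= \<Union>\<D>"
  unfolding cube_def by (rule covering_lemma[OF N(2)[unfolded cube_def] ne gauge]) blast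
 have cubes: "\<exists>c r. K = cube c r & 0 < r" if KD: "K : \<D>" for K
 proof -
  obtain p q where K: "K = cbox p q" using \<D>(3)[OF KD] by blast
  obtain n where n: "!!i. i : Basis ==> q \<bullet> i - p \<bullet> i = ((x0 + vec R) \<bullet> i - (x0 - vec R) \<bullet> i) / 2^n"
   using \<D>(6) KD K by blast
  have pq: "q $ i - p $ i = 2 * (R / 2 ^ n)" for i
   using n[of "axis i 1"] by (simp add: inner_axis axis_in_Basis_iff)
  have "K = cube ((1/2) *\<^sub>R (p + q)) (R / 2 ^ n)"
  proof -
   have "p = (1/2) *\<^sub>R (p + q) - vec (R / 2 ^ n)" "q = (1/2) *\<^sub>R (p + q) + vec (R / 2 ^ n)"
   proof -
    have mid: "a = 1/2 * (a + b) - t & b = 1/2 * (a + b) + t" if "b - a = 2 * t" for a b t :: real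
     using that by (simp add: field_simps)
    note P = mid[OF pq, THEN conjunct1, symmetric] and Q = mid[OF pq, THEN conjunct2, symmetric]
    show "p = (1/2) *\<^sub>R (p + q) - vec (R / 2 ^ n)"
     unfolding vec_eq_iff vector_add_component vector_minus_component vector_scaleR_component vec_component
     by (simp only: real_scaleR_def P simp_thms)
    show "q = (1/2) *\<^sub>R (p + q) + vec (R / 2 ^ n)"
     unfolding vec_eq_iff vector_add_component vector_minus_component vector_scaleR_component vec_component
     by (simp only: real_scaleR_def Q simp_thms)
   qed
   then show ?thesis unfolding K cube_def by metis
  qed
  then show ?thesis using R by (intro exI[of _ "(1/2) *\<^sub>R (p + q)"] exI[of _ "R / 2 ^ n"]) simp
 qed
 have "\<forall>K\<in>\<D>. \<exists>c r \<rho>. K = cube c r & 0 < r & 0 <= \<rho> & u ` K <= cube (u c) \<rho> & 4 * \<rho>^2 <= 93312 * integral K ?G"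
 proof
  fix K assume K: "K : \<D>"
  obtain c r where cr: "K = cube c r" "0 < r" using cubes[OF K] by blast
  have Ks: "cube c r <= \<Omega>" using K \<D>(2) cr(1) sub by blast
  let ?I = "integral K (%x. norm (D x) ^ 3)"
  have iI: "(%x. norm (D x) ^ 3) integrable_on K"
   using D_integrable_on[of 0] unfolding cr(1) cube_def by simp
  have I0: "?I >= 0" by (intro integral_nonneg iI) auto
  have GI: "integral K ?G = 4 * r^2 + ?I"
  proof -
   have "integral K ?G = integral K (%x. 1) + ?I" using iI unfolding cr(1) cube_def by (intro integral_add) auto
   then show ?thesis using measure_cube[of r c] cr by (simp add: cube_def)
  qed
  define \<rho> where "\<rho> = root 3 (23328 * r * ?I)"
  have \<rho>: "0 <= \<rho>" "\<rho> ^ 3 = 23328 * r * ?I" using cr(2) I0 by (auto simp: \<rho>_def)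
  have uK: "u ` K <= cube (u c) \<rho>"
  proof
   fix y assume "y : u ` K"
   then obtain x where x: "x : cube c r" "y = u x" using cr by blast
   have "norm (u x - u c) ^ 3 <= 23328 * r * ?I"
    using Morrey_cube[OF Ks x(1) centre_in_cube cr(2), of 0] cr by simp
   then have "norm (u x - u c) ^ 3 <= \<rho> ^ 3" by (simp add: \<rho>)
   then have "norm (u x - u c) <= \<rho>" using \<rho>(1) by (subst (asm) power_mono_iff) auto
   then show "y : cube (u c) \<rho>"
    using cball_subset_cube[of "u c" \<rho>] x(2) by (auto simp: dist_norm norm_minus_commute subset_iff)
  qed
  \<comment> \<open>Young's inequality in disguise: the sixth power of \<rho> is a multiple of
    \<open>r^2 * ?I^2\<close>, which is dominated by a term of the expanded cube of
    \<open>r^2 + ?I\<close>.\<close>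
  have \<rho>2: "\<rho>^2 <= 23328 * (r^2 + ?I)"
  proof (rule ccontr)
   assume "\<not> ?thesis"
   then have "(23328 * (r^2 + ?I)) ^ 3 < (\<rho>^2) ^ 3" using I0 by (intro power_strict_mono) auto
   also have "(\<rho>^2) ^ 3 = (\<rho> ^ 3)^2" by (simp flip: power_mult)
   also have "... = 23328^2 * (r^2 * ?I^2)" by (simp add: \<rho> power_mult_distrib)
   also have "... <= 23328 ^ 3 * (r^2 + ?I) ^ 3"
   proof (intro mult_mono)
    have "(r^2 + ?I) ^ 3 = (r^2) ^ 3 + 3 * (r^2)^2 * ?I + 3 * (r^2 * ?I^2) + ?I ^ 3"
     by (simp add: power2_eq_square power3_eq_cube algebra_simps)
    moreover have "0 <= (r^2) ^ 3" "0 <= 3 * (r^2)^2 * ?I" "0 <= r^2 * ?I^2" "0 <= ?I ^ 3" using I0 by auto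
    ultimately show "r^2 * ?I^2 <= (r^2 + ?I) ^ 3" by linarith
   qed auto
   finally show False by (simp only: power_mult_distrib less_irrefl)
  qed
  have aux: "4 * a <= 93312 * (4 * b + c)" if "a <= 23328 * (b + c)" "0 <= b" for a b c :: real
   using that by simp
  have "4 * \<rho>^2 <= 93312 * integral K ?G" unfolding GI using \<rho>2 by (rule aux) simp
  then show "\<exists>c r \<rho>. K = cube c r & 0 < r & 0 <= \<rho> & u ` K <= cube (u c) \<rho> & 4 * \<rho>^2 <= 93312 * integral K ?G"
   using cr \<rho>(1) uK by blast
 qed
 then obtain c r \<rho> where K: "!!K. K : \<D> ==> K = cube (c K) (r K)" "!!K. K : \<D> ==> 0 < r K" "!!K. K : \<D> ==> 0 <= \<rho> K"
   "!!K. K : \<D> ==> u ` K <= cube (u (c K)) (\<rho> K)" "!!K. K : \<D> ==> 4 * (\<rho> K)^2 <= 93312 * integral K ?G"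
  by metis
 have meas: "cube (u (c K)) (\<rho> K) : lmeasurable" for K by (simp add: cube_def)
 have fin: "measure lebesgue (\<Union>K\<in>F. cube (u (c K)) (\<rho> K)) <= e" if F: "F <= \<D>" "finite F" for F
 proof -
  have KV: "K <= V" if "K : F" for K using \<D>(5)[of K] that F(1) by (auto split: if_splits)
  have gi: "?G integrable_on K" if "K : F" for K
  proof -
   have "?G integrable_on cube (c K) (r K)"
    unfolding cube_def by (intro integrable_add integrable_const D_integrable_on[where P=0, unfolded diff_zero])
   then show ?thesis using K(1)[of K] that F(1) by (metis subsetD)
  qed
  have hi: "(?G has_integral (\<Sum>K\<in>F. integral K ?G)) (\<Union>F)"
  proof (rule has_integral_Union[OF F(2)])
   show "(?G has_integral integral K ?G) K" if "K : F" for K using gi[OF that] by (rule integrable_integral)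
   show "pairwise (%S S'. negligible (S \<inter> S')) F"
    unfolding pairwise_def
   proof (intro ballI impI)
    fix S S' assume S: "S : F" "S' : F" "S ~= S'"
    have "interior S \<inter> interior S' = {}" using \<D>(4) S F(1) by (auto simp: pairwise_def)
    then have "S \<inter> S' <= frontier S \<union> frontier S'"
     by (auto simp: frontier_def closure_subset[THEN subsetD])
    moreover have "negligible (frontier S \<union> frontier S')"
     using S F(1) \<D>(3) by (metis convex_box(1) in_mono negligible_Un negligible_convex_frontier)
    ultimately show "negligible (S \<inter> S')" by (rule negligible_subset[rotated])
   qed
  qed
  have "measure lebesgue (\<Union>K\<in>F. cube (u (c K)) (\<rho> K)) <= (\<Sum>K\<in>F. measure lebesgue (cube (u (c K)) (\<rho> K)))"
   using F(2) meas by (intro measure_UNION_le) (auto simp: fmeasurableD)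
  also have "... <= (\<Sum>K\<in>F. 93312 * integral K ?G)"
  proof (rule sum_mono)
   fix J assume J: "J : F"
   have "measure lebesgue (cube (u (c J)) (\<rho> J)) = 4 * (\<rho> J)^2"
    using measure_cube[of "\<rho> J" "u (c J)"] K(3)[of J] J F(1) by (auto simp: cube_def)
   then show "measure lebesgue (cube (u (c J)) (\<rho> J)) <= 93312 * integral J ?G" using K(5)[of J] J F(1) by auto
  qed
  also have "... = 93312 * integral (\<Union>F) ?G" using integral_unique[OF hi] by (simp add: sum_distrib_left)
  also have "... <= 93312 * integral V ?G"
  proof (intro mult_left_mono integral_subset_le)
   show "\<Union>F <= V" using KV by blast
   show "?G integrable_on \<Union>F" using hi by blast
   show "?G integrable_on V" by (rule set_borel_integral_eq_integral(1)[OF GV])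
  qed auto
  also have "... <= 93312 * (2 * ?e)" by (intro mult_left_mono GVint) auto
  finally show ?thesis by simp
 qed
 show "\<exists>T. u ` N <= T & T : lmeasurable & measure lebesgue T <= e"
 proof (intro exI conjI)
  show "u ` N <= (\<Union>K\<in>\<D>. cube (u (c K)) (\<rho> K))"
  proof
   fix y assume "y : u ` N"
   then obtain x where x: "x : N" "y = u x" by blast
   then obtain J where J: "J : \<D>" "x : J" using \<D>(7) by blast
   then have "y : u ` J" using x(2) by blast
   then show "y : (\<Union>K\<in>\<D>. cube (u (c K)) (\<rho> K))" using K(4)[OF J(1)] J(1) by blast
  qed
  show "(\<Union>K\<in>\<D>. cube (u (c K)) (\<rho> K)) : lmeasurable"
   by (rule fmeasurable_UN_bound[OF \<D>(1) meas fin])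
  show "measure lebesgue (\<Union>K\<in>\<D>. cube (u (c K)) (\<rho> K)) <= e"
   by (rule measure_UN_bound[OF \<D>(1) meas fin])
 qed
qed

lemma cube_in_domain:
 assumes "x : \<Omega>"
 obtains r where "r > 0" "cube x r <= \<Omega>"
proof -
 obtain d where d: "d > 0" "ball x d <= \<Omega>" using open_\<Omega> assms open_contains_ball by blast
 have "cube x (d / 4) <= ball x d"
 proof
  fix y assume "y : cube x (d / 4)"
  then show "y : ball x d" using cube_radius[of y x "d / 4"] d(1) by (simp add: dist_norm norm_minus_commute)
 qed
 then show ?thesis using d by (intro that[of "d / 4"]) auto
qed

lemma Lusin_N:
 assumes N: "negligible N" "N <= \<Omega>"
 shows "negligible (u ` N)"
proof -
 define \<F> where "\<F> = {interior (cube x r) |x r. r > 0 & cube x r <= \<Omega>}"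
 have "!!S. S : \<F> ==> open S" by (auto simp: \<F>_def)
 then obtain \<F>' where \<F>': "\<F>' <= \<F>" "countable \<F>'" "\<Union>\<F>' = \<Union>\<F>" by (rule Lindelof)
 have cov: "N <= \<Union>\<F>"
 proof
  fix x assume "x : N"
  then obtain r where r: "r > 0" "cube x r <= \<Omega>" using cube_in_domain[of x] N(2) by blast
  have "ball x r <= interior (cube x r)"
   using cball_subset_cube[of x r] ball_subset_cball[of x r] by (intro interior_maximal) auto
  then have "x : interior (cube x r)" using r(1) by auto
  then show "x : \<Union>\<F>" using r by (auto simp: \<F>_def)
 qed
 have "u ` N <= (\<Union>S\<in>\<F>'. u ` (N \<inter> S))" using cov \<F>'(3) by blast
 moreover have "negligible (\<Union>S\<in>\<F>'. u ` (N \<inter> S))"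
 proof (rule negligible_countable_Union)
  show "countable ((%S. u ` (N \<inter> S)) ` \<F>')" using \<F>'(2) by simp
  fix T assume "T : (%S. u ` (N \<inter> S)) ` \<F>'"
  then obtain x r where T: "T = u ` (N \<inter> interior (cube x r))" "r > 0" "cube x r <= \<Omega>"
   using \<F>'(1) by (auto simp: \<F>_def)
  show "negligible T" unfolding T(1)
   using N(1) T interior_subset[of "cube x r"] by (intro Lusin_cube[of x r]) (auto intro: negligible_subset)
 qed
 ultimately show ?thesis by (rule negligible_subset[rotated])
qed

end

locale area_preserving = planar_Sobolev +
 assumes inj: "inj_on u \<Omega>" and det1: "negligible {x : \<Omega>. det (D x) ~= 1}"
begin

text \<open>Discarding a null set \<open>Z\<close> leaves points of differentiability with
  determinant 1, where the classical formula for injective maps applies with density 1; by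
  \<open>Lusin_N\<close> the image of \<open>Z\<close> is null as well.\<close>

theorem change_of_variables:
 fixes f :: "real^2 => real"
 shows "(%x. f (u x)) absolutely_integrable_on \<Omega> & integral \<Omega> (%x. f (u x)) = b
  \<longleftrightarrow> f absolutely_integrable_on (u ` \<Omega>) & integral (u ` \<Omega>) f = b"
proof -
 obtain N where N: "negligible N" "!!x. x : \<Omega> ==> x ~: N ==> (u has_derivative (%h. D x *v h)) (at x)"
  by (rule differentiable_almost_everywhere) blast
 define Z where "Z = \<Omega> \<inter> (N \<union> {x : \<Omega>. det (D x) ~= 1})"
 have Z: "negligible Z" "Z <= \<Omega>"
  unfolding Z_def using N(1) det1 by (auto intro: negligible_subset[of "N \<union> {x : \<Omega>. det (D x) ~= 1}"])
 define S where "S = \<Omega> - Z"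
 have S: "S : sets lebesgue" "S <= \<Omega>"
  unfolding S_def using open_\<Omega> negligible_imp_sets[OF Z(1)] by (auto intro: borel_open)
 \<comment> \<open>The formula for the change of variables concerns vector-valued integrands, so
   \<open>f\<close> is embedded into \<open>real^1\<close> and projected back.\<close>
 define F :: "real^2 => real^1" where "F y = f y *\<^sub>R axis 1 1" for y
 have ld: "bounded_linear (%c. c *\<^sub>R (axis 1 1 :: real^1))" by (rule bounded_linear_scaleR_left)
 have lc: "bounded_linear (%v :: real^1. v $ 1)" by (rule bounded_linear_vec_nth)
 have Fiff: "(%x. F (p x)) absolutely_integrable_on T & integral T (%x. F (p x)) = b *\<^sub>R axis 1 1
  \<longleftrightarrow> (%x. f (p x)) absolutely_integrable_on T & integral T (%x. f (p x)) = b" for p :: "real^2 => real^2" and T :: "(real^2) set"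
 proof
  assume a: "(%x. F (p x)) absolutely_integrable_on T & integral T (%x. F (p x)) = b *\<^sub>R axis 1 1"
  then have "((%v. v $ 1) \<circ> (%x. F (p x))) absolutely_integrable_on T"
   by (intro absolutely_integrable_linear lc) simp
  moreover have "integral T ((%v. v $ 1) \<circ> (%x. F (p x))) = (integral T (%x. F (p x))) $ 1"
   using a by (intro integral_linear lc) (auto dest: set_lebesgue_integral_eq_integral(1))
  ultimately show "(%x. f (p x)) absolutely_integrable_on T & integral T (%x. f (p x)) = b"
   using a by (simp add: F_def o_def)
 next
  assume a: "(%x. f (p x)) absolutely_integrable_on T & integral T (%x. f (p x)) = b"
  then have "((%c. c *\<^sub>R (axis 1 1 :: real^1)) \<circ> (%x. f (p x))) absolutely_integrable_on T"
   by (intro absolutely_integrable_linear ld) simp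
  moreover have "integral T ((%c. c *\<^sub>R (axis 1 1 :: real^1)) \<circ> (%x. f (p x))) = integral T (%x. f (p x)) *\<^sub>R axis 1 1"
   using a by (intro integral_linear ld) (auto dest: set_lebesgue_integral_eq_integral(1))
  ultimately show "(%x. F (p x)) absolutely_integrable_on T & integral T (%x. F (p x)) = b *\<^sub>R axis 1 1"
   using a by (simp add: F_def o_def)
 qed
 have der: "(u has_derivative (%h. D x *v h)) (at x within S)" if "x : S" for x
  using that N(2)[of x] by (auto simp: S_def Z_def intro: has_derivative_at_withinI)
 have cov: "(%x. \<bar>det (matrix (%h. D x *v h))\<bar> *\<^sub>R F (u x)) absolutely_integrable_on S
   & integral S (%x. \<bar>det (matrix (%h. D x *v h))\<bar> *\<^sub>R F (u x)) = b *\<^sub>R axis 1 1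
   \<longleftrightarrow> F absolutely_integrable_on (u ` S) & integral (u ` S) F = b *\<^sub>R axis 1 1"
  by (rule has_absolute_integral_change_of_variables[OF S(1) der inj_on_subset[OF inj S(2)]])
 have d1: "\<bar>det (matrix (%h. D x *v h))\<bar> = 1" if "x : S" for x
  using that by (auto simp: S_def Z_def)
 have c1: "(%x. \<bar>det (matrix (%h. D x *v h))\<bar> *\<^sub>R F (u x)) absolutely_integrable_on S \<longleftrightarrow> (%x. F (u x)) absolutely_integrable_on S"
  by (rule set_integrable_cong) (use d1 in \<open>auto simp del: matrix_of_matrix_vector_mul\<close>)
 have c2: "integral S (%x. \<bar>det (matrix (%h. D x *v h))\<bar> *\<^sub>R F (u x)) = integral S (%x. F (u x))"
  by (rule integral_cong) (use d1 in \<open>simp del: matrix_of_matrix_vector_mul\<close>)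
 have "(%x. f (u x)) absolutely_integrable_on S & integral S (%x. f (u x)) = b
   \<longleftrightarrow> f absolutely_integrable_on (u ` S) & integral (u ` S) f = b"
  using cov Fiff[of S u] Fiff[of "u ` S" "%x. x"] unfolding c1 c2 by simp
 moreover have "(f' absolutely_integrable_on A \<longleftrightarrow> f' absolutely_integrable_on B) & integral A f' = integral B f'"
  if "A <= B" "negligible (B - A)" for A B and f' :: "real^2 => real"
 proof -
  have "negligible {x : A - B. f' x ~= 0}" "negligible {x : B - A. f' x ~= 0}"
   using that by (auto intro: negligible_subset simp: Diff_eq_empty_iff[THEN iffD2])
  then show ?thesis using absolutely_integrable_spike_set_eq[of A B f'] integral_spike_set[of A B f'] by blast
 qed
 note this[of S \<Omega> "%x. f (u x)"] this[of "u ` S" "u ` \<Omega>" f]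
 moreover have "negligible (\<Omega> - S)" by (rule negligible_subset[OF Z(1)]) (auto simp: S_def)
 moreover have "negligible (u ` \<Omega> - u ` S)" by (rule negligible_subset[OF Lusin_N[OF Z]]) (auto simp: S_def)
 ultimately show ?thesis using S(2) by (simp add: image_mono)
qed

end

section \<open>Null Lagrangians\<close>

definition C1_fun :: "('a::euclidean_space => real) => ('a => 'a) => bool"
 where "C1_fun a ga \<longleftrightarrow> (\<forall>x. (a has_derivative (%h. ga x \<bullet> h)) (at x)) & continuous_on UNIV ga"

lemma C1_fun_continuous: "C1_fun a ga ==> continuous_on UNIV a"
 unfolding C1_fun_def by (meson continuous_at_imp_continuous_on has_derivative_continuous)

lemma C1_fun_mult:
 assumes "C1_fun a ga" "C1_fun b gb"
 shows "C1_fun (%x. a x * b x) (%x. a x *\<^sub>R gb x + b x *\<^sub>R ga x)"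
 using assms C1_fun_continuous[OF assms(1)] C1_fun_continuous[OF assms(2)] unfolding C1_fun_def
 by (auto intro!: continuous_intros derivative_eq_intros simp: inner_add_left algebra_simps)

lemma C1_fun_translate:
 assumes "C1_fun a ga" shows "C1_fun (%x. a (x + s)) (%x. ga (x + s))"
proof -
 have "((%x. a (x + s)) has_derivative (%h. ga (x + s) \<bullet> h)) (at x)" for x
 proof -
  have "((%x. x + s) has_derivative (%h. h)) (at x)" by (auto intro!: derivative_eq_intros)
  moreover have "(a has_derivative (%h. ga (x + s) \<bullet> h)) (at (x + s))" using assms by (simp add: C1_fun_def)
  ultimately show ?thesis by (rule has_derivative_compose)
 qed
 moreover have "continuous_on UNIV (%x. ga (x + s))"
  by (rule continuous_on_compose2[of UNIV ga]) (use assms in \<open>auto simp: C1_fun_def intro!: continuous_intros\<close>)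
 ultimately show ?thesis by (simp add: C1_fun_def)
qed

lemma C1_fun_scale: "C1_fun a ga ==> C1_fun (%x. c * a x) (%x. c *\<^sub>R ga x)"
 unfolding C1_fun_def by (auto intro!: continuous_intros derivative_eq_intros)

lemma C1_fun_diff: "C1_fun a ga ==> C1_fun b gb ==> C1_fun (%x. a x - b x) (%x. ga x - gb x)"
 unfolding C1_fun_def by (auto intro!: continuous_intros derivative_eq_intros simp: inner_diff_left)

lemma C1_fun_component: "C1_map f F ==> C1_fun (%x. f x $ i) (%x. F x $ i)"
proof -
 assume f: "C1_map f F"
 have "((%x. f x $ i) has_derivative (%h. (F x *v h) $ i)) (at x)" for x
  using f by (intro bounded_linear.has_derivative[OF bounded_linear_vec_nth]) (simp add: C1_map_def)
 then show ?thesis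
  using f unfolding C1_fun_def C1_map_def by (auto simp: matrix_vector_mul_component intro: continuous_intros)
qed

lemma C1_fun_compose:
 assumes p: "C1_fun p gp" and f: "C1_map f F"
 shows "C1_fun (%x. p (f x)) (%x. transpose (F x) *v gp (f x))"
proof -
 have cf: "continuous_on UNIV f" and cF: "continuous_on UNIV F"
  using C1_map_continuous[OF f] C1_map_continuous_deriv[OF f] by auto
 have "((%x. p (f x)) has_derivative (%h. (transpose (F x) *v gp (f x)) \<bullet> h)) (at x)" for x
 proof -
  have "((%x. p (f x)) has_derivative (%h. gp (f x) \<bullet> (F x *v h))) (at x)"
   using f p by (intro has_derivative_compose[of f _ x UNIV p]) (auto simp: C1_map_def C1_fun_def)
  then show ?thesis by (simp add: dot_lmul_matrix transpose_matrix_vector)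
 qed
 moreover have "continuous_on UNIV (%x. transpose (F x) *v gp (f x))"
 proof -
  have "continuous_on UNIV (%x. gp (f x))"
   by (rule continuous_on_compose2[OF _ cf]) (use p in \<open>auto simp: C1_fun_def\<close>)
  then show ?thesis
   unfolding matrix_vector_mult_def transpose_def
   by (intro continuous_on_vec_lambda continuous_intros) (simp, intro continuous_intros cF)
 qed
 ultimately show ?thesis by (simp add: C1_fun_def)
qed

lemma C1_fun_vanish:
 assumes a: "C1_fun a ga" and "!!x. norm x > R ==> a x = 0" "norm x > R"
 shows "ga x = 0"
proof -
 have "(a has_derivative (%h. 0)) (at x)"
  by (rule has_derivative_transform_within_open[of "%x. 0" _ _ UNIV "{x. norm x > R}"])
   (use assms in \<open>auto intro!: open_Collect_less continuous_intros\<close>)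
 moreover have "(a has_derivative (%h. ga x \<bullet> h)) (at x)" using a by (simp add: C1_fun_def)
 ultimately have "(%h. ga x \<bullet> h) = (%h. 0)" by (rule has_derivative_unique[rotated])
 then have "ga x \<bullet> ga x = 0" by (rule fun_cong)
 then show ?thesis by simp
qed

lemma C1_fun_increment_le:
 assumes a: "C1_fun a ga" and B: "!!z. norm z <= R ==> norm (ga z) <= B" and x: "norm x <= R" "norm (x + h) <= R"
 shows "\<bar>a (x + h) - a x\<bar> <= B * norm h"
proof -
 have "norm (a (x + h) - a x) <= B * norm (x + h - x)"
 proof (rule differentiable_bound[of "cball 0 R" a "%x h. ga x \<bullet> h"])
  show "(a has_derivative (%h. ga y \<bullet> h)) (at y within cball 0 R)" for y
   using a by (auto simp: C1_fun_def intro: has_derivative_at_withinI)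
  show "onorm (%h. ga y \<bullet> h) <= B" if "y : cball 0 R" for y
  proof (rule onorm_le)
   fix h show "norm (ga y \<bullet> h) <= B * norm h"
    using order_trans[OF Cauchy_Schwarz_ineq2 mult_right_mono[OF B norm_ge_zero], of y h] that by auto
  qed
 qed (use x in auto)
 then show ?thesis by simp
qed

lemma C1_fun_difference_quotient:
 assumes a: "C1_fun a ga"
 shows "(%n. real (Suc n) * (a (x + (1 / real (Suc n)) *\<^sub>R h) - a x)) \<longlonglongrightarrow> ga x \<bullet> h"
proof -
 have "((%t. a (x + t *\<^sub>R h)) has_derivative (%t. ga x \<bullet> (t *\<^sub>R h))) (at (0::real))"
 proof (rule has_derivative_compose[where g=a])
  show "((%t. x + t *\<^sub>R h) has_derivative (%t. t *\<^sub>R h)) (at 0)" by (auto intro!: derivative_eq_intros)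
  show "(a has_derivative (%h. ga x \<bullet> h)) (at (x + 0 *\<^sub>R h))" using a by (simp add: C1_fun_def)
 qed
 then have "((%t. a (x + t *\<^sub>R h)) has_real_derivative ga x \<bullet> h) (at 0)"
  by (simp add: has_field_derivative_def mult.commute[of _ "ga x \<bullet> h"])
 then have l: "((%t. (a (x + t *\<^sub>R h) - a x) / t) \<longlongrightarrow> ga x \<bullet> h) (at 0)" by (simp add: DERIV_def)
 have "filterlim (%n. 1 / real (Suc n)) (at 0) sequentially"
  using LIMSEQ_inverse_real_of_nat by (auto simp: filterlim_at inverse_eq_divide)
 from filterlim_compose[OF l this] show ?thesis by (simp add: mult.commute)
qed

lemma C1_bounded_on_ball:
 fixes ga :: "'a::euclidean_space => 'b::real_normed_vector"
 assumes "continuous_on UNIV ga"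
 obtains B where "B > 0" "!!z. norm z <= R ==> norm (ga z) <= B"
proof -
 have "compact (ga ` cball 0 R)"
  using assms by (intro compact_continuous_image) (auto intro: continuous_on_subset)
 then obtain B where "B > 0" "!!y. y : ga ` cball 0 R ==> norm y <= B"
  using compact_imp_bounded bounded_pos by metis
 then show ?thesis using that[of B] by auto
qed

lemma integral_translate_lborel:
 fixes f :: "'a::euclidean_space => real"
 assumes "f : borel_measurable borel"
 shows "(LINT x|lborel. f (x + s)) = (LINT x|lborel. f x)"
proof -
 have "(LINT x|lborel. f x) = (LINT x|distr lborel borel ((+) s). f x)" by (simp add: lborel_distr_plus)
 also have "... = (LINT x|lborel. f (s + x))" using assms by (subst integral_distr) auto
 finally show ?thesis by (simp add: add.commute)
qed

lemma difference_quotient_integral_limit: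
 fixes a :: "'a::euclidean_space => real"
 assumes a: "C1_fun a ga" and k: "continuous_on UNIV k" and h: "norm h <= 1"
  and van: "!!x. norm x > R ==> a x = 0 \<or> k x = 0" "!!x. norm x > R ==> a (x + (1 / real (Suc n)) *\<^sub>R h) = 0 \<or> k x = 0"
  and van': "!!x n. norm x > R ==> (real (Suc n) * (a (x + (1 / real (Suc n)) *\<^sub>R h) - a x)) * k x = 0"
 shows "(%n. LINT x|lborel. (real (Suc n) * (a (x + (1 / real (Suc n)) *\<^sub>R h) - a x)) * k x) \<longlonglongrightarrow> (LINT x|lborel. (ga x \<bullet> h) * k x)"
proof -
 have ca: "continuous_on UNIV a" by (rule C1_fun_continuous[OF a])
 have cga: "continuous_on UNIV ga" using a by (simp add: C1_fun_def)
 obtain B where B: "B > 0" "!!z. norm z <= R + 1 ==> norm (ga z) <= B" by (rule C1_bounded_on_ball[OF cga]) blast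
 obtain B' where B': "B' > 0" "!!z. norm z <= R ==> norm (k z) <= B'" by (rule C1_bounded_on_ball[OF k]) blast
 have [measurable]: "a : borel_measurable borel" "k : borel_measurable borel" "ga : borel_measurable borel"
  by (intro borel_measurable_continuous_onI ca cga k)+
 show ?thesis
 proof (rule integral_dominated_convergence)
  show "integrable lborel (%x. B * B' * indicator (cball (0::'a) R) x)"
   by (intro integrable_mult_right integrable_real_indicator) (use emeasure_lborel_cball_finite in auto)
  show "AE x in lborel. (%n. (real (Suc n) * (a (x + (1 / real (Suc n)) *\<^sub>R h) - a x)) * k x) \<longlonglongrightarrow> (ga x \<bullet> h) * k x"
   by (intro AE_I2 tendsto_mult C1_fun_difference_quotient[OF a] tendsto_const)
  show "AE x in lborel. norm ((real (Suc n) * (a (x + (1 / real (Suc n)) *\<^sub>R h) - a x)) * k x) <= B * B' * indicator (cball 0 R) x" for n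
  proof (rule AE_I2)
   fix x :: 'a
   show "norm ((real (Suc n) * (a (x + (1 / real (Suc n)) *\<^sub>R h) - a x)) * k x) <= B * B' * indicator (cball 0 R) x"
   proof (cases "norm x > R")
    case True
    then show ?thesis using van'[OF True, of n] by simp
   next
    case False
    let ?h = "(1 / real (Suc n)) *\<^sub>R h"
    have nh: "norm ?h <= 1 / real (Suc n)" using h by (simp add: divide_right_mono)
    also have "... <= 1" by simp
    finally have "norm ?h <= 1" .
    then have "norm (x + ?h) <= R + 1" using norm_triangle_ineq[of x ?h] False by linarith
    then have "\<bar>a (x + ?h) - a x\<bar> <= B * norm ?h"
     using False by (intro C1_fun_increment_le[OF a B(2)]) auto
    also have "... <= B * (1 / real (Suc n))" using B(1) nh by (intro mult_left_mono) auto
    finally have "real (Suc n) * \<bar>a (x + ?h) - a x\<bar> <= real (Suc n) * (B * (1 / real (Suc n)))"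
     by (intro mult_left_mono) auto
    also have "... = B" by simp
    finally have "real (Suc n) * \<bar>a (x + ?h) - a x\<bar> * \<bar>k x\<bar> <= B * B'"
     using B(1) B'(2)[of x] False by (intro mult_mono) auto
    then show ?thesis using False by (simp add: abs_mult)
   qed
  qed
 qed measurable
qed

text \<open>Translation invariance makes the integral of every difference quotient zero, and the
  derivative is their dominated limit.\<close>

lemma integral_derivative_zero:
 fixes a :: "'a::euclidean_space => real"
 assumes a: "C1_fun a ga" and van: "!!x. norm x > R ==> a x = 0" and h: "norm h <= 1"
 shows "(LINT x|lborel. ga x \<bullet> h) = 0"
proof -
 have ca: "continuous_on UNIV a" by (rule C1_fun_continuous[OF a])
 have i: "integrable lborel a" by (rule integrable_continuous_compact_support[OF ca van])
 have far: "norm (x + (1 / real (Suc n)) *\<^sub>R h) > R" if "norm x > R + 1" for x n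
 proof -
  have "norm ((1 / real (Suc n)) *\<^sub>R h) <= 1 / real (Suc n)" using h by (simp add: divide_right_mono)
  also have "... <= 1" by simp
  finally show ?thesis using norm_diff_ineq[of x "(1 / real (Suc n)) *\<^sub>R h"] that by linarith
 qed
 have "(%n. LINT x|lborel. (real (Suc n) * (a (x + (1 / real (Suc n)) *\<^sub>R h) - a x)) * 1) \<longlonglongrightarrow> (LINT x|lborel. (ga x \<bullet> h) * 1)"
  by (rule difference_quotient_integral_limit[OF a, where R="R + 1"]) (use h van far in auto)
 moreover have "(LINT x|lborel. (real (Suc n) * (a (x + (1 / real (Suc n)) *\<^sub>R h) - a x)) * 1) = 0" for n
 proof -
  have "integrable lborel (%x. a (x + (1 / real (Suc n)) *\<^sub>R h))"
   by (rule integrable_continuous_compact_support[where R="R + 1"])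
    (use van far C1_fun_continuous[OF C1_fun_translate[OF a]] in auto)
  then show ?thesis using i integral_translate_lborel[of a "(1 / real (Suc n)) *\<^sub>R h"]
   by (simp add: borel_measurable_continuous_onI[OF ca])
 qed
 ultimately show ?thesis by (simp add: LIMSEQ_unique)
qed

lemma integration_by_parts:
 fixes a b :: "'a::euclidean_space => real"
 assumes a: "C1_fun a ga" and b: "C1_fun b gb" and van: "!!x. norm x > R ==> b x = 0" and h: "norm h <= 1"
 shows "(LINT x|lborel. (ga x \<bullet> h) * b x) = - (LINT x|lborel. a x * (gb x \<bullet> h))"
proof -
 have ca: "continuous_on UNIV a" "continuous_on UNIV b" "continuous_on UNIV ga" "continuous_on UNIV gb"
  using C1_fun_continuous[OF a] C1_fun_continuous[OF b] a b by (auto simp: C1_fun_def)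
 have gv: "gb x = 0" if "norm x > R" for x by (rule C1_fun_vanish[OF b van that])
 have "(LINT x|lborel. (a x *\<^sub>R gb x + b x *\<^sub>R ga x) \<bullet> h) = 0"
  by (rule integral_derivative_zero[OF C1_fun_mult[OF a b] _ h, of R]) (simp add: van)
 moreover have "integrable lborel (%x. (ga x \<bullet> h) * b x)" "integrable lborel (%x. a x * (gb x \<bullet> h))"
  by (rule integrable_continuous_compact_support[where R=R]; use ca van gv in \<open>auto intro!: continuous_intros\<close>)+
 ultimately show ?thesis by (simp add: inner_add_left mult.commute)
qed

text \<open>Functions of class C^1 have no mixed second derivatives to commute. With difference
  quotients in direction \<open>k\<close> in place of the derivative, one integration by parts in
  direction \<open>h\<close> followed by a translation moves the quotient from \<open>b\<close> to
  \<open>a\<close>.\<close>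

lemma null_Lagrangian:
 fixes a b :: "'a::euclidean_space => real"
 assumes a: "C1_fun a ga" and b: "C1_fun b gb" and van: "!!x. norm x > R ==> b x = 0"
  and h: "norm h <= 1" and k: "norm k <= 1"
 shows "(LINT x|lborel. (ga x \<bullet> h) * (gb x \<bullet> k)) = (LINT x|lborel. (ga x \<bullet> k) * (gb x \<bullet> h))"
proof -
 have ca: "continuous_on UNIV a" "continuous_on UNIV b" "continuous_on UNIV ga" "continuous_on UNIV gb"
  using C1_fun_continuous[OF a] C1_fun_continuous[OF b] a b by (auto simp: C1_fun_def)
 have gv: "gb x = 0" if "norm x > R" for x by (rule C1_fun_vanish[OF b van that])
 have far: "norm (x + (1 / real (Suc n)) *\<^sub>R h) > R" if "norm x > R + 1" "norm h <= 1" for x h :: 'a and n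
 proof -
  have "norm ((1 / real (Suc n)) *\<^sub>R h) <= 1 / real (Suc n)" using that(2) by (simp add: divide_right_mono)
  also have "... <= 1" by simp
  finally show ?thesis using norm_diff_ineq[of x "(1 / real (Suc n)) *\<^sub>R h"] that(1) by linarith
 qed
 have l1: "(%n. LINT x|lborel. (real (Suc n) * (b (x + (1 / real (Suc n)) *\<^sub>R k) - b x)) * (ga x \<bullet> h)) \<longlonglongrightarrow> (LINT x|lborel. (gb x \<bullet> k) * (ga x \<bullet> h))"
  by (rule difference_quotient_integral_limit[OF b, where R="R + 1"]) (use k van far ca in \<open>auto intro!: continuous_intros\<close>)
 have l2: "(%n. LINT x|lborel. (real (Suc n) * (a (x + (1 / real (Suc n)) *\<^sub>R (- k)) - a x)) * (gb x \<bullet> h)) \<longlonglongrightarrow> (LINT x|lborel. (ga x \<bullet> (- k)) * (gb x \<bullet> h))"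
  by (rule difference_quotient_integral_limit[OF a, where R=R]) (use k gv ca in \<open>auto intro!: continuous_intros\<close>)
 \<comment> \<open>The translation reverses the shift, hence the direction \<open>- k\<close>; its
   sign cancels the one from integration by parts in the limit.\<close>
 have eq: "(LINT x|lborel. (real (Suc n) * (b (x + (1 / real (Suc n)) *\<^sub>R k) - b x)) * (ga x \<bullet> h))
   = - (LINT x|lborel. (real (Suc n) * (a (x + (1 / real (Suc n)) *\<^sub>R (- k)) - a x)) * (gb x \<bullet> h))" for n
 proof -
  let ?c = "real (Suc n)" and ?s = "(1 / real (Suc n)) *\<^sub>R k"
  have lin: "(LINT x|lborel. c * p x - c * q x) = c * (LINT x|lborel. p x) - c * (LINT x|lborel. q x)"
   if "integrable lborel p" "integrable lborel q" for p q :: "'a => real" and c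
   using that by simp
  have cas: "continuous_on UNIV (%x. a (x + - ?s) * (gb x \<bullet> h))"
   by (rule continuous_on_mult[OF C1_fun_continuous[OF C1_fun_translate[OF a]]]) (intro continuous_intros ca)
  have bt: "C1_fun (%x. ?c * (b (x + ?s) - b x)) (%x. ?c *\<^sub>R (gb (x + ?s) - gb x))"
   by (rule C1_fun_scale[OF C1_fun_diff[OF C1_fun_translate[OF b] b]])
  have cs: "continuous_on UNIV (%x. gb (x + ?s))"
   using C1_fun_translate[OF b, of ?s] by (simp add: C1_fun_def)
  have "(LINT x|lborel. (ga x \<bullet> h) * (?c * (b (x + ?s) - b x))) = - (LINT x|lborel. a x * ((?c *\<^sub>R (gb (x + ?s) - gb x)) \<bullet> h))"
   by (rule integration_by_parts[OF a bt _ h, of "R + 1"]) (use van far k in auto)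
  also have "(LINT x|lborel. a x * ((?c *\<^sub>R (gb (x + ?s) - gb x)) \<bullet> h))
    = ?c * (LINT x|lborel. a x * (gb (x + ?s) \<bullet> h)) - ?c * (LINT x|lborel. a x * (gb x \<bullet> h))"
  proof -
   have "integrable lborel (%x. a x * (gb (x + ?s) \<bullet> h))" "integrable lborel (%x. a x * (gb x \<bullet> h))"
    by (rule integrable_continuous_compact_support[where R="R + 1"]; use ca gv far k cs in \<open>auto intro!: continuous_intros\<close>)+
   from lin[OF this, of ?c] show ?thesis by (simp only: inner_scaleR_left inner_diff_left right_diff_distrib mult.left_commute)
  qed
  also have "(LINT x|lborel. a x * (gb (x + ?s) \<bullet> h)) = (LINT x|lborel. a (x + - ?s) * (gb x \<bullet> h))"
  proof -
   from integral_translate_lborel[OF borel_measurable_continuous_onI[OF cas], of ?s]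
   show ?thesis by simp
  qed
  also have "?c * (LINT x|lborel. a (x + - ?s) * (gb x \<bullet> h)) - ?c * (LINT x|lborel. a x * (gb x \<bullet> h))
    = (LINT x|lborel. (?c * (a (x + - ?s) - a x)) * (gb x \<bullet> h))"
  proof -
   have "integrable lborel (%x. a (x + - ?s) * (gb x \<bullet> h))"
    by (rule integrable_continuous_compact_support[OF cas, of R]) (simp add: gv)
   moreover have "integrable lborel (%x. a x * (gb x \<bullet> h))"
    by (rule integrable_continuous_compact_support[where R=R]) (use ca gv in \<open>auto intro!: continuous_intros\<close>)
   ultimately have "(LINT x|lborel. ?c * (a (x + - ?s) * (gb x \<bullet> h)) - ?c * (a x * (gb x \<bullet> h)))
    = ?c * (LINT x|lborel. a (x + - ?s) * (gb x \<bullet> h)) - ?c * (LINT x|lborel. a x * (gb x \<bullet> h))"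
    by (rule lin)
   then show ?thesis by (simp only: left_diff_distrib right_diff_distrib mult.assoc)
  qed
  finally show ?thesis by (simp add: mult.commute)
 qed
 have "(LINT x|lborel. (gb x \<bullet> k) * (ga x \<bullet> h)) = - (LINT x|lborel. (ga x \<bullet> (- k)) * (gb x \<bullet> h))"
  using l1[unfolded eq] tendsto_minus[OF l2] by (rule LIMSEQ_unique)
 then show ?thesis by (simp add: mult.commute)
qed

section \<open>Cofactors and the Piola identity\<close>

definition cofactor2 :: "real^2^2 => real^2^2"
 where "cofactor2 F = vector [vector [F $ 2 $ 2, - F $ 2 $ 1], vector [- F $ 1 $ 2, F $ 1 $ 1]]"

lemma cofactor2_entries [simp]:
 "cofactor2 F $ 1 $ 1 = F $ 2 $ 2" "cofactor2 F $ 1 $ 2 = - F $ 2 $ 1"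
 "cofactor2 F $ 2 $ 1 = - F $ 1 $ 2" "cofactor2 F $ 2 $ 2 = F $ 1 $ 1"
 by (simp_all add: cofactor2_def)

lemma cofactor2_transpose_mult: "transpose (cofactor2 F) ** F = det F *\<^sub>R mat 1"
 by (simp add: vec_eq_iff forall_2 matrix_matrix_mult_def transpose_def sum_2 det_2 mat_def algebra_simps)

lemma continuous_on_cofactor2 [continuous_intros]:
 assumes "continuous_on S F" shows "continuous_on S (%x. cofactor2 (F x))"
proof -
 have "linear cofactor2"
  by (auto simp: linear_iff vec_eq_iff forall_2)
 then have "continuous_on UNIV cofactor2" by (simp add: linear_continuous_on linear_conv_bounded_linear)
 then show ?thesis by (rule continuous_on_compose2[OF _ assms]) auto
qed

lemma inner_2: "x \<bullet> y = x $ 1 * y $ 1 + x $ 2 * y $ 2" for x y :: "real^2"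
 by (simp add: inner_vec_def sum_2)

lemma norm_cofactor2: "norm (cofactor2 F) = norm F"
proof -
 have "cofactor2 F \<bullet> cofactor2 F = F \<bullet> F"
  by (simp add: inner_vec_def sum_2)
 then show ?thesis by (simp add: norm_eq_sqrt_inner)
qed

lemma entry_le_norm: "\<bar>F $ i $ j\<bar> <= norm F" for F :: "real^'n^'m"
 by (rule order_trans[OF component_le_norm_cart Finite_Cartesian_Product.norm_nth_le])

lemma det_diff_le: "\<bar>det F - det G\<bar> <= 4 * ((1 + norm G) * norm (F - G) + (norm (F - G))^2)" for F G :: "real^2^2"
proof -
 define E where "E = F - G"
 define e g where "e = norm E" and "g = norm G"
 have F: "F = G + E" by (simp add: E_def)
 have m: "\<bar>G $ i $ j * E $ k $ l\<bar> <= g * e" "\<bar>E $ i $ j * E $ k $ l\<bar> <= e * e" for i j k l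
  unfolding abs_mult e_def g_def by (intro mult_mono entry_le_norm; simp)+
 have "det F - det G = G $ 1 $ 1 * E $ 2 $ 2 + G $ 2 $ 2 * E $ 1 $ 1 - G $ 1 $ 2 * E $ 2 $ 1 - G $ 2 $ 1 * E $ 1 $ 2
   + E $ 1 $ 1 * E $ 2 $ 2 - E $ 1 $ 2 * E $ 2 $ 1"
  by (simp add: F det_2 algebra_simps)
 then have "\<bar>det F - det G\<bar> <= 4 * (g * e) + 2 * (e * e)"
  using m(1)[of 1 1 2 2] m(1)[of 2 2 1 1] m(1)[of 1 2 2 1] m(1)[of 2 1 1 2] m(2)[of 1 1 2 2] m(2)[of 1 2 2 1] by linarith
 also have "... <= 4 * ((1 + g) * e + e^2)"
  by (simp add: e_def power2_eq_square algebra_simps)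
 finally show ?thesis by (simp add: e_def g_def E_def)
qed

lemma abs_det_le: "\<bar>det G\<bar> <= 2 * (1 + norm G)^2" for G :: "real^2^2"
proof -
 have "\<bar>G $ i $ j * G $ k $ l\<bar> <= norm G * norm G" for i j k l
  unfolding abs_mult by (intro mult_mono entry_le_norm) auto
 from this[of 1 1 2 2] this[of 1 2 2 1] have "\<bar>det G\<bar> <= 2 * (norm G * norm G)" unfolding det_2 by linarith
 also have "... <= 2 * (1 + norm G)^2" by (simp add: power2_eq_square algebra_simps)
 finally show ?thesis .
qed

lemma matrix_mult_entry_le: "\<bar>(A ** B) $ i $ j\<bar> <= norm A * norm B" for A :: "real^'n^'m" and B :: "real^'k^'n"
proof -
 have "(A ** B) $ i $ j = (A *v column j B) $ i"
  by (simp add: matrix_matrix_mult_def matrix_vector_mult_def column_def)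
 also have "column j B = B *v axis j 1" by (simp add: matrix_vector_mult_basis)
 finally have "\<bar>(A ** B) $ i $ j\<bar> <= norm (A *v (B *v axis j 1))"
  using component_le_norm_cart by simp
 also have "... <= norm A * norm (B *v axis j 1)" by (rule norm_matrix_vector_mult_le)
 also have "... <= norm A * (norm B * norm (axis j 1 :: real^'k))" by (intro mult_left_mono norm_matrix_vector_mult_le) auto
 finally show ?thesis by simp
qed

text \<open>With \<phi> times the composition of \<psi> and \<open>f\<close> as one function, the
  sum of both integrands is, up to order, the determinant of its gradient and the gradient of the
  component of \<open>f\<close> other than \<open>j\<close>; \<open>null_Lagrangian\<close> makes
  the integral vanish.\<close>

lemma Piola_identity:
 assumes f: "C1_map f F" and \<phi>: "C1_fun \<phi> g\<phi>" and \<psi>: "C1_fun \<psi> g\<psi>" and van: "!!x. norm x > R ==> \<phi> x = 0"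
 shows "(LINT x|lborel. \<phi> x * g\<psi> (f x) $ j * det (F x)) = - (LINT x|lborel. \<psi> (f x) * (cofactor2 (F x) $ j \<bullet> g\<phi> x))"
proof -
 let ?g = "%x. transpose (F x) *v g\<psi> (f x)"
 have b: "C1_fun (%x. \<phi> x * \<psi> (f x)) (%x. \<phi> x *\<^sub>R ?g x + \<psi> (f x) *\<^sub>R g\<phi> x)"
  by (rule C1_fun_mult[OF \<phi> C1_fun_compose[OF \<psi> f]])
 have g\<phi>0: "g\<phi> x = 0" if "norm x > R" for x by (rule C1_fun_vanish[OF \<phi> van that])
 have cont: "continuous_on UNIV f" "continuous_on UNIV F" "continuous_on UNIV \<phi>" "continuous_on UNIV g\<phi>"
   "continuous_on UNIV (%x. \<psi> (f x))" "continuous_on UNIV (%x. g\<psi> (f x))" "continuous_on UNIV ?g"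
  using C1_map_continuous[OF f] C1_map_continuous_deriv[OF f] C1_fun_continuous[OF \<phi>] \<phi>
   C1_fun_continuous[OF C1_fun_compose[OF \<psi> f]] C1_fun_compose[OF \<psi> f]
   continuous_on_compose2[of UNIV g\<psi> UNIV f] \<psi> by (auto simp: C1_fun_def)
 have cF: "continuous_on UNIV (%x. F x $ i $ k)" for i k by (intro continuous_intros cont)
 have "continuous_on UNIV (%x. det (F x))" unfolding det_2 by (intro continuous_intros cF)
 then have i1: "integrable lborel (%x. \<phi> x * g\<psi> (f x) $ j * det (F x))" for j
  by (intro integrable_continuous_compact_support[where R=R] continuous_intros cont) (auto simp: van)
 have i2: "integrable lborel (%x. \<psi> (f x) * (cofactor2 (F x) $ j \<bullet> g\<phi> x))" for j
  by (intro integrable_continuous_compact_support[where R=R] continuous_intros cont) (simp add: g\<phi>0)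
 have tr: "?g x $ k = F x $ 1 $ k * g\<psi> (f x) $ 1 + F x $ 2 $ k * g\<psi> (f x) $ 2" for x k
  by (simp add: matrix_vector_mult_def transpose_def sum_2)
 have i3: "integrable lborel (%x. F x $ i $ k * (\<phi> x *\<^sub>R ?g x + \<psi> (f x) *\<^sub>R g\<phi> x) $ l)" for i k l
  by (rule integrable_continuous_compact_support[where R=R]) (auto intro!: continuous_intros cF cont simp: van g\<phi>0 simp del: transpose_matrix_vector)
 have null: "(LINT x|lborel. F x $ i $ 1 * (\<phi> x *\<^sub>R ?g x + \<psi> (f x) *\<^sub>R g\<phi> x) $ 2)
   = (LINT x|lborel. F x $ i $ 2 * (\<phi> x *\<^sub>R ?g x + \<psi> (f x) *\<^sub>R g\<phi> x) $ 1)" for i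
  using null_Lagrangian[OF C1_fun_component[OF f, of i] b, of R "axis 1 1" "axis 2 1"] van
  by (simp add: inner_axis)
 consider "j = 1" | "j = 2" using exhaust_2 by auto
 then have "(LINT x|lborel. \<phi> x * g\<psi> (f x) $ j * det (F x) + \<psi> (f x) * (cofactor2 (F x) $ j \<bullet> g\<phi> x)) = 0"
 proof cases
  case 1
  have "(LINT x|lborel. \<phi> x * g\<psi> (f x) $ j * det (F x) + \<psi> (f x) * (cofactor2 (F x) $ j \<bullet> g\<phi> x))
   = (LINT x|lborel. F x $ 2 $ 2 * (\<phi> x *\<^sub>R ?g x + \<psi> (f x) *\<^sub>R g\<phi> x) $ 1 - F x $ 2 $ 1 * (\<phi> x *\<^sub>R ?g x + \<psi> (f x) *\<^sub>R g\<phi> x) $ 2)"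
   by (rule LINT_cong) (simp_all add: 1 tr inner_2 det_2 cofactor2_entries algebra_simps del: transpose_matrix_vector)
  then show ?thesis using null[of 2] i3 by simp
 next
  case 2
  have "(LINT x|lborel. \<phi> x * g\<psi> (f x) $ j * det (F x) + \<psi> (f x) * (cofactor2 (F x) $ j \<bullet> g\<phi> x))
   = (LINT x|lborel. F x $ 1 $ 1 * (\<phi> x *\<^sub>R ?g x + \<psi> (f x) *\<^sub>R g\<phi> x) $ 2 - F x $ 1 $ 2 * (\<phi> x *\<^sub>R ?g x + \<psi> (f x) *\<^sub>R g\<phi> x) $ 1)"
   by (rule LINT_cong) (simp_all add: 2 tr inner_2 det_2 cofactor2_entries algebra_simps del: transpose_matrix_vector)
  then show ?thesis using null[of 1] i3 by simp
 qed
 then show ?thesis using i1 i2 by simp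
qed

section \<open>Passing to the limit in smooth approximations\<close>

text \<open>Young's inequality with exponents 3/2 and 3, from comparing \<open>e\<close> with
  \<open>\<rho> * a\<close>; it takes the place of Hoelder's inequality for three cubically
  integrable factors.\<close>

lemma cube_absorb: "a^2 * e <= \<rho> * a^3 + (1 / \<rho>^2) * e^3" if "\<rho> > 0" "a >= 0" "e >= 0" for a e \<rho> :: real
proof (cases "e <= \<rho> * a")
 case True
 have "a^2 * e <= a^2 * (\<rho> * a)" using True by (intro mult_left_mono) auto
 also have "... = \<rho> * a^3" by (simp add: power2_eq_square power3_eq_cube)
 also have "0 <= (1 / \<rho>^2) * e^3" using that by simp
 then have "\<rho> * a^3 <= \<rho> * a^3 + (1 / \<rho>^2) * e^3" by simp
 finally show ?thesis .
next
 case False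
 then have "a <= e / \<rho>" using that by (simp add: field_simps)
 then have "a^2 * e <= (e / \<rho>)^2 * e" using that by (intro mult_right_mono power_mono) auto
 also have "... = (1 / \<rho>^2) * e^3" by (simp add: power_divide power2_eq_square power3_eq_cube)
 also have "0 <= \<rho> * a^3" using that by simp
 then have "(1 / \<rho>^2) * e^3 <= \<rho> * a^3 + (1 / \<rho>^2) * e^3" by simp
 finally show ?thesis .
qed

lemma square_absorb: "a * e + e^2 <= 2 * \<rho> * a^3 + (2 / \<rho>^2 + 1) * e^3" if "\<rho> > 0" "a >= 1" "e >= 0" for a e \<rho> :: real
proof -
 have "a * 1 <= a * a" using that by (intro mult_left_mono) auto
 then have ae: "a * e <= a^2 * e" using that by (simp add: power2_eq_square mult_right_mono)
 have e2: "e^2 <= a^2 * e + e^3"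
 proof (cases "e <= a")
  case True
  have "e * e <= a * e" using True that by (intro mult_right_mono) auto
  moreover have "0 <= e ^ 3" using that by simp
  ultimately show ?thesis using ae unfolding power2_eq_square by linarith
 next
  case False
  have "e^2 * 1 <= e^2 * e" using False that by (intro mult_left_mono) auto
  moreover have "0 <= a^2 * e" using that by simp
  moreover have "e^2 * e = e ^ 3" by (simp add: power2_eq_square power3_eq_cube)
  ultimately show ?thesis by linarith
 qed
 have c: "a^2 * e <= \<rho> * a^3 + (1 / \<rho>^2) * e^3" using that by (intro cube_absorb) auto
 have "a * e + e^2 <= 2 * (a^2 * e) + e^3" using ae e2 by linarith
 also have "... <= 2 * (\<rho> * a^3 + (1 / \<rho>^2) * e^3) + e^3" using c by (intro add_right_mono mult_left_mono) auto
 also have "... = 2 * \<rho> * a^3 + (2 / \<rho>^2 + 1) * e^3" by (simp add: algebra_simps)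
 finally show ?thesis .
qed

text \<open>For an integrand of quadratic growth in the gradient, \<open>square_absorb\<close>
  splits the change into a small multiple of \<open>(1 + norm (D x)) ^ 3\<close>, integrable on the
  compact set, and a large multiple of the cubed error, which tends to zero in the mean.\<close>

lemma limit_integral:
 fixes D :: "'a::euclidean_space => 'b::euclidean_space"
 assumes K: "compact K" and D: "D : borel_measurable borel" "integrable lborel (%x. norm (D x) ^ 3)"
  and F: "!!n. integrable lborel (%x. indicator K x * norm (F n x - D x) ^ 3)"
   "!!n. (LINT x|lborel. indicator K x * norm (F n x - D x) ^ 3) < 1 / real (Suc n)"
  and X: "!!n. X n : borel_measurable borel" "Y : borel_measurable borel"
   "!!n x. x ~: K ==> X n x = 0" "!!x. x ~: K ==> Y x = 0"
  and C: "C >= 0" and Yb: "!!x. x : K ==> \<bar>Y x\<bar> <= C * (1 + norm (D x))^2"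
  and close: "!!\<eta>. \<eta> > 0 ==> \<forall>\<^sub>F n in sequentially. \<forall>x\<in>K. \<bar>X n x - Y x\<bar> <=
   C * ((1 + norm (D x)) * norm (F n x - D x) + (norm (F n x - D x))^2) + \<eta> * (1 + norm (D x))^2"
 shows "integrable lborel Y" "(%n. LINT x|lborel. X n x) \<longlonglongrightarrow> (LINT x|lborel. Y x)"
proof -
 note [measurable] = D(1) X(1,2)
 have Kb [measurable]: "K : sets borel" using K by (simp add: borel_compact)
 let ?a = "%x. indicator K x * (1 + norm (D x)) ^ 3"
 have ia: "integrable lborel ?a"
 proof (rule LINT_bound)
  show "integrable lborel (%x. 4 * (indicator K x + norm (D x) ^ 3))"
   using D(2) emeasure_bounded_finite[OF compact_imp_bounded[OF K]]
   by (intro integrable_mult_right LINT_add integrable_real_indicator) auto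
  have "(1 + norm (D x)) ^ 3 <= 4 * (1 + norm (D x) ^ 3)" for x
   using norm_add_cube[of 1 "norm (D x)"] by simp
  then show "AE x in lborel. norm (?a x) <= norm (4 * (indicator K x + norm (D x) ^ 3))"
   by (intro AE_I2) (auto simp: indicator_def)
 qed measurable
 have a23: "(1 + norm (D x))^2 <= (1 + norm (D x)) ^ 3" for x
  by (intro power_increasing) auto
 show iY: "integrable lborel Y"
 proof (rule LINT_bound)
  show "integrable lborel (%x. C * ?a x)" using ia by simp
  have "\<bar>Y x\<bar> <= C * ?a x" for x
  proof (cases "x : K")
   case True
   then show ?thesis using Yb[OF True] mult_left_mono[OF a23 C, of x] by simp
  qed (simp add: X(4))
  then show "AE x in lborel. norm (Y x) <= norm (C * ?a x)" by (auto intro: order_trans[OF _ abs_ge_self])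
 qed measurable
 define I where "I = (LINT x|lborel. ?a x)"
 have I: "I >= 0" unfolding I_def by (intro LINT_nonneg) auto
 show "(%n. LINT x|lborel. X n x) \<longlonglongrightarrow> (LINT x|lborel. Y x)"
  unfolding tendsto_iff
 proof (intro allI impI)
  fix t :: real assume t: "t > 0"
  \<comment> \<open>\<rho> and \<eta> are chosen so that their contributions and the one of the
    approximation error are each at most \<open>t / 4\<close>.\<close>
  define \<rho> where "\<rho> = t / (8 * (C + 1) * (I + 1))"
  define \<eta> where "\<eta> = t / (4 * (I + 1))"
  have \<rho>: "\<rho> > 0" "C * (2 * \<rho>) * I <= t / 4"
  proof -
   show "\<rho> > 0" using t C I by (simp add: \<rho>_def)
   have "C * (2 * \<rho>) * I <= (C + 1) * (2 * \<rho>) * (I + 1)" using C I \<open>\<rho> > 0\<close> by (intro mult_mono) auto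
   also have "... = t / 4"
   proof -
    have "p * (2 * (t / (8 * p * q))) * q = t / 4" if "p ~= 0" "q ~= 0" for p q :: real
     using that by (simp add: field_simps)
    from this[of "C + 1" "I + 1"] show ?thesis using C I unfolding \<rho>_def by simp
   qed
   finally show "C * (2 * \<rho>) * I <= t / 4" .
  qed
  have \<eta>: "\<eta> > 0" "\<eta> * I <= t / 4"
  proof -
   show "\<eta> > 0" using t I by (simp add: \<eta>_def)
   have "\<eta> * I <= \<eta> * (I + 1)" using \<open>\<eta> > 0\<close> by simp
   also have "... = t / 4" using I by (simp add: \<eta>_def divide_simps)
   finally show "\<eta> * I <= t / 4" .
  qed
  define c where "c = C * (2 / \<rho>^2 + 1)"
  have c: "c >= 0" using C by (simp add: c_def)
  have "(%n. c * (1 / real (Suc n))) \<longlonglongrightarrow> c * 0"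
   using LIMSEQ_inverse_real_of_nat by (intro tendsto_mult tendsto_const) (simp add: inverse_eq_divide)
  then have ev: "\<forall>\<^sub>F n in sequentially. c * (1 / real (Suc n)) < t / 4"
   using t by (intro order_tendstoD(2)) auto
  show "\<forall>\<^sub>F n in sequentially. dist (LINT x|lborel. X n x) (LINT x|lborel. Y x) < t"
   using close[OF \<eta>(1)] ev
  proof eventually_elim
   case (elim n)
   let ?e = "%x. norm (F n x - D x)"
   let ?w = "%x. (C * (2 * \<rho>) + \<eta>) * ?a x + c * (indicator K x * ?e x ^ 3)"
   have iw: "integrable lborel ?w" using ia F(1)[of n] by simp
   have pt: "\<bar>X n x - Y x\<bar> <= ?w x" for x
   proof (cases "x : K")
    case True
    have "\<bar>X n x - Y x\<bar> <= C * ((1 + norm (D x)) * ?e x + (?e x)^2) + \<eta> * (1 + norm (D x))^2"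
     using elim(1) True by blast
    also have "... <= C * (2 * \<rho> * (1 + norm (D x)) ^ 3 + (2 / \<rho>^2 + 1) * ?e x ^ 3) + \<eta> * (1 + norm (D x)) ^ 3"
     using C \<eta>(1) \<rho>(1) by (intro add_mono mult_left_mono square_absorb a23) auto
    also have "... = ?w x" using True by (simp add: c_def algebra_simps)
    finally show ?thesis .
   qed (simp add: X)
   have iX: "integrable lborel (X n)"
   proof -
    have "integrable lborel (%x. X n x - Y x)"
     using pt by (intro LINT_bound[OF iw]) (auto intro: order_trans[OF _ abs_ge_self])
    from LINT_add[OF this iY] show ?thesis by simp
   qed
   have "\<bar>(LINT x|lborel. X n x) - (LINT x|lborel. Y x)\<bar> = \<bar>LINT x|lborel. X n x - Y x\<bar>"
    using iX iY by simp
   also have "... <= (LINT x|lborel. \<bar>X n x - Y x\<bar>)" by (rule integral_abs_bound)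
   also have "... <= (LINT x|lborel. ?w x)"
    using iX iY iw pt by (intro integral_mono) auto
   also have "... = (C * (2 * \<rho>) + \<eta>) * I + c * (LINT x|lborel. indicator K x * ?e x ^ 3)"
    using ia F(1)[of n] by (simp add: I_def)
   also have "... <= (C * (2 * \<rho>) + \<eta>) * I + c * (1 / real (Suc n))"
    using c F(2)[of n] by (intro add_left_mono mult_left_mono) auto
   also have "... = C * (2 * \<rho>) * I + \<eta> * I + c * (1 / real (Suc n))" by (simp add: distrib_right)
   also have "... < t" using \<rho>(2) \<eta>(2) elim(2) t by linarith
   finally show ?case by (simp add: dist_real_def)
  qed
 qed
qed

section \<open>Weak gradients: uniqueness and chain rule\<close>

lemma lebesgue_on_lborel:
 fixes f :: "'a::euclidean_space => 'b::euclidean_space"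
 assumes [measurable]: "S : sets borel" "f : borel_measurable borel"
 shows "integrable (lebesgue_on S) f \<longleftrightarrow> integrable lborel (%x. indicator S x *\<^sub>R f x)"
  "integral\<^sup>L (lebesgue_on S) f = (LINT x|lborel. indicator S x *\<^sub>R f x)"
proof -
 have S: "S \<inter> space lebesgue : sets lebesgue" by simp
 show "integrable (lebesgue_on S) f \<longleftrightarrow> integrable lborel (%x. indicator S x *\<^sub>R f x)"
  using integrable_restrict_space[OF S, of f] by (simp add: integrable_completion)
 show "integral\<^sup>L (lebesgue_on S) f = (LINT x|lborel. indicator S x *\<^sub>R f x)"
  using integral_restrict_space[OF S, of f] by (simp add: integral_completion)
qed

lemma test_function_vanish:
 assumes "test_function S \<phi>"
 obtains K where "compact K" "K <= S" "!!x. x ~: K ==> \<phi> x = 0"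
 using assms closure_subset[of "{x. \<phi> x ~= 0}"] unfolding test_function_def
 by (metis (mono_tags, lifting) mem_Collect_eq subsetD)

lemma test_function_Ck: "test_function S \<phi> ==> Ck_on k UNIV \<phi>"
 by (simp add: test_function_def smooth_on_def)

lemma test_function_C1_fun: "test_function S \<phi> ==> C1_fun \<phi> (grad \<phi>)"
 unfolding C1_fun_def using Ck_on_imp_C1[OF test_function_Ck[of S \<phi> "Suc 0"]] by blast

lemma test_function_frechet:
 assumes "test_function S \<phi>" shows "frechet_derivative \<phi> (at x) h = grad \<phi> x \<bullet> h"
 using test_function_C1_fun[OF assms] unfolding C1_fun_def by (metis frechet_derivative_at)

lemma C1_fun_vanish_outside:
 assumes a: "C1_fun a ga" and "closed K" "!!x. x ~: K ==> a x = 0" "x ~: K"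
 shows "ga x = 0"
proof -
 have "(a has_derivative (%h. 0)) (at x)"
  by (rule has_derivative_transform_within_open[of "%x. 0" _ _ UNIV "- K"]) (use assms in auto)
 moreover have "(a has_derivative (%h. ga x \<bullet> h)) (at x)" using a by (simp add: C1_fun_def)
 ultimately have "(%h. ga x \<bullet> h) = (%h. 0)" by (rule has_derivative_unique[rotated])
 then have "ga x \<bullet> ga x = 0" by (rule fun_cong)
 then show ?thesis by simp
qed

text \<open>Mollified indicators of the box are admissible test functions and converge to the
  indicator off the frontier of the box, a null set, under the common bound 2.\<close>

lemma integral_box_zero:
 fixes h :: "'a::euclidean_space => real"
 assumes \<Omega>: "open \<Omega>" and h: "!!K. compact K ==> K <= \<Omega> ==> integrable (lebesgue_on K) h"
  and z: "!!\<phi>. test_function \<Omega> \<phi> ==> (LINT x|lebesgue_on \<Omega>. h x * \<phi> x) = 0"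
  and sub: "cbox a b <= \<Omega>"
 shows "integral (cbox a b) h = 0"
proof -
 obtain e K' where K': "e > 0" "compact K'" "K' <= \<Omega>" "!!x y. x : cbox a b ==> norm (x - y) <= e ==> y : K'"
  by (rule compact_neighbourhood[OF compact_cbox sub \<Omega>]) blast
 let ?i = "indicator (cbox a b) :: 'a => real"
 have ii: "integrable lborel ?i" by (rule integrable_real_indicator) (auto simp: emeasure_lborel_cbox_eq)
 define r where "r n = e / real (Suc n)" for n
 have r: "0 < r n" "r n <= e" for n using K'(1) by (auto simp: r_def field_simps)
 have r0: "r \<longlonglongrightarrow> 0" unfolding r_def[abs_def]
  using tendsto_mult[OF tendsto_const[of e] LIMSEQ_inverse_real_of_nat] by (simp add: divide_inverse)
 define \<phi> where "\<phi> n = conv (mollifier (r n)) ?i" for n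
 have van: "?i y = 0" if "x ~: K'" "norm (x - y) <= r n" for x y n
  using K'(4)[of y x] that r(2)[of n] by (auto simp: indicator_def norm_minus_commute)
 have \<phi>: "test_function \<Omega> (\<phi> n)" "!!x. x ~: K' ==> \<phi> n x = 0" for n
  unfolding \<phi>_def by (rule test_function_conv[OF ii r(1) K'(2,3) van]; simp)+
 have b: "\<bar>\<phi> n x\<bar> <= 2" for n x
 proof -
  have "norm (\<phi> n x - ?i x) <= 1"
   unfolding \<phi>_def by (rule mollification_close[OF ii r(1)]) (auto simp: indicator_def)
  then show ?thesis by (cases "x : cbox a b") auto
 qed
 have c\<phi>: "continuous_on UNIV (\<phi> n)" for n using test_function_Ck[OF \<phi>(1), of 0] by simp
 have hK: "integrable (lebesgue_on K') h" by (rule h[OF K'(2,3)])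
 have K'm: "K' : sets lebesgue" "K' : sets borel" using K'(2) by (auto simp: borel_compact)
 have int0: "(LINT x|lebesgue_on K'. h x * \<phi> n x) = 0" for n
 proof -
  have "(LINT x|lebesgue_on \<Omega>. h x * \<phi> n x) = (LINT x|lebesgue. indicator \<Omega> x *\<^sub>R (h x * \<phi> n x))"
   using \<Omega> by (intro integral_restrict_space) auto
  also have "... = (LINT x|lebesgue. indicator K' x *\<^sub>R (h x * \<phi> n x))"
   using \<phi>(2) K'(3) by (intro LINT_cong) (auto simp: indicator_def)
  also have "... = (LINT x|lebesgue_on K'. h x * \<phi> n x)"
   using K'm by (intro integral_restrict_space[symmetric]) auto
  finally show ?thesis using z[OF \<phi>(1)] by simp
 qed
 have "(%n. LINT x|lebesgue_on K'. h x * \<phi> n x) \<longlonglongrightarrow> (LINT x|lebesgue_on K'. h x * ?i x)"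
 proof (rule integral_dominated_convergence)
  have hm [measurable]: "h : borel_measurable (lebesgue_on K')" using hK by (auto dest: borel_measurable_integrable)
  have "\<phi> n : borel_measurable (lebesgue_on K')" for n
   using borel_measurable_continuous_onI[OF c\<phi>, of n] by (simp add: measurable_completion measurable_restrict_space1)
  then show "(%x. h x * \<phi> n x) : borel_measurable (lebesgue_on K')" for n by (intro borel_measurable_times hm)
  have "?i : borel_measurable (lebesgue_on K')"
   by (simp add: measurable_completion measurable_restrict_space1)
  then show "(%x. h x * ?i x) : borel_measurable (lebesgue_on K')" by (intro borel_measurable_times hm)
  show "integrable (lebesgue_on K') (%x. 2 * \<bar>h x\<bar>)" using hK by simp
  show "AE x in lebesgue_on K'. norm (h x * \<phi> n x) <= 2 * \<bar>h x\<bar>" for n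
  proof (rule AE_I2)
   fix x show "norm (h x * \<phi> n x) <= 2 * \<bar>h x\<bar>"
    using mult_left_mono[OF b[of n x], of "\<bar>h x\<bar>"] by (simp add: abs_mult mult.commute)
  qed
  have lim: "(%n. h x * \<phi> n x) \<longlonglongrightarrow> h x * ?i x" if x: "x ~: frontier (cbox a b)" for x
  proof -
   have "\<exists>d>0. \<forall>y. norm (x - y) < d --> ?i y = ?i x"
   proof (cases "x : cbox a b")
    case True
    then have "x : box a b" using x by (auto simp: frontier_cbox)
    then obtain d where "d > 0" "ball x d <= box a b" using open_box open_contains_ball by blast
    then show ?thesis using True box_subset_cbox[of a b]
     by (intro exI[of _ d]) (auto simp: indicator_def dist_norm subset_iff)
   next
    case False
    then obtain d where "d > 0" "ball x d <= - cbox a b" using open_contains_ball[of "- cbox a b"] by auto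
    then show ?thesis using False by (intro exI[of _ d]) (auto simp: indicator_def dist_norm subset_iff)
   qed
   then obtain d where d: "d > 0" "!!y. norm (x - y) < d ==> ?i y = ?i x" by blast
   have "\<forall>\<^sub>F n in sequentially. r n < d" using r0 d(1) by (rule order_tendstoD(2))
   then have "\<forall>\<^sub>F n in sequentially. h x * \<phi> n x = h x * ?i x"
   proof eventually_elim
    case (elim n)
    have "norm (\<phi> n x - ?i x) <= 0"
     unfolding \<phi>_def using d(2) elim by (intro mollification_close[OF ii r(1)]) auto
    then show ?case by simp
   qed
   then show ?thesis by (rule tendsto_eventually)
  qed
  have "AE x in lebesgue. x ~: frontier (cbox a b)"
   using negligible_convex_frontier[OF convex_box(1), of a b] by (intro AE_not_in) (simp add: negligible_iff_null_sets)
  then have "AE x in lebesgue_on K'. x ~: frontier (cbox a b)"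
   using K'm by (subst AE_restrict_space_iff) auto
  then show "AE x in lebesgue_on K'. (%n. h x * \<phi> n x) \<longlonglongrightarrow> h x * ?i x"
   using lim by (auto elim: eventually_mono)
 qed
 then have "(LINT x|lebesgue_on K'. h x * ?i x) = 0" using int0 by (simp add: LIMSEQ_const_iff)
 moreover have "(LINT x|lebesgue_on K'. h x * ?i x) = (LINT x|lebesgue_on (cbox a b). h x)"
 proof -
  have "cbox a b <= K'" using K'(4) K'(1) by (intro subsetI) (simp add: less_imp_le)
  then have "(LINT x|lebesgue. indicator K' x *\<^sub>R (h x * ?i x)) = (LINT x|lebesgue. indicator (cbox a b) x *\<^sub>R h x)"
   by (intro LINT_cong) (auto simp: indicator_def)
  then show ?thesis using K'm by (simp add: integral_restrict_space)
 qed
 moreover have "(LINT x|lebesgue_on (cbox a b). h x) = integral (cbox a b) h"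
  by (rule lebesgue_integral_eq_integral[OF h[OF compact_cbox sub]]) simp
 ultimately show ?thesis by simp
qed

text \<open>Vanishing integrals over boxes force a vanishing Lebesgue derivative almost everywhere.
  The exhaustion by compact sets makes each truncated function globally integrable, and a small box
  at an interior point does not see the truncation.\<close>

lemma du_Bois_Reymond:
 fixes h :: "'a::euclidean_space => real"
 assumes \<Omega>: "open \<Omega>" and h: "!!K. compact K ==> K <= \<Omega> ==> integrable (lebesgue_on K) h"
  and z: "!!\<phi>. test_function \<Omega> \<phi> ==> (LINT x|lebesgue_on \<Omega>. h x * \<phi> x) = 0"
 shows "AE x in lebesgue_on \<Omega>. h x = 0"
proof -
 obtain C where C: "!!n::nat. compact (C n)" "!!n. C n <= \<Omega>" "!!n. C n <= interior (C (Suc n))" "\<Union>(range C) = \<Omega>"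
  by (rule open_Union_compact_subsets[OF \<Omega>]) blast
 have "\<exists>N. negligible N & (\<forall>x. x : interior (C n) --> x ~: N --> h x = 0)" (is "\<exists>N. ?N n N") for n
 proof -
  let ?h = "%x. if x : C n then h x else 0"
  have "h integrable_on C n"
   using h[OF C(1,2)] C(1) by (intro integrable_on_lebesgue_on) (auto simp: borel_compact)
  then have hU: "?h integrable_on UNIV" by (simp add: integrable_restrict_UNIV)
  have i: "?h integrable_on cbox a b" for a b by (rule integrable_on_subcbox[OF hU]) simp
  obtain N where N: "negligible N"
   "!!x e. x ~: N ==> 0 < e ==> \<exists>d>0. \<forall>r. 0 < r & r < d -->
     norm (integral (cbox x (x + r *\<^sub>R \<Sum>Basis)) ?h /\<^sub>R r ^ DIM('a) - ?h x) < e"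
   by (rule integrable_ccontinuous_explicit[OF i]) blast
  have "h x = 0" if x: "x : interior (C n)" "x ~: N" for x
  proof (rule ccontr)
   assume hx: "h x ~= 0"
   have xC: "x : C n" using x(1) interior_subset by blast
   obtain d where d: "d > 0" "!!r. 0 < r ==> r < d ==>
     norm (integral (cbox x (x + r *\<^sub>R \<Sum>Basis)) ?h /\<^sub>R r ^ DIM('a) - ?h x) < \<bar>h x\<bar>"
    using N(2)[OF x(2), of "\<bar>h x\<bar>"] hx by auto
   obtain e where e: "e > 0" "cball x e <= C n"
    using x(1) mem_interior_cball by blast
   define r where "r = min (d / 2) (e / (norm (\<Sum>Basis :: 'a) + 1))"
   have r: "0 < r" "r < d" using d(1) e(1) by (auto simp: r_def intro!: divide_pos_pos add_nonneg_pos)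
   have "cbox x (x + r *\<^sub>R \<Sum>Basis) <= cball x e"
   proof
    fix y assume y: "y : cbox x (x + r *\<^sub>R \<Sum>Basis)"
    have "norm (y - x) <= norm (r *\<^sub>R (\<Sum>Basis :: 'a))"
     using y by (intro norm_le_componentwise) (auto simp: mem_box algebra_simps)
    also have "... <= r * (norm (\<Sum>Basis :: 'a) + 1)" using r by (simp add: mult_left_mono)
    also have "... <= e / (norm (\<Sum>Basis :: 'a) + 1) * (norm (\<Sum>Basis :: 'a) + 1)"
     by (intro mult_right_mono) (auto simp: r_def)
    also have "... = e" using norm_ge_zero[of "\<Sum>Basis :: 'a"] by (simp add: add_nonneg_eq_0_iff)
    finally show "y : cball x e" by (simp add: dist_norm norm_minus_commute)
   qed
   then have sub: "cbox x (x + r *\<^sub>R \<Sum>Basis) <= C n" using e(2) by blast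
   have "integral (cbox x (x + r *\<^sub>R \<Sum>Basis)) ?h = integral (cbox x (x + r *\<^sub>R \<Sum>Basis)) h"
    using sub by (intro integral_cong) auto
   also have "... = 0" using sub C(2)[of n] by (intro integral_box_zero[OF \<Omega> h z]) auto
   finally show False using d(2)[OF r] xC by simp
  qed
  then show ?thesis using N(1) by blast
 qed
 then have "\<forall>n. \<exists>N. ?N n N" by blast
 from choice[OF this] obtain N where N: "!!n. negligible (N n)" "!!n x. x : interior (C n) ==> x ~: N n ==> h x = 0"
  by blast
 have neg: "negligible (\<Union>n. N n)"
  using N(1) by (intro negligible_countable_Union) auto
 have "h x = 0" if "x : \<Omega>" "x ~: (\<Union>n. N n)" for x
 proof -
  have "x : \<Union>(range C)" using that(1) C(4) by simp
  then obtain n where "x : C n" by blast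
  then have "x : interior (C (Suc n))" using C(3) by blast
  then show ?thesis using N(2) that(2) by blast
 qed
 moreover have "AE x in lebesgue. x ~: (\<Union>n. N n)"
  using neg by (intro AE_not_in) (simp add: negligible_iff_null_sets)
 ultimately have "AE x in lebesgue. x : \<Omega> --> h x = 0" by (auto elim: eventually_mono)
 then show ?thesis using \<Omega> by (subst AE_restrict_space_iff) auto
qed

lemma Lp_on_1_component:
 fixes G :: "'a::euclidean_space => real^'n^'m"
 assumes "Lp_on 1 K G"
 shows "integrable (lebesgue_on K) (%x. G x $ i $ j)"
proof (rule integral_mat_nth(2))
 show "integrable (lebesgue_on K) G"
  using assms unfolding Lp_on_def by (subst integrable_norm_iff[symmetric]) auto
qed

text \<open>\<open>weak_gradient\<close> is selected by \<open>SOME\<close>; every gradient obtained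
  by computation is connected with it only through this uniqueness.\<close>

lemma weak_gradient_unique:
 fixes w :: "real^'n => real^'m"
 assumes \<Omega>: "open \<Omega>" and G: "has_weak_gradient \<Omega> w G" "has_weak_gradient \<Omega> w H"
 shows "AE x in lebesgue_on \<Omega>. G x = H x"
proof -
 have "AE x in lebesgue_on \<Omega>. G x $ i $ j - H x $ i $ j = 0" for i j
 proof (rule du_Bois_Reymond[OF \<Omega>])
  have GH: "integrable (lebesgue_on K) (%x. G x $ i $ j)" "integrable (lebesgue_on K) (%x. H x $ i $ j)"
   if "compact K" "K <= \<Omega>" for K
   using G that by (auto simp: has_weak_gradient_def Lp_loc_on_def intro!: Lp_on_1_component)
  then show "integrable (lebesgue_on K) (%x. G x $ i $ j - H x $ i $ j)" if "compact K" "K <= \<Omega>" for K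
   using that by simp
  fix \<phi> :: "real^'n => real" assume \<phi>: "test_function \<Omega> \<phi>"
  obtain K where K: "compact K" "K <= \<Omega>" "!!x. x ~: K ==> \<phi> x = 0"
   by (rule test_function_vanish[OF \<phi>]) blast
  have c: "continuous_on UNIV \<phi>" using test_function_Ck[OF \<phi>, of 0] by simp
  have Km: "K : sets lebesgue" using K(1) by (auto simp: borel_compact)
  obtain R where R: "!!x. norm x > R ==> x ~: K"
   using compact_imp_bounded[OF K(1)] unfolding bounded_iff by (meson not_le)
  obtain B where B: "!!x. norm (\<phi> x) <= B"
   by (rule compact_support_bounded[OF c, of R]) (use K(3) R in blast)+
  have i: "integrable (lebesgue_on \<Omega>) (%x. g x * \<phi> x)" if g: "integrable (lebesgue_on K) g" for g
  proof -
   have "integrable (lebesgue_on K) (%x. g x * \<phi> x)"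
   proof (rule LINT_bound)
    show "integrable (lebesgue_on K) (%x. B * g x)" using g by simp
    have "\<phi> : borel_measurable (lebesgue_on K)"
     using borel_measurable_continuous_onI[OF c] by (simp add: measurable_completion measurable_restrict_space1)
    then show "(%x. g x * \<phi> x) : borel_measurable (lebesgue_on K)"
     using g by (intro borel_measurable_times) (auto dest: borel_measurable_integrable)
    have "norm (g x * \<phi> x) <= norm (B * g x)" for x
     using mult_left_mono[OF B[of x], of "\<bar>g x\<bar>"] B[of x] by (auto simp: abs_mult mult.commute)
    then show "AE x in lebesgue_on K. norm (g x * \<phi> x) <= norm (B * g x)" by simp
   qed
   then have "integrable lebesgue (%x. indicator K x *\<^sub>R (g x * \<phi> x))" using Km by (simp add: integrable_restrict_space)
   moreover have "(%x. indicator K x *\<^sub>R (g x * \<phi> x)) = (%x. indicator \<Omega> x *\<^sub>R (g x * \<phi> x))"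
    using K(2,3) by (auto simp: indicator_def fun_eq_iff)
   ultimately show ?thesis using \<Omega> by (simp add: integrable_restrict_space)
  qed
  have "(LINT x|lebesgue_on \<Omega>. G x $ i $ j * \<phi> x) = (LINT x|lebesgue_on \<Omega>. H x $ i $ j * \<phi> x)"
  proof -
   have "- (LINT x|lebesgue_on \<Omega>. G x $ i $ j * \<phi> x) = - (LINT x|lebesgue_on \<Omega>. H x $ i $ j * \<phi> x)"
    using G \<phi> unfolding has_weak_gradient_def by simp
   then show ?thesis by simp
  qed
  then show "(LINT x|lebesgue_on \<Omega>. (G x $ i $ j - H x $ i $ j) * \<phi> x) = 0"
   using i[OF GH(1)[OF K(1,2)]] i[OF GH(2)[OF K(1,2)]] by (simp add: left_diff_distrib)
 qed
 then have "AE x in lebesgue_on \<Omega>. \<forall>i j. G x $ i $ j - H x $ i $ j = 0"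
  by (simp add: AE_all_countable)
 then show ?thesis by eventually_elim (simp add: vec_eq_iff)
qed

lemma borel_measurable_nth [measurable (raw)]:
 fixes f :: "'a => 'b::topological_space^'n"
 assumes "f : borel_measurable M" shows "(%x. f x $ i) : borel_measurable M"
 by (rule measurable_compose[OF assms]) (intro borel_measurable_continuous_onI continuous_intros)

lemma borel_measurable_matrix_mult [measurable (raw)]:
 fixes f :: "'a => real^'n^'m" and g :: "'a => real^'k^'n"
 assumes "f : borel_measurable M" "g : borel_measurable M"
 shows "(%x. f x ** g x) : borel_measurable M"
proof -
 have "continuous_on UNIV (%p :: (real^'n^'m) \<times> (real^'k^'n). fst p ** snd p)"
  unfolding matrix_matrix_mult_def by (intro continuous_intros)
 from measurable_compose[OF borel_measurable_Pair[OF assms] borel_measurable_continuous_onI[OF this]]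
 show ?thesis by simp
qed

lemma norm_matrix_mult_le: "norm (A ** B) <= 4 * (norm A * norm B)" for A B :: "real^2^2"
proof -
 have "norm x <= norm (x $ 1) + norm (x $ 2)" for x :: "'b::real_normed_vector^2"
  unfolding norm_vec_def using L2_set_le_sum[of UNIV "%i. norm (x $ i)"] by (simp add: sum_2)
 from this[of "A ** B"] this[of "(A ** B) $ 1"] this[of "(A ** B) $ 2"]
 have "norm (A ** B) <= norm ((A ** B) $ 1 $ 1) + norm ((A ** B) $ 1 $ 2) + (norm ((A ** B) $ 2 $ 1) + norm ((A ** B) $ 2 $ 2))"
  by linarith
 then show ?thesis
  using matrix_mult_entry_le[of A B 1 1] matrix_mult_entry_le[of A B 1 2] matrix_mult_entry_le[of A B 2 1] matrix_mult_entry_le[of A B 2 2]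
  by simp
qed

lemma Lp_on_1I:
 fixes f :: "'a::euclidean_space => 'b::euclidean_space"
 assumes K: "compact K" "K <= \<Omega>" and f [measurable]: "(%x. indicator \<Omega> x *\<^sub>R f x) : borel_measurable borel"
  and i: "integrable lborel (%x. indicator K x *\<^sub>R f x)"
 shows "Lp_on 1 K f"
proof -
 let ?f = "%x. indicator \<Omega> x *\<^sub>R f x"
 have Kb [measurable]: "K : sets borel" using K(1) by (simp add: borel_compact)
 have e: "?f x = f x" if "x : K" for x using that K(2) by auto
 have "?f : borel_measurable (lebesgue_on K)"
  using f by (simp add: measurable_completion measurable_restrict_space1)
 moreover have "?f : borel_measurable (lebesgue_on K) \<longleftrightarrow> f : borel_measurable (lebesgue_on K)"
  by (rule measurable_cong) (simp add: e)
 moreover have "integrable (lebesgue_on K) (%x. norm (f x) powr 1)"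
 proof -
  have "integrable lborel (%x. indicator K x *\<^sub>R norm (?f x))"
   by (rule Bochner_Integration.integrable_cong[THEN iffD1, OF refl _ integrable_norm[OF i]])
    (use K(2) in \<open>auto simp: indicator_def\<close>)
  then have "integrable (lebesgue_on K) (%x. norm (?f x))"
   by (rule lebesgue_on_lborel(1)[OF Kb measurable_compose[OF f borel_measurable_norm], THEN iffD2])
  then show ?thesis
   by (rule Bochner_Integration.integrable_cong[THEN iffD1, OF refl, rotated]) (simp add: e)
 qed
 ultimately show ?thesis by (simp add: Lp_on_def)
qed

lemma has_weak_gradientI:
 fixes w :: "real^'n => real^'m" and W :: "real^'n => real^'n^'m"
 assumes \<Omega>: "open \<Omega>"
  and w [measurable]: "(%x. indicator \<Omega> x *\<^sub>R w x) : borel_measurable borel"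
  and W [measurable]: "(%x. indicator \<Omega> x *\<^sub>R W x) : borel_measurable borel"
  and int: "!!K. compact K ==> K <= \<Omega> ==> integrable lborel (%x. indicator K x *\<^sub>R w x)"
   "!!K. compact K ==> K <= \<Omega> ==> integrable lborel (%x. indicator K x *\<^sub>R W x)"
  and weak: "!!\<phi> i j. test_function \<Omega> \<phi> ==>
   (LINT x|lborel. (indicator \<Omega> x *\<^sub>R w x) $ i * frechet_derivative \<phi> (at x) (axis j 1))
    = - (LINT x|lborel. (indicator \<Omega> x *\<^sub>R W x) $ i $ j * \<phi> x)"
 shows "has_weak_gradient \<Omega> w W"
 unfolding has_weak_gradient_def Lp_loc_on_def
proof (intro conjI allI impI)
 fix \<phi> :: "real^'n => real" and i j assume \<phi>: "test_function \<Omega> \<phi>"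
 note C1 = test_function_C1_fun[OF \<phi>]
 have [measurable]: "\<phi> : borel_measurable borel" "grad \<phi> : borel_measurable borel" "\<Omega> : sets borel"
  using C1_fun_continuous[OF C1] C1 \<Omega> by (auto simp: C1_fun_def intro: borel_measurable_continuous_onI)
 have fd: "(%x. frechet_derivative \<phi> (at x) (axis j 1)) : borel_measurable borel"
  by (simp add: test_function_frechet[OF \<phi>])
 have "(LINT x|lebesgue_on \<Omega>. w x $ i * frechet_derivative \<phi> (at x) (axis j 1))
   = (LINT x|lebesgue_on \<Omega>. (indicator \<Omega> x *\<^sub>R w x) $ i * frechet_derivative \<phi> (at x) (axis j 1))"
  by (rule LINT_cong) auto
 also have "... = (LINT x|lborel. indicator \<Omega> x *\<^sub>R ((indicator \<Omega> x *\<^sub>R w x) $ i * frechet_derivative \<phi> (at x) (axis j 1)))"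
  by (rule lebesgue_on_lborel) (simp, intro borel_measurable_times borel_measurable_nth w fd)
 also have "... = (LINT x|lborel. (indicator \<Omega> x *\<^sub>R w x) $ i * frechet_derivative \<phi> (at x) (axis j 1))"
  by (rule LINT_cong) (auto simp: indicator_def)
 also have "... = - (LINT x|lborel. (indicator \<Omega> x *\<^sub>R W x) $ i $ j * \<phi> x)" by (rule weak[OF \<phi>])
 also have "(LINT x|lborel. (indicator \<Omega> x *\<^sub>R W x) $ i $ j * \<phi> x)
   = (LINT x|lborel. indicator \<Omega> x *\<^sub>R ((indicator \<Omega> x *\<^sub>R W x) $ i $ j * \<phi> x))"
  by (rule LINT_cong) (auto simp: indicator_def)
 also have "... = (LINT x|lebesgue_on \<Omega>. (indicator \<Omega> x *\<^sub>R W x) $ i $ j * \<phi> x)"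
  by (rule lebesgue_on_lborel[symmetric]) measurable
 also have "... = (LINT x|lebesgue_on \<Omega>. W x $ i $ j * \<phi> x)"
  by (rule LINT_cong) auto
 finally show "(LINT x|lebesgue_on \<Omega>. w x $ i * frechet_derivative \<phi> (at x) (axis j 1))
  = - (LINT x|lebesgue_on \<Omega>. W x $ i $ j * \<phi> x)" .
qed (use Lp_on_1I[OF _ _ w int(1)] Lp_on_1I[OF _ _ W int(2)] in auto)

lemma C1_fun_compact_support:
 fixes a :: "'a::euclidean_space => real"
 assumes a: "C1_fun a ga" and K: "compact K" "!!x. x ~: K ==> a x = 0"
 shows "\<exists>R B. B > 0 & (\<forall>x. \<bar>a x\<bar> <= B) & (\<forall>x. norm (ga x) <= B) & (\<forall>x. norm x > R --> a x = 0) &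
  (\<forall>x. x ~: K --> ga x = 0)"
proof -
 have ga0: "ga x = 0" if "x ~: K" for x
  by (rule C1_fun_vanish_outside[OF a compact_imp_closed[OF K(1)] K(2) that])
 obtain R where R: "!!x. norm x > R ==> x ~: K"
  using compact_imp_bounded[OF K(1)] unfolding bounded_iff by (meson not_le)
 have c: "continuous_on UNIV a" "continuous_on UNIV ga" using a C1_fun_continuous[OF a] by (auto simp: C1_fun_def)
 obtain B1 where B1: "B1 > 0" "!!x. norm (a x) <= B1"
  by (rule compact_support_bounded[OF c(1), of R]) (use K(2) R in blast)+
 obtain B2 where B2: "B2 > 0" "!!x. norm (ga x) <= B2"
  by (rule compact_support_bounded[OF c(2), of R]) (use ga0 R in blast)+
 have "\<bar>a x\<bar> <= B1 + B2" "norm (ga x) <= B1 + B2" for x using B1(1) B1(2)[of x] B2(1) B2(2)[of x] by simp_all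
 then show ?thesis using B1(1) B2(1) K(2) R ga0 by (intro exI[of _ R] exI[of _ "B1 + B2"]) auto
qed

text \<open>One class contains the weighted determinant, the cofactor, the matrix entries and
  functions of \<open>x\<close> alone, so that a single limit lemma serves them all; the two growth
  conditions are those of \<open>limit_integral\<close>.\<close>

definition quadratic_integrand :: "'a::euclidean_space set => real => ('a => 'b::euclidean_space => real) => bool"
 where "quadratic_integrand K C b \<longleftrightarrow> C >= 0 & (\<forall>x P. x ~: K --> b x P = 0) &
  (\<forall>x P. \<bar>b x P\<bar> <= C * (1 + norm P)^2) &
  (\<forall>x F P. \<bar>b x F - b x P\<bar> <= C * ((1 + norm P) * norm (F - P) + (norm (F - P))^2)) &
  (\<forall>F\<in>borel_measurable borel. (%x. b x (F x)) : borel_measurable borel)"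

lemma quadratic_integrand_linear:
 fixes b :: "'a::euclidean_space => 'b::euclidean_space => real"
 assumes C: "C >= 0" and lin: "!!x. linear (b x)" and b: "!!x P. \<bar>b x P\<bar> <= C * norm P" "!!x P. x ~: K ==> b x P = 0"
  and m: "!!F. F : borel_measurable borel ==> (%x. b x (F x)) : borel_measurable borel"
 shows "quadratic_integrand K C b"
 unfolding quadratic_integrand_def
proof (intro conjI allI impI ballI)
 fix x :: 'a and F P :: 'b
 have "norm P <= (1 + norm P)^2" by (simp add: power2_eq_square algebra_simps)
 then show "\<bar>b x P\<bar> <= C * (1 + norm P)^2" using b(1)[of x P] mult_left_mono[OF _ C] by (meson order_trans)
 have "\<bar>b x F - b x P\<bar> <= C * norm (F - P)" using b(1)[of x "F - P"] linear_diff[OF lin, of x F P] by simp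
 also have "norm (F - P) <= (1 + norm P) * norm (F - P) + (norm (F - P))^2" by (simp add: algebra_simps)
 then have "C * norm (F - P) <= C * ((1 + norm P) * norm (F - P) + (norm (F - P))^2)" by (rule mult_left_mono[OF _ C])
 finally show "\<bar>b x F - b x P\<bar> <= C * ((1 + norm P) * norm (F - P) + (norm (F - P))^2)" .
qed (use C b(2) m in auto)

lemma quadratic_integrand_const:
 assumes C: "C >= 0" and c: "!!x. \<bar>c x\<bar> <= C" "!!x. x ~: K ==> c x = 0" and m: "c : borel_measurable borel"
 shows "quadratic_integrand K C (%x P :: 'b::euclidean_space. c x)"
 unfolding quadratic_integrand_def
proof (intro conjI allI impI ballI)
 fix x and P :: 'b
 have "1 <= (1 + norm P)^2" by (simp add: power2_eq_square algebra_simps)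
 then have "C * 1 <= C * (1 + norm P)^2" by (rule mult_left_mono[OF _ C])
 then show "\<bar>c x\<bar> <= C * (1 + norm P)^2" using c(1)[of x] by simp
qed (use C c(2) m in auto)

section \<open>Limits, Piola identity and chain rule for the Sobolev map\<close>

context planar_Sobolev
begin

abbreviation u0 where "u0 x \<equiv> indicator \<Omega> x *\<^sub>R u x"

lemma u0_borel [measurable]: "u0 : borel_measurable borel"
 using int_u by (auto dest: borel_measurable_integrable)

lemma approx_sequence:
 assumes K: "compact K" "K <= \<Omega>"
 obtains f F where "!!n. C1_map (f n) (F n)" "!!n x. x : K ==> norm (f n x - u x) <= 1 / real (Suc n)"
  "!!n. integrable lborel (%x. indicator K x * norm (F n x - D x) ^ 3)"
  "!!n. (LINT x|lborel. indicator K x * norm (F n x - D x) ^ 3) < 1 / real (Suc n)"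
proof -
 let ?P = "%n f F. C1_map f F & (\<forall>x\<in>K. norm (f x - u x) <= 1 / real (Suc n)) &
  integrable lborel (%x. indicator K x * norm (F x - D x) ^ 3) &
  (LINT x|lborel. indicator K x * norm (F x - D x) ^ 3) < 1 / real (Suc n)"
 have "\<exists>f F. ?P n f F" for n
  by (rule C1_approx[OF K, of "1 / real (Suc n)"]) (simp, blast)
 then have "\<forall>n. \<exists>p. ?P n (fst p) (snd p)" by simp
 from choice[OF this] obtain p where "\<forall>n. ?P n (fst (p n)) (snd (p n))" by blast
 then show ?thesis by (intro that[of "%n. fst (p n)" "%n. snd (p n)"]) auto
qed

text \<open>\<open>h (f n x)\<close> converges uniformly on the compact set, because
  \<open>f n\<close> does and \<open>h\<close> is uniformly continuous on a ball containing all
  values; the gradient enters only through the quadratic integrand, so \<open>limit_integral\<close>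
  applies.\<close>

lemma compose_limit:
 assumes K: "compact K" "K <= \<Omega>"
  and f: "!!n. C1_map (f n) (F n)" "!!n x. x : K ==> norm (f n x - u x) <= 1 / real (Suc n)"
  and F: "!!n. integrable lborel (%x. indicator K x * norm (F n x - D x) ^ 3)"
   "!!n. (LINT x|lborel. indicator K x * norm (F n x - D x) ^ 3) < 1 / real (Suc n)"
  and h: "continuous_on UNIV (h :: real^2 => real)" and b: "quadratic_integrand K C b"
 shows "integrable lborel (%x. h (u0 x) * b x (D x))"
  "(%n. LINT x|lborel. h (f n x) * b x (F n x)) \<longlonglongrightarrow> (LINT x|lborel. h (u0 x) * b x (D x))"
proof -
 have C: "C >= 0" and b0: "!!x P. x ~: K ==> b x P = 0" and bb: "!!x P. \<bar>b x P\<bar> <= C * (1 + norm P)^2"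
  and bd: "!!x F P. \<bar>b x F - b x P\<bar> <= C * ((1 + norm P) * norm (F - P) + (norm (F - P))^2)"
  and bm: "!!F. F : borel_measurable borel ==> (%x. b x (F x)) : borel_measurable borel"
  using b by (auto simp: quadratic_integrand_def)
 have [measurable]: "h : borel_measurable borel" by (rule borel_measurable_continuous_onI[OF h])
 have "compact (u ` K)" using cont_u K by (intro compact_continuous_image) (auto intro: continuous_on_subset)
 then obtain R where R: "!!x. x : K ==> norm (u x) <= R"
  using compact_imp_bounded[of "u ` K"] by (auto simp: bounded_iff)
 have fR: "norm (f n x) <= R + 1" if "x : K" for n x
 proof -
  have "1 / real (Suc n) <= 1" by simp
  then show ?thesis
   using norm_triangle_sub[of "f n x" "u x"] f(2)[OF that, of n] R[OF that] by linarith
 qed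
 obtain B where B: "B > 0" "!!y. norm y <= R + 1 ==> norm (h y) <= B" by (rule C1_bounded_on_ball[OF h]) blast
 have uc: "uniformly_continuous_on (cball 0 (R + 1)) h"
  using h by (intro compact_uniformly_continuous) (auto intro: continuous_on_subset)
 have u0: "u0 x = u x" if "x : K" for x using that K(2) by auto
 have fm [measurable]: "f n : borel_measurable borel" "F n : borel_measurable borel" for n
  using C1_map_continuous[OF f(1)] C1_map_continuous_deriv[OF f(1)] by (auto intro: borel_measurable_continuous_onI)
 have p1: "(%x. h (f n x) * b x (F n x)) : borel_measurable borel" for n
   by (intro borel_measurable_times bm fm) measurable
 have p2: "(%x. h (u0 x) * b x (D x)) : borel_measurable borel"
   by (intro borel_measurable_times bm D_borel) measurable
 have p3: "B * C >= 0" using B(1) C by simp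
 have p4: "\<bar>h (u0 x) * b x (D x)\<bar> <= B * C * (1 + norm (D x))^2" if "x : K" for x
  proof -
   have "\<bar>h (u0 x)\<bar> <= B" using B(2)[of "u x"] R[OF that] u0[OF that] by simp
   then have "\<bar>h (u0 x)\<bar> * \<bar>b x (D x)\<bar> <= B * (C * (1 + norm (D x))^2)"
    using bb B(1) by (intro mult_mono) auto
   then show ?thesis by (simp add: abs_mult mult.assoc)
  qed
 have p5: "\<forall>\<^sub>F n in sequentially. \<forall>x\<in>K. \<bar>h (f n x) * b x (F n x) - h (u0 x) * b x (D x)\<bar> <=
   B * C * ((1 + norm (D x)) * norm (F n x - D x) + (norm (F n x - D x))^2) + \<eta> * (1 + norm (D x))^2"
  if \<eta>: "\<eta> > 0" for \<eta>
 proof -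
  have "\<eta> / (C + 1) > 0" using C \<eta> by simp
  then obtain d where d: "d > 0" "!!y z. norm y <= R + 1 ==> norm z <= R + 1 ==> norm (y - z) < d ==> \<bar>h y - h z\<bar> < \<eta> / (C + 1)"
   using uc unfolding uniformly_continuous_on_def by (force simp: dist_norm)
  have "(%n. 1 / real (Suc n)) \<longlonglongrightarrow> 0" using LIMSEQ_inverse_real_of_nat by (simp add: inverse_eq_divide)
  then have "\<forall>\<^sub>F n in sequentially. 1 / real (Suc n) < d" using d(1) by (rule order_tendstoD(2))
  then show ?thesis
  proof eventually_elim
   case (elim n)
   show ?case
   proof
    fix x assume x: "x : K"
    let ?e = "(1 + norm (D x)) * norm (F n x - D x) + (norm (F n x - D x))^2" and ?a = "(1 + norm (D x))^2"
    have 1: "\<bar>h (f n x)\<bar> * \<bar>b x (F n x) - b x (D x)\<bar> <= B * (C * ?e)"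
     using B fR[OF x, of n] bd by (intro mult_mono) auto
    have "\<bar>h (f n x) - h (u x)\<bar> <= \<eta> / (C + 1)"
     using d(2)[OF fR[OF x, of n], of "u x"] R[OF x] f(2)[OF x, of n] elim by fastforce
    then have "\<bar>h (f n x) - h (u x)\<bar> * \<bar>b x (D x)\<bar> <= \<eta> / (C + 1) * (C * ?a)"
     using bb \<eta> C by (intro mult_mono) auto
    also have "... = (\<eta> * ?a) * (C / (C + 1))" by simp
    also have "... <= (\<eta> * ?a) * 1" using C \<eta> by (intro mult_left_mono) auto
    finally have 2: "\<bar>h (f n x) - h (u x)\<bar> * \<bar>b x (D x)\<bar> <= \<eta> * ?a" by simp
    have "h (f n x) * b x (F n x) - h (u x) * b x (D x) = h (f n x) * (b x (F n x) - b x (D x)) + (h (f n x) - h (u x)) * b x (D x)"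
     by (simp add: algebra_simps)
    then have "\<bar>h (f n x) * b x (F n x) - h (u x) * b x (D x)\<bar> <= \<bar>h (f n x)\<bar> * \<bar>b x (F n x) - b x (D x)\<bar> + \<bar>h (f n x) - h (u x)\<bar> * \<bar>b x (D x)\<bar>"
     by (metis abs_mult abs_triangle_ineq)
    then show "\<bar>h (f n x) * b x (F n x) - h (u0 x) * b x (D x)\<bar> <= B * C * ?e + \<eta> * ?a"
     using 1 2 by (simp add: u0[OF x] mult.assoc)
   qed
  qed
 qed
 show "integrable lborel (%x. h (u0 x) * b x (D x))"
  "(%n. LINT x|lborel. h (f n x) * b x (F n x)) \<longlonglongrightarrow> (LINT x|lborel. h (u0 x) * b x (D x))"
  by (rule limit_integral[OF K(1) D_borel D_int3 F p1 p2 _ _ p3 p4 p5]; simp add: b0)+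
qed

text \<open>Both sides of \<open>Piola_identity\<close> are products of a function of
  \<open>f\<close> and a quadratic integrand supported in \<open>K\<close>, the determinant on one
  side and the linear cofactor on the other; hence the identity survives the limit.\<close>

lemma Piola:
 assumes K: "compact K" "K <= \<Omega>" and \<phi>: "C1_fun \<phi> g\<phi>" "!!x. x ~: K ==> \<phi> x = 0" and \<psi>: "C1_fun \<psi> g\<psi>"
 shows "integrable lborel (%x. \<phi> x * g\<psi> (u0 x) $ j * det (D x))"
  "integrable lborel (%x. \<psi> (u0 x) * (cofactor2 (D x) $ j \<bullet> g\<phi> x))"
  "(LINT x|lborel. \<phi> x * g\<psi> (u0 x) $ j * det (D x)) = - (LINT x|lborel. \<psi> (u0 x) * (cofactor2 (D x) $ j \<bullet> g\<phi> x))"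
proof -
 obtain f F where f: "!!n. C1_map (f n) (F n)" "!!n x. x : K ==> norm (f n x - u x) <= 1 / real (Suc n)"
  "!!n. integrable lborel (%x. indicator K x * norm (F n x - D x) ^ 3)"
  "!!n. (LINT x|lborel. indicator K x * norm (F n x - D x) ^ 3) < 1 / real (Suc n)"
  by (rule approx_sequence[OF K]) blast
 obtain R B where B: "B > 0" "!!x. \<bar>\<phi> x\<bar> <= B" "!!x. norm (g\<phi> x) <= B" "!!x. norm x > R ==> \<phi> x = 0"
  "!!x. x ~: K ==> g\<phi> x = 0" using C1_fun_compact_support[OF \<phi>(1) K(1) \<phi>(2)] by auto
 have [measurable]: "\<phi> : borel_measurable borel" "g\<phi> : borel_measurable borel"
  using C1_fun_continuous[OF \<phi>(1)] \<phi>(1) by (auto simp: C1_fun_def intro: borel_measurable_continuous_onI)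
 have cofm: "(%x. cofactor2 (G x) $ j) : borel_measurable borel" if "G : borel_measurable borel" for G :: "real^2 => real^2^2"
  by (rule measurable_compose[OF that]) (intro borel_measurable_continuous_onI continuous_intros)
 have 1: "quadratic_integrand K (4 * B) (%x (P :: real^2^2). \<phi> x * det P)"
  unfolding quadratic_integrand_def
 proof (intro conjI allI impI ballI)
  fix x and P G :: "real^2^2"
  have "\<bar>\<phi> x\<bar> * \<bar>det P\<bar> <= B * (2 * (1 + norm P)^2)"
   using B(1,2) abs_det_le by (intro mult_mono) auto
  also have "... <= 4 * B * (1 + norm P)^2" using B(1) by simp
  finally show "\<bar>\<phi> x * det P\<bar> <= 4 * B * (1 + norm P)^2" by (simp add: abs_mult)
  have "\<bar>\<phi> x\<bar> * \<bar>det G - det P\<bar> <= B * (4 * ((1 + norm P) * norm (G - P) + (norm (G - P))^2))"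
   using B(1,2) det_diff_le by (intro mult_mono) auto
  also have "\<bar>\<phi> x\<bar> * \<bar>det G - det P\<bar> = \<bar>\<phi> x * det G - \<phi> x * det P\<bar>"
   by (simp add: abs_mult[symmetric] right_diff_distrib)
  also have "B * (4 * ((1 + norm P) * norm (G - P) + (norm (G - P))^2)) = 4 * B * ((1 + norm P) * norm (G - P) + (norm (G - P))^2)"
   by simp
  finally show "\<bar>\<phi> x * det G - \<phi> x * det P\<bar> <= 4 * B * ((1 + norm P) * norm (G - P) + (norm (G - P))^2)" .
 next
  fix G :: "real^2 => real^2^2" assume [measurable]: "G : borel_measurable borel"
  show "(%x. \<phi> x * det (G x)) : borel_measurable borel" unfolding det_2 by measurable
 qed (use B(1) \<phi>(2) in auto)
 have 2: "quadratic_integrand K B (%x P. cofactor2 P $ j \<bullet> g\<phi> x)"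
 proof (rule quadratic_integrand_linear)
  fix x and P :: "real^2^2"
  show "linear (%P. cofactor2 P $ j \<bullet> g\<phi> x)"
   using exhaust_2[of j] by (intro linearI) (auto simp: inner_2 algebra_simps)
  have "\<bar>cofactor2 P $ j \<bullet> g\<phi> x\<bar> <= norm (cofactor2 P $ j) * norm (g\<phi> x)" by (rule Cauchy_Schwarz_ineq2)
  also have "... <= norm P * B" using B(1,3) Finite_Cartesian_Product.norm_nth_le[of "cofactor2 P" j]
   by (intro mult_mono) (auto simp: norm_cofactor2)
  finally show "\<bar>cofactor2 P $ j \<bullet> g\<phi> x\<bar> <= B * norm P" by (simp add: mult.commute)
 next
  fix G :: "real^2 => real^2^2" assume "G : borel_measurable borel"
  note [measurable] = cofm[OF this]
  show "(%x. cofactor2 (G x) $ j \<bullet> g\<phi> x) : borel_measurable borel" by measurable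
 qed (use B in auto)
 have h: "continuous_on UNIV (%y. g\<psi> y $ j)" "continuous_on UNIV \<psi>"
  using \<psi> C1_fun_continuous[OF \<psi>] by (auto simp: C1_fun_def intro!: continuous_intros)
 note l1 = compose_limit[OF K f h(1) 1] and l2 = compose_limit[OF K f h(2) 2]
 show "integrable lborel (%x. \<phi> x * g\<psi> (u0 x) $ j * det (D x))" using l1(1) by (simp add: mult_ac)
 show "integrable lborel (%x. \<psi> (u0 x) * (cofactor2 (D x) $ j \<bullet> g\<phi> x))" using l2(1) .
 have "(LINT x|lborel. g\<psi> (f n x) $ j * (\<phi> x * det (F n x))) = - (LINT x|lborel. \<psi> (f n x) * (cofactor2 (F n x) $ j \<bullet> g\<phi> x))" for n
  using Piola_identity[OF f(1) \<phi>(1) \<psi> B(4), where j=j] by (simp add: mult_ac)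
 then have "(LINT x|lborel. g\<psi> (u0 x) $ j * (\<phi> x * det (D x))) = - (LINT x|lborel. \<psi> (u0 x) * (cofactor2 (D x) $ j \<bullet> g\<phi> x))"
  using LIMSEQ_unique[OF l1(2)] tendsto_minus[OF l2(2)] by simp
 then show "(LINT x|lborel. \<phi> x * g\<psi> (u0 x) $ j * det (D x)) = - (LINT x|lborel. \<psi> (u0 x) * (cofactor2 (D x) $ j \<bullet> g\<phi> x))"
  by (simp add: mult_ac)
qed

text \<open>After integration by parts for the approximations, the matrix product is split into its
  two summands, because \<open>compose_limit\<close> treats one function of \<open>u\<close> times
  one integrand in the gradient.\<close>

lemma chain_rule_test:
 fixes \<phi> :: "real^2 => real"
 assumes v: "C1_map v V" and \<phi>: "test_function \<Omega> \<phi>"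
 shows "(LINT x|lborel. v (u0 x) $ i * frechet_derivative \<phi> (at x) (axis j 1)) = - (LINT x|lborel. (V (u0 x) ** D x) $ i $ j * \<phi> x)"
proof -
 obtain K where K: "compact K" "K <= \<Omega>" "!!x. x ~: K ==> \<phi> x = 0" by (rule test_function_vanish[OF \<phi>]) blast
 note C1 = test_function_C1_fun[OF \<phi>]
 obtain f F where f: "!!n. C1_map (f n) (F n)" "!!n x. x : K ==> norm (f n x - u x) <= 1 / real (Suc n)"
  "!!n. integrable lborel (%x. indicator K x * norm (F n x - D x) ^ 3)"
  "!!n. (LINT x|lborel. indicator K x * norm (F n x - D x) ^ 3) < 1 / real (Suc n)"
  by (rule approx_sequence[OF K(1,2)]) blast
 obtain R B where B: "B > 0" "!!x. \<bar>\<phi> x\<bar> <= B" "!!x. norm (grad \<phi> x) <= B" "!!x. norm x > R ==> \<phi> x = 0"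
  "!!x. x ~: K ==> grad \<phi> x = 0" using C1_fun_compact_support[OF C1 K(1,3)] by auto
 have c: "continuous_on UNIV \<phi>" "continuous_on UNIV (grad \<phi>)" using C1_fun_continuous[OF C1] C1 by (auto simp: C1_fun_def)
 have [measurable]: "\<phi> : borel_measurable borel" "grad \<phi> : borel_measurable borel"
  using c by (auto intro: borel_measurable_continuous_onI)
 have cv: "continuous_on UNIV (%y. v y $ i)" "continuous_on UNIV (%y. V y $ i $ k)" for k
  using C1_map_continuous[OF v] C1_map_continuous_deriv[OF v] by (auto intro!: continuous_intros)
 have "quadratic_integrand K B (%x (P :: real^2^2). grad \<phi> x \<bullet> axis j 1)"
 proof (rule quadratic_integrand_const)
  show "\<bar>grad \<phi> x \<bullet> axis j 1\<bar> <= B" for x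
   using Cauchy_Schwarz_ineq2[of "grad \<phi> x" "axis j 1"] B(3)[of x] by simp
 qed (use B in auto)
 note l0 = compose_limit[OF K(1,2) f cv(1) this]
 have q: "quadratic_integrand K B (%x (P :: real^2^2). P $ k $ j * \<phi> x)" for k
 proof (rule quadratic_integrand_linear)
  fix x and P :: "real^2^2"
  show "linear (%P :: real^2^2. P $ k $ j * \<phi> x)" by (intro linearI) (auto simp: algebra_simps)
  show "\<bar>P $ k $ j * \<phi> x\<bar> <= B * norm P"
   using mult_mono[OF entry_le_norm[of P k j] B(2)[of x]] by (simp add: abs_mult mult.commute)
 next
  fix G :: "real^2 => real^2^2" assume [measurable]: "G : borel_measurable borel"
  show "(%x. G x $ k $ j * \<phi> x) : borel_measurable borel" by measurable
 qed (use B K in auto)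
 have l1: "integrable lborel (%x. V (u0 x) $ i $ k * (D x $ k $ j * \<phi> x))"
  "(%n. LINT x|lborel. V (f n x) $ i $ k * (F n x $ k $ j * \<phi> x)) \<longlonglongrightarrow> (LINT x|lborel. V (u0 x) $ i $ k * (D x $ k $ j * \<phi> x))" for k
  using compose_limit[OF K(1,2) f cv(2) q] by blast+
 have "(LINT x|lborel. v (f n x) $ i * (grad \<phi> x \<bullet> axis j 1))
   = - ((LINT x|lborel. V (f n x) $ i $ 1 * (F n x $ 1 $ j * \<phi> x)) + (LINT x|lborel. V (f n x) $ i $ 2 * (F n x $ 2 $ j * \<phi> x)))" for n
 proof -
  have "C1_fun (%x. v (f n x) $ i) (%x. transpose (F n x) *v (V (f n x) $ i))"
   by (rule C1_fun_compose[OF C1_fun_component[OF v] f(1)])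
  from integration_by_parts[OF this C1 B(4), where h="axis j 1"]
  have "(LINT x|lborel. v (f n x) $ i * (grad \<phi> x \<bullet> axis j 1))
    = - (LINT x|lborel. ((transpose (F n x) *v (V (f n x) $ i)) \<bullet> axis j 1) * \<phi> x)" by simp
  also have "(LINT x|lborel. ((transpose (F n x) *v (V (f n x) $ i)) \<bullet> axis j 1) * \<phi> x)
   = (LINT x|lborel. V (f n x) $ i $ 1 * (F n x $ 1 $ j * \<phi> x) + V (f n x) $ i $ 2 * (F n x $ 2 $ j * \<phi> x))"
   by (rule LINT_cong)
    (simp_all add: inner_axis matrix_vector_mult_def transpose_def sum_2 algebra_simps del: transpose_matrix_vector)
  also have "... = (LINT x|lborel. V (f n x) $ i $ 1 * (F n x $ 1 $ j * \<phi> x)) + (LINT x|lborel. V (f n x) $ i $ 2 * (F n x $ 2 $ j * \<phi> x))"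
  proof (rule Bochner_Integration.integral_add)
   have ci: "continuous_on UNIV (%x. V (f n x) $ i $ k * (F n x $ k $ j * \<phi> x))" for k
    by (intro continuous_intros c C1_map_continuous_deriv[OF f(1)])
     (rule continuous_on_compose2[OF C1_map_continuous_deriv[OF v, of UNIV] C1_map_continuous[OF f(1)]], simp)
   show "integrable lborel (%x. V (f n x) $ i $ 1 * (F n x $ 1 $ j * \<phi> x))"
    "integrable lborel (%x. V (f n x) $ i $ 2 * (F n x $ 2 $ j * \<phi> x))"
    by (rule integrable_continuous_compact_support[OF ci, where R=R]; simp add: B(4))+
  qed
  finally show ?thesis .
 qed
 then have "(LINT x|lborel. v (u0 x) $ i * (grad \<phi> x \<bullet> axis j 1))
   = - ((LINT x|lborel. V (u0 x) $ i $ 1 * (D x $ 1 $ j * \<phi> x)) + (LINT x|lborel. V (u0 x) $ i $ 2 * (D x $ 2 $ j * \<phi> x)))"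
  using LIMSEQ_unique[OF l0(2)] tendsto_minus[OF tendsto_add[OF l1(2)[of 1] l1(2)[of 2]]] by simp
 also have "... = - (LINT x|lborel. V (u0 x) $ i $ 1 * (D x $ 1 $ j * \<phi> x) + V (u0 x) $ i $ 2 * (D x $ 2 $ j * \<phi> x))"
  using l1(1)[of 1] l1(1)[of 2] by simp
 also have "... = - (LINT x|lborel. (V (u0 x) ** D x) $ i $ j * \<phi> x)"
  by (simp add: matrix_matrix_mult_def sum_2 algebra_simps)
 finally show ?thesis by (simp add: test_function_frechet[OF \<phi>])
qed

text \<open>This identifies the weak gradient of the composed test field in the definition of the
  pressure with a product that can be paired with \<open>A (D x)\<close>.\<close>

theorem chain_rule:
 fixes v :: "real^2 => real^2"
 assumes v: "C1_map v V"
 shows "has_weak_gradient \<Omega> (v \<circ> u) (%x. V (u x) ** D x)"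
proof (rule has_weak_gradientI[OF open_\<Omega>])
 have \<Omega>b [measurable]: "\<Omega> : sets borel" using open_\<Omega> by simp
 have cv: "continuous_on UNIV v" "continuous_on UNIV V" by (rule C1_map_continuous[OF v], rule C1_map_continuous_deriv[OF v])
 have vm [measurable]: "v : borel_measurable borel" "V : borel_measurable borel"
  using cv by (auto intro: borel_measurable_continuous_onI)
 have e: "indicator \<Omega> x *\<^sub>R (v \<circ> u) x = indicator \<Omega> x *\<^sub>R v (u0 x)" "indicator \<Omega> x *\<^sub>R (V (u x) ** D x) = V (u0 x) ** D x" for x
  using D_outside[of x] by (auto simp: indicator_def)
 show "(%x. indicator \<Omega> x *\<^sub>R (v \<circ> u) x) : borel_measurable borel" unfolding e by measurable
 show "(%x. indicator \<Omega> x *\<^sub>R (V (u x) ** D x)) : borel_measurable borel" unfolding e by measurable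
 fix K :: "(real^2) set" assume K: "compact K" "K <= \<Omega>"
 have Kb [measurable]: "K : sets borel" using K(1) by (simp add: borel_compact)
 have cK: "continuous_on K (%x. v (u x))" "continuous_on K (%x. V (u x))"
  by (rule continuous_on_compose2[OF cv(1) continuous_on_subset[OF cont_u K(2)]], simp,
    rule continuous_on_compose2[OF cv(2) continuous_on_subset[OF cont_u K(2)]], simp)
 show "integrable lborel (%x. indicator K x *\<^sub>R (v \<circ> u) x)"
  using borel_integrable_compact[OF K(1) cK(1)] by (simp add: indicator_scaleR_eq_if)
 have "compact ((%x. V (u x)) ` K)" by (rule compact_continuous_image[OF cK(2) K(1)])
 then obtain B where B: "!!x. x : K ==> norm (V (u x)) <= B"
  using compact_imp_bounded[of "(%x. V (u x)) ` K"] by (auto simp: bounded_iff)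
 show "integrable lborel (%x. indicator K x *\<^sub>R (V (u x) ** D x))"
 proof (rule LINT_bound)
  show "integrable lborel (%x. 4 * (\<bar>B\<bar> * norm (D x)))" using D_int by simp
  have "(%x. indicator K x *\<^sub>R (V (u x) ** D x)) = (%x. indicator K x *\<^sub>R (V (u0 x) ** D x))"
   using K(2) by (auto simp: fun_eq_iff indicator_def)
  then show "(%x. indicator K x *\<^sub>R (V (u x) ** D x)) : borel_measurable lborel" by simp
  have "norm (V (u x) ** D x) <= 4 * (\<bar>B\<bar> * norm (D x))" if "x : K" for x
  proof -
   have "norm (V (u x) ** D x) <= 4 * (norm (V (u x)) * norm (D x))" by (rule norm_matrix_mult_le)
   also have "... <= 4 * (\<bar>B\<bar> * norm (D x))" using B[OF that] by (intro mult_left_mono mult_right_mono) auto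
   finally show ?thesis .
  qed
  then show "AE x in lborel. norm (indicator K x *\<^sub>R (V (u x) ** D x)) <= norm (4 * (\<bar>B\<bar> * norm (D x)))"
   by (intro AE_I2) (auto simp: indicator_def)
 qed
next
 fix \<phi> :: "real^2 => real" and i j :: 2 assume \<phi>: "test_function \<Omega> \<phi>"
 obtain K where K: "compact K" "K <= \<Omega>" "!!x. x ~: K ==> \<phi> x = 0" by (rule test_function_vanish[OF \<phi>]) blast
 have g0: "grad \<phi> x = 0" if "x ~: \<Omega>" for x
  by (rule C1_fun_vanish_outside[OF test_function_C1_fun[OF \<phi>] compact_imp_closed[OF K(1)] K(3)]) (use that K(2) in auto)
 have "(LINT x|lborel. (indicator \<Omega> x *\<^sub>R (v \<circ> u) x) $ i * frechet_derivative \<phi> (at x) (axis j 1))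
   = (LINT x|lborel. v (u0 x) $ i * frechet_derivative \<phi> (at x) (axis j 1))"
  by (rule LINT_cong) (auto simp: indicator_def test_function_frechet[OF \<phi>] g0)
 also have "... = - (LINT x|lborel. (V (u0 x) ** D x) $ i $ j * \<phi> x)" by (rule chain_rule_test[OF v \<phi>])
 also have "(LINT x|lborel. (V (u0 x) ** D x) $ i $ j * \<phi> x) = (LINT x|lborel. (indicator \<Omega> x *\<^sub>R (V (u x) ** D x)) $ i $ j * \<phi> x)"
  using D_outside by (intro LINT_cong) (auto simp: indicator_def)
 finally show "(LINT x|lborel. (indicator \<Omega> x *\<^sub>R (v \<circ> u) x) $ i * frechet_derivative \<phi> (at x) (axis j 1))
   = - (LINT x|lborel. (indicator \<Omega> x *\<^sub>R (V (u x) ** D x)) $ i $ j * \<phi> x)" .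
qed

end

section \<open>The pressure equation in the reference configuration\<close>

lemma abs_integral_le_integral:
 fixes f g :: "'a => real"
 assumes g: "integrable M g" and f: "f : borel_measurable M" and le: "!!x. \<bar>f x\<bar> <= g x"
 shows "integrable M f" "\<bar>integral\<^sup>L M f\<bar> <= integral\<^sup>L M g"
proof -
 show i: "integrable M f"
  by (rule LINT_bound[OF g f]) (use le in \<open>auto intro: order_trans[OF _ abs_ge_self]\<close>)
 have "\<bar>integral\<^sup>L M f\<bar> <= (LINT x|M. \<bar>f x\<bar>)" using integral_norm_bound[of M f] by simp
 also have "... <= integral\<^sup>L M g" using i g le by (intro Bochner_Integration.integral_mono) auto
 finally show "\<bar>integral\<^sup>L M f\<bar> <= integral\<^sup>L M g" .
qed

lemma abs_trace_le: "\<bar>trace E\<bar> <= 2 * norm E" for E :: "real^2^2"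
 using entry_le_norm[of E 1 1] entry_le_norm[of E 2 2] by (simp add: trace_def sum_2)

section \<open>Change of variables and the pulled-back test field\<close>

context area_preserving
begin

lemma change_of_variables_lborel:
 fixes f :: "real^2 => real"
 assumes f [measurable]: "f : borel_measurable borel" and T: "open (u ` \<Omega>)"
 shows "integrable lborel (%x. indicator \<Omega> x * f (u0 x)) \<longleftrightarrow> integrable lborel (%y. indicator (u ` \<Omega>) y * f y)"
  "(LINT x|lborel. indicator \<Omega> x * f (u0 x)) = (LINT y|lborel. indicator (u ` \<Omega>) y * f y)"
proof -
 have [measurable]: "\<Omega> : sets borel" "u ` \<Omega> : sets borel" using open_\<Omega> T by simp_all
 have m [measurable]: "(%x. indicator \<Omega> x * f (u0 x)) : borel_measurable lborel"
  "(%y. indicator (u ` \<Omega>) y * f y) : borel_measurable lborel" by measurable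
 have e: "indicator \<Omega> x *\<^sub>R f (u x) = indicator \<Omega> x * f (u0 x)" for x by (simp add: indicator_def)
 have 1: "(%x. f (u x)) absolutely_integrable_on \<Omega> \<longleftrightarrow> integrable lborel (%x. indicator \<Omega> x * f (u0 x))"
  unfolding set_integrable_def e by (rule integrable_completion[OF m(1)])
 have 2: "f absolutely_integrable_on (u ` \<Omega>) \<longleftrightarrow> integrable lborel (%y. indicator (u ` \<Omega>) y * f y)"
  unfolding set_integrable_def real_scaleR_def by (rule integrable_completion[OF m(2)])
 have 3: "integral \<Omega> (%x. f (u x)) = (LINT x|lborel. indicator \<Omega> x * f (u0 x))"
  if "(%x. f (u x)) absolutely_integrable_on \<Omega>"
  using set_lebesgue_integral_eq_integral(2)[OF that, symmetric] integral_completion[OF m(1)]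
  by (simp only: set_lebesgue_integral_def e)
 have 4: "integral (u ` \<Omega>) f = (LINT y|lborel. indicator (u ` \<Omega>) y * f y)"
  if "f absolutely_integrable_on (u ` \<Omega>)"
  using set_lebesgue_integral_eq_integral(2)[OF that, symmetric] integral_completion[OF m(2)]
  by (simp add: set_lebesgue_integral_def)
 have c: "(%x. f (u x)) absolutely_integrable_on \<Omega> \<longleftrightarrow> f absolutely_integrable_on (u ` \<Omega>)"
  "(%x. f (u x)) absolutely_integrable_on \<Omega> ==> integral \<Omega> (%x. f (u x)) = integral (u ` \<Omega>) f"
  using change_of_variables[of f] by blast+
 show iff: "integrable lborel (%x. indicator \<Omega> x * f (u0 x)) \<longleftrightarrow> integrable lborel (%y. indicator (u ` \<Omega>) y * f y)"
  using c(1) 1 2 by simp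
 show "(LINT x|lborel. indicator \<Omega> x * f (u0 x)) = (LINT y|lborel. indicator (u ` \<Omega>) y * f y)"
 proof (cases "integrable lborel (%x. indicator \<Omega> x * f (u0 x))")
  case True
  then show ?thesis using 1 3 4 c by simp
 next
  case False
  then show ?thesis using iff by (simp add: not_integrable_integral_eq)
 qed
qed

lemma det1_AE: "AE x in lborel. x : \<Omega> --> det (D x) = 1"
proof -
 have "AE x in lebesgue. x ~: {x : \<Omega>. det (D x) ~= 1}"
  using det1 by (intro AE_not_in) (simp add: negligible_iff_null_sets)
 then show ?thesis by (simp add: AE_completion_iff)
qed

lemma cofactor2_borel [measurable]: "(%x. cofactor2 (D x)) : borel_measurable borel"
 by (rule measurable_compose[OF D_borel]) (intro borel_measurable_continuous_onI continuous_intros)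

text \<open>The field to be inserted, \<phi> composed with the inverse \<open>g\<close> of
  \<open>u\<close>, need not be smooth, and its weak gradient \<open>W\<close> is only as integrable
  as \<open>D\<close>. After mollification the defect on the left is a product of two factors
  growing like \<open>D\<close> and the mollification error, which the area-preserving change of
  variables carries from the image to the reference domain. All defects become of order \<rho> for a
  free parameter \<rho>.\<close>

lemma pressure_equation:
 assumes T: "open (u ` \<Omega>)" and g: "continuous_on (u ` \<Omega>) g" "!!x. x : \<Omega> ==> g (u x) = x"
  and bd: "bounded \<Omega>"
  and A: "continuous_on UNIV A" "!!P. norm (A P) <= C * (1 + norm P)"
  and q: "continuous_on (u ` \<Omega>) q"
  and eq: "!!v V. test_function (u ` \<Omega>) v ==> C1_map v V ==>
   (LINT x|lborel. A (D x) \<bullet> (V (u0 x) ** D x)) = (LINT y|lborel. indicator (u ` \<Omega>) y * (q y * trace (V y)))"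
  and \<phi>: "C1_map \<phi> \<Phi>" and K: "compact K" "K <= \<Omega>" "!!x. x ~: K ==> \<phi> x = 0"
 shows "(LINT x|lborel. A (D x) \<bullet> \<Phi> x) = (LINT x|lborel. indicator \<Omega> x * (q (u x) * (cofactor2 (D x) \<bullet> \<Phi> x)))"
proof -
 let ?T = "u ` \<Omega>"
 have [measurable]: "\<Omega> : sets borel" "?T : sets borel" "K : sets borel" using open_\<Omega> T K(1) by (simp_all add: borel_compact)
 have \<Phi>0: "\<Phi> x = 0" if "x ~: K" for x
  by (rule C1_map_vanish[OF \<phi> compact_imp_closed[OF K(1)] K(3) that])
 have \<phi>\<Omega>: "\<phi> x = 0" "\<Phi> x = 0" if "x ~: \<Omega>" for x using that K(2,3) \<Phi>0 by blast+
 have c: "continuous_on UNIV \<phi>" "continuous_on UNIV \<Phi>" using C1_map_continuous[OF \<phi>] C1_map_continuous_deriv[OF \<phi>] by auto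
 obtain R where R: "!!x. norm x > R ==> x ~: K"
  using compact_imp_bounded[OF K(1)] unfolding bounded_iff by (meson not_le)
 obtain B where B: "B > 0" "!!x. norm (\<Phi> x) <= B"
  by (rule compact_support_bounded[OF c(2), of R]) (use \<Phi>0 R in blast)+
 have C: "C >= 0" using order_trans[OF norm_ge_zero A(2)[of 0]] by simp
 define g\<^sub>0 where "g\<^sub>0 y = indicator ?T y *\<^sub>R g y" for y
 have [measurable]: "g\<^sub>0 : borel_measurable borel"
  unfolding g\<^sub>0_def[abs_def] using g(1) by (intro borel_measurable_continuous_on_indicator) auto
 define q\<^sub>0 where "q\<^sub>0 y = indicator ?T y *\<^sub>R q y" for y
 have [measurable]: "q\<^sub>0 : borel_measurable borel"
  unfolding q\<^sub>0_def[abs_def] using q by (intro borel_measurable_continuous_on_indicator) auto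
 have [measurable]: "\<phi> : borel_measurable borel" "\<Phi> : borel_measurable borel" "A : borel_measurable borel"
  using c A(1) by (auto intro: borel_measurable_continuous_onI)
 define v where "v y = indicator ?T y *\<^sub>R \<phi> (g\<^sub>0 y)" for y
 \<comment> \<open>For determinant 1 the transposed cofactor is the inverse matrix, so this is the
   gradient that the chain rule predicts for \<phi> composed with the inverse of
   \<open>u\<close>.\<close>
 define W where "W y = indicator ?T y *\<^sub>R (\<Phi> (g\<^sub>0 y) ** transpose (cofactor2 (D (g\<^sub>0 y))))" for y
 have trm [measurable]: "(transpose :: real^2^2 => real^2^2) : borel_measurable borel"
 proof (rule borel_measurable_continuous_onI)
  show "continuous_on UNIV (transpose :: real^2^2 => real^2^2)"
   unfolding transpose_def[abs_def] by (intro continuous_intros)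
 qed
 have [measurable]: "v : borel_measurable borel" unfolding v_def[abs_def] by measurable
 have Wm [measurable]: "W : borel_measurable borel" unfolding W_def[abs_def] by measurable
 have vu: "v (u x) = \<phi> x" "W (u x) = \<Phi> x ** transpose (cofactor2 (D x))" "q\<^sub>0 (u x) = q (u x)" if "x : \<Omega>" for x
  using that by (simp_all add: v_def W_def g\<^sub>0_def q\<^sub>0_def g(2))
 have T0: "v y = 0" "W y = 0" if "y ~: ?T" for y using that by (simp_all add: v_def W_def)
 have vK: "v y = 0" "W y = 0" if "y ~: u ` K" for y
  using T0[of y] vu K(3) \<Phi>0 that by (cases "y : ?T"; force)+
 have nW: "norm (W (u x)) <= 4 * B * norm (D x)" if "x : \<Omega>" for x
 proof -
  have "norm (W (u x)) <= 4 * (norm (\<Phi> x) * norm (transpose (cofactor2 (D x))))"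
   unfolding vu(2)[OF that] by (rule norm_matrix_mult_le)
  also have "norm (transpose (cofactor2 (D x))) = norm (D x)"
   unfolding norm_cofactor2[of "D x", symmetric] by (simp add: norm_eq_sqrt_inner inner_vec_def sum_2 transpose_def)
  also have "4 * (norm (\<Phi> x) * norm (D x)) <= 4 * (B * norm (D x))" using B by (intro mult_left_mono mult_right_mono) auto
  finally show ?thesis by simp
 qed
 have iW: "integrable lborel (%y. norm (W y) ^ k)" if "k = 1 \<or> k = 3" for k :: nat
 proof -
  have "integrable lborel (%x. indicator \<Omega> x * norm (W (u0 x)) ^ k)"
  proof (rule abs_integral_le_integral(1))
   show "integrable lborel (%x. (4 * B) ^ k * norm (D x) ^ k)" using that D_int D_int3 by auto
   show "\<bar>indicator \<Omega> x * norm (W (u0 x)) ^ k\<bar> <= (4 * B) ^ k * norm (D x) ^ k" for x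
    using power_mono[OF nW[of x] norm_ge_zero, of k] B(1) by (auto simp: indicator_def power_mult_distrib)
  qed measurable
  then have "integrable lborel (%y. indicator ?T y * norm (W y) ^ k)"
   by (subst (asm) change_of_variables_lborel(1)[OF _ T]) measurable
  moreover have "(%y. indicator ?T y * norm (W y) ^ k) = (%y. norm (W y) ^ k)"
   using that by (auto simp: fun_eq_iff indicator_def T0)
  ultimately show ?thesis by simp
 qed
 have Wi: "integrable lborel W" using iW[of 1] by (simp add: integrable_norm_iff)
 have vi: "integrable lborel v"
 proof -
  have "integrable lborel (%x. indicator \<Omega> x * norm (v (u0 x)))"
  proof (rule abs_integral_le_integral(1))
   show "integrable lborel (%x. norm (\<phi> x))"
    using R K(3) by (intro integrable_continuous_compact_support[where R=R] continuous_intros c) auto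
  qed (measurable, auto simp: indicator_def vu)
  then have "integrable lborel (%y. indicator ?T y * norm (v y))"
   by (subst (asm) change_of_variables_lborel(1)[OF _ T]) measurable
  moreover have "(%y. indicator ?T y * norm (v y)) = (%y. norm (v y))"
   by (auto simp: fun_eq_iff indicator_def T0)
  ultimately show ?thesis by (simp add: integrable_norm_iff)
 qed
 \<comment> \<open>Pulled back to the reference domain, the weak derivative of \<open>v\<close> is
   the Piola identity with a component of \<phi> as the compactly supported factor; the determinant
   is inserted as a factor 1.\<close>
 have weak: "(LINT y|lborel. v y $ i * (g\<psi> y \<bullet> axis j 1)) = - (LINT y|lborel. W y $ i $ j * \<psi> y)"
  if \<psi>: "C1_fun \<psi> g\<psi>" for \<psi> g\<psi> i j
 proof -
  have [measurable]: "\<psi> : borel_measurable borel" "g\<psi> : borel_measurable borel"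
   using C1_fun_continuous[OF \<psi>] \<psi> by (auto simp: C1_fun_def intro: borel_measurable_continuous_onI)
  note P = Piola(3)[OF K(1,2) C1_fun_component[OF \<phi>] _ \<psi>, of i j]
  have "(LINT y|lborel. v y $ i * (g\<psi> y \<bullet> axis j 1)) = (LINT y|lborel. indicator ?T y * (v y $ i * g\<psi> y $ j))"
   by (rule LINT_cong) (auto simp: indicator_def T0 inner_axis)
  also have "... = (LINT x|lborel. indicator \<Omega> x * (v (u0 x) $ i * g\<psi> (u0 x) $ j))"
   by (rule change_of_variables_lborel(2)[OF _ T, symmetric]) measurable
  also have "... = (LINT x|lborel. \<phi> x $ i * g\<psi> (u0 x) $ j * det (D x))"
  proof (rule LINT_cong_AE)
   show "AE x in lborel. indicator \<Omega> x * (v (u0 x) $ i * g\<psi> (u0 x) $ j) = \<phi> x $ i * g\<psi> (u0 x) $ j * det (D x)"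
    using det1_AE by eventually_elim (auto simp: indicator_def vu \<phi>\<Omega>)
   show "(%x. \<phi> x $ i * g\<psi> (u0 x) $ j * det (D x)) : borel_measurable lborel" unfolding det_2 by measurable
  qed measurable
  also have "... = - (LINT x|lborel. \<psi> (u0 x) * (cofactor2 (D x) $ j \<bullet> \<Phi> x $ i))" using P K(3) by simp
  also have "(LINT x|lborel. \<psi> (u0 x) * (cofactor2 (D x) $ j \<bullet> \<Phi> x $ i)) = (LINT x|lborel. indicator \<Omega> x * (W (u0 x) $ i $ j * \<psi> (u0 x)))"
  proof (rule LINT_cong)
   fix x show "\<psi> (u0 x) * (cofactor2 (D x) $ j \<bullet> \<Phi> x $ i) = indicator \<Omega> x * (W (u0 x) $ i $ j * \<psi> (u0 x))"
    using vu(2)[of x] \<phi>\<Omega>[of x]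
    by (cases "x : \<Omega>") (auto simp: matrix_matrix_mult_def transpose_def inner_2 sum_2 algebra_simps)
  qed simp
  also have "... = (LINT y|lborel. indicator ?T y * (W y $ i $ j * \<psi> y))"
   by (rule change_of_variables_lborel(2)[OF _ T]) measurable
  also have "... = (LINT y|lborel. W y $ i $ j * \<psi> y)"
   by (rule LINT_cong) (auto simp: indicator_def T0)
  finally show ?thesis .
 qed
 have KT: "compact (u ` K)" "u ` K <= ?T"
  using cont_u K by (auto intro!: compact_continuous_image intro: continuous_on_subset)
 obtain e1 K' where K': "e1 > 0" "compact K'" "K' <= ?T" "!!x y. x : u ` K ==> norm (x - y) <= e1 ==> y : K'"
  by (rule compact_neighbourhood[OF KT T]) blast
 have [measurable]: "K' : sets borel" using K'(2) by (simp add: borel_compact)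
 have "compact (q ` K')" using q K' by (intro compact_continuous_image) (auto intro: continuous_on_subset)
 then obtain Q where Q: "Q > 0" "!!y. y : K' ==> \<bar>q y\<bar> <= Q"
  using compact_imp_bounded[of "q ` K'"] by (auto simp: bounded_pos)
 let ?a = "%x. indicator \<Omega> x * (1 + norm (D x)) ^ 3"
 have ia: "integrable lborel ?a"
 proof (rule abs_integral_le_integral(1))
  show "integrable lborel (%x. 4 * (indicator \<Omega> x + norm (D x) ^ 3))"
   using D_int3 emeasure_bounded_finite[OF bd]
   by (intro integrable_mult_right LINT_add integrable_real_indicator) auto
  show "\<bar>?a x\<bar> <= 4 * (indicator \<Omega> x + norm (D x) ^ 3)" for x
   using norm_add_cube[of 1 "norm (D x)"] by (auto simp: indicator_def)
 qed measurable
 have iK': "integrable lborel (indicator K' :: _ => real)"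
  using emeasure_bounded_finite[OF compact_imp_bounded[OF K'(2)]] by (intro integrable_real_indicator) auto
 define I where "I = (LINT x|lborel. ?a x)"
 define m where "m = (LINT y|lborel. indicator K' y :: real)"
 have Im: "I >= 0" "m >= 0" unfolding I_def m_def by (intro LINT_nonneg; simp)+
 define X where "X = (LINT x|lborel. A (D x) \<bullet> \<Phi> x) - (LINT x|lborel. indicator \<Omega> x * (q (u x) * (cofactor2 (D x) \<bullet> \<Phi> x)))"
 have WD: "AE x in lborel. W (u0 x) ** D x = \<Phi> x"
  using det1_AE
 proof eventually_elim
  case (elim x)
  show ?case
  proof (cases "x : \<Omega>")
   case True
   have "W (u x) ** D x = \<Phi> x ** (transpose (cofactor2 (D x)) ** D x)" by (simp add: vu(2)[OF True] matrix_mul_assoc)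
   then show ?thesis using True elim by (simp add: cofactor2_transpose_mult)
  next
   case False
   then show ?thesis using D_outside[OF False] \<Phi>0[of x] K(2) by auto
  qed
 qed
 have iA\<Phi>: "integrable lborel (%x. A (D x) \<bullet> \<Phi> x)"
 proof (rule abs_integral_le_integral(1))
  show "integrable lborel (%x. C * B * ?a x)" using ia by simp
  show "\<bar>A (D x) \<bullet> \<Phi> x\<bar> <= C * B * ?a x" for x
  proof (cases "x : K")
   case True
   have "\<bar>A (D x) \<bullet> \<Phi> x\<bar> <= norm (A (D x)) * norm (\<Phi> x)" by (rule Cauchy_Schwarz_ineq2)
   also have "... <= (C * (1 + norm (D x))) * B" using A(2) B C by (intro mult_mono) auto
   also have "... = C * B * (1 + norm (D x))" by simp
   also have "... <= C * B * (1 + norm (D x)) ^ 3"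
    using C B(1) power_increasing[of 1 3 "1 + norm (D x)"] by (intro mult_left_mono) auto
   finally show ?thesis using True K(2) by (auto simp: indicator_def)
  qed (use \<Phi>0 C B(1) in \<open>simp add: indicator_def\<close>)
 qed measurable
 have iAW: "integrable lborel (%x. A (D x) \<bullet> (W (u0 x) ** D x))"
 proof (rule integrable_cong_AE_imp[OF iA\<Phi>])
  show "AE x in lborel. A (D x) \<bullet> \<Phi> x = A (D x) \<bullet> (W (u0 x) ** D x)" using WD by eventually_elim simp
 qed measurable
 have AW: "(LINT x|lborel. A (D x) \<bullet> (W (u0 x) ** D x)) = (LINT x|lborel. A (D x) \<bullet> \<Phi> x)"
 proof (rule LINT_cong_AE)
  show "AE x in lborel. A (D x) \<bullet> (W (u0 x) ** D x) = A (D x) \<bullet> \<Phi> x" using WD by eventually_elim simp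
 qed measurable
 \<comment> \<open>At \<open>u x\<close> the trace of \<open>W\<close> is the inner product of the
   cofactor and \<Phi>; this is where the cofactor term of the reference equation comes
   from.\<close>
 have qW: "(LINT x|lborel. indicator \<Omega> x * (q (u x) * (cofactor2 (D x) \<bullet> \<Phi> x))) = (LINT y|lborel. q\<^sub>0 y * trace (W y))"
 proof -
  have [measurable]: "(%y. q\<^sub>0 y * trace (W y)) : borel_measurable borel" unfolding trace_def sum_2 by measurable
  have ha: "indicator \<Omega> x * (q (u x) * (cofactor2 (D x) \<bullet> \<Phi> x)) = indicator \<Omega> x * (q\<^sub>0 (u0 x) * trace (W (u0 x)))" for x
   by (auto simp: indicator_def vu trace_def sum_2 matrix_matrix_mult_def transpose_def inner_vec_def algebra_simps)
  have hb: "indicator ?T y * (q\<^sub>0 y * trace (W y)) = q\<^sub>0 y * trace (W y)" for y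
   by (simp add: indicator_def q\<^sub>0_def)
  have "(LINT x|lborel. indicator \<Omega> x * (q\<^sub>0 (u0 x) * trace (W (u0 x)))) = (LINT y|lborel. indicator ?T y * (q\<^sub>0 y * trace (W y)))"
   by (rule change_of_variables_lborel(2)[OF _ T]) measurable
  then show ?thesis by (simp only: ha hb)
 qed
 have iqW: "integrable lborel (%y. q\<^sub>0 y * trace (W y))"
 proof (rule abs_integral_le_integral(1))
  show "integrable lborel (%y. Q * (2 * norm (W y)))" using Wi by simp
  show "(%y. q\<^sub>0 y * trace (W y)) : borel_measurable lborel" unfolding trace_def sum_2 by measurable
  have uK': "u ` K <= K'" using K'(1,4) by force
  show "\<bar>q\<^sub>0 y * trace (W y)\<bar> <= Q * (2 * norm (W y))" for y
  proof (cases "y : K'")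
   case True
   then show ?thesis unfolding abs_mult using Q K'(3) by (intro mult_mono abs_trace_le) (auto simp: q\<^sub>0_def)
  next
   case False
   then have "y ~: u ` K" using uK' by blast
   then show ?thesis using Q(1) by (simp add: vK(2) trace_def)
  qed
 qed
 \<comment> \<open>\<rho> weights the fixed integrals, while \<eta> bounds the cubed mollification
   error in the image and, by area preservation, in the reference domain. The factor 4 belongs to
   the matrix product, the factor 2 to the trace.\<close>
 have bound: "\<bar>X\<bar> <= 4 * C * (\<rho> * I + (1 / \<rho>^2) * \<eta>) + 2 * Q * (\<rho> * m + (1 / \<rho>^2) * \<eta>)" if \<rho>: "\<rho> > 0" and \<eta>: "\<eta> > 0" for \<rho> \<eta>
 proof -
  obtain e0 where e0: "e0 > 0"
   "!!e. 0 < e ==> e < e0 ==> integrable lborel (%x. norm (conv (mollifier e) W x - W x) ^ 3)"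
   "!!e. 0 < e ==> e < e0 ==> (LINT x|lborel. norm (conv (mollifier e) W x - W x) ^ 3) < \<eta>"
   by (rule mollification_L3[OF Wi iW[of 3] \<eta>]) simp_all
  define e where "e = min e0 e1 / 2"
  have e: "e > 0" "e < e0" "e <= e1" using e0(1) K'(1) by (auto simp: e_def)
  let ?V = "conv (mollifier e) W"
  have van: "v y = 0 & W y = 0" if "x ~: K'" "norm (x - y) <= e" for x y
   using K'(4)[of y x] that e(3) vK[of y] by (auto simp: norm_minus_commute)
  have tf: "test_function ?T (conv (mollifier e) v)"
   by (rule test_function_conv(1)[OF vi e(1) K'(2,3)]) (use van in blast)
  have V0: "?V x = 0" if "x ~: K'" for x
   by (rule test_function_conv(2)[OF Wi e(1) K'(2,3) _ that]) (use van in blast)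
  have cV: "continuous_on UNIV ?V"
   by (rule conv_continuous[OF Wi mollifier_continuous, where R=e]) (use e(1) in \<open>simp add: mollifier_vanish\<close>)
  have C1: "C1_map (conv (mollifier e) v) ?V"
   unfolding C1_map_def
  proof (intro conjI allI cV conv_mollifier_derivative[OF vi Wi e(1)])
   fix x :: "real^2" and i j :: 2
   have "test_function UNIV (%y. mollifier e (y - x))" by (rule test_function_mollifier[OF e(1)]) simp
   from test_function_C1_fun[OF this] have tC: "C1_fun (%y. mollifier e (y - x)) (grad (%y. mollifier e (y - x)))" .
   have "frechet_derivative (%y. mollifier e (y - x)) (at y) (axis j 1) = grad (%y. mollifier e (y - x)) y \<bullet> axis j 1" for y
    by (rule test_function_frechet[OF test_function_mollifier[OF e(1) subset_UNIV]])
   then show "(LINT y|lborel. v y $ i * frechet_derivative (%y. mollifier e (y - x)) (at y) (axis j 1))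
    = - (LINT y|lborel. W y $ i $ j * mollifier e (y - x))" using weak[OF tC, of i j] by simp
  qed
  have [measurable]: "?V : borel_measurable borel" by (rule borel_measurable_continuous_onI[OF cV])
  define E where "E y = ?V y - W y" for y
  have [measurable]: "E : borel_measurable borel" unfolding E_def[abs_def] by measurable
  have E3: "integrable lborel (%y. norm (E y) ^ 3)" "(LINT y|lborel. norm (E y) ^ 3) < \<eta>"
   using e0(2,3)[OF e(1,2)] by (simp_all add: E_def)
  have E0: "E y = 0" if "y ~: K'" for y
   using V0[OF that] van[OF that, of y] e(1) by (simp add: E_def)
  have ET: "(%y. indicator ?T y * norm (E y) ^ 3) = (%y. norm (E y) ^ 3)"
   using E0 K'(3) by (auto simp: fun_eq_iff indicator_def)
  have Em: "(%y. norm (E y) ^ 3) : borel_measurable borel" by measurable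
  have Eu: "integrable lborel (%x. indicator \<Omega> x * norm (E (u0 x)) ^ 3)"
   "(LINT x|lborel. indicator \<Omega> x * norm (E (u0 x)) ^ 3) < \<eta>"
   using change_of_variables_lborel[OF Em T] E3 unfolding ET by simp_all
  let ?b = "%x. 4 * C * (\<rho> * ?a x + (1 / \<rho>^2) * (indicator \<Omega> x * norm (E (u0 x)) ^ 3))"
  have ib: "integrable lborel ?b" using ia Eu(1) by (intro integrable_mult_right LINT_add) auto
  have le: "\<bar>A (D x) \<bullet> (E (u0 x) ** D x)\<bar> <= ?b x" for x
  proof (cases "x : \<Omega>")
   case True
   let ?d = "1 + norm (D x)" and ?e = "norm (E (u0 x))"
   have "\<bar>A (D x) \<bullet> (E (u0 x) ** D x)\<bar> <= norm (A (D x)) * norm (E (u0 x) ** D x)" by (rule Cauchy_Schwarz_ineq2)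
   also have "... <= (C * ?d) * (4 * (?e * ?d))"
   proof (intro mult_mono A(2))
    have "norm (E (u0 x) ** D x) <= 4 * (?e * norm (D x))" by (rule norm_matrix_mult_le)
    also have "... <= 4 * (?e * ?d)" by (intro mult_left_mono) auto
    finally show "norm (E (u0 x) ** D x) <= 4 * (?e * ?d)" .
   qed (use C in auto)
   also have "... = 4 * C * (?d^2 * ?e)" by (simp add: power2_eq_square)
   also have "... <= 4 * C * (\<rho> * ?d ^ 3 + (1 / \<rho>^2) * ?e ^ 3)"
    using C \<rho> by (intro mult_left_mono cube_absorb) auto
   finally show ?thesis using True by simp
  qed (simp add: D_outside)
  note AE = abs_integral_le_integral[OF ib _ le]
  have AEm: "(%x. A (D x) \<bullet> (E (u0 x) ** D x)) : borel_measurable lborel" by measurable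
  let ?c = "%y. 2 * Q * (\<rho> * indicator K' y + (1 / \<rho>^2) * norm (E y) ^ 3)"
  have ic: "integrable lborel ?c" using iK' E3(1) by (intro integrable_mult_right LINT_add) auto
  have lec: "\<bar>q\<^sub>0 y * trace (E y)\<bar> <= ?c y" for y
  proof (cases "y : K'")
   case True
   have "\<bar>q\<^sub>0 y * trace (E y)\<bar> <= Q * (2 * norm (E y))"
    unfolding abs_mult using Q K'(3) True by (intro mult_mono abs_trace_le) (auto simp: q\<^sub>0_def)
   also have "... = 2 * Q * (1^2 * norm (E y))" by simp
   also have "... <= 2 * Q * (\<rho> * 1 ^ 3 + (1 / \<rho>^2) * norm (E y) ^ 3)"
    using Q(1) \<rho> by (intro mult_left_mono cube_absorb) auto
   finally show ?thesis using True by simp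
  qed (simp add: E0 trace_def)
  note QE = abs_integral_le_integral[OF ic _ lec]
  have QEm: "(%y. q\<^sub>0 y * trace (E y)) : borel_measurable lborel" unfolding trace_def sum_2 by measurable
  have "(LINT x|lborel. A (D x) \<bullet> (?V (u0 x) ** D x)) = (LINT x|lborel. A (D x) \<bullet> (W (u0 x) ** D x) + A (D x) \<bullet> (E (u0 x) ** D x))"
  proof (rule LINT_cong)
   fix x
   have "?V (u0 x) ** D x = W (u0 x) ** D x + E (u0 x) ** D x"
    by (simp add: E_def vec_eq_iff matrix_matrix_mult_def sum_2 algebra_simps)
   then show "A (D x) \<bullet> (?V (u0 x) ** D x) = A (D x) \<bullet> (W (u0 x) ** D x) + A (D x) \<bullet> (E (u0 x) ** D x)"
    by (simp add: inner_add_right)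
  qed simp
  then have 1: "(LINT x|lborel. A (D x) \<bullet> (?V (u0 x) ** D x)) = (LINT x|lborel. A (D x) \<bullet> \<Phi> x) + (LINT x|lborel. A (D x) \<bullet> (E (u0 x) ** D x))"
   using iAW AE(1)[OF AEm] by (simp add: AW)
  have "(LINT y|lborel. indicator ?T y * (q y * trace (?V y))) = (LINT y|lborel. q\<^sub>0 y * trace (W y) + q\<^sub>0 y * trace (E y))"
   by (rule LINT_cong) (simp_all add: q\<^sub>0_def E_def trace_def sum_2 algebra_simps)
  also have "... = (LINT y|lborel. q\<^sub>0 y * trace (W y)) + (LINT y|lborel. q\<^sub>0 y * trace (E y))"
   using iqW QE(1)[OF QEm] by simp
  finally have "X = (LINT y|lborel. q\<^sub>0 y * trace (E y)) - (LINT x|lborel. A (D x) \<bullet> (E (u0 x) ** D x))"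
   using eq[OF tf C1] 1 unfolding X_def qW by linarith
  then have "\<bar>X\<bar> <= (LINT x|lborel. ?b x) + (LINT y|lborel. ?c y)"
   using AE(2)[OF AEm] QE(2)[OF QEm] by linarith
  also have "(LINT x|lborel. ?b x) = 4 * C * (\<rho> * I + (1 / \<rho>^2) * (LINT x|lborel. indicator \<Omega> x * norm (E (u0 x)) ^ 3))"
   using ia Eu(1) unfolding I_def by simp
  also have "... <= 4 * C * (\<rho> * I + (1 / \<rho>^2) * \<eta>)"
   using Eu(2) C by (intro mult_left_mono add_left_mono) auto
  also have "(LINT y|lborel. ?c y) = 2 * Q * (\<rho> * m + (1 / \<rho>^2) * (LINT y|lborel. norm (E y) ^ 3))"
   using iK' E3(1) unfolding m_def by simp
  also have "... <= 2 * Q * (\<rho> * m + (1 / \<rho>^2) * \<eta>)"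
   using E3(2) Q(1) by (intro mult_left_mono add_left_mono) auto
  finally show ?thesis by simp
 qed
 define S where "S = 4 * C * (I + 1) + 2 * Q * (m + 1)"
 \<comment> \<open>With \<open>\<eta> = \<rho> ^ 3\<close> both kinds of terms are of order
   \<rho>.\<close>
 have X\<rho>: "\<bar>X\<bar> <= \<rho> * S" if \<rho>: "\<rho> > 0" for \<rho>
 proof -
  have "(1 / \<rho>^2) * \<rho> ^ 3 = \<rho>" using \<rho> by (simp add: power2_eq_square power3_eq_cube)
  then show ?thesis using bound[OF \<rho>, of "\<rho> ^ 3"] \<rho> by (simp add: S_def algebra_simps)
 qed
 have S: "S >= 0" using C Q(1) Im by (simp add: S_def)
 have "\<bar>X\<bar> <= 0 + t" if t: "t > 0" for t
 proof -
  have "\<bar>X\<bar> <= t / (S + 1) * S" by (rule X\<rho>) (use t S in simp)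
  also have "... <= t / (S + 1) * (S + 1)" using t S by (intro mult_left_mono) auto
  finally show ?thesis using S by simp
 qed
 then have "\<bar>X\<bar> <= 0" by (rule field_le_epsilon)
 then show ?thesis by (simp add: X_def)
qed

text \<open>The Piola identity with constant \<psi>: the gradient of \<psi> vanishes, hence so does
  the other side.\<close>

lemma cofactor2_null:
 assumes \<phi>: "C1_map \<phi> \<Phi>" and K: "compact K" "K <= \<Omega>" "!!x. x ~: K ==> \<phi> x = 0"
 shows "integrable lborel (%x. cofactor2 (D x) \<bullet> \<Phi> x)" "(LINT x|lborel. cofactor2 (D x) \<bullet> \<Phi> x) = 0"
proof -
 have c: "C1_fun (%y :: real^2. 1) (%y. 0)" by (simp add: C1_fun_def)
 have i: "integrable lborel (%x. cofactor2 (D x) $ i \<bullet> \<Phi> x $ i)" "(LINT x|lborel. cofactor2 (D x) $ i \<bullet> \<Phi> x $ i) = 0" for i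
  using Piola(2,3)[OF K(1,2) C1_fun_component[OF \<phi>, of i] _ c, of i] K(3) by simp_all
 have e: "cofactor2 (D x) \<bullet> \<Phi> x = cofactor2 (D x) $ 1 \<bullet> \<Phi> x $ 1 + cofactor2 (D x) $ 2 \<bullet> \<Phi> x $ 2" for x
  by (simp add: inner_vec_def sum_2)
 show "integrable lborel (%x. cofactor2 (D x) \<bullet> \<Phi> x)" "(LINT x|lborel. cofactor2 (D x) \<bullet> \<Phi> x) = 0"
  unfolding e using i[of 1] i[of 2] by simp_all
qed

end

section \<open>Uniform ellipticity from the Hessian\<close>

lemma matrix_basis_2: "H = H $ 1 $ 1 *\<^sub>R axis 1 (axis 1 1) + H $ 1 $ 2 *\<^sub>R axis 1 (axis 2 1) + H $ 2 $ 1 *\<^sub>R axis 2 (axis 1 1) + H $ 2 $ 2 *\<^sub>R axis 2 (axis 2 1)"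
 for H :: "real^2^2"
 by (simp add: vec_eq_iff forall_2 axis_def)

lemma has_derivative_matrix_gradient:
 fixes F :: "real^2^2 => real"
 assumes "F differentiable (at P)"
 shows "(F has_derivative (%H. matrix_gradient F P \<bullet> H)) (at P)"
proof -
 have d: "(F has_derivative frechet_derivative F (at P)) (at P)" using assms frechet_derivative_works by blast
 then interpret f: linear "frechet_derivative F (at P)" by (rule has_derivative_linear)
 have "frechet_derivative F (at P) H = matrix_gradient F P \<bullet> H" for H
  by (subst matrix_basis_2[of H])
   (simp add: f.add f.scale inner_vec_def sum_2 matrix_gradient_def entry_deriv_def algebra_simps)
 then show ?thesis using d by presburger
qed

lemma uniformly_elliptic_matrix_gradient:
 fixes L :: "real^2^2 => real"
 assumes L: "smooth_on UNIV L" and convex: "uniformly_convex L" and bounded: "bounded_Hessian L"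
 shows "\<exists>\<mu> M. uniformly_elliptic L (matrix_gradient L) \<mu> M"
proof -
 let ?A = "matrix_gradient L"
 have C2: "Ck_on (Suc (Suc 0)) UNIV L" using L by (simp add: smooth_on_def)
 then have dL: "L differentiable (at P)" for P by simp
 have cL: "continuous_on UNIV L"
  using dL differentiable_imp_continuous_within by (metis continuous_at_imp_continuous_on)
 have "entry_deriv k l L differentiable (at P)" for k l P
 proof -
  have "entry_deriv k l L = (%P. frechet_derivative L (at P) (axis k (axis l 1)))"
   by (simp add: entry_deriv_def fun_eq_iff)
  then show ?thesis using C2 by simp
 qed
 note dE = has_derivative_matrix_gradient[OF this]
 obtain \<mu> where \<mu>: "\<mu> > 0" "!!P \<xi>. (\<Sum>i\<in>UNIV. \<Sum>j\<in>UNIV. \<Sum>k\<in>UNIV. \<Sum>l\<in>UNIV.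
   entry_deriv i j (entry_deriv k l L) P * \<xi> $ i $ j * \<xi> $ k $ l) >= \<mu> * (norm \<xi>)^2"
  using convex unfolding uniformly_convex_def by blast
 obtain m where m: "!!P i j k l. \<bar>entry_deriv i j (entry_deriv k l L) P\<bar> <= m"
  using bounded unfolding bounded_Hessian_def by blast
 have m0: "m >= 0" using m[of 1 1 1 1 0] by linarith
 let ?h = "%P H G. \<Sum>i\<in>UNIV. \<Sum>j\<in>UNIV. \<Sum>k\<in>UNIV. \<Sum>l\<in>UNIV. entry_deriv i j (entry_deriv k l L) P * H $ i $ j * G $ k $ l"
 have der: "((%t. ?A (P + t *\<^sub>R H) \<bullet> G) has_real_derivative ?h (P + t *\<^sub>R H) H G) (at t)" for P H G t
 proof -
  have line: "((%t. P + t *\<^sub>R H) has_derivative (%s. s *\<^sub>R H)) (at t)" by (auto intro!: derivative_eq_intros)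
  have e: "((%t. entry_deriv k l L (P + t *\<^sub>R H)) has_derivative (%s. matrix_gradient (entry_deriv k l L) (P + t *\<^sub>R H) \<bullet> (s *\<^sub>R H))) (at t)" for k l
   by (rule has_derivative_compose[OF line dE])
  have "((%t. \<Sum>k\<in>UNIV. \<Sum>l\<in>UNIV. entry_deriv k l L (P + t *\<^sub>R H) * G $ k $ l) has_derivative
   (%s. \<Sum>k\<in>UNIV. \<Sum>l\<in>UNIV. (matrix_gradient (entry_deriv k l L) (P + t *\<^sub>R H) \<bullet> (s *\<^sub>R H)) * G $ k $ l)) (at t)"
   by (intro has_derivative_sum has_derivative_mult_left e)
  moreover have "(%t. \<Sum>k\<in>UNIV. \<Sum>l\<in>UNIV. entry_deriv k l L (P + t *\<^sub>R H) * G $ k $ l) = (%t. ?A (P + t *\<^sub>R H) \<bullet> G)"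
   by (simp add: fun_eq_iff inner_vec_def matrix_gradient_def)
  moreover have "(%s. \<Sum>k\<in>UNIV. \<Sum>l\<in>UNIV. (matrix_gradient (entry_deriv k l L) (P + t *\<^sub>R H) \<bullet> (s *\<^sub>R H)) * G $ k $ l)
    = (*) (?h (P + t *\<^sub>R H) H G)"
   by (simp add: fun_eq_iff inner_vec_def matrix_gradient_def sum_2 algebra_simps)
  ultimately show ?thesis by (simp add: has_field_derivative_def)
 qed
 \<comment> \<open>The mean value theorem is used for the pairing with a fixed \<open>G\<close>:
   \<open>G = P - Q\<close> gives monotonicity, and \<open>G\<close> equal to the increment of
   \<open>?A\<close> itself gives the Lipschitz bound.\<close>
 have mvt: "\<exists>z. (?A (P + H) - ?A P) \<bullet> G = ?h (P + z *\<^sub>R H) H G" for P H G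
 proof -
  obtain z where "?A (P + 1 *\<^sub>R H) \<bullet> G - ?A (P + 0 *\<^sub>R H) \<bullet> G = (1 - 0) * ?h (P + z *\<^sub>R H) H G"
   using MVT2[of 0 1 "%t. ?A (P + t *\<^sub>R H) \<bullet> G" "%t. ?h (P + t *\<^sub>R H) H G"] der by auto
  then show ?thesis by (intro exI[of _ z]) (simp add: inner_diff_left)
 qed
 have mono: "\<mu> * (norm (P - Q))^2 <= (?A P - ?A Q) \<bullet> (P - Q)" for P Q
  using mvt[of Q "P - Q" "P - Q"] \<mu>(2)[of "P - Q"] by auto
 \<comment> \<open>16 is the number of entries of the Hessian; adding 1 keeps \<open>M\<close>
   positive when \<open>m\<close> is 0.\<close>
 define M where "M = 16 * m + 1"
 have M: "M > 0" using m0 by (simp add: M_def)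
 have lip: "norm (?A P - ?A Q) <= M * norm (P - Q)" for P Q
 proof -
  define G where "G = ?A P - ?A Q"
  define H where "H = P - Q"
  obtain z where z: "G \<bullet> G = ?h (Q + z *\<^sub>R H) H G" using mvt[of Q "P - Q" G] by (auto simp: G_def H_def)
  have "?h (Q + z *\<^sub>R H) H G <= (\<Sum>i\<in>(UNIV :: 2 set). \<Sum>j\<in>(UNIV :: 2 set). \<Sum>k\<in>(UNIV :: 2 set). \<Sum>l\<in>(UNIV :: 2 set). m * norm H * norm G)"
  proof (intro sum_mono)
   fix i j k l :: 2
   have "\<bar>entry_deriv i j (entry_deriv k l L) (Q + z *\<^sub>R H) * H $ i $ j * G $ k $ l\<bar> <= m * norm H * norm G"
    unfolding abs_mult using m m0 by (intro mult_mono entry_le_norm) auto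
   then show "entry_deriv i j (entry_deriv k l L) (Q + z *\<^sub>R H) * H $ i $ j * G $ k $ l <= m * norm H * norm G" by linarith
  qed
  also have "... = 16 * m * norm H * norm G" by simp
  also have "... <= M * norm H * norm G" using m0 by (intro mult_right_mono) (auto simp: M_def)
  finally have "norm G * norm G <= (M * norm H) * norm G" using z by (simp add: dot_square_norm power2_eq_square)
  then show ?thesis unfolding G_def[symmetric] H_def[symmetric] using M
   by (cases "norm G = 0") (auto dest: mult_right_le_imp_le)
 qed
 have dt: "((%t. L (P + t *\<^sub>R H)) has_real_derivative ?A (P + t *\<^sub>R H) \<bullet> H) (at t)" for P H t
 proof -
  have line: "((%t. P + t *\<^sub>R H) has_derivative (%s. s *\<^sub>R H)) (at t)" by (auto intro!: derivative_eq_intros)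
  from has_derivative_compose[OF line has_derivative_matrix_gradient[OF dL]]
  show ?thesis by (simp add: has_field_derivative_def mult_commute_abs)
 qed
 have inc: "\<mu> * t * (norm H)^2 <= (?A (P + t *\<^sub>R H) - ?A P) \<bullet> H" "(?A (P + t *\<^sub>R H) - ?A P) \<bullet> H <= M * t * (norm H)^2" if "t >= 0" for t P H
 proof -
  show "(?A (P + t *\<^sub>R H) - ?A P) \<bullet> H <= M * t * (norm H)^2"
  proof -
   have "(?A (P + t *\<^sub>R H) - ?A P) \<bullet> H <= norm (?A (P + t *\<^sub>R H) - ?A P) * norm H" by (rule norm_cauchy_schwarz)
   also have "... <= (M * (t * norm H)) * norm H" using lip[of "P + t *\<^sub>R H" P] that by (intro mult_right_mono) auto
   finally show ?thesis by (simp add: power2_eq_square mult_ac)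
  qed
  show "\<mu> * t * (norm H)^2 <= (?A (P + t *\<^sub>R H) - ?A P) \<bullet> H"
  proof (cases "t = 0")
   case False
   then have t: "t > 0" using that by simp
   have "\<mu> * (norm (t *\<^sub>R H))^2 <= (?A (P + t *\<^sub>R H) - ?A P) \<bullet> (t *\<^sub>R H)" using mono[of "P + t *\<^sub>R H" P] by simp
   then have "t * (\<mu> * t * (norm H)^2) <= t * ((?A (P + t *\<^sub>R H) - ?A P) \<bullet> H)"
    by (simp add: power_mult_distrib power2_eq_square mult_ac)
   then show ?thesis using t by (rule mult_left_le_imp_le)
  qed simp
 qed
 have "L P + ?A P \<bullet> H + \<mu> / 2 * (norm H)^2 <= L (P + H)" for P H
 proof -
  let ?s = "%t. L (P + t *\<^sub>R H) - t * (?A P \<bullet> H) - \<mu> / 2 * t^2 * (norm H)^2"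
  have "?s 0 <= ?s 1"
  proof (rule DERIV_nonneg_imp_nondecreasing[where f="?s"])
   fix t :: real assume "0 <= t"
   have "(?s has_real_derivative (?A (P + t *\<^sub>R H) \<bullet> H - ?A P \<bullet> H - \<mu> * t * (norm H)^2)) (at t)"
    by (auto intro!: derivative_eq_intros dt)
   then show "\<exists>y. (?s has_real_derivative y) (at t) & 0 <= y"
    using inc(1)[OF \<open>0 <= t\<close>, of H P] by (auto simp: inner_diff_left)
  qed simp
  then show ?thesis by simp
 qed
 moreover have "L (P + H) <= L P + ?A P \<bullet> H + M * (norm H)^2" for P H
 proof -
  let ?s = "%t. t * (?A P \<bullet> H) + M * t^2 * (norm H)^2 - L (P + t *\<^sub>R H)"
  have "?s 0 <= ?s 1"
  proof (rule DERIV_nonneg_imp_nondecreasing[where f="?s"])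
   fix t :: real assume t: "0 <= t"
   have d: "(?s has_real_derivative (?A P \<bullet> H + 2 * (M * t * (norm H)^2) - ?A (P + t *\<^sub>R H) \<bullet> H)) (at t)"
    by (auto intro!: derivative_eq_intros dt)
   have "0 <= M * t * (norm H)^2" using M t by simp
   then have "0 <= ?A P \<bullet> H + 2 * (M * t * (norm H)^2) - ?A (P + t *\<^sub>R H) \<bullet> H"
    using inc(2)[OF t, of P H] unfolding inner_diff_left by linarith
   then show "\<exists>y. (?s has_real_derivative y) (at t) & 0 <= y" using d by blast
  qed simp
  then show ?thesis by simp
 qed
 ultimately have "uniformly_elliptic L ?A \<mu> M"
  using \<mu>(1) M mono lip cL by unfold_locales
 then show ?thesis by blast
qed

section \<open>Decay of the excess\<close>

lemma square_le_cube: "e^2 <= \<rho>^2 + e ^ 3 / \<rho>" if "\<rho> > 0" "e >= 0" for e \<rho> :: real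
proof (cases "e <= \<rho>")
 case True
 then have "e^2 <= \<rho>^2" using that by (intro power_mono) auto
 moreover have "0 <= e ^ 3 / \<rho>" using that by simp
 ultimately show ?thesis by linarith
next
 case False
 then have "e^2 * \<rho> <= e^2 * e" by (intro mult_left_mono) auto
 then have "e^2 <= e ^ 3 / \<rho>" using that by (simp add: field_simps power2_eq_square power3_eq_cube)
 moreover have "0 <= \<rho>^2" by simp
 ultimately show ?thesis by linarith
qed

lemma norm_diff_square_le: "(norm (a - b))^2 <= 2 * (norm a)^2 + 2 * (norm b)^2" for a b :: "'a::real_inner"
proof -
 have "(norm (a - b))^2 + (norm (a + b))^2 = 2 * (norm a)^2 + 2 * (norm b)^2"
  by (simp add: power2_norm_eq_inner algebra_simps)
 then show ?thesis using zero_le_power2[of "norm (a + b)"] by linarith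
qed

lemma norm_add3_square_le: "(norm (a + b + c))^2 <= 3 * ((norm a)^2 + (norm b)^2 + (norm c)^2)" for a b c :: "'a::real_inner"
proof -
 have "3 * ((norm a)^2 + (norm b)^2 + (norm c)^2) - (norm (a + b + c))^2 = (norm (a - b))^2 + (norm (b - c))^2 + (norm (a - c))^2"
  by (simp add: power2_norm_eq_inner algebra_simps inner_commute)
 then show ?thesis using zero_le_power2[of "norm (a - b)"] zero_le_power2[of "norm (b - c)"] zero_le_power2[of "norm (a - c)"] by linarith
qed

lemma Young_le: "a * b <= c / 8 * b^2 + 2 / c * a^2" if "c > 0" for a b c :: real
proof -
 have "c / 8 * b^2 + 2 / c * a^2 - a * b = (c * b - 4 * a)^2 / (8 * c)"
  using that by (simp add: field_simps power2_eq_square)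
 moreover have "0 <= (c * b - 4 * a)^2 / (8 * c)" using that by simp
 ultimately show ?thesis by linarith
qed

section \<open>Square integrability and the excess\<close>

context planar_Sobolev
begin

lemma integrable_growth:
 fixes f :: "real^2 => 'b::euclidean_space"
 assumes f: "f : borel_measurable borel" and le: "!!x. x : cube x0 r ==> norm (f x) <= c * (1 + norm (D x) ^ 3)"
 shows "set_integrable lborel (cube x0 r) f" "f integrable_on cube x0 r"
proof -
 have Q [measurable]: "cube x0 r : sets borel" using compact_cube by (simp add: borel_compact)
 have i: "integrable lborel (%x. c * (indicator (cube x0 r) x + norm (D x) ^ 3))"
  using D_int3 emeasure_bounded_finite[OF compact_imp_bounded[OF compact_cube], of x0 r]
  by (intro integrable_mult_right LINT_add integrable_real_indicator) auto
 show "set_integrable lborel (cube x0 r) f"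
  unfolding set_integrable_def
 proof (rule LINT_bound[OF i])
  show "(%x. indicator (cube x0 r) x *\<^sub>R f x) : borel_measurable lborel" using f by measurable
  have "norm (indicator (cube x0 r) x *\<^sub>R f x) <= \<bar>c * (indicator (cube x0 r) x + norm (D x) ^ 3)\<bar>" for x
   using le[of x] by (cases "x : cube x0 r") auto
  then show "AE x in lborel. norm (indicator (cube x0 r) x *\<^sub>R f x) <= norm (c * (indicator (cube x0 r) x + norm (D x) ^ 3))"
   by simp
 qed
 then show "f integrable_on cube x0 r" by (rule set_borel_integral_eq_integral(1))
qed

lemma growth_le: "norm (D x) <= 1 + norm (D x) ^ 3" "(norm (D x))^2 <= 1 + norm (D x) ^ 3"
proof -
 have "a <= 1 + a ^ 3 & a^2 <= 1 + a ^ 3" if "a >= 0" for a :: real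
 proof (cases "a <= 1")
  case True
  then have "a^2 <= 1" using that by (simp add: power_le_one)
  then show ?thesis using True that zero_le_power[OF that, of 3] by linarith
 next
  case False
  then have "a ^ 1 <= a ^ 3" "a ^ 2 <= a ^ 3" by (intro power_increasing; simp)+
  then show ?thesis by simp
 qed
 then show "norm (D x) <= 1 + norm (D x) ^ 3" "(norm (D x))^2 <= 1 + norm (D x) ^ 3" by simp_all
qed

lemma D_integrable_cube: "D integrable_on cube x0 r"
 using growth_le(1) by (intro integrable_growth(2)[where c=1]) auto

lemma D_diff_square_integrable:
 assumes F: "continuous_on UNIV F"
 shows "(%x. (norm (D x - F x))^2) integrable_on cube x0 r"
proof -
 have [measurable]: "F : borel_measurable borel" by (rule borel_measurable_continuous_onI[OF F])
 have "compact (F ` cube x0 r)" using F by (intro compact_continuous_image compact_cube) (auto intro: continuous_on_subset)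
 then obtain B where B: "!!x. x : cube x0 r ==> norm (F x) <= B"
  using compact_imp_bounded[of "F ` cube x0 r"] by (auto simp: bounded_iff)
 show ?thesis
 proof (rule integrable_growth(2)[where c="2 + 2 * B^2"])
  fix x assume x: "x : cube x0 r"
  have "(norm (D x - F x))^2 <= 2 * (norm (D x))^2 + 2 * (norm (F x))^2" by (rule norm_diff_square_le)
  also have "... <= 2 * (1 + norm (D x) ^ 3) + 2 * B^2"
   using growth_le(2)[of x] power_mono[OF B[OF x] norm_ge_zero, of 2]
   by (intro add_mono mult_left_mono) auto
  also have "... <= (2 + 2 * B^2) * (1 + norm (D x) ^ 3)" by (simp add: algebra_simps)
  finally show "norm ((norm (D x - F x))^2) <= (2 + 2 * B^2) * (1 + norm (D x) ^ 3)" by simp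
 qed measurable
qed

definition cube_mean :: "real^2 => real => real^2^2"
 where "cube_mean x r = integral (cube x r) D /\<^sub>R (4 * r^2)"

text \<open>Not divided by the area, so that integrals over nested cubes compare directly; the
  normalization is put into \<open>U\<close>.\<close>

definition excess :: "real^2 => real => real"
 where "excess x r = integral (cube x r) (%y. (norm (D y - cube_mean x r))^2)"

lemma square_integrable: "(%y. (norm (D y - P))^2) integrable_on cube x r"
 by (rule D_diff_square_integrable) simp

lemma excess_nonneg: "excess x r >= 0"
 unfolding excess_def by (intro integral_nonneg square_integrable) simp

lemma has_integral_const_cube: "r >= 0 ==> ((%y. c) has_integral (4 * r^2) *\<^sub>R c) (cube x r)" for c :: "'b::euclidean_space"
 using has_integral_const[of c "x - vec r" "x + vec r"] measure_cube[of r x] by (simp add: cube_def)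

text \<open>The deviation from the mean integrates to zero, so the cross term vanishes. Hence the
  mean minimizes the mean square deviation, and distances of means can be read off from such
  integrals.\<close>

lemma excess_expand:
 assumes "r > 0"
 shows "integral (cube x r) (%y. (norm (D y - P))^2) = excess x r + 4 * r^2 * (norm (cube_mean x r - P))^2"
proof -
 let ?m = "cube_mean x r"
 have "((%y. D y - ?m) has_integral (integral (cube x r) D - (4 * r^2) *\<^sub>R ?m)) (cube x r)"
  using assms by (intro has_integral_diff integrable_integral D_integrable_cube has_integral_const_cube) auto
 then have "((%y. D y - ?m) has_integral 0) (cube x r)" using assms by (simp add: cube_mean_def)
 from has_integral_linear[OF this bounded_linear_inner_left[of "2 *\<^sub>R (?m - P)"]]
 have "((%y. (D y - ?m) \<bullet> (2 *\<^sub>R (?m - P))) has_integral 0) (cube x r)" by (simp add: o_def)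
 moreover have "((%y. (norm (D y - ?m))^2) has_integral excess x r) (cube x r)"
  unfolding excess_def by (rule integrable_integral[OF square_integrable])
 moreover have "((%y. (norm (?m - P))^2) has_integral (4 * r^2) *\<^sub>R (norm (?m - P))^2) (cube x r)"
  by (rule has_integral_const_cube) (use assms in simp)
 ultimately have "((%y. (norm (D y - ?m))^2 + (D y - ?m) \<bullet> (2 *\<^sub>R (?m - P)) + (norm (?m - P))^2) has_integral
   (excess x r + 0 + (4 * r^2) *\<^sub>R (norm (?m - P))^2)) (cube x r)" by (intro has_integral_add)
 moreover have "(norm (D y - ?m))^2 + (D y - ?m) \<bullet> (2 *\<^sub>R (?m - P)) + (norm (?m - P))^2 = (norm (D y - P))^2" for y
  by (simp add: power2_norm_eq_inner algebra_simps inner_commute)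
 ultimately show ?thesis by (simp add: integral_unique)
qed

lemma excess_le:
 assumes "r > 0" shows "excess x r <= integral (cube x r) (%y. (norm (D y - P))^2)"
 unfolding excess_expand[OF assms, of x P] by simp

lemma C1_approx_square:
 assumes Q: "cube x0 R <= \<Omega>" and R: "R > 0" and \<eta>: "\<eta> > 0"
 obtains f F where "C1_map f F" "integral (cube x0 R) (%x. (norm (D x - F x))^2) <= \<eta>"
proof -
 \<comment> \<open>In \<open>square_le_cube\<close> the constant part then contributes
   \<open>\<eta> / 2\<close> over the cube of area \<open>4 * R^2\<close>, and the cubed error is
   made smaller than \<open>\<rho> * \<eta> / 2\<close>.\<close>
 define \<rho> where "\<rho> = sqrt (\<eta> / (8 * R^2))"
 have \<rho>: "\<rho> > 0" "\<rho>^2 * (4 * R^2) = \<eta> / 2" using \<eta> R by (auto simp: \<rho>_def)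
 obtain f F where f: "C1_map f F" "(%x. norm (F x - D x) ^ 3) integrable_on cube x0 R"
  "integral (cube x0 R) (%x. norm (F x - D x) ^ 3) < \<rho> * \<eta> / 2"
  by (rule C1_approx_cbox[OF Q[unfolded cube_def], of "\<rho> * \<eta> / 2"]) (use \<rho> \<eta> in \<open>auto simp: cube_def\<close>)
 have cF: "continuous_on UNIV F" by (rule C1_map_continuous_deriv[OF f(1)])
 have c: "((%y. \<rho>^2) has_integral (4 * R^2) *\<^sub>R \<rho>^2) (cube x0 R)" using R by (intro has_integral_const_cube) auto
 have "integral (cube x0 R) (%x. (norm (D x - F x))^2) <= integral (cube x0 R) (%x. \<rho>^2 + norm (F x - D x) ^ 3 / \<rho>)"
 proof (rule integral_le[OF D_diff_square_integrable[OF cF]])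
  show "(%x. \<rho>^2 + norm (F x - D x) ^ 3 / \<rho>) integrable_on cube x0 R"
   using c f(2) by (intro integrable_add integrable_on_divide) (auto simp: integrable_on_def)
  show "(norm (D x - F x))^2 <= \<rho>^2 + norm (F x - D x) ^ 3 / \<rho>" for x
   using square_le_cube[OF \<rho>(1) norm_ge_zero, of "D x - F x"] by (simp add: norm_minus_commute)
 qed
 also have "... = (4 * R^2) *\<^sub>R \<rho>^2 + integral (cube x0 R) (%x. norm (F x - D x) ^ 3) / \<rho>"
  using has_integral_add[OF c has_integral_divide[OF integrable_integral[OF f(2)], of \<rho>]] by (rule integral_unique)
 also have "... <= \<eta> / 2 + \<eta> / 2"
 proof (rule add_mono)
  show "(4 * R^2) *\<^sub>R \<rho>^2 <= \<eta> / 2" using \<rho>(2) by (simp add: mult.commute)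
  show "integral (cube x0 R) (%x. norm (F x - D x) ^ 3) / \<rho> <= \<eta> / 2"
   using f(3) \<rho>(1) by (simp add: divide_simps mult.commute)
 qed
 finally have "integral (cube x0 R) (%x. (norm (D x - F x))^2) <= \<eta>" by simp
 then show ?thesis using that f(1) by blast
qed

end

text \<open>The outcome of the pressure equation in abstract form: \<open>p\<close> stands for the
  pressure carried back to the reference domain.\<close>

locale pressure_critical = area_preserving \<Omega> u D + uniformly_elliptic L A \<mu> M
 for \<Omega> u D L A \<mu> M +
 fixes p :: "real^2 => real"
 assumes p_continuous: "continuous_on \<Omega> p"
  and critical: "!!\<phi> \<Phi> K. C1_map \<phi> \<Phi> ==> compact K ==> K <= \<Omega> ==> (!!x. x ~: K ==> \<phi> x = 0) ==>
   (LINT x|lborel. A (D x) \<bullet> \<Phi> x) = (LINT x|lborel. indicator \<Omega> x * (p x * (cofactor2 (D x) \<bullet> \<Phi> x)))"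
begin

lemma A_growth: "norm (A P) <= norm (A 0) + M * norm P"
 using Lipschitz[of P 0] norm_triangle_sub[of "A P" "A 0"] by simp

text \<open>By \<open>cofactor2_null\<close> any constant may be subtracted from the pressure; with
  its value at the centre of the cube only the oscillation remains.\<close>

lemma critical_cube:
 assumes \<phi>: "C1_map \<phi> \<Phi>" and Q: "cube x0 R <= \<Omega>" and van: "!!x. x ~: cube x0 R ==> \<phi> x = 0"
  and \<omega>: "!!x. x : cube x0 R ==> \<bar>p x - c\<bar> <= \<omega>"
 shows "(%x. A (D x) \<bullet> \<Phi> x) integrable_on cube x0 R"
  "(%x. (p x - c) * (cofactor2 (D x) \<bullet> \<Phi> x)) integrable_on cube x0 R"
  "integral (cube x0 R) (%x. A (D x) \<bullet> \<Phi> x) = integral (cube x0 R) (%x. (p x - c) * (cofactor2 (D x) \<bullet> \<Phi> x))"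
proof -
 let ?Q = "cube x0 R"
 have Qm [measurable]: "?Q : sets borel" using compact_cube by (simp add: borel_compact)
 have c\<Phi>: "continuous_on UNIV \<Phi>" by (rule C1_map_continuous_deriv[OF \<phi>])
 have \<Phi>0: "\<Phi> x = 0" if "x ~: ?Q" for x
  by (rule C1_map_vanish[OF \<phi> compact_imp_closed[OF compact_cube] van that])
 have [measurable]: "\<Phi> : borel_measurable borel" "A : borel_measurable borel"
  using c\<Phi> A_continuous by (auto intro: borel_measurable_continuous_onI)
 define p\<^sub>0 where "p\<^sub>0 x = indicator \<Omega> x *\<^sub>R p x" for x
 have [measurable]: "p\<^sub>0 : borel_measurable borel"
  unfolding p\<^sub>0_def[abs_def] using p_continuous open_\<Omega> by (intro borel_measurable_continuous_on_indicator) auto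
 have p0: "p\<^sub>0 x = p x" if "x : ?Q" for x using that Q by (auto simp: p\<^sub>0_def)
 have "compact (\<Phi> ` ?Q)" using c\<Phi> by (intro compact_continuous_image compact_cube) (auto intro: continuous_on_subset)
 then obtain B where B: "B > 0" "!!x. x : ?Q ==> norm (\<Phi> x) <= B"
  using compact_imp_bounded[of "\<Phi> ` ?Q"] by (auto simp: bounded_pos)
 have full: "integrable lborel f & integral\<^sup>L lborel f = integral ?Q f"
  if i: "set_integrable lborel ?Q f" and z: "!!x. x ~: ?Q ==> f x = 0" for f :: "real^2 => real"
 proof -
  have "(%x. indicator ?Q x *\<^sub>R f x) = f" using z by (auto simp: indicator_def fun_eq_iff)
  then show ?thesis using i set_borel_integral_eq_integral(2)[OF i] by (simp add: set_integrable_def set_lebesgue_integral_def)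
 qed
 have cof: "\<bar>cofactor2 (D x) \<bullet> \<Phi> x\<bar> <= (1 + norm (D x) ^ 3) * B" if "x : ?Q" for x
 proof -
  have "\<bar>cofactor2 (D x) \<bullet> \<Phi> x\<bar> <= norm (D x) * norm (\<Phi> x)"
   using Cauchy_Schwarz_ineq2[of "cofactor2 (D x)" "\<Phi> x"] by (simp add: norm_cofactor2)
  also have "... <= (1 + norm (D x) ^ 3) * B" using growth_le(1) B(2)[OF that] by (intro mult_mono) auto
  finally show ?thesis .
 qed
 have iA: "set_integrable lborel ?Q (%x. A (D x) \<bullet> \<Phi> x)"
 proof (rule integrable_growth(1)[where c="(norm (A 0) + M) * B"])
  fix x assume x: "x : ?Q"
  have "norm (A (D x)) <= norm (A 0) * 1 + M * norm (D x)" using A_growth[of "D x"] by simp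
  also have "... <= norm (A 0) * (1 + norm (D x) ^ 3) + M * (1 + norm (D x) ^ 3)"
   using growth_le(1)[of x] M_pos by (intro add_mono mult_left_mono) auto
  finally have le: "norm (A (D x)) <= norm (A 0) * (1 + norm (D x) ^ 3) + M * (1 + norm (D x) ^ 3)" .
  have "0 <= (norm (A 0) + M) * (1 + norm (D x) ^ 3)"
   using M_pos by (intro mult_nonneg_nonneg add_nonneg_nonneg) auto
  then have "norm (A (D x)) * norm (\<Phi> x) <= ((norm (A 0) + M) * (1 + norm (D x) ^ 3)) * B"
   using B(2)[OF x] B(1) le by (intro mult_mono) (auto simp: algebra_simps)
  then show "norm (A (D x) \<bullet> \<Phi> x) <= (norm (A 0) + M) * B * (1 + norm (D x) ^ 3)"
   using Cauchy_Schwarz_ineq2[of "A (D x)" "\<Phi> x"] by (simp add: mult_ac)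
 qed measurable
 have ip: "set_integrable lborel ?Q (%x. (p\<^sub>0 x - c) * (cofactor2 (D x) \<bullet> \<Phi> x))"
 proof (rule integrable_growth(1)[where c="\<omega> * B"])
  fix x assume x: "x : ?Q"
  have "\<bar>p\<^sub>0 x - c\<bar> * \<bar>cofactor2 (D x) \<bullet> \<Phi> x\<bar> <= \<omega> * ((1 + norm (D x) ^ 3) * B)"
   using \<omega>[OF x] cof[OF x] p0[OF x] abs_ge_zero[of "p x - c"] by (intro mult_mono) auto
  then show "norm ((p\<^sub>0 x - c) * (cofactor2 (D x) \<bullet> \<Phi> x)) <= \<omega> * B * (1 + norm (D x) ^ 3)"
   by (simp add: abs_mult mult_ac)
 qed measurable
 note fA = full[OF iA] and fp = full[OF ip]
 note null = cofactor2_null[OF \<phi> compact_cube Q van]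
 show "(%x. A (D x) \<bullet> \<Phi> x) integrable_on ?Q" by (rule set_borel_integral_eq_integral(1)[OF iA])
 have "(%x. (p\<^sub>0 x - c) * (cofactor2 (D x) \<bullet> \<Phi> x)) integrable_on ?Q" by (rule set_borel_integral_eq_integral(1)[OF ip])
 then show "(%x. (p x - c) * (cofactor2 (D x) \<bullet> \<Phi> x)) integrable_on ?Q"
  by (rule integrable_eq) (simp add: p0)
 have "integral ?Q (%x. A (D x) \<bullet> \<Phi> x) = (LINT x|lborel. A (D x) \<bullet> \<Phi> x)" using fA \<Phi>0 by simp
 also have "... = (LINT x|lborel. indicator \<Omega> x * (p x * (cofactor2 (D x) \<bullet> \<Phi> x)))"
  by (rule critical[OF \<phi> compact_cube Q van])
 also have "... = (LINT x|lborel. (p\<^sub>0 x - c) * (cofactor2 (D x) \<bullet> \<Phi> x) + c * (cofactor2 (D x) \<bullet> \<Phi> x))"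
  by (rule LINT_cong) (simp_all add: p\<^sub>0_def algebra_simps)
 also have "... = (LINT x|lborel. (p\<^sub>0 x - c) * (cofactor2 (D x) \<bullet> \<Phi> x)) + c * (LINT x|lborel. cofactor2 (D x) \<bullet> \<Phi> x)"
  using fp \<Phi>0 null(1) by simp
 also have "... = integral ?Q (%x. (p\<^sub>0 x - c) * (cofactor2 (D x) \<bullet> \<Phi> x))" using fp \<Phi>0 null(2) by simp
 also have "... = integral ?Q (%x. (p x - c) * (cofactor2 (D x) \<bullet> \<Phi> x))"
  by (rule integral_cong) (simp add: p0)
 finally show "integral ?Q (%x. A (D x) \<bullet> \<Phi> x) = integral ?Q (%x. (p x - c) * (cofactor2 (D x) \<bullet> \<Phi> x))" .
qed

text \<open>The sum of the three coefficients that \<open>comparison\<close> produces, so that one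
  constant bounds each of them.\<close>

definition "C\<^sub>2 = 8 * M / \<mu>^2 + 4 * M^2 / \<mu>^2 + 4 / \<mu>^2"

lemma C2_pos: "C\<^sub>2 > 0"
 unfolding C\<^sub>2_def using \<mu>_pos M_pos by (intro add_pos_pos divide_pos_pos) auto

text \<open>\<Phi>, the step from the smooth approximation \<open>F\<close> to the near minimizer,
  is tested in both equations, the near-critical one for \<open>F + \<Phi>\<close> and the exact one
  for \<open>D\<close>. Monotonicity yields its square; what remains is the defect, the
  approximation error, and the oscillation of the pressure times the gradient.\<close>

lemma comparison:
 assumes Q: "cube x0 R <= \<Omega>" and R: "R > 0" and \<omega>: "\<omega> >= 0" "!!x. x : cube x0 R ==> \<bar>p x - c\<bar> <= \<omega>"
  and f: "C1_map f F" and \<delta>: "\<delta> > 0" and \<phi>: "C1_map \<phi> \<Phi>" "!!x. x ~: cube x0 R ==> \<phi> x = 0"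
  and ac: "almost_critical \<delta> (%x. F x + \<Phi> x) (cube x0 R)"
 shows "integral (cube x0 R) (%x. (norm (\<Phi> x))^2) <=
  C\<^sub>2 * (\<delta> + integral (cube x0 R) (%x. (norm (D x - F x))^2) + \<omega>^2 * integral (cube x0 R) (%x. (norm (D x))^2))"
proof -
 let ?Q = "cube x0 R"
 have c: "continuous_on UNIV F" "continuous_on UNIV \<Phi>"
  using C1_map_continuous_deriv[OF f] C1_map_continuous_deriv[OF \<phi>(1)] by auto
 have cA: "continuous_on UNIV (%x. A (G x))" if "continuous_on UNIV G" for G :: "real^2 => real^2^2"
  by (rule continuous_on_compose2[OF A_continuous that]) simp
 define S X Y where "S = integral ?Q (%x. (norm (\<Phi> x))^2)" and "X = integral ?Q (%x. (norm (D x - F x))^2)"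
  and "Y = integral ?Q (%x. (norm (D x))^2)"
 have hS: "((%x. (norm (\<Phi> x))^2) has_integral S) ?Q"
  unfolding S_def by (intro integrable_integral integrable_on_cube continuous_intros c)
 have hX: "((%x. (norm (D x - F x))^2) has_integral X) ?Q"
  unfolding X_def by (intro integrable_integral D_diff_square_integrable c)
 have hY: "((%x. (norm (D x))^2) has_integral Y) ?Q"
  unfolding Y_def using square_integrable[of 0 x0 R] by (simp add: integrable_integral)
 note cc = critical_cube[OF \<phi>(1) Q \<phi>(2) \<omega>(2)]
 define a b d where "a = integral ?Q (%x. A (F x + \<Phi> x) \<bullet> \<Phi> x)" and "b = integral ?Q (%x. A (D x) \<bullet> \<Phi> x)"
  and "d = integral ?Q (%x. (p x - c) * (cofactor2 (D x) \<bullet> \<Phi> x))"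
 have ha: "((%x. A (F x + \<Phi> x) \<bullet> \<Phi> x) has_integral a) ?Q"
  unfolding a_def by (intro integrable_integral integrable_on_cube continuous_intros cA c)
 have hb: "((%x. A (D x) \<bullet> \<Phi> x) has_integral b) ?Q" unfolding b_def by (rule integrable_integral[OF cc(1)])
 have hd: "((%x. (p x - c) * (cofactor2 (D x) \<bullet> \<Phi> x)) has_integral d) ?Q" unfolding d_def by (rule integrable_integral[OF cc(2)])
 have bd: "b = d" unfolding b_def d_def by (rule cc(3))
 \<comment> \<open>Half of the ellipticity is spent: \<open>\<mu> / 4\<close> on the defect through
   this value of \<open>t\<close>, and twice \<open>\<mu> / 8\<close> in Young's inequality.\<close>
 have t: "\<mu> / (4 * M) > 0" using \<mu>_pos M_pos by simp
 have "\<bar>a\<bar> <= \<delta> / (\<mu> / (4 * M)) + M * (\<mu> / (4 * M)) * S"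
  unfolding a_def S_def by (rule almost_criticalD[OF ac \<phi> t])
 then have a: "a <= 4 * M / \<mu> * \<delta> + \<mu> / 4 * S" using M_pos by (simp add: mult.commute)
 have point: "\<mu> * (norm (\<Phi> x))^2 <= A (F x + \<Phi> x) \<bullet> \<Phi> x - A (D x) \<bullet> \<Phi> x + (p x - c) * (cofactor2 (D x) \<bullet> \<Phi> x)
   + (\<mu> / 4 * (norm (\<Phi> x))^2 + 2 * M^2 / \<mu> * (norm (D x - F x))^2 + 2 * \<omega>^2 / \<mu> * (norm (D x))^2)" if x: "x : ?Q" for x
 proof -
  have "\<mu> * (norm (\<Phi> x))^2 <= (A (F x + \<Phi> x) - A (F x)) \<bullet> \<Phi> x" using monotone[of "F x + \<Phi> x" "F x"] by simp
  moreover have "(A (F x + \<Phi> x) - A (F x)) \<bullet> \<Phi> x = A (F x + \<Phi> x) \<bullet> \<Phi> x - A (D x) \<bullet> \<Phi> x + (A (D x) - A (F x)) \<bullet> \<Phi> x"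
   by (simp add: inner_diff_left)
  moreover have "(A (D x) - A (F x)) \<bullet> \<Phi> x <= \<mu> / 8 * (norm (\<Phi> x))^2 + 2 * M^2 / \<mu> * (norm (D x - F x))^2"
  proof -
   have "(A (D x) - A (F x)) \<bullet> \<Phi> x <= norm (A (D x) - A (F x)) * norm (\<Phi> x)" by (rule norm_cauchy_schwarz)
   also have "... <= (M * norm (D x - F x)) * norm (\<Phi> x)" by (intro mult_right_mono Lipschitz) simp
   also have "... <= \<mu> / 8 * (norm (\<Phi> x))^2 + 2 / \<mu> * (M * norm (D x - F x))^2" by (rule Young_le[OF \<mu>_pos])
   finally show ?thesis by (simp add: power_mult_distrib)
  qed
  moreover have "- ((p x - c) * (cofactor2 (D x) \<bullet> \<Phi> x)) <= \<mu> / 8 * (norm (\<Phi> x))^2 + 2 * \<omega>^2 / \<mu> * (norm (D x))^2"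
  proof -
   have "- ((p x - c) * (cofactor2 (D x) \<bullet> \<Phi> x)) <= \<bar>p x - c\<bar> * \<bar>cofactor2 (D x) \<bullet> \<Phi> x\<bar>"
    by (simp add: abs_mult[symmetric])
   also have "... <= \<omega> * (norm (D x) * norm (\<Phi> x))"
    using \<omega>(1) \<omega>(2)[OF x] Cauchy_Schwarz_ineq2[of "cofactor2 (D x)" "\<Phi> x"] by (intro mult_mono) (auto simp: norm_cofactor2)
   also have "... = (\<omega> * norm (D x)) * norm (\<Phi> x)" by simp
   also have "... <= \<mu> / 8 * (norm (\<Phi> x))^2 + 2 / \<mu> * (\<omega> * norm (D x))^2" by (rule Young_le[OF \<mu>_pos])
   finally show ?thesis by (simp add: power_mult_distrib)
  qed
  moreover have "\<mu> / 4 * (norm (\<Phi> x))^2 = \<mu> / 8 * (norm (\<Phi> x))^2 + \<mu> / 8 * (norm (\<Phi> x))^2" by simp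
  ultimately show ?thesis by linarith
 qed
 have "\<mu> * S <= a - b + d + (\<mu> / 4 * S + 2 * M^2 / \<mu> * X + 2 * \<omega>^2 / \<mu> * Y)"
  by (rule has_integral_le[OF has_integral_mult_right[OF hS] has_integral_add[OF has_integral_add[OF has_integral_diff[OF ha hb] hd]
   has_integral_add[OF has_integral_add[OF has_integral_mult_right[OF hS] has_integral_mult_right[OF hX]] has_integral_mult_right[OF hY]]]])
   (rule point)
 then have "\<mu> / 2 * S <= 4 * M / \<mu> * \<delta> + 2 * M^2 / \<mu> * X + 2 * \<omega>^2 / \<mu> * Y" using a bd by linarith
 then have "2 / \<mu> * (\<mu> / 2 * S) <= 2 / \<mu> * (4 * M / \<mu> * \<delta> + 2 * M^2 / \<mu> * X + 2 * \<omega>^2 / \<mu> * Y)"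
  using \<mu>_pos by (intro mult_left_mono) auto
 then have "S <= 8 * M / \<mu>^2 * \<delta> + 4 * M^2 / \<mu>^2 * X + 4 / \<mu>^2 * (\<omega>^2 * Y)"
  using \<mu>_pos by (simp add: algebra_simps power2_eq_square)
 also have "... <= C\<^sub>2 * \<delta> + C\<^sub>2 * X + C\<^sub>2 * (\<omega>^2 * Y)"
 proof -
  have "X >= 0" "Y >= 0" using has_integral_nonneg[OF hX] has_integral_nonneg[OF hY] by auto
  moreover have "0 <= 8 * M / \<mu>^2" "0 <= 4 * M^2 / \<mu>^2" "0 <= 4 / \<mu>^2" using \<mu>_pos M_pos by auto
  then have "8 * M / \<mu>^2 <= C\<^sub>2" "4 * M^2 / \<mu>^2 <= C\<^sub>2" "4 / \<mu>^2 <= C\<^sub>2" unfolding C\<^sub>2_def by linarith+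
  ultimately show ?thesis using \<delta> by (intro add_mono mult_right_mono) auto
 qed
 finally show ?thesis by (simp add: S_def X_def Y_def algebra_simps)
qed

text \<open>1728 is \<open>3 * 576\<close> and 12 is \<open>3 * 4\<close>: the factors of
  \<open>excess_decay\<close> times the 3 of \<open>norm_add3_square_le\<close>.\<close>

definition "C\<^sub>3 = 3 * (1 + C\<^sub>2) * (1 + 1728 * C\<^sub>1) + 12 * (C\<^sub>1 + C\<^sub>1 / (1 - \<theta>))"

text \<open>The decay of the near minimizer \<open>H\<close> passes to \<open>D\<close>, since the
  two differ by the approximation error and \<Phi>, both controlled on the large cube. The defect is
  arbitrary and disappears in the end; the pressure term stays.\<close>

lemma excess_decay_pressure:
 assumes Q: "cube x0 R <= \<Omega>" and R: "R > 0" and \<omega>: "\<omega> >= 0" "!!x. x : cube x0 R ==> \<bar>p x - c\<bar> <= \<omega>"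
 shows "excess x0 (R / (6 * 3 ^ k)) <= 5184 * C\<^sub>1 * \<theta> ^ k * (1 / (3 ^ k)^2) * excess x0 R
  + C\<^sub>3 * \<omega>^2 * integral (cube x0 R) (%x. (norm (D x))^2)"
proof -
 let ?Q = "cube x0 R" and ?r = "R / (6 * 3 ^ k)"
 let ?q = "cube x0 ?r"
 define Y where "Y = integral ?Q (%x. (norm (D x))^2)"
 define e where "e = \<theta> ^ k * (1 / (3 ^ k)^2)"
 have \<theta>: "0 < \<theta>" "\<theta> < 1" by (rule \<theta>_bounds)+
 have C1: "C\<^sub>1 > 0" by (rule C\<^sub>1_pos)
 have "e <= 1 * 1" unfolding e_def using \<theta> by (intro mult_mono) (auto simp: power_le_one)
 then have e: "0 <= e" "e <= 1" using \<theta> by (auto simp: e_def)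
 have r: "?r > 0" "?r <= R"
 proof -
  show "?r > 0" using R by simp
  have "R / (6 * 3 ^ k) <= R / 1" using R by (intro divide_left_mono) (auto intro: order_trans[of 1 6])
  then show "?r <= R" by simp
 qed
 have C3: "C\<^sub>3 > 0" unfolding C\<^sub>3_def using C1 C2_pos \<theta> by (intro add_pos_pos mult_pos_pos divide_pos_pos) auto
 have "excess x0 ?r <= 5184 * C\<^sub>1 * e * excess x0 R + C\<^sub>3 * \<omega>^2 * Y + \<epsilon>" if \<epsilon>: "\<epsilon> > 0" for \<epsilon>
 proof -
  \<comment> \<open>\<delta> serves twice, as the defect of near minimality and as the approximation
    error; together they cost \<epsilon>.\<close>
  define \<delta> where "\<delta> = \<epsilon> / (2 * C\<^sub>3)"
  have \<delta>: "\<delta> > 0" "C\<^sub>3 * (2 * \<delta>) = \<epsilon>" using \<epsilon> C3 by (auto simp: \<delta>_def)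
  obtain f F where f: "C1_map f F" and X: "integral ?Q (%x. (norm (D x - F x))^2) <= \<delta>"
   by (rule C1_approx_square[OF Q R \<delta>(1)]) blast
  obtain \<phi> \<Phi> where \<phi>: "C1_map \<phi> \<Phi>" "!!x. x ~: ?Q ==> \<phi> x = 0"
   and ac: "almost_critical \<delta> (%x. F x + \<Phi> x) ?Q"
   by (rule almost_critical_exists[OF f \<delta>(1)]) blast
  define H where "H x = F x + \<Phi> x" for x
  define m where "m = cube_mean x0 R"
  have h: "C1_map (%x. f x + \<phi> x) H" unfolding H_def[abs_def] by (rule C1_map_add[OF f \<phi>(1)])
  have c: "continuous_on UNIV F" "continuous_on UNIV \<Phi>" "continuous_on UNIV H"
   using C1_map_continuous_deriv[OF f] C1_map_continuous_deriv[OF \<phi>(1)] C1_map_continuous_deriv[OF h] by auto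
  obtain m' where m': "integral ?q (%x. (norm (H x - m'))^2) <= 576 * C\<^sub>1 * \<theta> ^ k * (1 / (3 ^ k)^2) * integral ?Q (%x. (norm (H x - m))^2)
   + 4 * (C\<^sub>1 + C\<^sub>1 / (1 - \<theta>)) * \<delta>"
   by (rule excess_decay[OF h ac[folded H_def] less_imp_le[OF \<delta>(1)] R]) blast
  define S X' Z Z' where "S = integral ?Q (%x. (norm (\<Phi> x))^2)" and "X' = integral ?Q (%x. (norm (D x - F x))^2)"
   and "Z = integral ?Q (%x. (norm (H x - m))^2)" and "Z' = integral ?q (%x. (norm (H x - m'))^2)"
  have hS: "((%x. (norm (\<Phi> x))^2) has_integral S) ?Q" "(%x. (norm (\<Phi> x))^2) integrable_on ?q"
   unfolding S_def by (intro integrable_integral integrable_on_cube continuous_intros c)+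
  have hX: "((%x. (norm (D x - F x))^2) has_integral X') ?Q" "(%x. (norm (D x - F x))^2) integrable_on ?q"
   unfolding X'_def by (intro integrable_integral D_diff_square_integrable c)+
  have hZ: "((%x. (norm (H x - m))^2) has_integral Z) ?Q" "((%x. (norm (H x - m'))^2) has_integral Z') ?q"
   unfolding Z_def Z'_def by (intro integrable_integral integrable_on_cube continuous_intros c)+
  have hV: "((%x. (norm (D x - m))^2) has_integral excess x0 R) ?Q"
   unfolding excess_def m_def by (rule integrable_integral[OF square_integrable])
  have X0: "X' >= 0" "S >= 0" using has_integral_nonneg[OF hX(1)] has_integral_nonneg[OF hS(1)] by auto
  have Y0: "\<omega>^2 * Y >= 0"
   unfolding Y_def using square_integrable[of 0 x0 R] by (intro mult_nonneg_nonneg integral_nonneg) auto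
  have S: "S <= C\<^sub>2 * (\<delta> + X' + \<omega>^2 * Y)"
   unfolding S_def X'_def Y_def by (rule comparison[OF Q R \<omega> f \<delta>(1) \<phi> ac])
  have Z: "Z <= 3 * (excess x0 R + X' + S)"
  proof (rule has_integral_le[OF hZ(1) has_integral_mult_right[OF has_integral_add[OF has_integral_add[OF hV hX(1)] hS(1)]]])
   fix x
   have "H x - m = (D x - m) + (- (D x - F x)) + \<Phi> x" by (simp add: H_def)
   then show "(norm (H x - m))^2 <= 3 * ((norm (D x - m))^2 + (norm (D x - F x))^2 + (norm (\<Phi> x))^2)"
    using norm_add3_square_le[of "D x - m" "- (D x - F x)" "\<Phi> x"] by (metis norm_minus_cancel)
  qed
  have sub: "?q <= ?Q" by (rule cube_mono[OF r(2)])
  have "excess x0 ?r <= integral ?q (%x. (norm (D x - m'))^2)" by (rule excess_le[OF r(1)])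
  also have "... <= 3 * (integral ?q (%x. (norm (D x - F x))^2) + integral ?q (%x. (norm (\<Phi> x))^2) + Z')"
  proof (rule has_integral_le[OF integrable_integral[OF square_integrable] has_integral_mult_right[OF has_integral_add[OF has_integral_add[OF integrable_integral[OF hX(2)] integrable_integral[OF hS(2)]] hZ(2)]]])
   fix x
   have "D x - m' = (D x - F x) + (- \<Phi> x) + (H x - m')" by (simp add: H_def)
   then show "(norm (D x - m'))^2 <= 3 * ((norm (D x - F x))^2 + (norm (\<Phi> x))^2 + (norm (H x - m'))^2)"
    using norm_add3_square_le[of "D x - F x" "- \<Phi> x" "H x - m'"] by (metis norm_minus_cancel)
  qed
  also have "... <= 3 * (X' + S + Z')"
  proof -
   have "integral ?q (%x. (norm (D x - F x))^2) <= X'"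
    unfolding X'_def using hX by (intro integral_subset_le sub) (auto simp: integrable_on_def)
   moreover have "integral ?q (%x. (norm (\<Phi> x))^2) <= S"
    unfolding S_def using hS by (intro integral_subset_le sub) (auto simp: integrable_on_def)
   ultimately show ?thesis by (intro mult_left_mono add_mono) auto
  qed
  finally have 1: "excess x0 ?r <= 3 * (X' + S + Z')" .
  have c0: "0 <= 576 * C\<^sub>1 * e" using C1 e by simp
  have 2: "Z' <= 576 * C\<^sub>1 * e * Z + 4 * (C\<^sub>1 + C\<^sub>1 / (1 - \<theta>)) * \<delta>"
   using m' unfolding Z_def Z'_def e_def by (simp add: mult.assoc)
  have 3: "576 * C\<^sub>1 * e * Z <= 576 * C\<^sub>1 * e * (3 * excess x0 R) + 1728 * C\<^sub>1 * (X' + S)"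
  proof -
   have "576 * C\<^sub>1 * e * Z <= 576 * C\<^sub>1 * e * (3 * (excess x0 R + X' + S))" by (rule mult_left_mono[OF Z c0])
   also have "... = 576 * C\<^sub>1 * e * (3 * excess x0 R) + 1728 * C\<^sub>1 * e * (X' + S)" by (simp add: algebra_simps)
   also have "1728 * C\<^sub>1 * e * (X' + S) <= 1728 * C\<^sub>1 * 1 * (X' + S)"
    using C1 e X0 by (intro mult_right_mono mult_left_mono) auto
   finally show ?thesis by simp
  qed
  define W where "W = \<delta> + \<delta> + \<omega>^2 * Y"
  have XS: "X' + S <= (1 + C\<^sub>2) * W"
  proof -
   have X'\<delta>: "X' <= \<delta>" using X by (simp add: X'_def)
   then have "C\<^sub>2 * (\<delta> + X' + \<omega>^2 * Y) <= C\<^sub>2 * W" using C2_pos by (intro mult_left_mono) (auto simp: W_def)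
   moreover have "X' <= W" using X'\<delta> \<delta>(1) Y0 by (simp add: W_def)
   ultimately show ?thesis using S by (simp add: algebra_simps)
  qed
  \<comment> \<open>5184 is \<open>9 * 576\<close>: one factor 3 for passing from \<open>H\<close>
    to \<open>D\<close> on the small cube, another for passing from \<open>D\<close> to
    \<open>H\<close> on the large one.\<close>
  have "excess x0 ?r <= 5184 * C\<^sub>1 * e * excess x0 R + 3 * (1 + 1728 * C\<^sub>1) * (X' + S) + 12 * (C\<^sub>1 + C\<^sub>1 / (1 - \<theta>)) * \<delta>"
  proof -
   have "v <= 5184 * c * e * x + 3 * (1 + 1728 * c) * w + 12 * g * d"
    if "v <= 3 * (w + z)" "z <= q + 4 * g * d" "q <= 576 * c * e * (3 * x) + 1728 * c * w" for v w z q c e x g d :: real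
   proof -
    have "v <= 3 * w + 3 * T + 3 * G" if "v <= 3 * (w + z)" "z <= q + G" "q <= T" for v w z q G T :: real
     using that by simp
    from this[OF that] show ?thesis by (simp add: algebra_simps)
   qed
   from this[OF 1 2 3] show ?thesis .
  qed
  also have "3 * (1 + 1728 * C\<^sub>1) * (X' + S) <= 3 * (1 + 1728 * C\<^sub>1) * ((1 + C\<^sub>2) * W)"
   using XS C1 by (intro mult_left_mono) auto
  also have "12 * (C\<^sub>1 + C\<^sub>1 / (1 - \<theta>)) * \<delta> <= 12 * (C\<^sub>1 + C\<^sub>1 / (1 - \<theta>)) * W"
   using C1 \<theta> \<delta>(1) Y0 by (intro mult_left_mono) (auto simp: W_def)
  finally have "excess x0 ?r <= 5184 * C\<^sub>1 * e * excess x0 R + C\<^sub>3 * W"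
   by (simp add: C\<^sub>3_def algebra_simps)
  also have "C\<^sub>3 * W = C\<^sub>3 * \<omega>^2 * Y + \<epsilon>" using \<delta>(2) by (simp add: W_def algebra_simps)
  finally show ?thesis by simp
 qed
 then have "excess x0 ?r <= 5184 * C\<^sub>1 * e * excess x0 R + C\<^sub>3 * \<omega>^2 * Y" by (rule field_le_epsilon)
 then show ?thesis by (simp add: e_def Y_def mult.assoc)
qed

end

section \<open>Campanato iteration\<close>

text \<open>\<open>a\<close> is the scaled oscillation and \<open>m\<close> the size of the mean.
  Alone, the oscillation would halve at each step; the perturbation couples it to the mean, but with
  a geometric coefficient, while the mean grows only by the sum of the oscillations. So the rate
  \<nu> is reached from any starting size \<open>K\<close>, provided \<open>s\<close> is small,
  which a small initial scale achieves.\<close>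

lemma iteration_bounds:
 fixes a m \<kappa> :: "nat => real"
 assumes a: "!!k. 0 <= a k" "!!k. a (Suc k) <= a k / 2 + \<kappa> k * (a k + m k)"
  and m: "!!k. m (Suc k) <= m k + l * a k" and l: "l >= 0"
  and \<kappa>: "!!k. 0 <= \<kappa> k" "!!k. \<kappa> k <= s * \<nu> ^ k" and \<nu>: "3 / 4 <= \<nu>" "\<nu> < 1"
  and s: "s * (2 + l / (1 - \<nu>)) <= 1 / 4"
  and K: "a 0 <= K" "m 0 <= K"
 shows "a k <= K * \<nu> ^ k"
proof -
 have K0: "K >= 0" using a(1)[of 0] K(1) by linarith
 have s0: "s >= 0" using \<kappa>(1)[of 0] \<kappa>(2)[of 0] by simp
 \<comment> \<open>The bound for \<open>m\<close> is a partial geometric sum of at most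
   \<open>1 + l / (1 - \<nu>)\<close>; with \<open>a\<close> added this is the factor in the
   smallness condition, and \<open>1/2 + 1/4 <= \<nu>\<close> closes the induction.\<close>
 have "a k <= K * \<nu> ^ k & m k <= K * (1 + l * (1 - \<nu> ^ k) / (1 - \<nu>))"
 proof (induction k)
  case 0
  show ?case using K by simp
 next
  case (Suc k)
  let ?B = "1 + l / (1 - \<nu>)"
  have p: "0 <= \<nu> ^ k" "\<nu> ^ k <= 1" using \<nu> by (auto simp: power_le_one)
  have "l * (1 - \<nu> ^ k) <= l * 1" using p l by (intro mult_left_mono) auto
  then have "l * (1 - \<nu> ^ k) / (1 - \<nu>) <= l / (1 - \<nu>)" using \<nu> by (intro divide_right_mono) auto
  then have "K * (1 + l * (1 - \<nu> ^ k) / (1 - \<nu>)) <= K * ?B" using K0 by (intro mult_left_mono) auto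
  then have mB: "m k <= K * ?B" using Suc by linarith
  have aK: "a k <= K" using Suc p K0 mult_left_mono[of "\<nu> ^ k" 1 K] by simp
  have B0: "0 <= ?B" using l \<nu> by auto
  have "\<kappa> k * (a k + m k) <= \<kappa> k * (K + K * ?B)" using \<kappa>(1) aK mB by (intro mult_left_mono) auto
  also have "... <= (s * \<nu> ^ k) * (K + K * ?B)" using \<kappa>(2) K0 l \<nu> by (intro mult_right_mono add_nonneg_nonneg mult_nonneg_nonneg) auto
  also have "... = (K * \<nu> ^ k) * (s * (2 + l / (1 - \<nu>)))" by (simp add: algebra_simps)
  also have "... <= (K * \<nu> ^ k) * (1 / 4)" using s K0 p by (intro mult_left_mono) auto
  finally have "a (Suc k) <= K * \<nu> ^ k * (3 / 4)" using a(2)[of k] Suc by simp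
  also have "... <= K * \<nu> ^ k * \<nu>" using \<nu> K0 p by (intro mult_left_mono) auto
  finally have 1: "a (Suc k) <= K * \<nu> ^ Suc k" by (simp add: mult_ac)
  have "m (Suc k) <= K * (1 + l * (1 - \<nu> ^ k) / (1 - \<nu>)) + l * (K * \<nu> ^ k)"
   using m[of k] Suc l mult_left_mono[of "a k" "K * \<nu> ^ k" l] by linarith
  also have "... = K * (1 + l * (1 - \<nu> ^ Suc k) / (1 - \<nu>))" using \<nu> by (simp add: field_simps)
  finally show ?case using 1 by simp
 qed
 then show ?thesis by simp
qed

lemma geometric_limit:
 fixes b :: "nat => 'a::banach"
 assumes b: "!!k. norm (b (Suc k) - b k) <= c * \<nu> ^ k" and \<nu>: "0 <= \<nu>" "\<nu> < 1"
 obtains l where "b \<longlonglongrightarrow> l" "!!k. norm (l - b k) <= c * \<nu> ^ k / (1 - \<nu>)"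
proof -
 have c: "c >= 0" using order_trans[OF norm_ge_zero b[of 0]] by simp
 have step: "norm (b (k + n) - b k) <= c * \<nu> ^ k * (1 - \<nu> ^ n) / (1 - \<nu>)" for k n
 proof (induction n)
  case (Suc n)
  have "norm (b (k + Suc n) - b k) <= norm (b (Suc (k + n)) - b (k + n)) + norm (b (k + n) - b k)"
   using norm_triangle_ineq[of "b (Suc (k + n)) - b (k + n)" "b (k + n) - b k"] by simp
  also have "... <= c * \<nu> ^ (k + n) + c * \<nu> ^ k * (1 - \<nu> ^ n) / (1 - \<nu>)" by (intro add_mono b Suc)
  also have "... = c * \<nu> ^ k * (1 - \<nu> ^ Suc n) / (1 - \<nu>)" using \<nu> by (simp add: field_simps power_add)
  finally show ?case .
 qed simp
 have bound: "norm (b n - b k) <= c * \<nu> ^ k / (1 - \<nu>)" if "n >= k" for n k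
 proof -
  have "norm (b n - b k) <= c * \<nu> ^ k * (1 - \<nu> ^ (n - k)) / (1 - \<nu>)" using step[of k "n - k"] that by simp
  also have "... <= c * \<nu> ^ k * 1 / (1 - \<nu>)" using c \<nu> by (intro divide_right_mono mult_left_mono) auto
  finally show ?thesis by simp
 qed
 have t: "(%k. c * \<nu> ^ k / (1 - \<nu>)) \<longlonglongrightarrow> c * 0 / (1 - \<nu>)"
  using \<nu> by (intro tendsto_intros LIMSEQ_power_zero) auto
 have "Cauchy b"
 proof (rule metric_CauchyI)
  fix e :: real assume "e > 0"
  then have "\<forall>\<^sub>F k in sequentially. c * \<nu> ^ k / (1 - \<nu>) < e / 2" using t by (intro order_tendstoD(2)) auto
  then obtain k where k: "c * \<nu> ^ k / (1 - \<nu>) < e / 2" by (auto simp: eventually_sequentially)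
  have "dist (b i) (b j) < e" if "i >= k" "j >= k" for i j
  proof -
   have "norm (b i - b j) <= norm (b i - b k) + norm (b j - b k)"
    using norm_triangle_ineq4[of "b i - b k" "b j - b k"] by simp
   then show ?thesis using bound[OF that(1)] bound[OF that(2)] k unfolding dist_norm by linarith
  qed
  then show "\<exists>M. \<forall>m\<ge>M. \<forall>n\<ge>M. dist (b m) (b n) < e" by blast
 qed
 then obtain l where l: "b \<longlonglongrightarrow> l" using Cauchy_convergent unfolding convergent_def by blast
 have "norm (l - b k) <= c * \<nu> ^ k / (1 - \<nu>)" for k
  by (rule LIMSEQ_le_const2[OF tendsto_norm[OF tendsto_diff[OF l tendsto_const]]]) (use bound in blast)
 then show ?thesis using that l by blast
qed

section \<open>Scaled oscillation and means of the gradient\<close>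

context pressure_critical
begin

text \<open>Twice the root mean square oscillation of \<open>D\<close> on the cube.\<close>

definition U :: "real^2 => real => real" where "U x r = sqrt (excess x r) / r"

lemma U_nonneg: "r > 0 ==> U x r >= 0" by (simp add: U_def excess_nonneg)

lemma excess_U: "r > 0 ==> excess x r = r^2 * (U x r)^2"
 by (simp add: U_def power_divide excess_nonneg)

lemma mean_diff_le:
 assumes r: "0 < \<tau>" "\<tau> <= 1" "0 < r"
 shows "norm (cube_mean x (\<tau> * r) - cube_mean x r) <= (1 / \<tau>) * U x r"
proof -
 have \<tau>r: "\<tau> * r > 0" "\<tau> * r <= r" using r by (auto simp: mult_left_le_one_le)
 have "4 * (\<tau> * r)^2 * (norm (cube_mean x (\<tau> * r) - cube_mean x r))^2 <= integral (cube x (\<tau> * r)) (%y. (norm (D y - cube_mean x r))^2)"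
  using excess_expand[OF \<tau>r(1), of x "cube_mean x r"] excess_nonneg[of x "\<tau> * r"] by linarith
 also have "... <= excess x r"
  unfolding excess_def by (intro integral_subset_le square_integrable cube_mono \<tau>r) auto
 also have "... = r^2 * (U x r)^2" by (rule excess_U[OF r(3)])
 finally have "r^2 * (4 * (\<tau> * norm (cube_mean x (\<tau> * r) - cube_mean x r))^2) <= r^2 * (U x r)^2"
  by (simp add: power_mult_distrib mult_ac)
 then have "4 * (\<tau> * norm (cube_mean x (\<tau> * r) - cube_mean x r))^2 <= (U x r)^2" using r by simp
 then have "(\<tau> * norm (cube_mean x (\<tau> * r) - cube_mean x r))^2 <= (U x r)^2"
  using zero_le_power2[of "\<tau> * norm (cube_mean x (\<tau> * r) - cube_mean x r)"] by linarith
 then have "\<tau> * norm (cube_mean x (\<tau> * r) - cube_mean x r) <= U x r"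
  by (rule power2_le_imp_le) (rule U_nonneg[OF r(3)])
 then show ?thesis using r by (simp add: field_simps)
qed

text \<open>Passing to the smaller cube multiplies the excess by a constant, the ratio of areas and
  \<open>\<theta> ^ k\<close>. The ratio of areas cancels in \<open>U\<close>, so a large
  \<open>k\<close> brings the factor below 1/2.\<close>

lemma U_step:
 obtains \<tau> C where "0 < \<tau>" "\<tau> <= 1 / 6" "C > 0"
  "!!x R \<omega> c. cube x R <= \<Omega> ==> R > 0 ==> \<omega> >= 0 ==> (!!y. y : cube x R ==> \<bar>p y - c\<bar> <= \<omega>) ==>
   U x (\<tau> * R) <= U x R / 2 + C * \<omega> * (U x R + norm (cube_mean x R))"
proof -
 have \<theta>: "0 < \<theta>" "\<theta> < 1" by (rule \<theta>_bounds)+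
 have C1: "C\<^sub>1 > 0" by (rule C\<^sub>1_pos)
 \<comment> \<open>186624 is \<open>36 * 5184\<close>, where \<open>36 * q^2\<close> is the inverse
   square of \<tau>; a bound of 1/4 for the squares gives the factor 1/2.\<close>
 have "(%k. 186624 * C\<^sub>1 * \<theta> ^ k) \<longlonglongrightarrow> 186624 * C\<^sub>1 * 0"
  using \<theta> by (intro tendsto_intros LIMSEQ_power_zero) auto
 then have "\<forall>\<^sub>F k in sequentially. 186624 * C\<^sub>1 * \<theta> ^ k < 1 / 4" by (intro order_tendstoD(2)) auto
 then obtain k where k: "186624 * C\<^sub>1 * \<theta> ^ k < 1 / 4" by (auto simp: eventually_sequentially)
 define q :: real where "q = 3 ^ k"
 have q: "q >= 1" by (simp add: q_def)
 define \<tau> where "\<tau> = 1 / (6 * q)"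
 have \<tau>: "0 < \<tau>" "\<tau> <= 1 / 6" using q by (auto simp: \<tau>_def field_simps)
 have C3: "C\<^sub>3 > 0" unfolding C\<^sub>3_def using C1 C2_pos \<theta> by (intro add_pos_pos mult_pos_pos divide_pos_pos) auto
 \<comment> \<open>144 is \<open>36 * 4\<close>; the 4 comes from bounding the gradient integral by
   \<open>4 * (?a + ?m)^2\<close> up to the factor \<open>R^2\<close>.\<close>
 define C where "C = sqrt (144 * q^2 * C\<^sub>3)"
 have C: "C > 0" "C^2 = 144 * q^2 * C\<^sub>3" using q C3 by (auto simp: C_def)
 have "U x (\<tau> * R) <= U x R / 2 + C * \<omega> * (U x R + norm (cube_mean x R))"
  if Q: "cube x R <= \<Omega>" and R: "R > 0" and \<omega>: "\<omega> >= 0" "!!y. y : cube x R ==> \<bar>p y - c\<bar> <= \<omega>" for x R \<omega> c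
 proof -
  let ?a = "U x R" and ?m = "norm (cube_mean x R)"
  have a0: "?a >= 0" by (rule U_nonneg[OF R])
  have Y: "integral (cube x R) (%x. (norm (D x))^2) = R^2 * ?a^2 + 4 * R^2 * ?m^2"
   using excess_expand[OF R, of x 0] by (simp add: excess_U[OF R])
  have r: "R / (6 * 3 ^ k) = \<tau> * R" by (simp add: \<tau>_def q_def)
  have "excess x (\<tau> * R) <= 5184 * C\<^sub>1 * \<theta> ^ k * (1 / q^2) * (R^2 * ?a^2) + C\<^sub>3 * \<omega>^2 * (R^2 * ?a^2 + 4 * R^2 * ?m^2)"
   using excess_decay_pressure[OF Q R \<omega>, of k] unfolding r Y excess_U[OF R] q_def .
  then have "(\<tau> * R)^2 * (U x (\<tau> * R))^2 <= R^2 * (5184 * C\<^sub>1 * \<theta> ^ k * (1 / q^2) * ?a^2 + C\<^sub>3 * \<omega>^2 * (?a^2 + 4 * ?m^2))"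
   using \<tau> R by (simp add: excess_U algebra_simps)
  then have "R^2 * (\<tau>^2 * (U x (\<tau> * R))^2) <= R^2 * (5184 * C\<^sub>1 * \<theta> ^ k * (1 / q^2) * ?a^2 + C\<^sub>3 * \<omega>^2 * (?a^2 + 4 * ?m^2))"
   by (simp add: power_mult_distrib mult_ac)
  then have "\<tau>^2 * (U x (\<tau> * R))^2 <= 5184 * C\<^sub>1 * \<theta> ^ k * (1 / q^2) * ?a^2 + C\<^sub>3 * \<omega>^2 * (?a^2 + 4 * ?m^2)"
   using R by simp
  then have "(36 * q^2) * (\<tau>^2 * (U x (\<tau> * R))^2) <= (36 * q^2) * (5184 * C\<^sub>1 * \<theta> ^ k * (1 / q^2) * ?a^2 + C\<^sub>3 * \<omega>^2 * (?a^2 + 4 * ?m^2))"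
   by (rule mult_left_mono) simp
  moreover have "(36 * q^2) * (\<tau>^2 * (U x (\<tau> * R))^2) = (U x (\<tau> * R))^2"
   using q by (simp add: \<tau>_def power_divide power_mult_distrib)
  moreover have "(36 * q^2) * (5184 * C\<^sub>1 * \<theta> ^ k * (1 / q^2) * ?a^2 + C\<^sub>3 * \<omega>^2 * (?a^2 + 4 * ?m^2))
    = 186624 * C\<^sub>1 * \<theta> ^ k * ?a^2 + 36 * q^2 * C\<^sub>3 * \<omega>^2 * (?a^2 + 4 * ?m^2)"
   using q by (simp add: algebra_simps)
  ultimately have "(U x (\<tau> * R))^2 <= 186624 * C\<^sub>1 * \<theta> ^ k * ?a^2 + 36 * q^2 * C\<^sub>3 * \<omega>^2 * (?a^2 + 4 * ?m^2)" by simp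
  also have "... <= 1 / 4 * ?a^2 + 36 * q^2 * C\<^sub>3 * \<omega>^2 * (4 * (?a + ?m)^2)"
  proof (intro add_mono mult_right_mono mult_left_mono)
   show "186624 * C\<^sub>1 * \<theta> ^ k <= 1 / 4" using k by simp
   have "?a^2 + 4 * ?m^2 + 3 * ?a^2 + 8 * (?a * ?m) = 4 * (?a + ?m)^2" by (simp add: power2_eq_square algebra_simps)
   moreover have "0 <= 3 * ?a^2 + 8 * (?a * ?m)" using a0 by simp
   ultimately show "?a^2 + 4 * ?m^2 <= 4 * (?a + ?m)^2" by linarith
   show "0 <= 36 * q^2 * C\<^sub>3 * \<omega>^2" using C3 by simp
  qed simp
  also have "... = (?a / 2)^2 + (C * \<omega> * (?a + ?m))^2" by (simp add: power_mult_distrib C(2) power_divide)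
  also have "... <= (?a / 2 + C * \<omega> * (?a + ?m))^2"
  proof -
   have "0 <= 2 * (?a / 2) * (C * \<omega> * (?a + ?m))" using a0 C(1) \<omega>(1) by (intro mult_nonneg_nonneg add_nonneg_nonneg) auto
   then show ?thesis by (simp only: power2_sum)
  qed
  finally show ?thesis
   by (rule power2_le_imp_le) (use a0 C(1) \<omega>(1) in \<open>intro add_nonneg_nonneg mult_nonneg_nonneg; simp\<close>)
 qed
 then show ?thesis using that[OF \<tau> C(1)] by blast
qed

text \<open>The cube of half side \<open>r / 2\<close> about \<open>y\<close> lies in both cubes,
  and comparing both means with \<open>D\<close> there costs only the two excesses.\<close>

lemma means_close:
 assumes r: "r > 0" and xy: "norm (x - y) <= r / 2" and K: "U x r <= K" "U y r <= K"
 shows "norm (cube_mean x r - cube_mean y r) <= 2 * K"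
proof -
 let ?q = "cube y (r / 2)" and ?c = "cube_mean x r - cube_mean y r"
 have sub: "?q <= cube x r"
 proof
  fix z assume "z : ?q"
  then show "z : cube x r" unfolding mem_cube
  proof (intro allI)
   fix i assume "\<forall>i. \<bar>z $ i - y $ i\<bar> <= r / 2"
   moreover have "\<bar>(x - y) $ i\<bar> <= r / 2" using component_le_norm_cart[of "x - y" i] xy by linarith
   ultimately show "\<bar>z $ i - x $ i\<bar> <= r" by (smt (verit) vector_minus_component field_sum_of_halves)
  qed
 qed
 have sub': "?q <= cube y r" by (rule cube_mono) (use r in simp)
 have r2: "r / 2 >= 0" using r by simp
 have "4 * (r / 2)^2 * (norm ?c)^2 <= 2 * integral ?q (%z. (norm (D z - cube_mean y r))^2) + 2 * integral ?q (%z. (norm (D z - cube_mean x r))^2)"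
 proof (rule has_integral_le[OF has_integral_const_cube[OF r2, of "(norm ?c)^2" y, unfolded real_scaleR_def]
   has_integral_add[OF has_integral_mult_right[OF integrable_integral[OF square_integrable]] has_integral_mult_right[OF integrable_integral[OF square_integrable]]]])
  show "(norm ?c)^2 <= 2 * (norm (D z - cube_mean y r))^2 + 2 * (norm (D z - cube_mean x r))^2" for z
   using norm_diff_square_le[of "D z - cube_mean y r" "D z - cube_mean x r"] by simp
 qed
 also have "integral ?q (%z. (norm (D z - cube_mean y r))^2) <= excess y r"
  unfolding excess_def by (intro integral_subset_le sub' square_integrable) auto
 also have "integral ?q (%z. (norm (D z - cube_mean x r))^2) <= excess x r"
  unfolding excess_def by (intro integral_subset_le sub square_integrable) auto
 also have "excess y r <= r^2 * K^2" using K(2) U_nonneg[OF r, of y] by (simp add: excess_U[OF r] mult_left_mono power_mono)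
 also have "excess x r <= r^2 * K^2" using K(1) U_nonneg[OF r, of x] by (simp add: excess_U[OF r] mult_left_mono power_mono)
 finally have "r^2 * (norm ?c)^2 <= r^2 * (2 * K)^2" by (simp add: power_divide power_mult_distrib mult_ac)
 then have "(norm ?c)^2 <= (2 * K)^2" using r by simp
 then show ?thesis by (rule power2_le_imp_le) (use K(1) U_nonneg[OF r, of x] in simp)
qed

text \<open>At a Lebesgue point of order three, \<open>excess_expand\<close> with
  \<open>P = D x\<close> bounds the distance of the mean to \<open>D x\<close>.\<close>

lemma means_converge_AE:
 obtains N where "negligible N" "!!x. x ~: N ==> ((%r. cube_mean x r) \<longlongrightarrow> D x) (at_right 0)"
proof -
 obtain N where N: "negligible N"
  "!!x e. x ~: N ==> 0 < e ==> \<exists>d>0. \<forall>h. 0 < h & h < d --> integral (cube x h) (%y. norm (D y - D x) ^ 3) <= e * h^2"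
  by (rule Lebesgue_points[OF D_borel D_int3]) blast
 have "((%r. cube_mean x r) \<longlongrightarrow> D x) (at_right 0)" if x: "x ~: N" for x
  unfolding tendsto_iff
 proof (intro allI impI)
  fix e :: real assume "e > 0"
  define \<rho> where "\<rho> = e / 2"
  have \<rho>: "\<rho> > 0" using \<open>e > 0\<close> by (simp add: \<rho>_def)
  then obtain d where d: "d > 0" "!!h. 0 < h ==> h < d ==> integral (cube x h) (%y. norm (D y - D x) ^ 3) <= (4 * \<rho> ^ 3) * h^2"
   using N(2)[OF x, of "4 * \<rho> ^ 3"] by auto
  have "dist (cube_mean x h) (D x) < e" if h: "0 < h" "h < d" for h
  proof -
   have i3: "(%y. norm (D y - D x) ^ 3) integrable_on cube x h" using D_integrable_on by (simp add: cube_def)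
   have "4 * h^2 * (norm (cube_mean x h - D x))^2 <= integral (cube x h) (%y. (norm (D y - D x))^2)"
    using excess_expand[OF h(1), of x "D x"] excess_nonneg[of x h] by linarith
   also have "... <= (4 * h^2) *\<^sub>R \<rho>^2 + integral (cube x h) (%y. norm (D y - D x) ^ 3) / \<rho>"
    by (rule has_integral_le[OF integrable_integral[OF square_integrable] has_integral_add[OF has_integral_const_cube[OF less_imp_le[OF h(1)]] has_integral_divide[OF integrable_integral[OF i3]]]])
     (rule square_le_cube[OF \<rho> norm_ge_zero])
   also have "integral (cube x h) (%y. norm (D y - D x) ^ 3) / \<rho> <= (4 * \<rho> ^ 3) * h^2 / \<rho>"
    using d(2)[OF h] \<rho> by (intro divide_right_mono) auto
   also have "(4 * \<rho> ^ 3) * h^2 / \<rho> = 4 * h^2 * \<rho>^2" using \<rho> by (simp add: power2_eq_square power3_eq_cube)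
   finally have "4 * h^2 * (norm (cube_mean x h - D x))^2 <= 4 * h^2 * (2 * \<rho>^2)" by simp
   then have "(norm (cube_mean x h - D x))^2 <= 2 * \<rho>^2" using h(1) by simp
   also have "... < (2 * \<rho>)^2" using \<rho> by (simp add: power_mult_distrib)
   finally have "norm (cube_mean x h - D x) < 2 * \<rho>" by (rule power2_less_imp_less) (use \<rho> in simp)
   then show ?thesis by (simp add: dist_norm \<rho>_def)
  qed
  then show "\<forall>\<^sub>F h in at_right 0. dist (cube_mean x h) (D x) < e"
   using d(1) by (auto simp: eventually_at_right_field)
 qed
 then show ?thesis using that N(1) by blast
qed

text \<open>The ratio \<tau>, the rate \<nu> and the exponent \<beta> are fixed once; only the
  starting scale \<open>\<tau> ^ N\<close> and the bound \<open>K0\<close> depend on the compact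
  set. As all scales are powers of the same \<tau>, the limits of the means agree for different
  compact sets and define one function \<open>G\<close>.\<close>

theorem Holder_gradient:
 assumes \<gamma>: "\<gamma> > 0"
  and p: "!!K. compact K ==> K <= \<Omega> ==> \<exists>r\<^sub>0 C. r\<^sub>0 > 0 & (\<forall>x\<in>K. cube x r\<^sub>0 <= \<Omega> &
   (\<forall>r y. 0 < r --> r <= r\<^sub>0 --> y : cube x r --> \<bar>p y - p x\<bar> <= C * r powr \<gamma>))"
 shows "\<exists>\<beta> G. 0 < \<beta> & \<beta> < 1 & Holder_on \<beta> \<Omega> G & (AE x in lebesgue_on \<Omega>. D x = G x)"
proof -
 obtain \<tau> C where \<tau>: "0 < \<tau>" "\<tau> <= 1 / 6" and C: "C > 0"
  and step: "!!x R \<omega> c. cube x R <= \<Omega> ==> R > 0 ==> \<omega> >= 0 ==> (!!y. y : cube x R ==> \<bar>p y - c\<bar> <= \<omega>) ==>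
   U x (\<tau> * R) <= U x R / 2 + C * \<omega> * (U x R + norm (cube_mean x R))"
  by (rule U_step) blast
 have "\<tau> powr \<gamma> < 1 powr \<gamma>" using \<tau> \<gamma> by (intro powr_less_mono2) auto
 then have "\<tau> powr \<gamma> < 1" by simp
 \<comment> \<open>3/4 is what \<open>iteration_bounds\<close> requires,
   \<open>\<tau> powr \<gamma>\<close> the decay of the pressure oscillation from one scale to the
   next.\<close>
 define \<nu> where "\<nu> = max (3 / 4) (\<tau> powr \<gamma>)"
 have \<nu>: "3 / 4 <= \<nu>" "\<nu> < 1" "\<tau> powr \<gamma> <= \<nu>" using \<open>\<tau> powr \<gamma> < 1\<close> by (auto simp: \<nu>_def)
 define l where "l = 1 / \<tau>"
 have l: "l > 0" using \<tau> by (simp add: l_def)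
 \<comment> \<open>The exponent with \<open>\<tau> powr \<beta> = \<nu>\<close>; it is below 1
   because \<tau> is smaller than \<nu>.\<close>
 define \<beta> where "\<beta> = ln \<nu> / ln \<tau>"
 have ln: "ln \<tau> < 0" "ln \<nu> < 0" "ln \<tau> < ln \<nu>" using \<tau> \<nu> by (auto simp: ln_less_zero)
 have \<beta>: "0 < \<beta>" "\<beta> < 1" "\<tau> powr \<beta> = \<nu>"
 proof -
  show "0 < \<beta>" "\<beta> < 1" using ln by (auto simp: \<beta>_def zero_less_divide_iff divide_less_eq)
  show "\<tau> powr \<beta> = \<nu>" using ln \<tau> \<nu> by (simp add: powr_def \<beta>_def)
 qed
 have \<nu>pow: "(\<tau> ^ k) powr \<beta> = \<nu> ^ k" for k
  using \<tau> \<beta>(3) \<nu> by (metis powr_powr powr_realpow mult.commute less_le_trans zero_less_divide_iff zero_less_numeral)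
 have local: "\<exists>N K0. K0 >= 0 & (\<forall>x\<in>K. norm (cube_mean x (\<tau> ^ N)) <= K0 & (\<forall>k. U x (\<tau> ^ (N + k)) <= K0 * \<nu> ^ k))"
  if K: "compact K" "K <= \<Omega>" for K
 proof -
  obtain r\<^sub>0 Cp where r\<^sub>0: "r\<^sub>0 > 0" "!!x. x : K ==> cube x r\<^sub>0 <= \<Omega>"
   and Cp: "!!x r y. x : K ==> 0 < r ==> r <= r\<^sub>0 ==> y : cube x r ==> \<bar>p y - p x\<bar> <= Cp * r powr \<gamma>"
   using p[OF K] by blast
  define B where "B = 2 + l / (1 - \<nu>)"
  have B: "B > 0" using l \<nu> by (auto simp: B_def intro: add_pos_nonneg)
  have t1: "(%N. \<tau> ^ N) \<longlonglongrightarrow> 0" using \<tau> by (intro LIMSEQ_power_zero) auto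
  \<comment> \<open>The starting scale is taken so small that the pressure coefficient meets the
    smallness condition and all cubes stay inside \<Omega>; the size of the gradient on them does
    not enter this choice.\<close>
  have "(%N. C * \<bar>Cp\<bar> * (\<tau> powr \<gamma>) ^ N * B) \<longlonglongrightarrow> C * \<bar>Cp\<bar> * 0 * B"
   using \<open>\<tau> powr \<gamma> < 1\<close> by (intro tendsto_intros LIMSEQ_power_zero) auto
  then have "\<forall>\<^sub>F N in sequentially. C * \<bar>Cp\<bar> * (\<tau> powr \<gamma>) ^ N * B < 1 / 4" by (intro order_tendstoD(2)) auto
  moreover have "\<forall>\<^sub>F N in sequentially. \<tau> ^ N < r\<^sub>0" using t1 r\<^sub>0(1) by (rule order_tendstoD(2))
  ultimately have "\<forall>\<^sub>F N in sequentially. C * \<bar>Cp\<bar> * (\<tau> powr \<gamma>) ^ N * B < 1 / 4 & \<tau> ^ N < r\<^sub>0" by (rule eventually_conj)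
  then obtain N where N: "C * \<bar>Cp\<bar> * (\<tau> powr \<gamma>) ^ N * B < 1 / 4" "\<tau> ^ N < r\<^sub>0" by (auto simp: eventually_sequentially)
  let ?r = "\<tau> ^ N"
  have r: "?r > 0" "?r <= 1" using \<tau> by (auto simp: power_le_one)
  obtain b where b: "!!x. x : K ==> norm x <= b" using compact_imp_bounded[OF K(1)] by (auto simp: bounded_iff)
  \<comment> \<open>The starting scale is at most 1, so this cube contains all starting cubes; its
    integral bounds the initial oscillation and mean at once, uniformly on \<open>K\<close>.\<close>
  define I where "I = integral (cube 0 (b + 1)) (%y. (norm (D y))^2)"
  define K0 where "K0 = sqrt I / ?r"
  have sq0: "(%y. (norm (D y))^2) integrable_on cube x s" for x s using square_integrable[of 0 x s] by simp
  have I: "I >= 0" unfolding I_def by (intro integral_nonneg sq0) simp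
  have init: "U x ?r <= K0" "norm (cube_mean x ?r) <= K0" if x: "x : K" for x
  proof -
   have "cube x ?r <= cube 0 (b + 1)"
   proof
    fix y assume "y : cube x ?r"
    then have y: "\<bar>y $ i - x $ i\<bar> <= ?r" for i by (simp add: mem_cube)
    have "\<bar>y $ i\<bar> <= b + 1" for i
    proof -
     have "\<bar>y $ i\<bar> <= \<bar>y $ i - x $ i\<bar> + \<bar>x $ i\<bar>" by arith
     then show ?thesis using y[of i] component_le_norm_cart[of x i] b[OF x] r(2) by linarith
    qed
    then show "y : cube 0 (b + 1)" by (simp add: mem_cube)
   qed
   then have "integral (cube x ?r) (%y. (norm (D y))^2) <= I" unfolding I_def by (intro integral_subset_le sq0) auto
   then have e: "excess x ?r + 4 * ?r^2 * (norm (cube_mean x ?r))^2 <= I" using excess_expand[OF r(1), of x 0] by simp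
   moreover have "0 <= 4 * ?r^2 * (norm (cube_mean x ?r))^2" by simp
   ultimately have "excess x ?r <= I" by linarith
   then show "U x ?r <= K0" unfolding U_def K0_def using r by (intro divide_right_mono real_sqrt_le_mono) auto
   have "excess x ?r + 4 * (?r^2 * (norm (cube_mean x ?r))^2) <= I" using e by (simp add: mult.assoc)
   moreover have "0 <= ?r^2 * (norm (cube_mean x ?r))^2" by simp
   ultimately have "?r^2 * (norm (cube_mean x ?r))^2 <= I" using excess_nonneg[of x ?r] by linarith
   then have "(?r * norm (cube_mean x ?r)) <= sqrt I" by (intro real_le_rsqrt) (simp add: power_mult_distrib)
   then show "norm (cube_mean x ?r) <= K0" using r by (simp add: K0_def field_simps)
  qed
  have "U x (\<tau> ^ (N + k)) <= K0 * \<nu> ^ k" if x: "x : K" for x k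
  proof (rule iteration_bounds[where a="%k. U x (\<tau> ^ (N + k))" and m="%k. norm (cube_mean x (\<tau> ^ (N + k)))" and l=l
     and \<kappa>="%k. C * (\<bar>Cp\<bar> * (\<tau> ^ (N + k)) powr \<gamma>)" and s="C * \<bar>Cp\<bar> * (\<tau> powr \<gamma>) ^ N"])
   fix k
   let ?R = "\<tau> ^ (N + k)"
   have R: "?R > 0" "?R <= r\<^sub>0"
   proof -
    show "?R > 0" using \<tau> by simp
    have "?R <= \<tau> ^ N" using \<tau> by (intro power_decreasing) auto
    then show "?R <= r\<^sub>0" using N(2) by simp
   qed
   show "0 <= U x ?R" by (rule U_nonneg[OF R(1)])
   have cs: "cube x ?R <= \<Omega>" using cube_mono[OF R(2)] r\<^sub>0(2)[OF x] by blast
   have "U x (\<tau> * ?R) <= U x ?R / 2 + C * (\<bar>Cp\<bar> * ?R powr \<gamma>) * (U x ?R + norm (cube_mean x ?R))"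
   proof (rule step[OF cs R(1), of _ "p x"])
    show "\<bar>p y - p x\<bar> <= \<bar>Cp\<bar> * ?R powr \<gamma>" if "y : cube x ?R" for y
     using Cp[OF x R that] mult_right_mono[OF abs_ge_self[of Cp] powr_ge_zero[of ?R \<gamma>]] by linarith
   qed simp
   then show "U x (\<tau> ^ (N + Suc k)) <= U x ?R / 2 + C * (\<bar>Cp\<bar> * ?R powr \<gamma>) * (U x ?R + norm (cube_mean x ?R))" by simp
   have "norm (cube_mean x (\<tau> * ?R) - cube_mean x ?R) <= l * U x ?R"
    unfolding l_def by (rule mean_diff_le) (use \<tau> R in auto)
   then show "norm (cube_mean x (\<tau> ^ (N + Suc k))) <= norm (cube_mean x ?R) + l * U x ?R"
    using norm_triangle_sub[of "cube_mean x (\<tau> * ?R)" "cube_mean x ?R"] by simp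
   show "0 <= C * (\<bar>Cp\<bar> * ?R powr \<gamma>)" using C by simp
   have "?R powr \<gamma> = (\<tau> powr \<gamma>) ^ N * (\<tau> powr \<gamma>) ^ k"
    using \<tau> by (simp add: powr_realpow[symmetric] powr_powr powr_add[symmetric] algebra_simps)
   also have "... <= (\<tau> powr \<gamma>) ^ N * \<nu> ^ k" using \<nu> by (intro mult_left_mono power_mono) auto
   finally have "C * \<bar>Cp\<bar> * ?R powr \<gamma> <= C * \<bar>Cp\<bar> * ((\<tau> powr \<gamma>) ^ N * \<nu> ^ k)" using C by (intro mult_left_mono) auto
   then show "C * (\<bar>Cp\<bar> * ?R powr \<gamma>) <= C * \<bar>Cp\<bar> * (\<tau> powr \<gamma>) ^ N * \<nu> ^ k" by (simp add: mult_ac)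
  qed (use l \<nu> N(1) init[OF x] in \<open>auto simp: B_def\<close>)
  moreover have "K0 >= 0" using I r by (simp add: K0_def)
  ultimately show ?thesis using init by blast
 qed
 define b where "b N x k = cube_mean x (\<tau> ^ (N + k))" for N x k
 have lim: "\<exists>L. b N x \<longlonglongrightarrow> L & (\<forall>k. norm (L - b N x k) <= (l * K0) * \<nu> ^ k / (1 - \<nu>))"
  if "!!k. U x (\<tau> ^ (N + k)) <= K0 * \<nu> ^ k" for x N K0
 proof -
  have g: "norm (b N x (Suc k) - b N x k) <= (l * K0) * \<nu> ^ k" for k
  proof -
   have "norm (cube_mean x (\<tau> * \<tau> ^ (N + k)) - cube_mean x (\<tau> ^ (N + k))) <= (1 / \<tau>) * U x (\<tau> ^ (N + k))"
    by (rule mean_diff_le) (use \<tau> in auto)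
   also have "... <= (1 / \<tau>) * (K0 * \<nu> ^ k)" using that \<tau> by (intro mult_left_mono) auto
   finally show ?thesis by (simp add: b_def l_def)
  qed
  obtain L where "b N x \<longlonglongrightarrow> L" "!!k. norm (L - b N x k) <= (l * K0) * \<nu> ^ k / (1 - \<nu>)"
   by (rule geometric_limit[OF g _ \<nu>(2)]) (use \<nu>(1) in simp, blast)
  then show ?thesis by blast
 qed
 define G where "G x = lim (%k. cube_mean x (\<tau> ^ k))" for x
 have G: "norm (G x - b N x k) <= (l * K0) * \<nu> ^ k / (1 - \<nu>)" "(%k. cube_mean x (\<tau> ^ k)) \<longlonglongrightarrow> G x"
  if U: "!!k. U x (\<tau> ^ (N + k)) <= K0 * \<nu> ^ k" for x N K0 k
 proof -
  obtain L where L: "b N x \<longlonglongrightarrow> L" "!!k. norm (L - b N x k) <= (l * K0) * \<nu> ^ k / (1 - \<nu>)"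
   using lim[OF U] by blast
  have "(%k. cube_mean x (\<tau> ^ (k + N))) \<longlonglongrightarrow> L" using L(1) by (simp add: b_def[abs_def] add.commute)
  then have "(%k. cube_mean x (\<tau> ^ k)) \<longlonglongrightarrow> L" by (rule LIMSEQ_offset)
  moreover from this have "G x = L" unfolding G_def by (rule limI)
  ultimately show "norm (G x - b N x k) <= (l * K0) * \<nu> ^ k / (1 - \<nu>)" "(%k. cube_mean x (\<tau> ^ k)) \<longlonglongrightarrow> G x"
   using L(2) by auto
 qed
 have "Holder_on \<beta> \<Omega> G"
  unfolding Holder_on_def
 proof (intro allI impI)
  fix K assume K: "compact K & K <= \<Omega>"
  obtain N K0 where K0: "K0 >= 0" and m: "!!x. x : K ==> norm (cube_mean x (\<tau> ^ N)) <= K0"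
   and U: "!!x k. x : K ==> U x (\<tau> ^ (N + k)) <= K0 * \<nu> ^ k"
   using local[of K] K by blast
  define c where "c = l * K0 / (1 - \<nu>)"
  have c: "c >= 0" using l K0 \<nu> by (simp add: c_def)
  have Gb: "norm (G x - cube_mean x (\<tau> ^ (N + k))) <= c * \<nu> ^ k" if "x : K" for x k
   using G(1)[OF U[OF that], of k] by (simp add: b_def c_def)
  define A' where "A' = 2 * (c + K0)"
  have A': "A' >= 0" using c K0 by (simp add: A'_def)
  \<comment> \<open>\<open>A' * \<nu> ^ k\<close> is the bound at the scale matching the distance;
    dividing by \<open>\<nu> ^ Suc N\<close> undoes the shift of the index, and
    \<open>2 powr \<beta>\<close> accounts for the factor 2 between scale and distance.\<close>
  define Q where "Q = A' * (2 powr \<beta> / \<nu> ^ Suc N)"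
  have "dist (G x) (G y) <= Q * dist x y powr \<beta>" if x: "x : K" and y: "y : K" for x y
  proof (cases "x = y")
   case False
   define d where "d = norm (x - y)"
   have d: "d > 0" using False by (simp add: d_def)
   have key: "dist (G x) (G y) <= A' * \<nu> ^ k ==> \<tau> ^ Suc (N + k) <= 2 * d ==> ?thesis" for k
   proof -
    assume a: "dist (G x) (G y) <= A' * \<nu> ^ k" "\<tau> ^ Suc (N + k) <= 2 * d"
    have "\<nu> ^ Suc (N + k) = (\<tau> ^ Suc (N + k)) powr \<beta>" by (rule \<nu>pow[symmetric])
    also have "... <= (2 * d) powr \<beta>" using a(2) \<tau> \<beta> by (intro powr_mono2) auto
    also have "... = 2 powr \<beta> * d powr \<beta>" using d by (simp add: powr_mult)
    finally have "\<nu> ^ k * \<nu> ^ Suc N <= 2 powr \<beta> * d powr \<beta>" by (simp add: power_add mult_ac)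
    then have "\<nu> ^ k <= 2 powr \<beta> / \<nu> ^ Suc N * d powr \<beta>" using \<nu> by (simp add: field_simps)
    then have "A' * \<nu> ^ k <= A' * (2 powr \<beta> / \<nu> ^ Suc N * d powr \<beta>)" by (rule mult_left_mono[OF _ A'])
    then show ?thesis using a(1) by (simp add: Q_def d_def dist_norm mult.assoc)
   qed
   show ?thesis
   proof (cases "d <= \<tau> ^ N / 2")
    case False
    show ?thesis
    proof (rule key[of 0])
     have "dist (G x) (G y) <= norm (G x - cube_mean x (\<tau> ^ N)) + norm (cube_mean x (\<tau> ^ N)) + (norm (G y - cube_mean y (\<tau> ^ N)) + norm (cube_mean y (\<tau> ^ N)))"
      using norm_triangle_ineq4[of "G x" "G y"] norm_triangle_sub[of "G x" "cube_mean x (\<tau> ^ N)"] norm_triangle_sub[of "G y" "cube_mean y (\<tau> ^ N)"]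
      by (simp add: dist_norm)
     then show "dist (G x) (G y) <= A' * \<nu> ^ 0" using Gb[OF x, of 0] Gb[OF y, of 0] m[OF x] m[OF y] by (simp add: A'_def)
     have "\<tau> * \<tau> ^ N <= 1 * \<tau> ^ N" using \<tau> by (intro mult_right_mono) auto
     then show "\<tau> ^ Suc (N + 0) <= 2 * d" using False by simp
    qed
   next
    case True
    have "(%k. \<tau> ^ k) \<longlonglongrightarrow> 0" using \<tau> by (intro LIMSEQ_power_zero) auto
    then have "\<forall>\<^sub>F k in sequentially. \<tau> ^ k < 2 * d" using d by (intro order_tendstoD(2)) auto
    then obtain k\<^sub>0 where "\<tau> ^ k\<^sub>0 < 2 * d" by (auto simp: eventually_sequentially)
    moreover have "\<tau> ^ Suc (N + k\<^sub>0) <= \<tau> ^ k\<^sub>0" using \<tau> by (intro power_decreasing) auto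
    ultimately have ex: "\<tau> ^ Suc (N + k\<^sub>0) < 2 * d" by linarith
    \<comment> \<open>The first index whose next scale drops below twice the distance: minimality
      gives \<open>2 * d <= \<tau> ^ (N + k)\<close>, as \<open>means_close\<close> requires, while
      the next scale being below \<open>2 * d\<close> turns powers of \<nu> into powers of the
      distance.\<close>
    define k where "k = (LEAST k. \<tau> ^ Suc (N + k) < 2 * d)"
    have k: "\<tau> ^ Suc (N + k) < 2 * d" unfolding k_def by (rule LeastI[of "%k. \<tau> ^ Suc (N + k) < 2 * d", OF ex])
    have k': "2 * d <= \<tau> ^ (N + k)"
    proof (cases k)
     case 0
     then show ?thesis using True by simp
    next
     case (Suc j)
     then have "\<not> \<tau> ^ Suc (N + j) < 2 * d" unfolding k_def by (intro not_less_Least) simp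
     then show ?thesis using Suc by simp
    qed
    show ?thesis
    proof (rule key[of k])
     have "norm (cube_mean x (\<tau> ^ (N + k)) - cube_mean y (\<tau> ^ (N + k))) <= 2 * (K0 * \<nu> ^ k)"
      by (rule means_close) (use \<tau> k' U x y in \<open>auto simp: d_def\<close>)
     moreover have "dist (G x) (G y) <= norm (G x - cube_mean x (\<tau> ^ (N + k))) + norm (cube_mean x (\<tau> ^ (N + k)) - cube_mean y (\<tau> ^ (N + k)))
       + norm (G y - cube_mean y (\<tau> ^ (N + k)))"
      using dist_triangle[of "G x" "G y" "cube_mean x (\<tau> ^ (N + k))"] dist_triangle[of "cube_mean x (\<tau> ^ (N + k))" "G y" "cube_mean y (\<tau> ^ (N + k))"]
      by (simp add: dist_norm norm_minus_commute)
     ultimately show "dist (G x) (G y) <= A' * \<nu> ^ k" using Gb[OF x, of k] Gb[OF y, of k] by (simp add: A'_def algebra_simps)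
     show "\<tau> ^ Suc (N + k) <= 2 * d" using k by simp
    qed
   qed
  qed simp
  then show "\<exists>C. \<forall>x\<in>K. \<forall>y\<in>K. dist (G x) (G y) <= C * dist x y powr \<beta>" by blast
 qed
 moreover have "AE x in lebesgue_on \<Omega>. D x = G x"
 proof -
  obtain N where N: "negligible N" "!!x. x ~: N ==> ((%r. cube_mean x r) \<longlongrightarrow> D x) (at_right 0)"
   by (rule means_converge_AE) blast
  have "D x = G x" if x: "x : \<Omega>" "x ~: N" for x
  proof -
   obtain M K0 where "!!k. U x (\<tau> ^ (M + k)) <= K0 * \<nu> ^ k" using local[of "{x}"] x(1) by auto
   from G(2)[OF this] have 1: "(%k. cube_mean x (\<tau> ^ k)) \<longlonglongrightarrow> G x" .
   have "(%k. \<tau> ^ k) \<longlonglongrightarrow> 0" using \<tau> by (intro LIMSEQ_power_zero) auto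
   then have "filterlim (%k. \<tau> ^ k) (at_right 0) sequentially"
    using \<tau> by (intro tendsto_imp_filterlim_at_right) auto
   from filterlim_compose[OF N(2)[OF x(2)] this] show ?thesis by (rule LIMSEQ_unique[OF _ 1])
  qed
  moreover have "AE x in lebesgue. x ~: N"
   using N(1) by (intro AE_not_in) (simp add: negligible_iff_null_sets)
  ultimately have "AE x in lebesgue. x : \<Omega> --> D x = G x" by (auto elim: eventually_mono)
  then show ?thesis using open_\<Omega> by (subst AE_restrict_space_iff) auto
 qed
 ultimately show ?thesis using \<beta>(1,2) by blast
qed

end

section \<open>Hoelder continuity of the gradient\<close>

text \<open>Measurability is assumed of \<open>g\<close> alone; completeness of Lebesgue measure
  transfers it to \<open>f\<close>, which may stem from a choice such as
  \<open>weak_gradient\<close>.\<close>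

lemma integral_cong_AE_lebesgue_on:
 fixes f g :: "'a::euclidean_space => 'b::euclidean_space"
 assumes S: "S : sets lebesgue" and g: "g : borel_measurable (lebesgue_on S)" and ae: "AE x in lebesgue_on S. f x = g x"
 shows "f : borel_measurable (lebesgue_on S)" "integral\<^sup>L (lebesgue_on S) f = integral\<^sup>L (lebesgue_on S) g"
proof -
 have SS: "S \<inter> space lebesgue : sets lebesgue" using S by simp
 have "(%x. indicator S x *\<^sub>R g x) : borel_measurable lebesgue"
  using g borel_measurable_restrict_space_iff[OF SS, of g] by simp
 moreover have "AE x in lebesgue. x : S --> f x = g x" using ae AE_restrict_space_iff[OF SS] by simp
 then have "AE x in lebesgue. indicator S x *\<^sub>R g x = indicator S x *\<^sub>R f x"
  by eventually_elim (auto simp: indicator_def)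
 ultimately have "(%x. indicator S x *\<^sub>R f x) : borel_measurable lebesgue" by (rule borel_measurable_AE)
 then show f: "f : borel_measurable (lebesgue_on S)"
  using borel_measurable_restrict_space_iff[OF SS, of f] by simp
 show "integral\<^sup>L (lebesgue_on S) f = integral\<^sup>L (lebesgue_on S) g"
  by (rule LINT_cong_AE[OF f g ae])
qed

lemma borel_measurable_lebesgue_on: "f : borel_measurable borel ==> f : borel_measurable (lebesgue_on S)"
 for f :: "'a::euclidean_space => 'b::topological_space"
 by (simp add: measurable_completion measurable_restrict_space1)

lemma borel_representative_matrix:
 fixes G :: "'a::euclidean_space => real^2^2"
 assumes S: "S : sets borel" and G: "G : borel_measurable (lebesgue_on S)"
 obtains D where "D : borel_measurable borel" "!!x. x ~: S ==> D x = 0" "AE x in lebesgue_on S. G x = D x"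
proof -
 have SS: "S \<inter> space lebesgue : sets lebesgue" using S by simp
 let ?G = "%x. indicator S x *\<^sub>R G x"
 have m: "?G : borel_measurable lebesgue" using G borel_measurable_restrict_space_iff[OF SS, of G] by simp
 have ex: "\<exists>g. g : borel_measurable borel & (AE x in lborel. ?G x $ i $ j = g x)" for i j
  using completion_ex_borel_measurable_real[OF borel_measurable_nth[OF borel_measurable_nth[OF m]], of i j] by auto
 define g where "g i j = (SOME g. g : borel_measurable borel & (AE x in lborel. ?G x $ i $ j = g x))" for i j
 have g: "g i j : borel_measurable borel" "AE x in lborel. ?G x $ i $ j = g i j x" for i j
  using someI_ex[OF ex[of i j]] unfolding g_def by blast+
 define D where "D x = indicator S x *\<^sub>R (g 1 1 x *\<^sub>R axis 1 (axis 1 1) + g 1 2 x *\<^sub>R axis 1 (axis 2 1)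
   + g 2 1 x *\<^sub>R axis 2 (axis 1 1) + g 2 2 x *\<^sub>R axis 2 (axis 2 1) :: real^2^2)" for x
 show ?thesis
 proof (rule that)
  show "D : borel_measurable borel" unfolding D_def[abs_def] using g(1) S by measurable
  show "D x = 0" if "x ~: S" for x using that by (simp add: D_def)
  have "AE x in lborel. \<forall>i j. ?G x $ i $ j = g i j x" using g(2) by (simp add: AE_all_countable)
  then have "AE x in lborel. x : S --> G x = D x"
  proof eventually_elim
   case (elim x)
   show ?case
   proof
    assume x: "x : S"
    then have "g i j x = G x $ i $ j" for i j using elim by simp
    then show "G x = D x" using matrix_basis_2[of "G x"] x by (simp add: D_def)
   qed
  qed
  then have "AE x in lebesgue. x : S --> G x = D x" by (rule AE_completion)
  then show "AE x in lebesgue_on S. G x = D x" by (simp add: AE_restrict_space_iff[OF SS])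
 qed
qed

lemma Lp_on_3_integrable:
 fixes f :: "'a::euclidean_space => 'b::euclidean_space"
 assumes S: "S : sets borel" "bounded S" and f: "Lp_on 3 S f"
  and d: "d : borel_measurable borel" "!!x. x ~: S ==> d x = 0" "AE x in lebesgue_on S. f x = d x"
 shows "integrable lborel (%x. norm (d x) ^ 3)" "integrable lborel d"
proof -
 note [measurable] = d(1) S(1)
 have "integrable (lebesgue_on S) (%x. norm (f x) powr 3)" using f by (simp add: Lp_on_def)
 then have "integrable (lebesgue_on S) (%x. norm (d x) powr 3)"
 proof (rule integrable_cong_AE_imp)
  have "(%x. norm (d x) powr 3) : borel_measurable borel" by measurable
  then show "(%x. norm (d x) powr 3) : borel_measurable (lebesgue_on S)" by (rule borel_measurable_lebesgue_on)
  show "AE x in lebesgue_on S. norm (f x) powr 3 = norm (d x) powr 3" using d(3) by eventually_elim simp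
 qed
 then have "integrable lborel (%x. indicator S x *\<^sub>R norm (d x) powr 3)"
  by (subst (asm) lebesgue_on_lborel(1)) measurable
 moreover have "(%x. indicator S x *\<^sub>R norm (d x) powr 3) = (%x. norm (d x) ^ 3)"
 proof
  fix x show "indicator S x *\<^sub>R norm (d x) powr 3 = norm (d x) ^ 3"
   using d(2)[of x] by (cases "d x = 0") (auto simp: indicator_def powr_numeral)
 qed
 ultimately show i3: "integrable lborel (%x. norm (d x) ^ 3)" by (simp only:)
 show "integrable lborel d"
 proof (rule LINT_bound)
  show "integrable lborel (%x. indicator S x + norm (d x) ^ 3)"
   using i3 emeasure_bounded_finite[OF S(2)] by (intro LINT_add integrable_real_indicator) auto
  have "norm (d x) <= indicator S x + norm (d x) ^ 3" for x
  proof (cases "x : S")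
   case True
   have "a <= 1 + a ^ 3" if "a >= 0" for a :: real
   proof (cases "a <= 1")
    case False
    then have "a ^ 1 <= a ^ 3" by (intro power_increasing) auto
    then show ?thesis by simp
   qed (use zero_le_power[OF that, of 3] in linarith)
   then show ?thesis using True by simp
  qed (simp add: d(2))
  then show "AE x in lborel. norm (d x) <= norm (indicator S x + norm (d x) ^ 3)" by (intro AE_I2) simp
 qed measurable
qed

lemma has_weak_gradientD:
 fixes w :: "real^'n => real^'m" and D :: "real^'n => real^'n^'m" and \<phi> :: "real^'n => real"
 assumes W: "has_weak_gradient \<Omega> w W" and \<Omega>: "open \<Omega>"
  and w [measurable]: "(%x. indicator \<Omega> x *\<^sub>R w x) : borel_measurable borel"
  and D [measurable]: "D : borel_measurable borel" and D0: "!!x. x ~: \<Omega> ==> D x = 0" "AE x in lebesgue_on \<Omega>. W x = D x"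
  and \<phi>: "test_function \<Omega> \<phi>"
 shows "(LINT x|lborel. (indicator \<Omega> x *\<^sub>R w x) $ i * frechet_derivative \<phi> (at x) (axis j 1)) = - (LINT x|lborel. D x $ i $ j * \<phi> x)"
proof -
 note C1 = test_function_C1_fun[OF \<phi>]
 have [measurable]: "\<phi> : borel_measurable borel" "grad \<phi> : borel_measurable borel" "\<Omega> : sets borel"
  using C1_fun_continuous[OF C1] C1 \<Omega> by (auto simp: C1_fun_def intro: borel_measurable_continuous_onI)
 have fd: "(%x. frechet_derivative \<phi> (at x) (axis j 1)) : borel_measurable borel"
  by (simp add: test_function_frechet[OF \<phi>])
 have "(LINT x|lborel. (indicator \<Omega> x *\<^sub>R w x) $ i * frechet_derivative \<phi> (at x) (axis j 1))
   = (LINT x|lborel. indicator \<Omega> x *\<^sub>R ((indicator \<Omega> x *\<^sub>R w x) $ i * frechet_derivative \<phi> (at x) (axis j 1)))"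
  by (rule LINT_cong) (auto simp: indicator_def)
 also have "... = (LINT x|lebesgue_on \<Omega>. (indicator \<Omega> x *\<^sub>R w x) $ i * frechet_derivative \<phi> (at x) (axis j 1))"
  by (rule lebesgue_on_lborel(2)[symmetric]) (simp, intro borel_measurable_times borel_measurable_nth w fd)
 also have "... = (LINT x|lebesgue_on \<Omega>. w x $ i * frechet_derivative \<phi> (at x) (axis j 1))"
  by (rule LINT_cong) auto
 also have "... = - (LINT x|lebesgue_on \<Omega>. W x $ i $ j * \<phi> x)" using W \<phi> by (simp add: has_weak_gradient_def)
 also have "(LINT x|lebesgue_on \<Omega>. W x $ i $ j * \<phi> x) = (LINT x|lebesgue_on \<Omega>. D x $ i $ j * \<phi> x)"
 proof (rule integral_cong_AE_lebesgue_on(2))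
  have "(%x. D x $ i $ j * \<phi> x) : borel_measurable borel" by measurable
  then show "(%x. D x $ i $ j * \<phi> x) : borel_measurable (lebesgue_on \<Omega>)" by (rule borel_measurable_lebesgue_on)
  show "AE x in lebesgue_on \<Omega>. W x $ i $ j * \<phi> x = D x $ i $ j * \<phi> x" using D0(2) by eventually_elim simp
 qed simp
 also have "... = (LINT x|lborel. indicator \<Omega> x *\<^sub>R (D x $ i $ j * \<phi> x))"
  by (rule lebesgue_on_lborel(2)) measurable
 also have "... = (LINT x|lborel. D x $ i $ j * \<phi> x)"
  by (rule LINT_cong) (auto simp: indicator_def D0(1))
 finally show ?thesis .
qed

lemma Holder_on_imp_continuous_on:
 fixes f :: "'a::euclidean_space => 'b::metric_space"
 assumes f: "Holder_on \<alpha> S f" and \<alpha>: "\<alpha> > 0" and S: "open S"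
 shows "continuous_on S f"
proof (rule continuous_at_imp_continuous_on, rule ballI)
 fix x assume "x : S"
 then obtain e where e: "e > 0" "cball x e <= S" using S open_contains_cball by blast
 then obtain C where C: "!!y z. y : cball x e ==> z : cball x e ==> dist (f y) (f z) <= C * dist y z powr \<alpha>"
  using f[unfolded Holder_on_def, THEN spec, THEN mp, OF conjI[OF compact_cball e(2)]] by blast
 have "((%y. dist (f y) (f x)) \<longlongrightarrow> 0) (at x)"
 proof (rule real_tendsto_sandwich)
  show "\<forall>\<^sub>F y in at x. 0 <= dist (f y) (f x)" by simp
  show "\<forall>\<^sub>F y in at x. dist (f y) (f x) <= C * dist y x powr \<alpha>"
   using e(1) C by (auto simp: eventually_at dist_commute intro!: exI[of _ e])
  have "((%y. dist y x) \<longlongrightarrow> dist x x) (at x)" by (intro tendsto_intros)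
  then have "((%y. C * dist y x powr \<alpha>) \<longlongrightarrow> C * 0 powr \<alpha>) (at x)"
   using \<alpha> by (intro tendsto_intros tendsto_powr2) (auto simp: eventually_at intro!: exI[of _ 1])
  then show "((%y. C * dist y x powr \<alpha>) \<longlongrightarrow> 0) (at x)" by simp
 qed simp
 then show "isCont f x" unfolding isCont_def by (rule tendsto_dist_iff[THEN iffD2])
qed

text \<open>By Morrey's inequality the third power of the oscillation of \<open>u\<close> on a cube
  is at most a multiple of its half side; so \<open>u\<close> has Hoelder exponent 1/3, and the
  composition a third of \<alpha>.\<close>

lemma (in planar_Sobolev) Holder_compose:
 assumes q: "Holder_on \<alpha> (u ` \<Omega>) q" and \<alpha>: "\<alpha> > 0" and K: "compact K" "K <= \<Omega>"
 shows "\<exists>r\<^sub>0 C. r\<^sub>0 > 0 & (\<forall>x\<in>K. cube x r\<^sub>0 <= \<Omega> &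
  (\<forall>r y. 0 < r --> r <= r\<^sub>0 --> y : cube x r --> \<bar>q (u y) - q (u x)\<bar> <= C * r powr (\<alpha> / 3)))"
proof -
 obtain e K' where K': "e > 0" "compact K'" "K' <= \<Omega>" "!!x y. x : K ==> norm (x - y) <= e ==> y : K'"
  by (rule compact_neighbourhood[OF K open_\<Omega>]) blast
 have cK: "compact (u ` K')"
  by (rule compact_continuous_image[OF continuous_on_subset[OF cont_u K'(3)] K'(2)])
 have "\<exists>C. \<forall>y\<in>u ` K'. \<forall>z\<in>u ` K'. dist (q y) (q z) <= C * dist y z powr \<alpha>"
  by (rule q[unfolded Holder_on_def, THEN spec, THEN mp, OF conjI[OF cK image_mono[OF K'(3)]]])
 then obtain C where C: "\<forall>y\<in>u ` K'. \<forall>z\<in>u ` K'. dist (q y) (q z) <= C * dist y z powr \<alpha>" ..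
 define I where "I = integral UNIV (%x. norm (D x) ^ 3)"
 have iU: "(%x. norm (D x) ^ 3) integrable_on UNIV" by (rule integrable_on_lborel[OF D_int3])
 have I: "I >= 0" unfolding I_def by (rule integral_nonneg[OF iU]) simp
 have sub: "cube x (e / 2) <= K'" if "x : K" for x
 proof
  fix y assume "y : cube x (e / 2)"
  then show "y : K'" using K'(4)[OF that, of y] cube_radius[of y x "e / 2"] by (simp add: norm_minus_commute)
 qed
 have "\<bar>q (u y) - q (u x)\<bar> <= (\<bar>C\<bar> * (23328 * I) powr (\<alpha> / 3)) * r powr (\<alpha> / 3)"
  if x: "x : K" and r: "0 < r" "r <= e / 2" and y: "y : cube x r" for x r y
 proof -
  have cs: "cube x r <= K'" using sub[OF x] cube_mono[OF r(2)] by blast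
  have xr: "x : cube x r" using r by (simp add: centre_in_cube)
  define a where "a = dist (u y) (u x)"
  have a0: "a >= 0" by (simp add: a_def)
  have "a ^ 3 <= 23328 * r * integral (cube x r) (%y. norm (D y - 0) ^ 3)"
   using Morrey_cube[of x r y x 0] cs K'(3) y xr r(1) by (simp add: a_def dist_norm)
  also have "... <= 23328 * r * I"
  proof (rule mult_left_mono)
   have "(%y. norm (D y) ^ 3) integrable_on cube x r" using D_integrable_on[of 0] by (simp add: cube_def)
   then have "integral (cube x r) (%y. norm (D y) ^ 3) <= I"
    unfolding I_def by (rule integral_subset_le[OF subset_UNIV _ iU]) simp
   then show "integral (cube x r) (%y. norm (D y - 0) ^ 3) <= I" by simp
  qed (use r(1) in simp)
  finally have a3: "a ^ 3 <= 23328 * I * r" by (simp add: mult_ac)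
  have "a powr \<alpha> = (a ^ 3) powr (\<alpha> / 3)"
  proof (cases "a = 0")
   case False
   then have "a ^ 3 = a powr 3" using a0 by (simp add: powr_numeral)
   then show ?thesis by (simp add: powr_powr)
  qed simp
  also have "... <= (23328 * I * r) powr (\<alpha> / 3)" using a3 a0 \<alpha> by (intro powr_mono2) auto
  also have "... = (23328 * I) powr (\<alpha> / 3) * r powr (\<alpha> / 3)" using I r by (simp add: powr_mult)
  finally have "\<bar>C\<bar> * a powr \<alpha> <= \<bar>C\<bar> * ((23328 * I) powr (\<alpha> / 3) * r powr (\<alpha> / 3))" by (intro mult_left_mono) auto
  moreover have "\<bar>q (u y) - q (u x)\<bar> <= \<bar>C\<bar> * a powr \<alpha>"
  proof -
   have "dist (q (u y)) (q (u x)) <= C * a powr \<alpha>" unfolding a_def using cs y xr by (intro C[rule_format] imageI) auto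
   also have "... <= \<bar>C\<bar> * a powr \<alpha>" by (intro mult_right_mono) auto
   finally show ?thesis by (simp add: dist_real_def)
  qed
  ultimately show ?thesis by (simp add: mult.assoc)
 qed
 note est = this
 show ?thesis
 proof (intro exI conjI ballI allI impI)
  show "e / 2 > 0" using K'(1) by simp
  show "cube x (e / 2) <= \<Omega>" if "x : K" for x using sub[OF that] K'(3) by (rule order_trans)
 qed (rule est)
qed

theorem theorem5p1:
  fixes \<Omega> :: "(real^2) set"
    and L :: "real^2^2 \<Rightarrow> real"
    and u :: "real^2 \<Rightarrow> real^2"
    and q :: "real^2 \<Rightarrow> real"
    and \<alpha> :: real
  assumes "open \<Omega>" and "\<Omega> \<noteq> {}" and "connected \<Omega>"
    and "bounded \<Omega>" and "simply_connected \<Omega>" and "smooth_boundary \<Omega>"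
    and "smooth_on UNIV L" and "uniformly_convex L"
    and "linear_growth (matrix_gradient L)" and "bounded_Hessian L"
    and "Sobolev1 3 \<Omega> u"
    and "open (u ` \<Omega>)" and "\<exists>g. homeomorphism \<Omega> (u ` \<Omega>) u g"
    and "area_preserving_minimizer L \<Omega> u"
    and "hydrostatic_pressure L \<Omega> u q"
    and "0 < \<alpha>" and "\<alpha> < 1" and "Holder_on \<alpha> (u ` \<Omega>) q"
  shows "\<exists>\<Omega>\<^sub>0. open \<Omega>\<^sub>0 \<and> \<Omega>\<^sub>0 \<subseteq> \<Omega> \<and> \<Omega> \<subseteq> closure \<Omega>\<^sub>0 \<and>
    (\<exists>\<beta> G. 0 < \<beta> \<and> \<beta> < 1 \<and> Holder_on \<beta> \<Omega>\<^sub>0 G \<and>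
       (AE x in lebesgue_on \<Omega>\<^sub>0. weak_gradient \<Omega> u x = G x))"
proof -
 let ?W = "weak_gradient \<Omega> u" and ?A = "matrix_gradient L" and ?T = "u ` \<Omega>"
 note \<Omega> = \<open>open \<Omega>\<close> and T = \<open>open ?T\<close> and pressure = \<open>hydrostatic_pressure L \<Omega> u q\<close>
 have \<Omega>b [measurable]: "\<Omega> : sets borel" "?T : sets borel" using \<Omega> T by simp_all
 have \<Omega>l: "\<Omega> \<inter> space lebesgue : sets lebesgue" using \<Omega> by simp
 obtain g where g: "homeomorphism \<Omega> ?T u g" using \<open>\<exists>g. homeomorphism \<Omega> ?T u g\<close> by blast
 have cu: "continuous_on \<Omega> u" "continuous_on ?T g" "!!x. x : \<Omega> ==> g (u x) = x"
  using g by (auto simp: homeomorphism_def)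
 have u0 [measurable]: "(%x. indicator \<Omega> x *\<^sub>R u x) : borel_measurable borel"
  by (rule borel_measurable_continuous_on_indicator[OF \<Omega>b(1) cu(1)])
 obtain G\<^sub>0 where G\<^sub>0: "has_weak_gradient \<Omega> u G\<^sub>0" "Lp_on 3 \<Omega> G\<^sub>0" and u3: "Lp_on 3 \<Omega> u"
  using \<open>Sobolev1 3 \<Omega> u\<close> unfolding Sobolev1_def by blast
 \<comment> \<open>The chosen gradient is a weak gradient because one exists, but integrability is
   known for \<open>G\<^sub>0\<close>; the two are identified almost everywhere below, and
   \<open>D\<close> represents both.\<close>
 have W: "has_weak_gradient \<Omega> u ?W" unfolding weak_gradient_def by (rule someI[of _ G\<^sub>0]) (rule G\<^sub>0(1))
 have "G\<^sub>0 : borel_measurable (lebesgue_on \<Omega>)" using G\<^sub>0(2) by (simp add: Lp_on_def)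
 then obtain D where D [measurable]: "D : borel_measurable borel" and D0: "!!x. x ~: \<Omega> ==> D x = 0"
  and GD: "AE x in lebesgue_on \<Omega>. G\<^sub>0 x = D x"
  by (rule borel_representative_matrix[OF \<Omega>b(1)]) blast
 have WD: "AE x in lebesgue_on \<Omega>. ?W x = D x"
  using weak_gradient_unique[OF \<Omega> W G\<^sub>0(1)] GD by eventually_elim simp
 note D3 = Lp_on_3_integrable[OF \<Omega>b(1) \<open>bounded \<Omega>\<close> G\<^sub>0(2) D D0 GD]
 have "AE x in lebesgue_on \<Omega>. u x = indicator \<Omega> x *\<^sub>R u x" by (rule AE_I2) simp
 note ui = Lp_on_3_integrable(2)[OF \<Omega>b(1) \<open>bounded \<Omega>\<close> u3 u0 _ this]
 interpret planar_Sobolev \<Omega> u D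
 proof unfold_locales
  show "integrable lborel (%x. indicator \<Omega> x *\<^sub>R u x)" by (rule ui) simp
  show "(LINT x|lborel. (indicator \<Omega> x *\<^sub>R u x) $ i * frechet_derivative \<phi> (at x) (axis j 1)) = - (LINT x|lborel. D x $ i $ j * \<phi> x)"
   if "test_function \<Omega> \<phi>" for \<phi> i j
   by (rule has_weak_gradientD[OF W \<Omega> u0 D D0 WD that])
 qed (use \<Omega> cu D D0 D3 in auto)
 interpret area_preserving \<Omega> u D
 proof unfold_locales
  show "inj_on u \<Omega>" by (rule inj_on_inverseI[of _ g]) (rule cu(3))
  have "AE x in lebesgue_on \<Omega>. det (?W x) = 1"
   using \<open>area_preserving_minimizer L \<Omega> u\<close> by (simp add: area_preserving_minimizer_def admissible_def)
  then have "AE x in lebesgue_on \<Omega>. det (D x) = 1" using WD by eventually_elim simp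
  then have ae: "AE x in lebesgue. x ~: {x : \<Omega>. det (D x) ~= 1}"
   unfolding AE_restrict_space_iff[OF \<Omega>l] by eventually_elim simp
  have "(%x. det (D x)) : borel_measurable borel" unfolding det_2 by measurable
  then have "{x : space borel. x : \<Omega> & det (D x) ~= 1} : sets borel" by measurable
  then have "{x : \<Omega>. det (D x) ~= 1} : sets lebesgue" by simp
  then show "negligible {x : \<Omega>. det (D x) ~= 1}"
   using ae by (simp add: negligible_iff_null_sets AE_iff_null_sets)
 qed
 obtain \<mu> M where "uniformly_elliptic L ?A \<mu> M"
  using uniformly_elliptic_matrix_gradient[OF \<open>smooth_on UNIV L\<close> \<open>uniformly_convex L\<close> \<open>bounded_Hessian L\<close>] by blast
 then interpret uniformly_elliptic L ?A \<mu> M .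
 obtain C where C: "!!P. norm (?A P) <= C * (1 + norm P)"
  using \<open>linear_growth ?A\<close> unfolding linear_growth_def by blast
 have cq: "continuous_on ?T q"
  by (rule Holder_on_imp_continuous_on[OF \<open>Holder_on \<alpha> ?T q\<close> \<open>0 < \<alpha>\<close> T])
 have q0 [measurable]: "(%y. indicator ?T y *\<^sub>R q y) : borel_measurable borel"
  by (rule borel_measurable_continuous_on_indicator[OF \<Omega>b(2) cq])
 have Am [measurable]: "?A : borel_measurable borel" by (rule borel_measurable_continuous_onI[OF A_continuous])
 \<comment> \<open>The definition of the pressure in terms of \<open>D\<close>: up to null sets the
   chosen weak gradients are replaced by \<open>D\<close> and by the product from the chain rule,
   and the divergence is the trace of the Jacobian.\<close>
 have eq: "(LINT x|lborel. ?A (D x) \<bullet> (V (u0 x) ** D x)) = (LINT y|lborel. indicator ?T y * (q y * trace (V y)))"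
  if v: "test_function ?T v" and V: "C1_map v V" for v V
 proof -
  have [measurable]: "V : borel_measurable borel" by (rule borel_measurable_continuous_onI[OF C1_map_continuous_deriv[OF V]])
  note chain = chain_rule[OF V]
  have "has_weak_gradient \<Omega> (v \<circ> u) (weak_gradient \<Omega> (v \<circ> u))"
   unfolding weak_gradient_def by (rule someI[of "has_weak_gradient \<Omega> (v \<circ> u)"]) (rule chain)
  from weak_gradient_unique[OF \<Omega> this chain]
  have ch: "AE x in lebesgue_on \<Omega>. weak_gradient \<Omega> (v \<circ> u) x = V (u x) ** D x" .
  have AVm: "(%x. ?A (D x) \<bullet> (V (u0 x) ** D x)) : borel_measurable borel" by measurable
  have trm: "(%y. indicator ?T y *\<^sub>R q y * trace (V y)) : borel_measurable borel"
   unfolding trace_def sum_2 by measurable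
  have "(LINT x|lborel. ?A (D x) \<bullet> (V (u0 x) ** D x)) = (LINT x|lborel. indicator \<Omega> x *\<^sub>R (?A (D x) \<bullet> (V (u0 x) ** D x)))"
   by (rule LINT_cong) (auto simp: indicator_def D0)
  also have "... = (LINT x|lebesgue_on \<Omega>. ?A (D x) \<bullet> (V (u0 x) ** D x))"
   by (rule lebesgue_on_lborel(2)[OF \<Omega>b(1) AVm, symmetric])
  also have "... = (LINT x|lebesgue_on \<Omega>. matrix_inner (?A (?W x)) (weak_gradient \<Omega> (v \<circ> u) x))"
  proof (rule integral_cong_AE_lebesgue_on(2)[OF _ borel_measurable_lebesgue_on[OF AVm], symmetric])
   have "AE x in lebesgue_on \<Omega>. x : \<Omega>" by (rule AE_I2) simp
   then show "AE x in lebesgue_on \<Omega>. matrix_inner (?A (?W x)) (weak_gradient \<Omega> (v \<circ> u) x) = ?A (D x) \<bullet> (V (u0 x) ** D x)"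
    using WD ch by eventually_elim (simp add: matrix_inner_eq)
  qed (use \<Omega> in simp)
  also have "... = (LINT y|lebesgue_on ?T. q y * divergence v y)"
   using pressure v by (simp add: hydrostatic_pressure_def)
  also have "... = (LINT y|lebesgue_on ?T. indicator ?T y *\<^sub>R q y * trace (V y))"
  proof (rule LINT_cong)
   fix y assume "y : space (lebesgue_on ?T)"
   have "frechet_derivative v (at y) = (%h. V y *v h)"
    using V by (auto simp: C1_map_def intro: frechet_derivative_at[symmetric])
   then have "divergence v y = trace (V y)" by (simp add: divergence_def jacobian_def)
   then show "q y * divergence v y = indicator ?T y *\<^sub>R q y * trace (V y)"
    using \<open>y : space (lebesgue_on ?T)\<close> by simp
  qed simp
  also have "... = (LINT y|lborel. indicator ?T y *\<^sub>R (indicator ?T y *\<^sub>R q y * trace (V y)))"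
   by (rule lebesgue_on_lborel(2)[OF \<Omega>b(2) trm])
  also have "... = (LINT y|lborel. indicator ?T y * (q y * trace (V y)))"
   by (rule LINT_cong) (auto simp: indicator_def)
  finally show ?thesis .
 qed
 interpret pressure_critical \<Omega> u D L ?A \<mu> M "%x. q (u x)"
 proof unfold_locales
  show "continuous_on \<Omega> (%x. q (u x))" by (rule continuous_on_compose2[OF cq cu(1)]) simp
  show "(LINT x|lborel. ?A (D x) \<bullet> \<Phi> x) = (LINT x|lborel. indicator \<Omega> x * (q (u x) * (cofactor2 (D x) \<bullet> \<Phi> x)))"
   if "C1_map \<phi> \<Phi>" "compact K" "K <= \<Omega>" "!!x. x ~: K ==> \<phi> x = 0" for \<phi> \<Phi> K
   by (rule pressure_equation[OF T cu(2,3) \<open>bounded \<Omega>\<close> A_continuous C cq eq that])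
 qed
 have "\<exists>\<beta> G. 0 < \<beta> & \<beta> < 1 & Holder_on \<beta> \<Omega> G & (AE x in lebesgue_on \<Omega>. D x = G x)"
 proof (rule Holder_gradient)
  show "\<alpha> / 3 > 0" using \<open>0 < \<alpha>\<close> by simp
 qed (rule Holder_compose[OF \<open>Holder_on \<alpha> ?T q\<close> \<open>0 < \<alpha>\<close>])
 then obtain \<beta> G where G: "0 < \<beta>" "\<beta> < 1" "Holder_on \<beta> \<Omega> G" "AE x in lebesgue_on \<Omega>. D x = G x" by blast
 have "AE x in lebesgue_on \<Omega>. ?W x = G x" using WD G(4) by eventually_elim simp
 then show ?thesis using \<Omega> closure_subset G(1-3) by blast
qed

end
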